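(* Let $m\in\mathbb N$ with $m\ge2$. Let $h=(h_1,\dots,h_m)\in(\mathrm{Rat})^m$ and let $G=\langle h_1,\dots,h_m\rangle$. Suppose that $\sharp J(G)\ge3$. Let $p=(p_1,\dots,p_m)\in(0,1)^m$ with $\sum_{j=1}^mp_j=1$ and let $\tau=\sum_{j=1}^mp_j\delta_{h_j}$. Suppose that $h$ satisfies the open set condition with an open set $U$. Let $\tilde\mu$ be an $\tilde h$-invariant ergodic Borel probability measure on $J(\tilde h)$ such that $\int\log\|D(h_{\gamma_1})_x\|_s\,d\tilde\mu(\gamma,x)>0$. Let $\mu:=(\pi_{\hat{\mathbb C}})_*(\tilde\mu)$. Suppose that $\mu(U\setminus P(G))>0$. Let $L$ be an attracting minimal set for $(G,\hat{\mathbb C})$. Suppose that there exists a point $\xi\in U$ such that $T_{L,\tau}$ is not constant on any neighborhood of $\xi$. Then for $\mu$-a.e. $z_0\in J(G)$, we have that $z_0\in F_{pt}^0(\tau)$, $T_{L,\tau}$ is continuous at $z_0$, and $\mathrm{H\ddot{o}l}(T_{L,\tau},z_0)\le v(h,p,\tilde\mu)$.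
   Context: $\hat{\mathbb C}$ is the Riemann sphere with spherical distance $d$. $\mathrm{Rat}$ is the space of all non-constant rational maps on $\hat{\mathbb C}$ with metric $\kappa(f,g)=\sup_{z}d(f(z),g(z))$. A rational semigroup is a subsemigroup of $\mathrm{Rat}$ under composition; $\langle h_1,\dots,h_m\rangle$ is the one generated by $h_1,\dots,h_m$. For a rational semigroup $G$: $F(G)$ is the maximal open subset of $\hat{\mathbb C}$ on which $G$ is equicontinuous with respect to $d$; $J(G)=\hat{\mathbb C}\setminus F(G)$; $P(G)=\overline{\bigcup_{g\in G}\mathrm{CV}(g)}$ (closure in $\hat{\mathbb C}$; $\mathrm{CV}(g)$ is the set of critical values of $g$). $h=(h_1,\dots,h_m)$ satisfies the open set condition with a non-empty open set $U\subset\hat{\mathbb C}$ if $\bigcup_{j=1}^mh_j^{-1}(U)\subset U$ and $h_i^{-1}(U)\cap h_j^{-1}(U)=\emptyset$ whenever $i\ne j$. Skew product: $\Sigma_m=\{1,\dots,m\}^{\mathbb N}$ with product topology, $\sigma$ the shift, $\tilde h:\Sigma_m\times\hat{\mathbb C}\to\Sigma_m\times\hat{\mathbb C}$, $\tilde h(w,y)=(\sigma(w),h_{w_1}(y))$; $J_w(\tilde h)$ is the complement of the maximal open subset of $\hat{\mathbb C}$ on which $\{h_{w_n}\circ\cdots\circ h_{w_1}\}_{n\in\mathbb N}$ is normal; $J(\tilde h)=\overline{\bigcup_{w\in\Sigma_m}\{w\}\times J_w(\tilde h)}$ (closure in $\Sigma_m\times\hat{\mathbb C}$); $\pi_{\hat{\mathbb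 C}}:\Sigma_m\times\hat{\mathbb C}\to\hat{\mathbb C}$ is the projection. $\|D\varphi_z\|_s$ is the norm of the derivative with respect to the spherical metric. For an $\tilde h$-invariant Borel probability measure $\tilde\mu$ on $J(\tilde h)$, $$v(h,p,\tilde\mu)=\frac{-\int_{\Sigma_m\times\hat{\mathbb C}}\log p_{w_1}\,d\tilde\mu(w,x)}{\int_{\Sigma_m\times\hat{\mathbb C}}\log\|D(h_{w_1})_x\|_s\,d\tilde\mu(w,x)}$$ when the denominator is positive. Minimal sets: a minimal set for $(G,\hat{\mathbb C})$ is a non-empty compact $L\subset\hat{\mathbb C}$ minimal with respect to inclusion among non-empty compact $C\subset\hat{\mathbb C}$ with $g(C)\subset C$ for all $g\in G$. For $G=\langle h_1,\dots,h_m\rangle$, $L$ is attracting (for $(G,\hat{\mathbb C})$) if there exist non-empty open subsets $U',V'$ of $F(G)$ and $n\in\mathbb N$ with $L\subset V'\subset\overline{V'}\subset U'\subset\overline{U'}\subset F(G)$, $\sharp(\hat{\mathbb C}\setminus V')\ge3$, and $h_{w_1}\cdots h_{w_n}(\overline{U'})\subset V'$ for each $(w_1,\dots,w_n)\in\{1,\dots,m\}^n$. With $\tilde\tau=\otimes_{n=1}^\infty\tau$ on $(\mathrm{Rat})^{\mathbb N}$: $T_{L,\tau}(z)=\tilde\tau(\{\gamma=(\gamma_1,\gamma_2,\dots):d(\gamma_n\cdots\gamma_1(z),L)\to0\text{ as }n\to\infty\})$ for $z\in\hat{\mathbb C}$. $\mathfrak M_1(\hat{\mathbb C})$ is the compact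 metrizable space of Borel probability measures on $\hat{\mathbb C}$ with the topology of weak convergence. $M_\tau(\varphi)(z)=\int\varphi(g(z))\,d\tau(g)$ on continuous functions $\varphi$ on $\hat{\mathbb C}$; $M_\tau^*:\mathfrak M_1(\hat{\mathbb C})\to\mathfrak M_1(\hat{\mathbb C})$ is its dual, $\int\varphi\,d(M_\tau^*\mu)=\int M_\tau(\varphi)\,d\mu$. Regard $\hat{\mathbb C}\subset\mathfrak M_1(\hat{\mathbb C})$ via $z\mapsto\delta_z$. $F_{pt}^0(\tau)$ is the set of $z_0\in\hat{\mathbb C}$ such that the sequence $\{(M_\tau^* )^n|_{\hat{\mathbb C}}:\hat{\mathbb C}\to\mathfrak M_1(\hat{\mathbb C})\}_{n\in\mathbb N}$ is equicontinuous at the one point $z_0$. Pointwise Hölder exponent: for a bounded function $\varphi$ near $y\in\hat{\mathbb C}$, $\mathrm{H\ddot{o}l}(\varphi,y)=\sup\{\beta\ge0:\limsup_{z\to y,z\ne y}|\varphi(z)-\varphi(y)|/d(z,y)^\beta<\infty\}\in[0,\infty]$ (at finite points the Euclidean distance gives the same value). *)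

theory Defs
  imports "HOL-Probability.Probability" "HOL-Computational_Algebra.Polynomial"
begin

section \<open>The Riemann sphere with its spherical distance\<close>

datatype riemann_sphere = Fin complex | Infty

text \<open>Inverse stereographic projection onto the unit sphere of \<open>complex \<times> real\<close>.\<close>

fun stereo :: "riemann_sphere \<Rightarrow> complex \<times> real" where
  "stereo (Fin z) = (scaleR (2 / (1 + (cmod z)\<^sup>2)) z, ((cmod z)\<^sup>2 - 1) / ((cmod z)\<^sup>2 + 1))"
| "stereo Infty = (0, 1)"

lemma norm_stereo [simp]: "norm (stereo x) = 1"
proof (cases x)
  case (Fin z)
  define t where "t = (cmod z)\<^sup>2"
  have t: "t \<ge> 0" by (simp add: t_def)
  have "(norm (stereo x))\<^sup>2 = (2 / (1 + t))\<^sup>2 * t + ((t - 1) / (t + 1))\<^sup>2"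
    using Fin t by (simp add: norm_Pair t_def power_mult_distrib power_divide)
  also have "\<dots> = (4 * t + (t - 1)\<^sup>2) / (1 + t)\<^sup>2"
    by (simp add: power_divide add_divide_distrib add.commute)
  also have "4 * t + (t - 1)\<^sup>2 = (1 + t)\<^sup>2"
    by (simp add: power2_eq_square algebra_simps)
  also have "(1 + t)\<^sup>2 / (1 + t)\<^sup>2 = 1"
    using t by simp
  finally show ?thesis
    using norm_ge_zero[of "stereo x"] by (auto simp only: power2_eq_1_iff)
qed (simp add: norm_Pair)

lemma inj_stereo: "stereo x = stereo y \<Longrightarrow> x = y"
proof -
  have height: "snd (stereo (Fin z)) = 1 - 2 / (1 + (cmod z)\<^sup>2)" for z
  proof -
    have "1 + (cmod z)\<^sup>2 > 0" by (simp add: add_pos_nonneg)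
    then have "1 + (cmod z)\<^sup>2 \<noteq> 0" by simp
    then show ?thesis by (simp add: field_simps)
  qed
  have pos: "1 + (cmod z)\<^sup>2 > 0" for z by (simp add: add_pos_nonneg)
  assume eq: "stereo x = stereo y"
  show "x = y"
  proof (cases x; cases y)
    fix z w assume xy: "x = Fin z" "y = Fin w"
    have "2 / (1 + (cmod z)\<^sup>2) = 2 / (1 + (cmod w)\<^sup>2)"
      using eq height[of z] height[of w] xy by simp
    moreover have "scaleR (2 / (1 + (cmod z)\<^sup>2)) z = scaleR (2 / (1 + (cmod w)\<^sup>2)) w"
      using eq xy by simp
    moreover have "2 / (1 + (cmod w)\<^sup>2) \<noteq> 0"
      using pos[of w] by simp
    ultimately show "x = y"
      using xy by (metis scaleR_cancel_left)
  next
    fix z assume xy: "x = Fin z" "y = Infty"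
    have "snd (stereo x) = 1" using eq xy by simp
    then show "x = y" using height[of z] pos[of z] xy by simp
  next
    fix z assume xy: "x = Infty" "y = Fin z"
    have "snd (stereo y) = 1" using eq xy by (metis snd_conv stereo.simps(2))
    then show "x = y" using height[of z] pos[of z] xy by simp
  qed simp
qed

lemma arccos_inner_triangle:
  fixes u v w :: "'a::real_inner"
  assumes u: "norm u = 1" and v: "norm v = 1" and w: "norm w = 1"
  shows "arccos (inner u w) \<le> arccos (inner u v) + arccos (inner v w)"
proof -
  have bd: "-1 \<le> inner a b \<and> inner a b \<le> 1" if "norm a = 1" "norm b = 1" for a b :: 'a
    using Cauchy_Schwarz_ineq2[of a b] that by (simp add: abs_le_iff)
  define a b where "a = arccos (inner u v)" and "b = arccos (inner v w)"
  have a: "0 \<le> a" "a \<le> pi" "cos a = inner u v"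
    using bd[OF u v] by (auto simp: a_def arccos_lbound arccos_ubound)
  have b: "0 \<le> b" "b \<le> pi" "cos b = inner v w"
    using bd[OF v w] by (auto simp: b_def arccos_lbound arccos_ubound)
  show ?thesis
  proof (cases "a + b \<le> pi")
    case False
    then show ?thesis
      using arccos_ubound[of "inner u w"] bd[OF u w] by (simp add: a_def b_def)
  next
    case True
    have uu: "inner u u = 1" and vv: "inner v v = 1" and ww: "inner w w = 1"
      using u v w by (simp_all add: dot_square_norm)
    define u' w' where "u' = u - scaleR (inner u v) v" and "w' = w - scaleR (inner v w) v"
    have "inner u' u' = 1 - (inner u v)\<^sup>2"
      unfolding u'_def using uu vv
      by (simp add: inner_diff_left inner_diff_right inner_commute power2_eq_square algebra_simps)
    then have "(norm u')\<^sup>2 = (sin a)\<^sup>2"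
      by (simp add: dot_square_norm sin_squared_eq a(3))
    then have nu: "norm u' = sin a"
      using a by (simp add: sin_ge_zero)
    have "inner w' w' = 1 - (inner v w)\<^sup>2"
      unfolding w'_def using ww vv
      by (simp add: inner_diff_left inner_diff_right inner_commute power2_eq_square algebra_simps)
    then have "(norm w')\<^sup>2 = (sin b)\<^sup>2"
      by (simp add: dot_square_norm sin_squared_eq b(3))
    then have nw: "norm w' = sin b"
      using b by (simp add: sin_ge_zero)
    have "inner u w = inner u v * inner v w + inner u' w'"
      unfolding u'_def w'_def using vv
      by (simp add: inner_diff_left inner_diff_right inner_commute algebra_simps)
    moreover have "- (sin a * sin b) \<le> inner u' w'"
      using Cauchy_Schwarz_ineq2[of u' w'] nu nw by (simp add: abs_le_iff)
    ultimately have "cos (a + b) \<le> inner u w"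
      by (simp add: cos_add a(3) b(3))
    then have "arccos (inner u w) \<le> arccos (cos (a + b))"
      using bd[OF u w] by (intro arccos_le_arccos) auto
    also have "\<dots> = a + b"
      using True a b by (intro arccos_cos) auto
    finally show ?thesis by (simp add: a_def b_def)
  qed
qed

text \<open>The spherical distance is the geodesic (angular) distance of the unit sphere.\<close>

instantiation riemann_sphere :: metric_space
begin

definition dist_riemann_sphere :: "riemann_sphere \<Rightarrow> riemann_sphere \<Rightarrow> real" where
  "dist_riemann_sphere x y = arccos (inner (stereo x) (stereo y))"

definition uniformity_riemann_sphere :: "(riemann_sphere \<times> riemann_sphere) filter" where
  "uniformity_riemann_sphere = (INF e\<in>{0<..}. principal {(x, y). dist x y < e})"

definition open_riemann_sphere :: "riemann_sphere set \<Rightarrow> bool" where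
  "open_riemann_sphere U \<longleftrightarrow> (\<forall>x\<in>U. eventually (\<lambda>(x', y). x' = x \<longrightarrow> y \<in> U) uniformity)"

instance
proof
  fix x y z :: riemann_sphere
  have bd: "-1 \<le> inner (stereo x) (stereo y)" "inner (stereo x) (stereo y) \<le> 1"
    using Cauchy_Schwarz_ineq2[of "stereo x" "stereo y"] by (simp_all add: abs_le_iff)
  show "dist x y = 0 \<longleftrightarrow> x = y"
  proof
    assume "dist x y = 0"
    then have "inner (stereo x) (stereo y) = 1"
      using bd by (metis cos_arccos cos_zero dist_riemann_sphere_def)
    moreover have "inner (stereo x) (stereo x) = 1" "inner (stereo y) (stereo y) = 1"
      by (simp_all add: dot_square_norm)
    ultimately have "inner (stereo x - stereo y) (stereo x - stereo y) = 0"
      by (simp add: inner_diff_left inner_diff_right inner_commute)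
    then show "x = y" by (simp add: inj_stereo)
  qed (simp add: dist_riemann_sphere_def dot_square_norm)
  show "dist x y \<le> dist x z + dist y z"
    using arccos_inner_triangle[of "stereo x" "stereo z" "stereo y"]
    by (simp add: dist_riemann_sphere_def inner_commute)
qed (simp_all add: uniformity_riemann_sphere_def open_riemann_sphere_def)

end

text \<open>Cardinality at least three, for possibly infinite sets.\<close>

definition at_least_three :: "'a set \<Rightarrow> bool" where
  "at_least_three A \<longleftrightarrow> (\<exists>B\<subseteq>A. card B = 3)"


section \<open>Rational maps\<close>

definition of_ratio :: "complex \<Rightarrow> complex \<Rightarrow> riemann_sphere" where
  "of_ratio a b = (if b = 0 then Infty else Fin (a / b))"

text \<open>The map \<open>P / Q\<close>, written in homogeneous coordinates: at infinity its value is given by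
  the coefficients of the top degree \<open>max (degree P) (degree Q)\<close>.\<close>

fun rat_map :: "complex poly \<Rightarrow> complex poly \<Rightarrow> riemann_sphere \<Rightarrow> riemann_sphere" where
  "rat_map P Q (Fin z) = of_ratio (poly P z) (poly Q z)"
| "rat_map P Q Infty =
     of_ratio (coeff P (max (degree P) (degree Q))) (coeff Q (max (degree P) (degree Q)))"

definition Rat :: "(riemann_sphere \<Rightarrow> riemann_sphere) set" where
  "Rat = {rat_map P Q | P Q. coprime P Q \<and> max (degree P) (degree Q) \<ge> 1}"

definition kappa ::
  "(riemann_sphere \<Rightarrow> riemann_sphere) \<Rightarrow> (riemann_sphere \<Rightarrow> riemann_sphere) \<Rightarrow> real" where
  "kappa f g = (SUP z. dist (f z) (g z))"

text \<open>Borel \<open>\<sigma>\<close>-algebra of the metric space \<open>(Rat, kappa)\<close> (the topology carried by the function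
  type itself, that of pointwise convergence, is not used).\<close>

definition borel_Rat :: "(riemann_sphere \<Rightarrow> riemann_sphere) measure" where
  "borel_Rat = sigma Rat {A. openin (Metric_space.mtopology Rat kappa) A}"

text \<open>Affine coordinate around a point \<open>a\<close>: the identity if \<open>a\<close> is finite, \<open>1 / z\<close> if it is
  infinity.  Both are used only near \<open>a\<close>; values elsewhere are irrelevant.  The spherical
  metric has density \<open>2 / (1 + |\<zeta>|\<^sup>2)\<close> in either coordinate.\<close>

fun chart :: "riemann_sphere \<Rightarrow> riemann_sphere \<Rightarrow> complex" where
  "chart (Fin a) (Fin z) = z"
| "chart (Fin a) Infty = 0"
| "chart Infty (Fin z) = 1 / z"
| "chart Infty Infty = 0"

fun chart_inv :: "riemann_sphere \<Rightarrow> complex \<Rightarrow> riemann_sphere" where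
  "chart_inv (Fin a) \<zeta> = Fin \<zeta>"
| "chart_inv Infty \<zeta> = (if \<zeta> = 0 then Infty else Fin (1 / \<zeta>))"

definition local_deriv :: "(riemann_sphere \<Rightarrow> riemann_sphere) \<Rightarrow> riemann_sphere \<Rightarrow> complex" where
  "local_deriv f x = deriv (\<lambda>\<zeta>. chart (f x) (f (chart_inv x \<zeta>))) (chart x x)"

definition sph_deriv_norm :: "(riemann_sphere \<Rightarrow> riemann_sphere) \<Rightarrow> riemann_sphere \<Rightarrow> real" where
  "sph_deriv_norm f x =
     cmod (local_deriv f x) * (1 + (cmod (chart x x))\<^sup>2) / (1 + (cmod (chart (f x) (f x)))\<^sup>2)"

definition CV :: "(riemann_sphere \<Rightarrow> riemann_sphere) \<Rightarrow> riemann_sphere set" where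
  "CV f = f ` {x. local_deriv f x = 0}"


section \<open>Rational semigroups\<close>

inductive_set gen_semigroup :: "('a \<Rightarrow> 'a) set \<Rightarrow> ('a \<Rightarrow> 'a) set" for H where
  generator: "f \<in> H \<Longrightarrow> f \<in> gen_semigroup H"
| compose: "f \<in> gen_semigroup H \<Longrightarrow> g \<in> gen_semigroup H \<Longrightarrow> f \<circ> g \<in> gen_semigroup H"

definition equicontinuous_at :: "('a::metric_space \<Rightarrow> 'b::metric_space) set \<Rightarrow> 'a \<Rightarrow> bool" where
  "equicontinuous_at F x \<longleftrightarrow>
     (\<forall>e>0. \<exists>d>0. \<forall>f\<in>F. \<forall>y. dist y x < d \<longrightarrow> dist (f y) (f x) < e)"

definition Fatou :: "(riemann_sphere \<Rightarrow> riemann_sphere) set \<Rightarrow> riemann_sphere set" where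
  "Fatou G = \<Union> {U. open U \<and> (\<forall>x\<in>U. equicontinuous_at G x)}"

definition Julia :: "(riemann_sphere \<Rightarrow> riemann_sphere) set \<Rightarrow> riemann_sphere set" where
  "Julia G = - Fatou G"

definition postcritical :: "(riemann_sphere \<Rightarrow> riemann_sphere) set \<Rightarrow> riemann_sphere set" where
  "postcritical G = closure (\<Union>g\<in>G. CV g)"

definition open_set_condition ::
  "nat \<Rightarrow> (nat \<Rightarrow> riemann_sphere \<Rightarrow> riemann_sphere) \<Rightarrow> riemann_sphere set \<Rightarrow> bool" where
  "open_set_condition m h U \<longleftrightarrow>
     open U \<and> U \<noteq> {} \<and> (\<Union>j\<in>{1..m}. h j -` U) \<subseteq> U \<and>
     (\<forall>i\<in>{1..m}. \<forall>j\<in>{1..m}. i \<noteq> j \<longrightarrow> (h i -` U) \<inter> (h j -` U) = {})"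

definition invariant_compact ::
  "(riemann_sphere \<Rightarrow> riemann_sphere) set \<Rightarrow> riemann_sphere set \<Rightarrow> bool" where
  "invariant_compact G C \<longleftrightarrow> C \<noteq> {} \<and> compact C \<and> (\<forall>g\<in>G. g ` C \<subseteq> C)"

definition minimal_set ::
  "(riemann_sphere \<Rightarrow> riemann_sphere) set \<Rightarrow> riemann_sphere set \<Rightarrow> bool" where
  "minimal_set G L \<longleftrightarrow>
     invariant_compact G L \<and> (\<forall>C. invariant_compact G C \<and> C \<subseteq> L \<longrightarrow> C = L)"

definition attracting_minimal_set ::
  "nat \<Rightarrow> (nat \<Rightarrow> riemann_sphere \<Rightarrow> riemann_sphere) \<Rightarrow> riemann_sphere set \<Rightarrow> bool" where
  "attracting_minimal_set m h L \<longleftrightarrow>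
     (let G = gen_semigroup (h ` {1..m}) in
      minimal_set G L \<and>
      (\<exists>U' V' n. open U' \<and> U' \<noteq> {} \<and> open V' \<and> V' \<noteq> {} \<and> n \<ge> 1 \<and>
         L \<subseteq> V' \<and> closure V' \<subseteq> U' \<and> closure U' \<subseteq> Fatou G \<and> at_least_three (- V') \<and>
         (\<forall>ws. length ws = n \<and> set ws \<subseteq> {1..m} \<longrightarrow>
            foldr (\<circ>) (map h ws) id ` closure U' \<subseteq> V')))"


section \<open>The skew product\<close>

text \<open>Words and sequences of maps are indexed from 0: \<open>w 0\<close> is the first letter.  The set of words
  is closed in \<open>nat \<Rightarrow> nat\<close>, which carries the product of the discrete topologies.\<close>

definition words :: "nat \<Rightarrow> (nat \<Rightarrow> nat) set" where
  "words m = {w. \<forall>n. w n \<in> {1..m}}"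

primrec iter_comp :: "(nat \<Rightarrow> 'a \<Rightarrow> 'a) \<Rightarrow> nat \<Rightarrow> 'a \<Rightarrow> 'a" where
  "iter_comp \<gamma> 0 = id"
| "iter_comp \<gamma> (Suc n) = \<gamma> n \<circ> iter_comp \<gamma> n"

definition skew ::
  "(nat \<Rightarrow> riemann_sphere \<Rightarrow> riemann_sphere) \<Rightarrow> (nat \<Rightarrow> nat) \<times> riemann_sphere
     \<Rightarrow> (nat \<Rightarrow> nat) \<times> riemann_sphere" where
  "skew h = (\<lambda>(w, y). (\<lambda>n. w (Suc n), h (w 0) y))"

definition normal_on :: "(riemann_sphere \<Rightarrow> riemann_sphere) set \<Rightarrow> riemann_sphere set \<Rightarrow> bool" where
  "normal_on F U \<longleftrightarrow>
     (\<forall>f :: nat \<Rightarrow> _. range f \<subseteq> F \<longrightarrow>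
        (\<exists>r l. strict_mono (r :: nat \<Rightarrow> nat) \<and>
           (\<forall>K\<subseteq>U. compact K \<longrightarrow> uniform_limit K (\<lambda>n. f (r n)) l sequentially)))"

definition fibre_Julia ::
  "(nat \<Rightarrow> riemann_sphere \<Rightarrow> riemann_sphere) \<Rightarrow> (nat \<Rightarrow> nat) \<Rightarrow> riemann_sphere set" where
  "fibre_Julia h w =
     - \<Union> {U. open U \<and> normal_on {iter_comp (\<lambda>i. h (w i)) n | n. n \<ge> 1} U}"

definition skew_Julia ::
  "nat \<Rightarrow> (nat \<Rightarrow> riemann_sphere \<Rightarrow> riemann_sphere) \<Rightarrow> ((nat \<Rightarrow> nat) \<times> riemann_sphere) set" where
  "skew_Julia m h = closure (\<Union>w\<in>words m. {w} \<times> fibre_Julia h w)"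

definition invariant_measure :: "'a measure \<Rightarrow> ('a \<Rightarrow> 'a) \<Rightarrow> bool" where
  "invariant_measure M T \<longleftrightarrow> T \<in> measurable M M \<and> distr M M T = M"

definition ergodic_measure :: "'a measure \<Rightarrow> ('a \<Rightarrow> 'a) \<Rightarrow> bool" where
  "ergodic_measure M T \<longleftrightarrow>
     (\<forall>A\<in>sets M. T -` A \<inter> space M = A \<longrightarrow> emeasure M A = 0 \<or> emeasure M (space M - A) = 0)"

text \<open>Since the derivative may vanish, its logarithm takes the value \<open>-\<infinity>\<close> (whereas \<open>ln 0 = 0\<close>),
  and the integral is the difference of the integrals of the positive and negative parts.
  The positive part of the integrand below is bounded, so no \<open>\<infinity> - \<infinity>\<close> arises.\<close>

definition ext_ln :: "real \<Rightarrow> ereal" where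
  "ext_ln x = (if x = 0 then -\<infinity> else ereal (ln x))"

definition ext_integral :: "'a measure \<Rightarrow> ('a \<Rightarrow> ereal) \<Rightarrow> ereal" where
  "ext_integral M f =
     enn2ereal (\<integral>\<^sup>+x. e2ennreal (f x) \<partial>M) - enn2ereal (\<integral>\<^sup>+x. e2ennreal (- f x) \<partial>M)"

definition lyapunov ::
  "(nat \<Rightarrow> riemann_sphere \<Rightarrow> riemann_sphere) \<Rightarrow> ((nat \<Rightarrow> nat) \<times> riemann_sphere) measure \<Rightarrow> ereal"
  where
  "lyapunov h M = ext_integral M (\<lambda>(w, x). ext_ln (sph_deriv_norm (h (w 0)) x))"

definition v_exponent ::
  "(nat \<Rightarrow> riemann_sphere \<Rightarrow> riemann_sphere) \<Rightarrow> (nat \<Rightarrow> real)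
     \<Rightarrow> ((nat \<Rightarrow> nat) \<times> riemann_sphere) measure \<Rightarrow> ereal" where
  "v_exponent h p M = ereal (- (\<integral>(w, x). ln (p (w 0)) \<partial>M)) / lyapunov h M"


section \<open>Random dynamics\<close>

definition tau_measure ::
  "nat \<Rightarrow> (nat \<Rightarrow> riemann_sphere \<Rightarrow> riemann_sphere) \<Rightarrow> (nat \<Rightarrow> real)
     \<Rightarrow> (riemann_sphere \<Rightarrow> riemann_sphere) measure" where
  "tau_measure m h p =
     measure_of (space borel_Rat) (sets borel_Rat)
       (\<lambda>A. \<Sum>j\<in>{1..m}. ennreal (p j) * emeasure (return borel_Rat (h j)) A)"

definition T_prob ::
  "riemann_sphere set \<Rightarrow> (riemann_sphere \<Rightarrow> riemann_sphere) measure \<Rightarrow> riemann_sphere \<Rightarrow> real" where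
  "T_prob L \<tau> z =
     (let P = PiM (UNIV :: nat set) (\<lambda>_. \<tau>) in
      measure P {\<gamma> \<in> space P. (\<lambda>n. infdist (iter_comp \<gamma> n z) L) \<longlonglongrightarrow> 0})"

definition M1 :: "riemann_sphere measure set" where
  "M1 = {\<mu>. sets \<mu> = sets borel \<and> prob_space \<mu>}"

definition weak_topology :: "riemann_sphere measure topology" where
  "weak_topology = topology_generated_by
     {{\<mu> \<in> M1. (\<integral>x. \<phi> x \<partial>\<mu>) \<in> V} | (\<phi> :: riemann_sphere \<Rightarrow> real) V.
        continuous_on UNIV \<phi> \<and> open V}"

definition M_op ::
  "(riemann_sphere \<Rightarrow> riemann_sphere) measure \<Rightarrow> (riemann_sphere \<Rightarrow> real) \<Rightarrow> riemann_sphere \<Rightarrow> real"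
  where
  "M_op \<tau> \<phi> z = (\<integral>g. \<phi> (g z) \<partial>\<tau>)"

definition M_dual ::
  "(riemann_sphere \<Rightarrow> riemann_sphere) measure \<Rightarrow> riemann_sphere measure \<Rightarrow> riemann_sphere measure"
  where
  "M_dual \<tau> \<mu> =
     (THE \<nu>. \<nu> \<in> M1 \<and>
        (\<forall>\<phi>. continuous_on UNIV \<phi> \<longrightarrow> (\<integral>x. \<phi> x \<partial>\<nu>) = (\<integral>x. M_op \<tau> \<phi> x \<partial>\<mu>)))"

text \<open>Equicontinuity refers to a metric inducing the weak topology.  As that topology is compact,
  all such metrics are uniformly equivalent and the choice does not matter.\<close>

definition F_pt0 :: "(riemann_sphere \<Rightarrow> riemann_sphere) measure \<Rightarrow> riemann_sphere set" where
  "F_pt0 \<tau> =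
     {z0. \<exists>D. Metric_space M1 D \<and> Metric_space.mtopology M1 D = weak_topology \<and>
        (\<forall>e>0. \<exists>d>0. \<forall>n\<ge>1. \<forall>z. dist z z0 < d \<longrightarrow>
           D ((M_dual \<tau> ^^ n) (return borel z)) ((M_dual \<tau> ^^ n) (return borel z0)) < e)}"

definition Hoelder_exponent :: "(riemann_sphere \<Rightarrow> real) \<Rightarrow> riemann_sphere \<Rightarrow> ereal" where
  "Hoelder_exponent \<phi> y =
     (SUP \<beta>\<in>{\<beta>::real. \<beta> \<ge> 0 \<and>
        Limsup (at y) (\<lambda>z. ereal (\<bar>\<phi> z - \<phi> y\<bar> / dist z y powr \<beta>)) < \<infinity>}. ereal \<beta>)"

end

theory Submission
  imports Defs "HOL-Complex_Analysis.Complex_Analysis"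
    "HOL-Computational_Algebra.Fundamental_Theorem_Algebra" "HOL-Real_Asymp.Real_Asymp"
begin

text \<open>Let the orbit of a point \<open>x\<close> along a word \<open>w\<close> stay in \<open>U\<close>.  By the open set condition, composing the
first \<open>n\<close> maps with a letter \<open>j \<noteq> w n\<close> gives, near \<open>x\<close>, a map that misses \<open>U\<close>; as \<open>U\<close> contains its
preimages, the whole semigroup still misses \<open>U\<close> afterwards, and Montel's theorem makes it equicontinuous
along this side branch.  All words contract uniformly near the attracting set \<open>L\<close> (\<open>contraction_to_L\<close>), so of
orbits that stay close together either all converge to \<open>L\<close> or none does.  Hence \<open>T = T_prob L \<tau>\<close> is locally
constant along side branches, and in the functional equation
\<open>T z = (\<Sum>j. p j * T (h j z))\<close> only the branch of \<open>w\<close> contributes to differences: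
near \<open>x\<close>, \<open>T y - T x = weight w n * (T (orb w n y) - T (orb w n x))\<close> with \<open>weight w n = (\<Prod>i<n. p (w i))\<close>
(\<open>T_local_product\<close>).  The weights tend to \<open>0\<close> and \<open>T\<close> is bounded, so \<open>T\<close> is continuous at \<open>x\<close>.  The same
telescoping, with the iterated averages of a bounded Lipschitz function in place of \<open>T\<close>, shows that the
dual operators are equicontinuous at \<open>x\<close> (\<open>F_pt0_orbit\<close>).

As \<open>T\<close> is not locally constant on \<open>U\<close>, it is nonconstant near every Julia point (\<open>T_nonconstant_near_Julia\<close>).  Around a Julia
point of \<open>U\<close> outside \<open>P(G)\<close> every return of an orbit to a small disc comes with a univalent inverse
branch over the disc, whose size is bounded by a constant times the reciprocal of the derivative \<open>D\<close>
of \<open>orb w n\<close> at \<open>x\<close>.  Pulling back a point of the disc at which \<open>T\<close> differs from its value at the return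
yields \<open>z\<close> with \<open>dist z x \<le> C / D\<close> and \<open>\<bar>T z - T x\<bar> \<ge> \<eta> * weight w n\<close> (\<open>return_estimate\<close>).  The difference
quotient of order \<open>\<beta>\<close> is therefore at least a constant times \<open>weight w n * D powr \<beta>\<close>.  The logarithm of this
product is the ergodic sum of \<open>\<beta>\<close> times the logarithmic derivative plus the logarithm of the probability of
the letter, a function whose mean is positive exactly for \<open>\<beta> > v\<close>.  By the maximal ergodic theorem such sums
tend to infinity almost everywhere (\<open>bsum_tendsto_infinity\<close>); this also provides the returns, since the
indicator of a set of positive measure has positive mean.

It remains to place the disc and to pass from words to points.  If the Fatou set carries mass, then by
ergodicity it carries all of it and the claim about Julia points is void.  Otherwise \<open>U - P(G)\<close> contains a
Julia point all of whose neighbourhoods have positive mass.  As long as an orbit stays in \<open>U\<close>, the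
open set condition recovers the word from the point, so the properties above become Borel properties
of the point alone (\<open>typical\<close>) and hold almost everywhere for the projected measure.\<close>

section \<open>Homogeneous coordinates on the sphere\<close>

lemma of_ratio_eq_Infty_iff [simp]: "of_ratio a b = Infty \<longleftrightarrow> b = 0"
  by (simp add: of_ratio_def)

lemma of_ratio_eq_iff:
  assumes "a \<noteq> 0 \<or> b \<noteq> 0" "c \<noteq> 0 \<or> d \<noteq> 0"
  shows "of_ratio a b = of_ratio c d \<longleftrightarrow> a * d = b * c"
  using assms by (auto simp: of_ratio_def field_simps)

lemma of_ratio_cases:
  obtains a b where "a \<noteq> 0 \<or> b \<noteq> 0" "x = of_ratio a b"
proof (cases x)
  case (Fin z)
  then show ?thesis using that[of z 1] by (simp add: of_ratio_def)
next
  case Infty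
  then show ?thesis using that[of 1 0] by (simp add: of_ratio_def)
qed

lemma hom_norm_pos:
  fixes a b :: complex
  assumes "a \<noteq> 0 \<or> b \<noteq> 0"
  shows "(cmod a)\<^sup>2 + (cmod b)\<^sup>2 > 0"
  using assms by (auto simp: add_pos_nonneg add_nonneg_pos)

lemma stereo_of_ratio:
  assumes "a \<noteq> 0 \<or> b \<noteq> 0"
  shows "stereo (of_ratio a b) =
    ((2 / ((cmod a)\<^sup>2 + (cmod b)\<^sup>2)) *\<^sub>R (a * cnj b),
     ((cmod a)\<^sup>2 - (cmod b)\<^sup>2) / ((cmod a)\<^sup>2 + (cmod b)\<^sup>2))"
proof (cases "b = 0")
  case True
  then show ?thesis using assms by (simp add: of_ratio_def)
next
  case False
  define N where "N = (cmod a)\<^sup>2 + (cmod b)\<^sup>2"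
  have N: "N > 0" unfolding N_def using assms by (rule hom_norm_pos)
  have b: "(cmod b)\<^sup>2 > 0" using False by simp
  have 1: "1 + (cmod (a / b))\<^sup>2 = N / (cmod b)\<^sup>2"
    using b by (simp add: N_def norm_divide power_divide field_simps)
  have 2: "(cmod (a / b))\<^sup>2 - 1 = ((cmod a)\<^sup>2 - (cmod b)\<^sup>2) / (cmod b)\<^sup>2"
    using b by (simp add: norm_divide power_divide field_simps)
  have "of_real ((cmod b)\<^sup>2) = b * cnj b"
    using complex_norm_square[of b] by simp
  then have "of_real ((cmod b)\<^sup>2) * (a / b) = a * cnj b"
    using False by (simp add: field_simps)
  then have "(cmod b)\<^sup>2 *\<^sub>R (a / b) = a * cnj b"
    by (simp add: scaleR_conv_of_real)
  then have 3: "(2 / (1 + (cmod (a / b))\<^sup>2)) *\<^sub>R (a / b) = (2 / N) *\<^sub>R (a * cnj b)"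
    unfolding 1 by (metis (no_types, lifting) divide_divide_eq_right scaleR_scaleR times_divide_eq_left)
  have 4: "((cmod (a / b))\<^sup>2 - 1) / ((cmod (a / b))\<^sup>2 + 1) = ((cmod a)\<^sup>2 - (cmod b)\<^sup>2) / N"
    using 1 2 b N by (simp add: add.commute)
  show ?thesis
    using False 3 4 unfolding N_def by (simp add: of_ratio_def)
qed

text \<open>In homogeneous coordinates the distance depends on the points only through the determinant, which makes
the effect of linear changes of coordinates visible.\<close>

lemma inner_stereo_of_ratio:
  assumes "a \<noteq> 0 \<or> b \<noteq> 0" "c \<noteq> 0 \<or> d \<noteq> 0"
  shows "inner (stereo (of_ratio a b)) (stereo (of_ratio c d)) =
    1 - 2 * (cmod (a * d - b * c))\<^sup>2 / (((cmod a)\<^sup>2 + (cmod b)\<^sup>2) * ((cmod c)\<^sup>2 + (cmod d)\<^sup>2))"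
proof -
  define N N' where "N = (cmod a)\<^sup>2 + (cmod b)\<^sup>2" and "N' = (cmod c)\<^sup>2 + (cmod d)\<^sup>2"
  have N: "N > 0" "N' > 0" unfolding N_def N'_def using assms by (auto intro: hom_norm_pos)
  have "4 * inner (a * cnj b) (c * cnj d) + ((cmod a)\<^sup>2 - (cmod b)\<^sup>2) * ((cmod c)\<^sup>2 - (cmod d)\<^sup>2)
     = N * N' - 2 * (cmod (a * d - b * c))\<^sup>2"
    unfolding N_def N'_def cmod_power2 inner_complex_def
    by (simp add: power2_eq_square algebra_simps)
  then have "inner (stereo (of_ratio a b)) (stereo (of_ratio c d)) = (N * N' - 2 * (cmod (a * d - b * c))\<^sup>2) / (N * N')"
    using N by (simp add: stereo_of_ratio[OF assms(1)] stereo_of_ratio[OF assms(2)] N_def[symmetric] N'_def[symmetric] field_simps)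
  also have "\<dots> = 1 - 2 * (cmod (a * d - b * c))\<^sup>2 / (N * N')"
    using N by (simp add: field_simps)
  finally show ?thesis by (simp add: N_def N'_def)
qed

lemma norm_diff_unit_vectors:
  fixes u v :: "'a::real_inner"
  assumes "norm u = 1" "norm v = 1"
  shows "(norm (u - v))\<^sup>2 = 2 - 2 * inner u v"
  using assms dot_norm_neg[of u v] by simp

definition chord :: "riemann_sphere \<Rightarrow> riemann_sphere \<Rightarrow> real" where
  "chord x y = norm (stereo x - stereo y)"

lemma chord_of_ratio:
  assumes "a \<noteq> 0 \<or> b \<noteq> 0" "c \<noteq> 0 \<or> d \<noteq> 0"
  shows "chord (of_ratio a b) (of_ratio c d) =
    2 * cmod (a * d - b * c) / (sqrt ((cmod a)\<^sup>2 + (cmod b)\<^sup>2) * sqrt ((cmod c)\<^sup>2 + (cmod d)\<^sup>2))"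
proof -
  have "(chord (of_ratio a b) (of_ratio c d))\<^sup>2 = 2 - 2 * inner (stereo (of_ratio a b)) (stereo (of_ratio c d))"
    unfolding chord_def by (rule norm_diff_unit_vectors) simp_all
  also have "\<dots> = (2 * cmod (a * d - b * c) / (sqrt ((cmod a)\<^sup>2 + (cmod b)\<^sup>2) * sqrt ((cmod c)\<^sup>2 + (cmod d)\<^sup>2)))\<^sup>2"
    by (simp add: inner_stereo_of_ratio[OF assms] power_divide power_mult_distrib)
  finally show ?thesis
    by (subst (asm) power2_eq_iff_nonneg) (auto simp: chord_def)
qed

lemma chord_le_dist: "chord x y \<le> dist x y"
  and dist_le_chord: "dist x y \<le> 2 * chord x y"
proof -
  define \<theta> where "\<theta> = dist x y"
  have bd: "-1 \<le> inner (stereo x) (stereo y)" "inner (stereo x) (stereo y) \<le> 1"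
    using Cauchy_Schwarz_ineq2[of "stereo x" "stereo y"] by (simp_all add: abs_le_iff)
  then have \<theta>: "0 \<le> \<theta>" "\<theta> \<le> pi" "cos \<theta> = inner (stereo x) (stereo y)"
    unfolding \<theta>_def dist_riemann_sphere_def
    by (rule arccos_lbound, rule arccos_ubound, rule cos_arccos)
  have "(chord x y)\<^sup>2 = 2 - 2 * cos \<theta>"
    unfolding chord_def \<theta>(3) by (rule norm_diff_unit_vectors) simp_all
  also have "\<dots> = (2 * sin (\<theta> / 2))\<^sup>2"
    using cos_double_sin[of "\<theta> / 2"] by (simp add: power_mult_distrib)
  finally have c: "chord x y = 2 * sin (\<theta> / 2)"
    using \<theta> by (subst (asm) power2_eq_iff_nonneg) (auto simp: chord_def intro!: sin_ge_zero)
  show "chord x y \<le> dist x y"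
    using sin_x_le_x[of "\<theta> / 2"] \<theta> c by (simp add: \<theta>_def)
  \<comment> \<open>the chord is \<open>2 * sin t\<close>; on \<open>[0, pi/2]\<close> the cubic Taylor bound suffices for \<open>t \<le> 2 * sin t\<close>\<close>
  define t where "t = \<theta> / 2"
  have t: "0 \<le> t" "t \<le> pi / 2" using \<theta> by (auto simp: t_def)
  have sin3: "\<bar>sin t - (\<Sum>k<3. sin_coeff k * t ^ k)\<bar> \<le> inverse (fact 3) * \<bar>t\<bar> ^ 3"
    by (rule Maclaurin_sin_bound)
  have sum3: "(\<Sum>k<3. sin_coeff k * t ^ k) = t"
    by (simp add: sin_coeff_def eval_nat_numeral)
  have "\<bar>sin t - t\<bar> \<le> inverse (fact 3) * \<bar>t\<bar> ^ 3"
    using sin3 unfolding sum3 .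
  moreover have "inverse (fact 3) * \<bar>t\<bar> ^ 3 = t ^ 3 / 6"
    using t(1) by (simp add: fact_numeral)
  ultimately have "t - sin t \<le> t ^ 3 / 6" by linarith
  moreover have "t ^ 3 \<le> 3 * t"
  proof -
    have "t \<le> 1.7" using t(2) pi_approx(2) by simp
    then have "t * t \<le> 1.7 * 1.7" using t(1) by (intro mult_mono) linarith+
    then have "t * t \<le> 3" by simp
    then have "(t * t) * t \<le> 3 * t" using t(1) by (rule mult_right_mono)
    then show ?thesis by (simp only: power3_eq_cube)
  qed
  moreover have "t / 2 = t - 3 * t / 6" by simp
  ultimately have "t \<le> 2 * sin t" by linarith
  then show "dist x y \<le> 2 * chord x y"
    using c by (simp add: t_def \<theta>_def)
qed

lemma dist_Fin_le: "dist (Fin a) (Fin b) \<le> 4 * cmod (a - b)"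
proof -
  have "chord (Fin a) (Fin b) = 2 * cmod (a - b) / (sqrt ((cmod a)\<^sup>2 + 1) * sqrt ((cmod b)\<^sup>2 + 1))"
    using chord_of_ratio[of a 1 b 1] by (simp add: of_ratio_def)
  also have "\<dots> \<le> 2 * cmod (a - b) / 1"
    by (intro divide_left_mono mult_pos_pos mult_ge1_I) (auto simp: add_nonneg_pos)
  finally show ?thesis using dist_le_chord[of "Fin a" "Fin b"] by simp
qed


section \<open>Meromorphic parametrisations\<close>

text \<open>A map from the plane to the sphere is meromorphic at a point when it is, near that point,
  the ratio of two holomorphic functions without common zero.  In this form no point of the sphere
  is special, and rational maps act by homogeneous polynomials.\<close>

definition hom_rep :: "(complex \<Rightarrow> complex) \<Rightarrow> (complex \<Rightarrow> complex) \<Rightarrow> (complex \<Rightarrow> riemann_sphere)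
    \<Rightarrow> complex set \<Rightarrow> bool" where
  "hom_rep A B F S \<longleftrightarrow> A holomorphic_on S \<and> B holomorphic_on S \<and>
     (\<forall>z\<in>S. (A z \<noteq> 0 \<or> B z \<noteq> 0) \<and> F z = of_ratio (A z) (B z))"

definition mero_at :: "(complex \<Rightarrow> riemann_sphere) \<Rightarrow> complex \<Rightarrow> bool" where
  "mero_at F z \<longleftrightarrow> (\<exists>A B r. r > 0 \<and> hom_rep A B F (ball z r))"

text \<open>Holomorphic self-maps of the sphere, described by their action on meromorphic
  parametrisations; this makes closure under composition immediate.\<close>

definition hmap :: "(riemann_sphere \<Rightarrow> riemann_sphere) \<Rightarrow> bool" where
  "hmap f \<longleftrightarrow> (\<forall>F z. mero_at F z \<longrightarrow> mero_at (f \<circ> F) z)"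

lemma hom_rep_subset: "hom_rep A B F S \<Longrightarrow> T \<subseteq> S \<Longrightarrow> hom_rep A B F T"
  unfolding hom_rep_def by (meson holomorphic_on_subset subsetD)

lemma hmap_comp: "hmap f \<Longrightarrow> hmap g \<Longrightarrow> hmap (f \<circ> g)"
  unfolding hmap_def by (metis comp_assoc)

lemma hmap_id: "hmap id"
  unfolding hmap_def by simp

lemma mero_at_isCont:
  assumes "mero_at F z"
  shows "isCont F z"
proof -
  obtain A B r where r: "r > 0" and rep: "hom_rep A B F (ball z r)"
    using assms unfolding mero_at_def by blast
  have nz: "A w \<noteq> 0 \<or> B w \<noteq> 0" "F w = of_ratio (A w) (B w)" if "w \<in> ball z r" for w
    using rep that unfolding hom_rep_def by auto
  have zb: "z \<in> ball z r" using r by simp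
  have cont: "isCont A z" "isCont B z"
    using rep r unfolding hom_rep_def
    by (meson centre_in_ball continuous_on_eq_continuous_at holomorphic_on_imp_continuous_on open_ball)+
  define c where "c w = 2 * cmod (A w * B z - B w * A z) /
    (sqrt ((cmod (A w))\<^sup>2 + (cmod (B w))\<^sup>2) * sqrt ((cmod (A z))\<^sup>2 + (cmod (B z))\<^sup>2))" for w
  have "isCont c z"
    unfolding c_def using cont hom_norm_pos[OF nz(1)[OF zb]]
    by (intro continuous_intros) (auto simp: add_nonneg_eq_0_iff)
  then have "(c \<longlongrightarrow> 0) (at z)"
    by (simp add: isCont_def c_def)
  then have lim: "((\<lambda>w. 2 * c w) \<longlongrightarrow> 0) (at z)"
    by (rule tendsto_mult_right_zero)
  have ev: "eventually (\<lambda>w. w \<in> ball z r) (at z)"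
    using r by (intro eventually_at_in_open') auto
  have "((\<lambda>w. dist (F w) (F z)) \<longlongrightarrow> 0) (at z)"
  proof (rule tendsto_sandwich[OF _ _ tendsto_const lim])
    show "eventually (\<lambda>w. dist (F w) (F z) \<le> 2 * c w) (at z)"
      using ev
    proof eventually_elim
      case (elim w)
      have "chord (F w) (F z) = c w"
        unfolding nz(2)[OF elim] nz(2)[OF zb] c_def
        by (rule chord_of_ratio[OF nz(1)[OF elim] nz(1)[OF zb]])
      then show ?case using dist_le_chord[of "F w" "F z"] by simp
    qed
  qed simp
  then show ?thesis
    unfolding isCont_def by (rule tendsto_dist_iff[THEN iffD2])
qed

subsection \<open>Charts\<close>

lemma mero_at_Fin_comp:
  assumes "f analytic_on {z}"
  shows "mero_at (\<lambda>w. Fin (f w)) z"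
proof -
  obtain r where "r > 0" "f holomorphic_on ball z r"
    using assms unfolding analytic_on_def by auto
  then show ?thesis unfolding mero_at_def hom_rep_def
    by (intro exI[of _ f] exI[of _ "\<lambda>_. 1"] exI[of _ r]) (auto simp: of_ratio_def)
qed

lemma mero_at_chart_inv: "mero_at (chart_inv x) z"
proof (cases x)
  case (Fin a)
  have "mero_at (\<lambda>w. Fin w) z" by (rule mero_at_Fin_comp) (rule analytic_on_ident)
  moreover have "chart_inv x = (\<lambda>w. Fin w)" using Fin by auto
  ultimately show ?thesis by simp
next
  case Infty
  have "hom_rep (\<lambda>_. 1) (\<lambda>w. w) (chart_inv x) (ball z 1)"
    unfolding hom_rep_def using Infty by (auto simp: of_ratio_def)
  then show ?thesis unfolding mero_at_def by (intro exI conjI) (auto intro: zero_less_one)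
qed

lemma chart_inv_chart_self [simp]: "chart_inv x (chart x x) = x"
  by (cases x) auto

lemma continuous_on_chart_inv: "continuous_on S (chart_inv x)"
  by (simp add: continuous_at_imp_continuous_on mero_at_chart_inv mero_at_isCont)

lemma continuous_on_Fin [continuous_intros]: "continuous_on S f \<Longrightarrow> continuous_on S (\<lambda>z. Fin (f z))"
  using continuous_on_compose2[OF continuous_on_chart_inv[of UNIV "Fin 0"], of S f] by simp

lemma compact_UNIV_sphere: "compact (UNIV :: riemann_sphere set)"
proof -
  have "x \<in> chart_inv (Fin 0) ` cball 0 1 \<union> chart_inv Infty ` cball 0 1" for x
  proof (cases x)
    case (Fin z)
    show ?thesis
    proof (cases "cmod z \<le> 1")
      case True
      show ?thesis by (rule UnI1, rule image_eqI[of _ _ z]) (use True Fin in simp_all)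
    next
      case False
      then have "z \<noteq> 0" "1 \<le> cmod z" by auto
      then show ?thesis
        by (intro UnI2, intro image_eqI[of _ _ "1 / z"]) (use Fin in \<open>simp_all add: norm_divide\<close>)
    qed
  next
    case Infty
    show ?thesis by (rule UnI2, rule image_eqI[of _ _ 0]) (use Infty in simp_all)
  qed
  then have "UNIV = chart_inv (Fin 0) ` cball 0 1 \<union> chart_inv Infty ` cball 0 1"
    by (intro UNIV_eq_I)
  moreover have "compact (chart_inv y ` cball 0 1)" for y
    by (intro compact_continuous_image continuous_on_chart_inv compact_cball)
  ultimately show ?thesis by (metis (no_types) compact_Un)
qed

lemma closed_imp_compact_sphere: "closed (S :: riemann_sphere set) \<Longrightarrow> compact S"
  using compact_Int_closed[OF compact_UNIV_sphere] by (simp add: Int_commute)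

subsection \<open>Rational maps in homogeneous coordinates\<close>

text \<open>The homogenised numerator and denominator have no common zero besides the origin, so rational maps act on homogeneous coordinates without exceptional points.\<close>

definition hom_poly :: "nat \<Rightarrow> complex poly \<Rightarrow> complex \<Rightarrow> complex \<Rightarrow> complex" where
  "hom_poly d P a b = (\<Sum>i\<le>d. coeff P i * a ^ i * b ^ (d - i))"

lemma hom_poly_finite:
  assumes "degree P \<le> d" "b \<noteq> 0"
  shows "hom_poly d P a b = b ^ d * poly P (a / b)"
proof -
  have P: "poly P (a / b) = (\<Sum>i\<le>d. coeff P i * (a / b) ^ i)"
    unfolding poly_altdef using assms(1)
    by (intro sum.mono_neutral_left) (auto simp: coeff_eq_0)
  have "b ^ d * (coeff P i * (a / b) ^ i) = coeff P i * a ^ i * b ^ (d - i)" if "i \<le> d" for i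
    using that assms(2) by (simp add: power_divide power_diff)
  then show ?thesis unfolding hom_poly_def P sum_distrib_left by (intro sum.cong refl) (simp only: atMost_iff)
qed

lemma hom_poly_infinite: "hom_poly d P a 0 = coeff P d * a ^ d"
proof -
  have "hom_poly d P a 0 = (\<Sum>i\<in>{d}. coeff P i * a ^ i * 0 ^ (d - i))"
    unfolding hom_poly_def by (rule sum.mono_neutral_right) auto
  then show ?thesis by simp
qed

lemma rat_map_of_ratio:
  assumes "a \<noteq> 0 \<or> b \<noteq> 0" and d: "d = max (degree P) (degree Q)"
  shows "rat_map P Q (of_ratio a b) = of_ratio (hom_poly d P a b) (hom_poly d Q a b)"
proof (cases "b = 0")
  case True
  then show ?thesis using assms by (simp add: hom_poly_infinite of_ratio_def)
next
  case False
  then show ?thesis using d by (simp add: hom_poly_finite of_ratio_def)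
qed

lemma coprime_no_common_root:
  assumes "coprime P Q" "poly P z = 0" "poly Q z = 0"
  shows False
proof -
  have "[:-z, 1:] dvd P" "[:-z, 1:] dvd Q" using assms by (simp_all add: poly_eq_0_iff_dvd)
  then have "is_unit [:-z, 1:]" using assms(1) coprime_common_divisor by blast
  then show False using poly_eq_0_iff_dvd[of 1 z] by simp
qed

lemma hom_poly_no_common_zero:
  assumes "coprime P Q" and d: "d = max (degree P) (degree Q)" "d \<ge> 1" and ab: "a \<noteq> 0 \<or> b \<noteq> 0"
  shows "hom_poly d P a b \<noteq> 0 \<or> hom_poly d Q a b \<noteq> 0"
proof (cases "b = 0")
  case True
  have "coeff P d \<noteq> 0 \<or> coeff Q d \<noteq> 0"
    using d by (metis leading_coeff_0_iff max_def degree_0 not_one_le_zero)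
  then show ?thesis using True ab by (auto simp: hom_poly_infinite)
next
  case False
  then show ?thesis
    using coprime_no_common_root[OF assms(1), of "a / b"] d by (auto simp: hom_poly_finite)
qed

lemma Rat_imp_hmap:
  assumes "f \<in> Rat"
  shows "hmap f"
proof -
  obtain P Q where f: "f = rat_map P Q" and PQ: "coprime P Q" "max (degree P) (degree Q) \<ge> 1"
    using assms unfolding Rat_def by blast
  define d where "d = max (degree P) (degree Q)"
  have "mero_at (f \<circ> F) z" if F: "mero_at F z" for F z
  proof -
    obtain A B r where r: "r > 0" and rep: "hom_rep A B F (ball z r)"
      using F unfolding mero_at_def by blast
    have "hom_rep (\<lambda>w. hom_poly d P (A w) (B w)) (\<lambda>w. hom_poly d Q (A w) (B w)) (f \<circ> F) (ball z r)"
      unfolding hom_rep_def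
    proof (intro conjI ballI)
      show "(\<lambda>w. hom_poly d P (A w) (B w)) holomorphic_on ball z r"
        "(\<lambda>w. hom_poly d Q (A w) (B w)) holomorphic_on ball z r"
        using rep unfolding hom_rep_def hom_poly_def by (auto intro!: holomorphic_intros)
    next
      fix w assume "w \<in> ball z r"
      then have w: "A w \<noteq> 0 \<or> B w \<noteq> 0" "F w = of_ratio (A w) (B w)"
        using rep unfolding hom_rep_def by auto
      show "hom_poly d P (A w) (B w) \<noteq> 0 \<or> hom_poly d Q (A w) (B w) \<noteq> 0"
        using hom_poly_no_common_zero[OF PQ(1) d_def _ w(1)] PQ(2) by (simp add: d_def)
      show "(f \<circ> F) w = of_ratio (hom_poly d P (A w) (B w)) (hom_poly d Q (A w) (B w))"
        using rat_map_of_ratio[OF w(1) d_def] w(2) by (simp add: f)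
    qed
    then show ?thesis using r unfolding mero_at_def by blast
  qed
  then show ?thesis unfolding hmap_def by blast
qed

lemma Rat_surj:
  assumes "f \<in> Rat"
  shows "surj f"
proof -
  obtain P Q where f: "f = rat_map P Q" and PQ: "coprime P Q" "max (degree P) (degree Q) \<ge> 1"
    using assms unfolding Rat_def by blast
  define d where "d = max (degree P) (degree Q)"
  have "\<exists>x. f x = y" for y
  proof -
    obtain u v where uv: "u \<noteq> 0 \<or> v \<noteq> 0" "y = of_ratio u v" by (rule of_ratio_cases)
    define R where "R = smult v P - smult u Q"
    \<comment> \<open>a common zero of the binary form \<open>v P - u Q\<close> is a preimage of \<open>u / v\<close>\<close>
    have "\<exists>a b. (a \<noteq> 0 \<or> b \<noteq> 0) \<and> v * hom_poly d P a b = u * hom_poly d Q a b"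
    proof (cases "degree R < d")
      case True
      then have "coeff R d = 0" by (rule coeff_eq_0)
      then have "v * hom_poly d P 1 0 = u * hom_poly d Q 1 0"
        by (simp add: R_def hom_poly_infinite)
      then show ?thesis by (intro exI[of _ 1] exI[of _ 0]) simp
    next
      case False
      then have "degree R > 0" using PQ(2) by (simp add: d_def)
      then obtain z where "poly R z = 0"
        using fundamental_theorem_of_algebra[of R] constant_degree[of R] by auto
      then have "v * hom_poly d P z 1 = u * hom_poly d Q z 1"
        by (simp add: R_def hom_poly_finite d_def)
      then show ?thesis by (intro exI[of _ z] exI[of _ 1]) simp
    qed
    then obtain a b where ab: "a \<noteq> 0 \<or> b \<noteq> 0" "v * hom_poly d P a b = u * hom_poly d Q a b" by blast
    have "f (of_ratio a b) = of_ratio u v"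
      unfolding f rat_map_of_ratio[OF ab(1) d_def]
      using hom_poly_no_common_zero[OF PQ(1) d_def _ ab(1)] PQ(2) uv(1) ab(2)
      by (subst of_ratio_eq_iff) (auto simp: d_def algebra_simps)
    then show ?thesis using uv by blast
  qed
  then show ?thesis by (metis surjI)
qed

subsection \<open>Moebius transformations\<close>

fun hom_x :: "riemann_sphere \<Rightarrow> complex" where
  "hom_x (Fin z) = z" | "hom_x Infty = 1"

fun hom_y :: "riemann_sphere \<Rightarrow> complex" where
  "hom_y (Fin z) = 1" | "hom_y Infty = 0"

definition mob :: "complex \<Rightarrow> complex \<Rightarrow> complex \<Rightarrow> complex \<Rightarrow> riemann_sphere \<Rightarrow> riemann_sphere" where
  "mob a b c d x = of_ratio (a * hom_x x + b * hom_y x) (c * hom_x x + d * hom_y x)"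

lemma mob_of_ratio:
  assumes "s \<noteq> 0 \<or> t \<noteq> 0"
  shows "mob a b c d (of_ratio s t) = of_ratio (a * s + b * t) (c * s + d * t)"
proof (cases "t = 0")
  case True
  then show ?thesis using assms by (auto simp: mob_def of_ratio_def)
next
  case False
  have "c * (s / t) + d = (c * s + d * t) / t" "a * (s / t) + b = (a * s + b * t) / t"
    using False by (simp_all add: field_simps)
  then show ?thesis using False by (simp add: mob_def of_ratio_def)
qed

lemma mob_nonzero:
  fixes s t :: complex
  assumes "a * d - b * c \<noteq> 0" "s \<noteq> 0 \<or> t \<noteq> 0"
  shows "a * s + b * t \<noteq> 0 \<or> c * s + d * t \<noteq> 0"
proof (rule ccontr)
  assume "\<not> ?thesis"
  then have z: "a * s + b * t = 0" "c * s + d * t = 0" by auto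
  have "(a * d - b * c) * s = d * (a * s + b * t) - b * (c * s + d * t)"
    "(a * d - b * c) * t = a * (c * s + d * t) - c * (a * s + b * t)"
    by (simp_all add: algebra_simps)
  then show False using z assms by simp
qed

lemma hmap_mob:
  assumes "a * d - b * c \<noteq> 0"
  shows "hmap (mob a b c d)"
  unfolding hmap_def
proof (intro allI impI)
  fix F z assume "mero_at F z"
  then obtain A B r where r: "r > 0" and rep: "hom_rep A B F (ball z r)"
    unfolding mero_at_def by blast
  have "hom_rep (\<lambda>w. a * A w + b * B w) (\<lambda>w. c * A w + d * B w) (mob a b c d \<circ> F) (ball z r)"
    unfolding hom_rep_def
  proof (intro conjI ballI)
    show "(\<lambda>w. a * A w + b * B w) holomorphic_on ball z r" "(\<lambda>w. c * A w + d * B w) holomorphic_on ball z r"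
      using rep unfolding hom_rep_def by (auto intro!: holomorphic_intros)
  next
    fix w assume "w \<in> ball z r"
    then have w: "A w \<noteq> 0 \<or> B w \<noteq> 0" "F w = of_ratio (A w) (B w)"
      using rep unfolding hom_rep_def by auto
    show "a * A w + b * B w \<noteq> 0 \<or> c * A w + d * B w \<noteq> 0" by (rule mob_nonzero[OF assms w(1)])
    show "(mob a b c d \<circ> F) w = of_ratio (a * A w + b * B w) (c * A w + d * B w)"
      using mob_of_ratio[OF w(1)] w(2) by simp
  qed
  then show "mero_at (mob a b c d \<circ> F) z" using r unfolding mero_at_def by blast
qed

lemma mob_inverse:
  assumes "a * d - b * c \<noteq> 0"
  shows "mob d (-b) (-c) a (mob a b c d x) = x"
proof -
  obtain s t where st: "s \<noteq> 0 \<or> t \<noteq> 0" and x: "x = of_ratio s t" by (rule of_ratio_cases)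
  define D where "D = a * d - b * c"
  have 1: "d * (a * s + b * t) + - b * (c * s + d * t) = D * s"
    "- c * (a * s + b * t) + a * (c * s + d * t) = D * t"
    by (simp_all add: D_def algebra_simps)
  show ?thesis
    unfolding x mob_of_ratio[OF st] mob_of_ratio[OF mob_nonzero[OF assms st]] 1
    using assms by (simp add: of_ratio_def D_def)
qed

text \<open>The determinant times a vector is a combination of the coordinates of its image, so the map distorts
lengths of homogeneous vectors, and with them the chordal distance, by a bounded factor.\<close>

lemma mob_chord_Lipschitz:
  assumes "a * d - b * c \<noteq> 0"
  shows "\<exists>C>0. \<forall>x y. chord (mob a b c d x) (mob a b c d y) \<le> C * chord x y"
proof -
  define D where "D = a * d - b * c"
  have D: "D \<noteq> 0" using assms by (simp add: D_def)
  define K where "K = sqrt 2 * (cmod a + cmod b + cmod c + cmod d) / cmod D"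
  have K: "sqrt ((cmod s)\<^sup>2 + (cmod t)\<^sup>2) \<le> K * sqrt ((cmod (a * s + b * t))\<^sup>2 + (cmod (c * s + d * t))\<^sup>2)"
    for s t
  proof -
    define N where "N = sqrt ((cmod (a * s + b * t))\<^sup>2 + (cmod (c * s + d * t))\<^sup>2)"
    have N: "cmod (a * s + b * t) \<le> N" "cmod (c * s + d * t) \<le> N" unfolding N_def
      by (simp_all add: real_le_rsqrt)
    define S where "S = cmod a + cmod b + cmod c + cmod d"
    have 1: "D * s = d * (a * s + b * t) - b * (c * s + d * t)"
      "D * t = a * (c * s + d * t) - c * (a * s + b * t)"
      by (simp_all add: D_def algebra_simps)
    have "cmod D * cmod s \<le> cmod d * cmod (a * s + b * t) + cmod b * cmod (c * s + d * t)"
      by (metis 1(1) norm_mult norm_triangle_ineq4)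
    also have "\<dots> \<le> cmod d * N + cmod b * N" using N by (intro add_mono mult_left_mono) auto
    also have "\<dots> \<le> S * N"
      using N norm_ge_zero[of "a * s + b * t"] unfolding S_def
      by (simp only: distrib_right[symmetric]) (intro mult_right_mono order_trans[OF norm_ge_zero], auto)
    finally have s: "cmod D * cmod s \<le> S * N" .
    have "cmod D * cmod t \<le> cmod a * cmod (c * s + d * t) + cmod c * cmod (a * s + b * t)"
      by (metis 1(2) norm_mult norm_triangle_ineq4)
    also have "\<dots> \<le> cmod a * N + cmod c * N" using N by (intro add_mono mult_left_mono) auto
    also have "\<dots> \<le> S * N"
      using N norm_ge_zero[of "a * s + b * t"] unfolding S_def
      by (simp only: distrib_right[symmetric]) (intro mult_right_mono order_trans[OF norm_ge_zero], auto)
    finally have t: "cmod D * cmod t \<le> S * N" .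
    have st: "cmod s \<le> S * N / cmod D" "cmod t \<le> S * N / cmod D"
      using s t D by (simp_all add: field_simps)
    have "(cmod s)\<^sup>2 + (cmod t)\<^sup>2 \<le> (S * N / cmod D)\<^sup>2 + (S * N / cmod D)\<^sup>2"
      using st by (intro add_mono power_mono) auto
    then have "sqrt ((cmod s)\<^sup>2 + (cmod t)\<^sup>2) \<le> sqrt (2 * (S * N / cmod D)\<^sup>2)"
      by simp
    also have "\<dots> = sqrt 2 * (S * N / cmod D)"
      using order_trans[OF norm_ge_zero st(1)] by (simp only: real_sqrt_mult real_sqrt_abs abs_of_nonneg)
    finally show ?thesis by (simp add: K_def S_def N_def)
  qed
  define C where "C = cmod D * K\<^sup>2 + 1"
  have "chord (mob a b c d x) (mob a b c d y) \<le> C * chord x y" for x y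
  proof -
    obtain s t where st: "s \<noteq> 0 \<or> t \<noteq> 0" and x: "x = of_ratio s t" by (rule of_ratio_cases)
    obtain u v where uv: "u \<noteq> 0 \<or> v \<noteq> 0" and y: "y = of_ratio u v" by (rule of_ratio_cases)
    define n1 n2 where "n1 = sqrt ((cmod s)\<^sup>2 + (cmod t)\<^sup>2)" and "n2 = sqrt ((cmod u)\<^sup>2 + (cmod v)\<^sup>2)"
    define m1 m2 where "m1 = sqrt ((cmod (a * s + b * t))\<^sup>2 + (cmod (c * s + d * t))\<^sup>2)"
      and "m2 = sqrt ((cmod (a * u + b * v))\<^sup>2 + (cmod (c * u + d * v))\<^sup>2)"
    have pos: "n1 > 0" "n2 > 0" "m1 > 0" "m2 > 0"
      unfolding n1_def n2_def m1_def m2_def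
      using hom_norm_pos[OF st] hom_norm_pos[OF uv] hom_norm_pos[OF mob_nonzero[OF assms st]]
        hom_norm_pos[OF mob_nonzero[OF assms uv]] by (simp_all only: real_sqrt_gt_0_iff)
    have det: "(a * s + b * t) * (c * u + d * v) - (c * s + d * t) * (a * u + b * v) = D * (s * v - t * u)"
      by (simp add: D_def algebra_simps)
    have "chord (mob a b c d x) (mob a b c d y) = 2 * (cmod D * cmod (s * v - t * u)) / (m1 * m2)"
      unfolding x y mob_of_ratio[OF st] mob_of_ratio[OF uv]
        chord_of_ratio[OF mob_nonzero[OF assms st] mob_nonzero[OF assms uv]] det m1_def m2_def
      by (simp add: norm_mult)
    moreover have K12: "n1 \<le> K * m1" "n2 \<le> K * m2"
      using K[of s t] K[of u v] unfolding n1_def n2_def m1_def m2_def by auto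
    have "n1 * n2 \<le> (K * m1) * (K * m2)"
      using K12 pos order_trans[OF less_imp_le[OF pos(1)] K12(1)] by (intro mult_mono) auto
    then have "1 / (m1 * m2) \<le> K\<^sup>2 / (n1 * n2)"
      using pos by (simp add: field_simps power2_eq_square)
    then have "(2 * (cmod D * cmod (s * v - t * u))) * (1 / (m1 * m2)) \<le> (2 * (cmod D * cmod (s * v - t * u))) * (K\<^sup>2 / (n1 * n2))"
      by (rule mult_left_mono) auto
    ultimately have "chord (mob a b c d x) (mob a b c d y) \<le> (cmod D * K\<^sup>2) * (2 * cmod (s * v - t * u) / (n1 * n2))"
      by (simp add: algebra_simps)
    also have "2 * cmod (s * v - t * u) / (n1 * n2) = chord x y"
      unfolding x y chord_of_ratio[OF st uv] n1_def n2_def ..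
    also have "(cmod D * K\<^sup>2) * chord x y \<le> C * chord x y"
      by (intro mult_right_mono) (auto simp: C_def chord_def)
    finally show ?thesis .
  qed
  moreover have "C > 0" by (simp add: C_def add_nonneg_pos)
  ultimately show ?thesis by blast
qed

lemma mob_Lipschitz:
  assumes "a * d - b * c \<noteq> 0"
  obtains C where "C > 0" "\<And>x y. dist (mob a b c d x) (mob a b c d y) \<le> C * dist x y"
proof -
  obtain C where C: "C > 0" "\<And>x y. chord (mob a b c d x) (mob a b c d y) \<le> C * chord x y"
    using mob_chord_Lipschitz[OF assms] by blast
  have "dist (mob a b c d x) (mob a b c d y) \<le> (2 * C) * dist x y" for x y
    using dist_le_chord[of "mob a b c d x" "mob a b c d y"] C(2)[of x y]
      mult_left_mono[OF chord_le_dist[of x y], of C] C(1) by linarith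
  with C(1) show thesis by (intro that[of "2 * C"]) auto
qed

subsection \<open>The spherical derivative\<close>

lemma isCont_eventually_in:
  fixes f :: "'a::t2_space \<Rightarrow> 'b::topological_space"
  assumes "isCont f x" "open S" "f x \<in> S"
  shows "eventually (\<lambda>y. f y \<in> S) (nhds x)"
proof -
  have "(f \<longlongrightarrow> f x) (nhds x)"
    using assms(1) by (simp add: continuous_at tendsto_at_iff_tendsto_nhds)
  then show ?thesis using assms(2,3) by (rule topological_tendstoD)
qed

lemma isCont_eventually_ne:
  fixes f :: "'a::t2_space \<Rightarrow> 'b::t1_space"
  assumes "isCont f x" "f x \<noteq> a"
  shows "eventually (\<lambda>y. f y \<noteq> a) (nhds x)"
proof -
  have "(f \<longlongrightarrow> f x) (nhds x)"
    using assms(1) by (simp add: continuous_at tendsto_at_iff_tendsto_nhds)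
  then show ?thesis using assms(2) by (rule tendsto_imp_eventually_ne)
qed

text \<open>Half of the spherical length of the derivative of a parametrisation: the factor \<open>2\<close> of the
spherical density cancels in \<^const>\<open>sph_deriv_norm\<close>.\<close>

definition sph_speed :: "(complex \<Rightarrow> riemann_sphere) \<Rightarrow> complex \<Rightarrow> real" where
  "sph_speed F z = cmod (deriv (\<lambda>w. chart (F z) (F w)) z) / (1 + (cmod (chart (F z) (F z)))\<^sup>2)"

lemma sph_deriv_norm_eq_speed:
  "sph_deriv_norm f x = sph_speed (f \<circ> chart_inv x) (chart x x) * (1 + (cmod (chart x x))\<^sup>2)"
  unfolding sph_deriv_norm_def local_deriv_def sph_speed_def by simp

text \<open>The Wronskian formula is symmetric in numerator and denominator, so poles need no separate treatment later.\<close>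

lemma sph_speed_hom_rep:
  assumes rep: "hom_rep A B F (ball z r)" and r: "r > 0"
  shows "sph_speed F z =
    cmod (deriv A z * B z - A z * deriv B z) / ((cmod (A z))\<^sup>2 + (cmod (B z))\<^sup>2)" (is "_ = ?W / _")
    and "(\<lambda>w. chart (F z) (F w)) analytic_on {z}"
proof -
  have hol: "A holomorphic_on ball z r" "B holomorphic_on ball z r" using rep unfolding hom_rep_def by auto
  have F: "F w = of_ratio (A w) (B w)" if "w \<in> ball z r" for w using that rep unfolding hom_rep_def by auto
  have nz: "A z \<noteq> 0 \<or> B z \<noteq> 0" using r rep unfolding hom_rep_def by auto
  have A: "(A has_field_derivative deriv A z) (at z)" and B: "(B has_field_derivative deriv B z) (at z)"
    using hol r by (auto intro!: holomorphic_derivI[of _ "ball z r"])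
  have ana: "A analytic_on {z}" "B analytic_on {z}"
    using hol r unfolding analytic_on_def by auto
  have cont: "isCont A z" "isCont B z" using A B by (auto intro: DERIV_isCont)
  have inb: "eventually (\<lambda>w. w \<in> ball z r) (nhds z)"
    using r by (intro eventually_nhds_in_open) auto
  have "sph_speed F z = ?W / ((cmod (A z))\<^sup>2 + (cmod (B z))\<^sup>2) \<and> (\<lambda>w. chart (F z) (F w)) analytic_on {z}"
  proof (cases "B z = 0")
    case False
    have Fz: "F z = Fin (A z / B z)" using F[of z] r False by (simp add: of_ratio_def)
    have "eventually (\<lambda>w. B w \<noteq> 0) (nhds z)"
      using cont(2) False by (rule isCont_eventually_ne)
    with inb have ev: "eventually (\<lambda>w. A w / B w = chart (F z) (F w)) (nhds z)"
      by eventually_elim (simp add: F Fz of_ratio_def)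
    have der: "((\<lambda>w. A w / B w) has_field_derivative (deriv A z * B z - A z * deriv B z) / (B z * B z)) (at z)"
      using A B False by (rule DERIV_divide)
    have "((\<lambda>w. chart (F z) (F w)) has_field_derivative (deriv A z * B z - A z * deriv B z) / (B z * B z)) (at z)"
      using der DERIV_cong_ev[OF refl ev refl] by simp
    then have d: "deriv (\<lambda>w. chart (F z) (F w)) z = (deriv A z * B z - A z * deriv B z) / (B z * B z)"
      by (rule DERIV_imp_deriv)
    have "(\<lambda>w. A w / B w) analytic_on {z}" using ana False by (intro analytic_intros) auto
    then have an: "(\<lambda>w. chart (F z) (F w)) analytic_on {z}"
      using ev by (simp add: analytic_at_cong)
    have "sph_speed F z = ?W / ((cmod (B z))\<^sup>2 * (1 + (cmod (A z / B z))\<^sup>2))"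
      unfolding sph_speed_def d by (simp add: Fz norm_divide norm_mult power2_eq_square)
    also have "(cmod (B z))\<^sup>2 * (1 + (cmod (A z / B z))\<^sup>2) = (cmod (A z))\<^sup>2 + (cmod (B z))\<^sup>2"
      using False by (simp add: norm_divide power_divide distrib_left)
    finally show ?thesis using an by simp
  next
    case True
    then have Az: "A z \<noteq> 0" using nz by simp
    have Fz: "F z = Infty" using F[of z] r True by (simp add: of_ratio_def)
    have "eventually (\<lambda>w. A w \<noteq> 0) (nhds z)"
      using cont(1) Az by (rule isCont_eventually_ne)
    with inb have ev: "eventually (\<lambda>w. B w / A w = chart (F z) (F w)) (nhds z)"
      by eventually_elim (simp add: F Fz of_ratio_def)
    have der: "((\<lambda>w. B w / A w) has_field_derivative (deriv B z * A z - B z * deriv A z) / (A z * A z)) (at z)"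
      using B A Az by (rule DERIV_divide)
    have "((\<lambda>w. chart (F z) (F w)) has_field_derivative (deriv B z * A z - B z * deriv A z) / (A z * A z)) (at z)"
      using der DERIV_cong_ev[OF refl ev refl] by simp
    then have d: "deriv (\<lambda>w. chart (F z) (F w)) z = (deriv B z * A z - B z * deriv A z) / (A z * A z)"
      by (rule DERIV_imp_deriv)
    have "(\<lambda>w. B w / A w) analytic_on {z}" using ana Az by (intro analytic_intros) auto
    then have an: "(\<lambda>w. chart (F z) (F w)) analytic_on {z}"
      using ev by (simp add: analytic_at_cong)
    show ?thesis using an unfolding sph_speed_def d
      by (simp add: Fz True norm_divide norm_mult power2_eq_square)
  qed
  then show "sph_speed F z = ?W / ((cmod (A z))\<^sup>2 + (cmod (B z))\<^sup>2)"
    and "(\<lambda>w. chart (F z) (F w)) analytic_on {z}" by auto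
qed

lemma mero_at_chart_analytic:
  assumes "mero_at F z"
  shows "(\<lambda>w. chart (F z) (F w)) analytic_on {z}"
  using assms sph_speed_hom_rep(2) unfolding mero_at_def by blast

lemma eventually_chart_inv_chart:
  assumes "mero_at F z"
  shows "eventually (\<lambda>w. F w = chart_inv (F z) (chart (F z) (F w))) (nhds z)"
proof -
  have c: "isCont F z" by (rule mero_at_isCont[OF assms])
  define y where "y = (case F z of Fin a \<Rightarrow> Infty | Infty \<Rightarrow> Fin 0)"
  have "F z \<noteq> y" by (cases "F z") (auto simp: y_def)
  then have "eventually (\<lambda>w. F w \<noteq> y) (nhds z)"
    by (rule isCont_eventually_ne[OF c])
  then show ?thesis
  proof eventually_elim
    case (elim w)
    then show ?case by (cases "F z"; cases "F w") (auto simp: y_def)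
  qed
qed

text \<open>The chain rule has no correction factors, because \<^const>\<open>sph_deriv_norm\<close> measures both
  ends with the spherical metric.\<close>

lemma sph_speed_chain:
  assumes g: "hmap g" and F: "mero_at F z"
  shows "sph_speed (g \<circ> F) z = sph_deriv_norm g (F z) * sph_speed F z"
proof -
  define \<phi> where "\<phi> w = chart (F z) (F w)" for w
  have ana: "\<phi> analytic_on {z}" unfolding \<phi>_def by (rule mero_at_chart_analytic[OF F])
  have "mero_at (g \<circ> chart_inv (F z)) (\<phi> z)"
    using g mero_at_chart_inv unfolding hmap_def by blast
  then obtain A B r where r: "r > 0" and rep: "hom_rep A B (g \<circ> chart_inv (F z)) (ball (\<phi> z) r)"
    unfolding mero_at_def by blast
  obtain s where s: "s > 0" "\<phi> holomorphic_on ball z s" using ana unfolding analytic_on_def by auto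
  then have "isCont \<phi> z"
    by (meson centre_in_ball continuous_on_eq_continuous_at holomorphic_on_imp_continuous_on open_ball)
  then have "eventually (\<lambda>w. \<phi> w \<in> ball (\<phi> z) r) (nhds z)"
    by (rule isCont_eventually_in) (use r in auto)
  moreover have "eventually (\<lambda>w. w \<in> ball z s) (nhds z)"
    using s by (intro eventually_nhds_in_open) auto
  moreover have "eventually (\<lambda>w. F w = chart_inv (F z) (\<phi> w)) (nhds z)"
    unfolding \<phi>_def by (rule eventually_chart_inv_chart[OF F])
  ultimately have "eventually (\<lambda>w. w \<in> ball z s \<and> \<phi> w \<in> ball (\<phi> z) r \<and> F w = chart_inv (F z) (\<phi> w)) (nhds z)"
    by eventually_elim auto
  then obtain \<delta> where \<delta>: "\<delta> > 0" and
    in_ball: "\<And>w. w \<in> ball z \<delta> \<Longrightarrow> w \<in> ball z s \<and> \<phi> w \<in> ball (\<phi> z) r \<and> F w = chart_inv (F z) (\<phi> w)"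
    unfolding eventually_nhds_metric by (auto simp: dist_commute)
  have hol: "A holomorphic_on ball (\<phi> z) r" "B holomorphic_on ball (\<phi> z) r"
    using rep unfolding hom_rep_def by auto
  have hol\<phi>: "\<phi> holomorphic_on ball z \<delta>"
    using s(2) by (rule holomorphic_on_subset) (use in_ball in blast)
  have rep2: "hom_rep (\<lambda>w. A (\<phi> w)) (\<lambda>w. B (\<phi> w)) (g \<circ> F) (ball z \<delta>)"
    unfolding hom_rep_def
  proof (intro conjI ballI)
    show "(\<lambda>w. A (\<phi> w)) holomorphic_on ball z \<delta>" "(\<lambda>w. B (\<phi> w)) holomorphic_on ball z \<delta>"
      using holomorphic_on_compose_gen[OF hol\<phi> hol(1)] holomorphic_on_compose_gen[OF hol\<phi> hol(2)] in_ball
      unfolding o_def by blast+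
  next
    fix w assume w: "w \<in> ball z \<delta>"
    from in_ball[OF w] rep
    show "A (\<phi> w) \<noteq> 0 \<or> B (\<phi> w) \<noteq> 0" "(g \<circ> F) w = of_ratio (A (\<phi> w)) (B (\<phi> w))"
      unfolding hom_rep_def by auto
  qed
  have d\<phi>: "(\<phi> has_field_derivative deriv \<phi> z) (at z)"
    using hol\<phi> \<delta> by (auto intro!: holomorphic_derivI[of _ "ball z \<delta>"])
  have dA: "(A has_field_derivative deriv A (\<phi> z)) (at (\<phi> z))"
    and dB: "(B has_field_derivative deriv B (\<phi> z)) (at (\<phi> z))"
    using hol r by (auto intro!: holomorphic_derivI[of _ "ball (\<phi> z) r"])
  have dd: "deriv (\<lambda>w. A (\<phi> w)) z = deriv A (\<phi> z) * deriv \<phi> z"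
    "deriv (\<lambda>w. B (\<phi> w)) z = deriv B (\<phi> z) * deriv \<phi> z"
    using DERIV_chain2[OF dA d\<phi>] DERIV_chain2[OF dB d\<phi>] by (auto intro: DERIV_imp_deriv)
  have *: "deriv A (\<phi> z) * deriv \<phi> z * B (\<phi> z) - A (\<phi> z) * (deriv B (\<phi> z) * deriv \<phi> z)
    = (deriv A (\<phi> z) * B (\<phi> z) - A (\<phi> z) * deriv B (\<phi> z)) * deriv \<phi> z"
    by (simp add: algebra_simps)
  have "sph_speed (g \<circ> F) z = sph_speed (g \<circ> chart_inv (F z)) (\<phi> z) * cmod (deriv \<phi> z)"
    unfolding sph_speed_hom_rep(1)[OF rep2 \<delta>] sph_speed_hom_rep(1)[OF rep r] dd *
    by (simp add: norm_mult)
  moreover have "sph_speed F z * (1 + (cmod (\<phi> z))\<^sup>2) = cmod (deriv \<phi> z)"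
    unfolding sph_speed_def \<phi>_def by (simp add: add_nonneg_eq_0_iff)
  ultimately show ?thesis
    unfolding sph_deriv_norm_eq_speed \<phi>_def by (simp add: mult_ac)
qed

lemma sph_speed_chart_inv: "sph_speed (chart_inv x) z = 1 / (1 + (cmod z)\<^sup>2)"
proof (cases x)
  case (Fin a)
  have "hom_rep (\<lambda>w. w) (\<lambda>_. 1) (chart_inv x) (ball z 1)"
    unfolding hom_rep_def using Fin by (auto simp: of_ratio_def)
  from sph_speed_hom_rep(1)[OF this] show ?thesis by (simp add: add.commute)
next
  case Infty
  have "hom_rep (\<lambda>_. 1) (\<lambda>w. w) (chart_inv x) (ball z 1)"
    unfolding hom_rep_def using Infty by (auto simp: of_ratio_def)
  from sph_speed_hom_rep(1)[OF this] show ?thesis by simp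
qed

lemma sph_deriv_norm_comp:
  assumes "hmap f" "hmap g"
  shows "sph_deriv_norm (f \<circ> g) x = sph_deriv_norm f (g x) * sph_deriv_norm g x"
proof -
  have "mero_at (g \<circ> chart_inv x) (chart x x)"
    using assms(2) mero_at_chart_inv unfolding hmap_def by blast
  from sph_speed_chain[OF assms(1) this] show ?thesis
    unfolding sph_deriv_norm_eq_speed[of "f \<circ> g"] sph_deriv_norm_eq_speed[of g] comp_assoc by simp
qed

lemma sph_deriv_norm_zero_iff: "sph_deriv_norm f x = 0 \<longleftrightarrow> local_deriv f x = 0"
proof -
  have "1 + (cmod u)\<^sup>2 \<noteq> 0" for u by (metis add_pos_nonneg less_irrefl zero_le_power2 zero_less_one)
  then show ?thesis unfolding sph_deriv_norm_def by simp
qed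

lemma continuous_on_stereo: "continuous_on S stereo"
proof (rule continuous_on_subset[of UNIV])
  show "continuous_on UNIV stereo"
    unfolding continuous_on_iff
    by (metis UNIV_I chord_def chord_le_dist dist_norm order.strict_trans1)
qed simp

lemma tendsto_chord: "((\<lambda>y. chord y z) \<longlongrightarrow> chord x z) (at x)"
proof -
  have "isCont stereo x" using continuous_on_stereo[of UNIV] by (simp add: continuous_on_eq_continuous_at)
  then have "isCont (\<lambda>y. chord y z) x" unfolding chord_def by (intro continuous_intros)
  then show ?thesis by (simp add: isCont_def)
qed

lemma isCont_chart_Fin: "isCont (chart (Fin 0)) (Fin a)"
proof -
  define k where "k y = chord y (Fin a) * sqrt ((cmod a)\<^sup>2 + 1) / chord y Infty" for y
  have inf: "chord (Fin w) Infty = 2 / sqrt ((cmod w)\<^sup>2 + 1)" for w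
    using chord_of_ratio[of w 1 1 0] by (simp add: of_ratio_def)
  have sq: "sqrt ((cmod w)\<^sup>2 + 1) > 0" for w by (simp add: add_nonneg_pos)
  have "chord (Fin a) Infty \<noteq> 0" using sq[of a] by (simp add: inf)
  then have "(k \<longlongrightarrow> chord (Fin a) (Fin a) * sqrt ((cmod a)\<^sup>2 + 1) / chord (Fin a) Infty) (at (Fin a))"
    unfolding k_def by (intro tendsto_intros tendsto_chord)
  then have lim: "(k \<longlongrightarrow> 0) (at (Fin a))" by (simp add: chord_def)
  have ne: "eventually (\<lambda>y. y \<noteq> Infty) (at (Fin a))"
    using tendsto_ident_at by (rule tendsto_imp_eventually_ne) simp
  have "((\<lambda>y. dist (chart (Fin 0) y) a) \<longlongrightarrow> 0) (at (Fin a))"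
  proof (rule Lim_transform_eventually[OF lim])
    show "eventually (\<lambda>y. k y = dist (chart (Fin 0) y) a) (at (Fin a))"
      using ne
    proof eventually_elim
      case (elim y)
      then obtain w where y: "y = Fin w" by (cases y) auto
      have "chord (Fin w) (Fin a) = 2 * cmod (w - a) / (sqrt ((cmod w)\<^sup>2 + 1) * sqrt ((cmod a)\<^sup>2 + 1))"
        using chord_of_ratio[of w 1 a 1] by (simp add: of_ratio_def)
      then show ?case using sq[of w] sq[of a] by (simp add: k_def y inf dist_norm)
    qed
  qed
  then have "(chart (Fin 0) \<longlongrightarrow> a) (at (Fin a))" by (rule tendsto_dist_iff[THEN iffD2])
  then show ?thesis by (simp add: isCont_def)
qed

lemma mob_imp_continuous:
  assumes "a * d - b * c \<noteq> 0"
  shows "continuous_on S (mob a b c d)"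
proof -
  obtain C where C: "C > 0" "\<And>x y. dist (mob a b c d x) (mob a b c d y) \<le> C * dist x y"
    using mob_Lipschitz[OF assms] by blast
  have "C-lipschitz_on S (mob a b c d)" using C by (intro lipschitz_onI) auto
  then show ?thesis by (rule lipschitz_on_continuous_on)
qed

lemma isCont_chart: "isCont (chart x) x"
proof (cases x)
  case (Fin a)
  have "chart (Fin a) y = chart (Fin 0) y" for y by (cases y) auto
  then have "chart (Fin a) = chart (Fin 0)" by (rule ext)
  then show ?thesis using isCont_chart_Fin Fin by simp
next
  case Infty
  have "chart Infty y = chart (Fin 0) (mob 0 1 1 0 y)" for y
    by (cases y) (auto simp: mob_def of_ratio_def)
  then have eq: "chart Infty = chart (Fin 0) \<circ> mob 0 1 1 0" by auto
  have m: "mob 0 1 1 0 Infty = Fin 0" by (simp add: mob_def of_ratio_def)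
  have "isCont (mob 0 1 1 0) Infty"
    using mob_imp_continuous[of 0 0 1 1 UNIV] by (simp add: continuous_on_eq_continuous_at)
  then show ?thesis unfolding Infty eq using isCont_chart_Fin[of 0] m
    by (intro continuous_at_compose) simp_all
qed

lemma eventually_chart_inv_chart_self: "eventually (\<lambda>y. chart_inv x (chart x y) = y) (nhds x)"
proof -
  define y0 where "y0 = (case x of Fin a \<Rightarrow> Infty | Infty \<Rightarrow> Fin 0)"
  have "x \<in> - {y0}" by (cases x) (auto simp: y0_def)
  then have "eventually (\<lambda>y. y \<in> - {y0}) (nhds x)"
    by (intro eventually_nhds_in_open) auto
  then show ?thesis
  proof eventually_elim
    case (elim y)
    then show ?case by (cases x; cases y) (auto simp: y0_def)
  qed
qed

lemma hmap_isCont: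
  assumes "hmap g"
  shows "isCont g x"
proof -
  have m: "mero_at (g \<circ> chart_inv x) (chart x x)"
    using assms mero_at_chart_inv unfolding hmap_def by blast
  have "isCont (\<lambda>y. (g \<circ> chart_inv x) (chart x y)) x"
    using isCont_chart mero_at_isCont[OF m] by (rule isCont_o2)
  moreover have "eventually (\<lambda>y. (g \<circ> chart_inv x) (chart x y) = g y) (nhds x)"
    using eventually_chart_inv_chart_self[of x] by eventually_elim simp
  ultimately show ?thesis using isCont_cong by fastforce
qed

lemma hmap_continuous_on: "hmap g \<Longrightarrow> continuous_on S g"
  by (simp add: continuous_at_imp_continuous_on hmap_isCont)

section \<open>Montel's theorem and a distortion estimate\<close>

lemma holomorphic_on_affine:
  assumes "f holomorphic_on T" "\<And>w. w \<in> S \<Longrightarrow> c + k * w \<in> T"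
  shows "(\<lambda>w. f (c + k * w)) holomorphic_on S"
proof -
  have "(f \<circ> (\<lambda>w. c + k * w)) holomorphic_on S"
    by (rule holomorphic_on_compose_gen[OF _ assms(1)]) (use assms(2) in \<open>auto intro!: holomorphic_intros\<close>)
  then show ?thesis by (simp only: o_def)
qed

text \<open>The Schwarz lemma.  It requires a strict bound by \<open>1\<close>, for which \<open>2 * C + 1\<close> leaves room also when \<open>C = 0\<close>.\<close>

lemma bounded_holomorphic_Lipschitz:
  assumes hol: "f holomorphic_on ball z0 \<rho>" and "\<rho> > 0" and C: "C \<ge> 0"
    and bd: "\<And>z. z \<in> ball z0 \<rho> \<Longrightarrow> cmod (f z) \<le> C" and z: "z \<in> ball z0 \<rho>"
  shows "cmod (f z - f z0) \<le> (2 * C + 1) * cmod (z - z0) / \<rho>"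
proof -
  define h where "h w = (f (z0 + \<rho> * w) - f z0) / (2 * C + 1)" for w :: complex
  have in_ball: "z0 + \<rho> * w \<in> ball z0 \<rho>" if "w \<in> ball 0 1" for w :: complex
    using that \<open>\<rho> > 0\<close> by (simp add: dist_norm norm_mult)
  have pos: "2 * C + 1 > 0" using C by simp
  have "(\<lambda>w. f (z0 + \<rho> * w)) holomorphic_on ball 0 1"
    by (rule holomorphic_on_affine[OF hol in_ball])
  moreover have "complex_of_real (2 * C + 1) \<noteq> 0" using pos by (simp only: of_real_eq_0_iff)
  ultimately have "h holomorphic_on ball 0 1"
    unfolding h_def by (intro holomorphic_intros) auto
  moreover have "cmod (h w) < 1" if "cmod w < 1" for w
  proof -
    have "cmod (f (z0 + \<rho> * w) - f z0) \<le> C + C"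
      using that in_ball[of w] \<open>\<rho> > 0\<close> by (intro order_trans[OF norm_triangle_ineq4] add_mono bd) auto
    moreover have "cmod (complex_of_real (2 * C + 1)) = 2 * C + 1" using pos by (simp only: norm_of_real)
    ultimately show ?thesis using pos unfolding h_def norm_divide by simp
  qed
  moreover have "h 0 = 0" by (simp add: h_def)
  ultimately have S: "cmod (h w) \<le> cmod w" if "cmod w < 1" for w
    using Schwarz_Lemma(1)[of h w] that by blast
  define w where "w = (z - z0) / \<rho>"
  have w: "cmod w = cmod (z - z0) / \<rho>" "z0 + \<rho> * w = z"
    using \<open>\<rho> > 0\<close> by (simp_all add: w_def norm_divide)
  have "cmod w < 1" using z \<open>\<rho> > 0\<close> w(1) by (simp add: dist_norm norm_minus_commute)
  from S[OF this] have "cmod (f z - f z0) / (2 * C + 1) \<le> cmod (z - z0) / \<rho>"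
    using pos unfolding h_def w norm_divide norm_of_real by simp
  then show ?thesis using pos by (simp add: field_simps)
qed

text \<open>The bound of Schottky's theorem at radius \<open>4/5\<close> for an initial value of modulus at most \<open>1\<close>.  As that
theorem speaks of the closed unit disc, a disc of radius \<open>r\<close> is first shrunk to \<open>5/6 * r\<close>, and
\<open>2/3 = 4/5 * 5/6\<close>.\<close>

definition schottky_const :: real where
  "schottky_const = exp (pi * exp (pi * (2 + 2 * 1 + 12 * (4/5) / (1 - 4/5))))"

lemma Schottky_ball:
  assumes hol: "f holomorphic_on ball z0 r" and r: "r > 0"
    and omit: "\<And>z. z \<in> ball z0 r \<Longrightarrow> f z \<noteq> 0 \<and> f z \<noteq> 1"
    and f0: "cmod (f z0) \<le> 1" and z: "cmod (z - z0) \<le> 2 / 3 * r"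
  shows "cmod (f z) \<le> schottky_const"
proof -
  define g where "g w = f (z0 + complex_of_real (5/6 * r) * w)" for w
  have in_ball: "z0 + complex_of_real (5/6 * r) * w \<in> ball z0 r" if "w \<in> cball 0 1" for w
  proof -
    have "5/6 * r * cmod w \<le> 5/6 * r * 1" using that r by (intro mult_left_mono) auto
    then show ?thesis using r by (simp add: dist_norm norm_mult)
  qed
  have "g holomorphic_on cball 0 1"
    unfolding g_def by (rule holomorphic_on_affine[OF hol in_ball])
  moreover have "cmod (g 0) \<le> 1" using f0 by (simp add: g_def)
  moreover have "\<not> (g w = 0 \<or> g w = 1)" if "w \<in> cball 0 1" for w
    using omit[OF in_ball[OF that]] by (simp add: g_def)
  moreover define w where "w = (z - z0) / complex_of_real (5/6 * r)"
  have "cmod w = cmod (z - z0) / (5/6 * r)"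
    unfolding w_def norm_divide norm_of_real using r by simp
  then have "cmod w \<le> 4/5" using z r by (simp add: pos_divide_le_eq)
  ultimately have "cmod (g w) \<le> schottky_const"
    unfolding schottky_const_def by (intro Schottky) auto
  moreover have "complex_of_real (5/6 * r) * w = z - z0" using r by (simp add: w_def)
  then have "g w = f z" by (simp only: g_def) simp
  ultimately show ?thesis by simp
qed

text \<open>The spherical metric is invariant under inversion, so a function omitting \<open>0\<close> and \<open>1\<close>
  may be replaced by its reciprocal; hence the initial value can be assumed to be bounded by \<open>1\<close>.\<close>

lemma dist_inverse:
  assumes "z \<noteq> 0" "w \<noteq> 0"
  shows "dist (Fin (1 / z)) (Fin (1 / w)) = dist (Fin z) (Fin w)"
proof -
  have "Fin (1 / z) = of_ratio 1 z" "Fin (1 / w) = of_ratio 1 w" "Fin z = of_ratio z 1" "Fin w = of_ratio w 1"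
    using assms by (simp_all add: of_ratio_def)
  then show ?thesis
    unfolding dist_riemann_sphere_def
    by (simp add: inner_stereo_of_ratio norm_minus_commute add.commute del: stereo.simps)
qed

lemma Lipschitz_omitting_0_1:
  assumes hol: "f holomorphic_on ball z0 r" and r: "r > 0"
    and omit: "\<And>z. z \<in> ball z0 r \<Longrightarrow> f z \<noteq> 0 \<and> f z \<noteq> 1"
    and z: "z \<in> ball z0 (2 / 3 * r)"
  shows "dist (Fin (f z)) (Fin (f z0)) \<le> 6 * (2 * schottky_const + 1) * cmod (z - z0) / r"
proof -
  have main: "dist (Fin (g z)) (Fin (g z0)) \<le> 6 * (2 * schottky_const + 1) * cmod (z - z0) / r"
    if hol: "g holomorphic_on ball z0 r" and omit: "\<And>z. z \<in> ball z0 r \<Longrightarrow> g z \<noteq> 0 \<and> g z \<noteq> 1"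
    and g0: "cmod (g z0) \<le> 1" for g
  proof -
    have "cmod (g z - g z0) \<le> (2 * schottky_const + 1) * cmod (z - z0) / (2 / 3 * r)"
    proof (rule bounded_holomorphic_Lipschitz)
      show "g holomorphic_on ball z0 (2 / 3 * r)"
        using hol by (rule holomorphic_on_subset) (use r in \<open>auto intro!: subset_ball\<close>)
      show "cmod (g w) \<le> schottky_const" if "w \<in> ball z0 (2 / 3 * r)" for w
        by (rule Schottky_ball[OF hol r omit g0]) (use that in \<open>auto simp: dist_norm norm_minus_commute\<close>)
    qed (use r z in \<open>auto simp: schottky_const_def\<close>)
    then have "4 * cmod (g z - g z0) \<le> 6 * (2 * schottky_const + 1) * cmod (z - z0) / r"
      using r by (simp add: field_simps)
    then show ?thesis using dist_Fin_le[of "g z" "g z0"] by linarith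
  qed
  show ?thesis
  proof (cases "cmod (f z0) \<le> 1")
    case True
    show ?thesis by (rule main[OF hol omit True])
  next
    case False
    have in_ball: "z0 \<in> ball z0 r" "z \<in> ball z0 r" using r z by auto
    have "dist (Fin (1 / f z)) (Fin (1 / f z0)) \<le> 6 * (2 * schottky_const + 1) * cmod (z - z0) / r"
    proof (rule main)
      show "(\<lambda>z. 1 / f z) holomorphic_on ball z0 r"
        using hol omit by (intro holomorphic_intros) auto
      show "1 / f w \<noteq> 0 \<and> 1 / f w \<noteq> 1" if "w \<in> ball z0 r" for w
        using omit[OF that] by simp
      have "1 \<le> cmod (f z0)" using False by simp
      then have "1 / cmod (f z0) \<le> 1" by (subst divide_le_eq_1) auto
      then show "cmod (1 / f z0) \<le> 1" by (simp only: norm_divide norm_one)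
    qed
    then show ?thesis using omit[OF in_ball(1)] omit[OF in_ball(2)] by (simp add: dist_inverse)
  qed
qed

lemma exists_mob_0_1_infinity:
  assumes "e1 \<noteq> e2" "e1 \<noteq> e3" "e2 \<noteq> e3"
  obtains a b c d where "a * d - b * c \<noteq> 0"
    "mob a b c d e1 = Fin 0" "mob a b c d e2 = Fin 1" "mob a b c d e3 = Infty"
proof -
  obtain a1 b1 where 1: "a1 \<noteq> 0 \<or> b1 \<noteq> 0" "e1 = of_ratio a1 b1" by (rule of_ratio_cases)
  obtain a2 b2 where 2: "a2 \<noteq> 0 \<or> b2 \<noteq> 0" "e2 = of_ratio a2 b2" by (rule of_ratio_cases)
  obtain a3 b3 where 3: "a3 \<noteq> 0 \<or> b3 \<noteq> 0" "e3 = of_ratio a3 b3" by (rule of_ratio_cases)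
  have ne: "a1 * b2 - b1 * a2 \<noteq> 0" "a1 * b3 - b1 * a3 \<noteq> 0" "a2 * b3 - b2 * a3 \<noteq> 0"
    using assms of_ratio_eq_iff[OF 1(1) 2(1)] of_ratio_eq_iff[OF 1(1) 3(1)] of_ratio_eq_iff[OF 2(1) 3(1)]
    by (simp_all add: 1 2 3)
  \<comment> \<open>the cross ratio with \<open>e1, e2, e3\<close>\<close>
  define k l where "k = a2 * b3 - b2 * a3" and "l = a2 * b1 - b2 * a1"
  have kl: "k \<noteq> 0" "l \<noteq> 0" using ne by (auto simp: k_def l_def algebra_simps)
  show thesis
  proof (rule that[of "k * b1" "- l * a3" "- k * a1" "l * b3"])
    have "k * b1 * (- l * a3) - - k * a1 * (l * b3) = k * l * (a1 * b3 - b1 * a3)"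
      by (simp add: algebra_simps)
    then show "k * b1 * (- l * a3) - - k * a1 * (l * b3) \<noteq> 0" using kl ne by simp
    have "l * b3 * a1 + - l * a3 * b1 = l * (a1 * b3 - b1 * a3)" by (simp add: algebra_simps)
    moreover have "k * b1 * a1 + - k * a1 * b1 = 0" by simp
    ultimately show "mob (k * b1) (- k * a1) (l * b3) (- l * a3) e1 = Fin 0"
      unfolding 1(2) mob_of_ratio[OF 1(1)] using kl ne by (simp only: of_ratio_def) simp
    have "k * b1 * a2 + - k * a1 * b2 = k * l" "l * b3 * a2 + - l * a3 * b2 = k * l"
      by (simp_all add: k_def l_def algebra_simps)
    then show "mob (k * b1) (- k * a1) (l * b3) (- l * a3) e2 = Fin 1"
      unfolding 2(2) mob_of_ratio[OF 2(1)] using kl by (simp only: of_ratio_def) simp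
    have "l * b3 * a3 + - l * a3 * b3 = 0" by simp
    then show "mob (k * b1) (- k * a1) (l * b3) (- l * a3) e3 = Infty"
      unfolding 3(2) mob_of_ratio[OF 3(1)] by (simp only: of_ratio_def) simp
  qed
qed

lemma mero_at_finite_holomorphic:
  assumes "open S" "\<And>z. z \<in> S \<Longrightarrow> mero_at F z" "\<And>z. z \<in> S \<Longrightarrow> F z \<noteq> Infty"
  shows "(\<lambda>z. chart (Fin 0) (F z)) holomorphic_on S"
    and "\<And>z. z \<in> S \<Longrightarrow> F z = Fin (chart (Fin 0) (F z))"
proof -
  show fin: "F z = Fin (chart (Fin 0) (F z))" if "z \<in> S" for z
    using assms(3)[OF that] by (cases "F z") auto
  have "(\<lambda>z. chart (Fin 0) (F z)) analytic_on {z}" if "z \<in> S" for z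
  proof -
    have "chart (F z) y = chart (Fin 0) y" for y
      using assms(3)[OF that] by (cases "F z"; cases y) auto
    then show ?thesis using mero_at_chart_analytic[OF assms(2)[OF that]] by simp
  qed
  then have "(\<lambda>z. chart (Fin 0) (F z)) analytic_on S"
    using analytic_on_analytic_at by blast
  then show "(\<lambda>z. chart (Fin 0) (F z)) holomorphic_on S" by (rule analytic_imp_holomorphic)
qed

text \<open>A Moebius transformation moves the three omitted values to \<open>0\<close>, \<open>1\<close> and infinity; it is bi-Lipschitz for
the spherical metric, so the estimate for functions omitting \<open>0\<close> and \<open>1\<close> carries over.\<close>

lemma Lipschitz_omitting_three_points:
  assumes "e1 \<noteq> e2" "e1 \<noteq> e3" "e2 \<noteq> e3"
  obtains K where "K > 0" "\<And>F z0 r z. r > 0 \<Longrightarrow>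
    (\<And>w. w \<in> ball z0 r \<Longrightarrow> mero_at F w \<and> F w \<noteq> e1 \<and> F w \<noteq> e2 \<and> F w \<noteq> e3) \<Longrightarrow>
    z \<in> ball z0 (2 / 3 * r) \<Longrightarrow> dist (F z) (F z0) \<le> K * cmod (z - z0) / r"
proof -
  obtain a b c d where det: "a * d - b * c \<noteq> 0"
    and e: "mob a b c d e1 = Fin 0" "mob a b c d e2 = Fin 1" "mob a b c d e3 = Infty"
    by (rule exists_mob_0_1_infinity[OF assms])
  define \<Phi> where "\<Phi> = mob a b c d"
  have det': "d * a - (- b) * (- c) \<noteq> 0" using det by (simp add: mult.commute)
  obtain C where C: "C > 0" "\<And>x y. dist (mob d (-b) (-c) a x) (mob d (-b) (-c) a y) \<le> C * dist x y"
    by (rule mob_Lipschitz[OF det']) blast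
  have inv: "mob d (-b) (-c) a (\<Phi> x) = x" for x unfolding \<Phi>_def by (rule mob_inverse[OF det])
  then have inj: "\<Phi> x = \<Phi> y \<Longrightarrow> x = y" for x y by metis
  have Lip: "dist x y \<le> C * dist (\<Phi> x) (\<Phi> y)" for x y
    using C(2)[of "\<Phi> x" "\<Phi> y"] by (simp add: inv)
  define K where "K = C * (6 * (2 * schottky_const + 1))"
  have sc: "schottky_const > 0" by (simp add: schottky_const_def)
  show thesis
  proof (rule that[of K])
    show "K > 0" using C(1) sc by (simp add: K_def)
    fix F :: "complex \<Rightarrow> riemann_sphere" and z0 z :: complex and r :: real
    assume r: "r > 0" and z: "z \<in> ball z0 (2 / 3 * r)"
      and F: "\<And>w. w \<in> ball z0 r \<Longrightarrow> mero_at F w \<and> F w \<noteq> e1 \<and> F w \<noteq> e2 \<and> F w \<noteq> e3"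
    define f where "f w = chart (Fin 0) ((\<Phi> \<circ> F) w)" for w
    have m: "mero_at (\<Phi> \<circ> F) w" if "w \<in> ball z0 r" for w
      using F[OF that] hmap_mob[OF det] unfolding \<Phi>_def hmap_def by blast
    have ne: "\<Phi> (F w) \<noteq> Fin 0" "\<Phi> (F w) \<noteq> Fin 1" "\<Phi> (F w) \<noteq> Infty" if "w \<in> ball z0 r" for w
      using F[OF that] e inj unfolding \<Phi>_def by metis+
    have hol: "f holomorphic_on ball z0 r"
      unfolding f_def by (rule mero_at_finite_holomorphic(1)[where F = "\<Phi> \<circ> F"]) (use m ne in auto)
    have fin: "\<Phi> (F w) = Fin (f w)" if "w \<in> ball z0 r" for w
      using mero_at_finite_holomorphic(2)[of "ball z0 r" "\<Phi> \<circ> F" w] m ne that unfolding f_def by auto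
    have omit: "f w \<noteq> 0 \<and> f w \<noteq> 1" if "w \<in> ball z0 r" for w
      using ne[OF that] fin[OF that] by auto
    have zb: "z \<in> ball z0 r" "z0 \<in> ball z0 r" using z r by auto
    have "dist (F z) (F z0) \<le> C * dist (Fin (f z)) (Fin (f z0))"
      using Lip[of "F z" "F z0"] unfolding fin[OF zb(1)] fin[OF zb(2)] .
    also have "\<dots> \<le> C * (6 * (2 * schottky_const + 1) * cmod (z - z0) / r)"
      using C(1) Lipschitz_omitting_0_1[OF hol r omit z] by (intro mult_left_mono) auto
    finally show "dist (F z) (F z0) \<le> K * cmod (z - z0) / r" by (simp add: K_def mult.assoc)
  qed
qed

theorem Montel_three_points:
  assumes hm: "\<And>g. g \<in> \<F> \<Longrightarrow> hmap g" and "open \<Omega>" "x \<in> \<Omega>"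
    and e: "e1 \<noteq> e2" "e1 \<noteq> e3" "e2 \<noteq> e3"
    and omit: "\<And>g y. g \<in> \<F> \<Longrightarrow> y \<in> \<Omega> \<Longrightarrow> g y \<noteq> e1 \<and> g y \<noteq> e2 \<and> g y \<noteq> e3"
  shows "equicontinuous_at \<F> x"
proof -
  define \<zeta> where "\<zeta> = chart x x"
  obtain K where K: "K > 0" "\<And>F z0 r z. r > 0 \<Longrightarrow>
    (\<And>w. w \<in> ball z0 r \<Longrightarrow> mero_at F w \<and> F w \<noteq> e1 \<and> F w \<noteq> e2 \<and> F w \<noteq> e3) \<Longrightarrow>
    z \<in> ball z0 (2 / 3 * r) \<Longrightarrow> dist (F z) (F z0) \<le> K * cmod (z - z0) / r"
    by (rule Lipschitz_omitting_three_points[OF e]) blast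
  have "open (chart_inv x -` \<Omega>)"
    using \<open>open \<Omega>\<close> by (rule open_vimage) (rule continuous_on_chart_inv)
  moreover have "\<zeta> \<in> chart_inv x -` \<Omega>" using \<open>x \<in> \<Omega>\<close> by (simp add: \<zeta>_def)
  ultimately obtain r where r: "r > 0" "ball \<zeta> r \<subseteq> chart_inv x -` \<Omega>"
    by (meson openE)
  show ?thesis
    unfolding equicontinuous_at_def
  proof (intro allI impI)
    fix \<epsilon> :: real assume "\<epsilon> > 0"
    define \<eta> where "\<eta> = min (2 / 3 * r) (r * \<epsilon> / K)"
    have \<eta>: "\<eta> > 0" using r K \<open>\<epsilon> > 0\<close> by (simp add: \<eta>_def)
    have "eventually (\<lambda>y. chart x y \<in> ball \<zeta> \<eta>) (nhds x)"
      by (rule isCont_eventually_in[OF isCont_chart]) (use \<eta> in \<open>auto simp: \<zeta>_def\<close>)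
    with eventually_chart_inv_chart_self[of x]
    have "eventually (\<lambda>y. chart x y \<in> ball \<zeta> \<eta> \<and> chart_inv x (chart x y) = y) (nhds x)"
      by eventually_elim auto
    then obtain \<delta> where \<delta>: "\<delta> > 0"
      "\<And>y. dist y x < \<delta> \<Longrightarrow> chart x y \<in> ball \<zeta> \<eta> \<and> chart_inv x (chart x y) = y"
      unfolding eventually_nhds_metric by auto
    have "dist (g y) (g x) < \<epsilon>" if "g \<in> \<F>" "dist y x < \<delta>" for g y
    proof -
      have y: "chart x y \<in> ball \<zeta> \<eta>" "chart_inv x (chart x y) = y" using \<delta>(2)[OF that(2)] by auto
      have "dist ((g \<circ> chart_inv x) (chart x y)) ((g \<circ> chart_inv x) \<zeta>) \<le> K * cmod (chart x y - \<zeta>) / r"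
      proof (rule K(2)[OF r(1)])
        show "chart x y \<in> ball \<zeta> (2 / 3 * r)" using y(1) by (simp add: \<eta>_def)
        fix w assume "w \<in> ball \<zeta> r"
        then have "chart_inv x w \<in> \<Omega>" using r(2) by auto
        moreover have "mero_at (g \<circ> chart_inv x) w"
          using hm[OF that(1)] mero_at_chart_inv unfolding hmap_def by blast
        ultimately show "mero_at (g \<circ> chart_inv x) w \<and> (g \<circ> chart_inv x) w \<noteq> e1 \<and>
          (g \<circ> chart_inv x) w \<noteq> e2 \<and> (g \<circ> chart_inv x) w \<noteq> e3"
          using omit[OF that(1)] by auto
      qed
      moreover have "cmod (chart x y - \<zeta>) < r * \<epsilon> / K"
        using y(1) by (simp add: \<eta>_def dist_norm norm_minus_commute)
      then have "K * cmod (chart x y - \<zeta>) / r < \<epsilon>" using K(1) r(1) by (simp add: field_simps)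
      ultimately show ?thesis using y(2) by (simp add: \<zeta>_def)
    qed
    then show "\<exists>\<delta>>0. \<forall>g\<in>\<F>. \<forall>y. dist y x < \<delta> \<longrightarrow> dist (g y) (g x) < \<epsilon>"
      using \<delta>(1) by blast
  qed
qed

text \<open>Otherwise the inverse function maps the disc of radius \<open>2\<close> into the unit disc and has derivative \<open>1\<close> at the
origin, against the Schwarz lemma.\<close>

lemma univalent_omits_small_value:
  assumes hol: "f holomorphic_on ball 0 1" and inj: "inj_on f (ball 0 1)"
    and f0: "f 0 = 0" "deriv f 0 = 1"
  shows "\<exists>a. cmod a < 2 \<and> a \<notin> f ` ball 0 1"
proof (rule ccontr)
  assume "\<not> ?thesis"
  then have "\<And>a. cmod a < 2 \<Longrightarrow> a \<in> f ` ball 0 1" by metis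
  then have sub: "ball 0 2 \<subseteq> f ` ball 0 1" by (simp add: subset_eq)
  obtain k where k: "k holomorphic_on f ` ball 0 1"
    "\<And>z. z \<in> ball 0 1 \<Longrightarrow> deriv f z * deriv k (f z) = 1" "\<And>z. z \<in> ball 0 1 \<Longrightarrow> k (f z) = z"
    by (rule holomorphic_has_inverse[OF hol open_ball inj]) blast
  define h where "h w = k (2 * w)" for w
  have in2: "2 * w \<in> ball 0 2" if "w \<in> ball 0 1" for w :: complex
    using that by (simp add: norm_mult)
  have hk: "k holomorphic_on ball 0 2" using k(1) sub by (rule holomorphic_on_subset)
  have "h holomorphic_on ball 0 1"
    using holomorphic_on_affine[OF hk, of "ball 0 1" 0 2] in2 unfolding h_def by simp
  moreover have "h 0 = 0" using k(3)[of 0] f0 by (simp add: h_def)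
  moreover have "cmod (h w) < 1" if "cmod w < 1" for w
  proof -
    have "w \<in> ball 0 1" using that by simp
    then have "2 * w \<in> f ` ball 0 1" by (rule subsetD[OF sub in2])
    then obtain z where "z \<in> ball 0 1" "2 * w = f z" by (elim imageE)
    then show ?thesis using k(3)[of z] by (simp add: h_def)
  qed
  ultimately have "cmod (deriv h 0) \<le> 1"
    using Schwarz_Lemma(2)[of h 0] by auto
  moreover have "deriv h 0 = 2"
  proof -
    have "(k has_field_derivative deriv k 0) (at (2 * 0))"
      using hk by (auto intro!: holomorphic_derivI[of _ "ball 0 2"])
    then have "((\<lambda>w. k (2 * w)) has_field_derivative deriv k 0 * 2) (at 0)"
      by (rule DERIV_chain2) (auto intro!: derivative_eq_intros)
    moreover have "deriv k 0 = 1" using k(2)[of 0] f0 by simp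
    ultimately show ?thesis unfolding h_def by (auto intro: DERIV_imp_deriv)
  qed
  ultimately show False by simp
qed

text \<open>Let \<open>a\<close> be an omitted value with \<open>\<bar>a\<bar> < 2\<close>.  A square root \<open>s\<close> of \<open>f - a\<close> omits \<open>0\<close>, and by injectivity of
\<open>f\<close> also \<open>- s 0\<close>; Schottky's theorem applies to \<open>- s / s 0\<close>.\<close>

lemma univalent_growth_normalised:
  assumes hol: "f holomorphic_on ball 0 1" and inj: "inj_on f (ball 0 1)"
    and f0: "f 0 = 0" "deriv f 0 = 1" and z: "cmod z \<le> 2 / 3"
  shows "cmod (f z) \<le> 2 * schottky_const\<^sup>2 + 2"
proof -
  obtain a where a: "cmod a < 2" "a \<notin> f ` ball 0 1"
    using univalent_omits_small_value[OF hol inj f0] by metis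
  have hola: "(\<lambda>w. f w - a) holomorphic_on ball 0 1" using hol by (intro holomorphic_intros)
  have nz: "f w - a \<noteq> 0" if "w \<in> ball 0 1" for w
    using a(2) imageI[OF that, of f] by (metis eq_iff_diff_eq_0)
  obtain s where s: "s holomorphic_on ball 0 1" "\<And>w. w \<in> ball 0 1 \<Longrightarrow> f w - a = (s w)\<^sup>2"
    by (rule contractible_imp_holomorphic_sqrt[OF hola convex_imp_contractible[OF convex_ball] nz]) (auto intro: that)
  have "0 \<in> f ` ball 0 1" using f0(1) by (intro image_eqI[of _ _ 0]) auto
  then have "a \<noteq> 0" using a(2) by metis
  then have s0: "s 0 \<noteq> 0" using s(2)[of 0] f0 by auto
  define q where "q w = - s w / s 0" for w
  have "cmod (q z) \<le> schottky_const"
  proof (rule Schottky_ball[where f = q and z = z and ?z0.0 = 0 and r = 1])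
    show "q holomorphic_on ball 0 1" unfolding q_def using s(1) s0 by (intro holomorphic_intros)
    show "q w \<noteq> 0 \<and> q w \<noteq> 1" if w: "w \<in> ball 0 1" for w
    proof
      show "q w \<noteq> 0" using s(2)[OF w] nz[OF w] s0 by (auto simp: q_def)
      show "q w \<noteq> 1"
      proof
        assume "q w = 1"
        then have sw: "s w = - s 0" using s0 by (simp add: q_def field_simps) (metis minus_equation_iff)
        then have "f w - a = f 0 - a" using s(2)[OF w] s(2)[of 0] by simp
        then have "w = 0" using inj w by (auto dest: inj_onD)
        then show False using sw s0 by simp
      qed
    qed
    show "cmod (q 0) \<le> 1" using s0 by (simp add: q_def norm_divide)
  qed (use z in auto)
  then have "cmod (s z) \<le> schottky_const * cmod (s 0)"
    using s0 by (simp add: q_def norm_divide field_simps)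
  then have "(cmod (s z))\<^sup>2 \<le> (schottky_const * cmod (s 0))\<^sup>2" by (intro power_mono) auto
  moreover have "(cmod (s z))\<^sup>2 = cmod (f z - a)" using s(2)[of z] z by (simp add: norm_power[symmetric])
  moreover have "(cmod (s 0))\<^sup>2 = cmod a" using s(2)[of 0] f0 by (simp add: norm_power[symmetric]) (metis norm_minus_cancel)
  ultimately have "cmod (f z - a) \<le> schottky_const\<^sup>2 * cmod a" by (simp add: power_mult_distrib)
  also have "\<dots> \<le> schottky_const\<^sup>2 * 2" using a(1) by (intro mult_left_mono) auto
  finally show ?thesis using a(1) norm_triangle_sub[of "f z" a] by linarith
qed

lemma univalent_growth:
  assumes hol: "\<phi> holomorphic_on ball c \<rho>" and inj: "inj_on \<phi> (ball c \<rho>)" and \<rho>: "\<rho> > 0"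
    and z: "cmod (z - c) \<le> 2 / 3 * \<rho>"
  shows "cmod (\<phi> z - \<phi> c) \<le> (2 * schottky_const\<^sup>2 + 2) * \<rho> * cmod (deriv \<phi> c)"
proof -
  define D where "D = deriv \<phi> c"
  have D: "D \<noteq> 0" unfolding D_def
    using holomorphic_injective_imp_regular[OF hol open_ball inj] \<rho> by simp
  define f where "f w = (\<phi> (c + \<rho> * w) - \<phi> c) / (\<rho> * D)" for w :: complex
  have rD: "complex_of_real \<rho> * D \<noteq> 0" using \<rho> D by simp
  have in_ball: "c + \<rho> * w \<in> ball c \<rho>" if "w \<in> ball 0 1" for w :: complex
    using that \<rho> by (simp add: dist_norm norm_mult)
  have "(\<lambda>w. \<phi> (c + \<rho> * w)) holomorphic_on ball 0 1"
    by (rule holomorphic_on_affine[OF hol in_ball])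
  then have hf: "f holomorphic_on ball 0 1"
    unfolding f_def using rD by (intro holomorphic_intros) auto
  have injf: "inj_on f (ball 0 1)"
  proof (rule inj_onI)
    fix u v assume uv: "u \<in> ball 0 1" "v \<in> ball 0 1" "f u = f v"
    then have "\<phi> (c + \<rho> * u) = \<phi> (c + \<rho> * v)" using rD by (simp add: f_def)
    then have "c + \<rho> * u = c + \<rho> * v" using inj in_ball uv by (meson inj_onD)
    then show "u = v" using \<rho> by simp
  qed
  have "(\<phi> has_field_derivative D) (at (c + complex_of_real \<rho> * 0))"
    unfolding D_def using hol \<rho> by (auto intro!: holomorphic_derivI[of _ "ball c \<rho>"])
  then have "((\<lambda>w. \<phi> (c + \<rho> * w)) has_field_derivative D * \<rho>) (at 0)"
    by (rule DERIV_chain2) (auto intro!: derivative_eq_intros)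
  then have "(f has_field_derivative (D * complex_of_real \<rho>) / (\<rho> * D)) (at 0)"
    unfolding f_def by (intro derivative_eq_intros refl | assumption | use rD in simp)+
  then have d1: "deriv f 0 = 1" using rD by (simp add: DERIV_imp_deriv mult.commute)
  define w where "w = (z - c) / \<rho>"
  have w: "c + \<rho> * w = z" "cmod w \<le> 2 / 3"
    using z \<rho> by (simp_all add: w_def norm_divide field_simps)
  have "cmod (f w) \<le> 2 * schottky_const\<^sup>2 + 2"
    by (rule univalent_growth_normalised[OF hf injf _ d1 w(2)]) (simp add: f_def)
  moreover have "cmod (f w) = cmod (\<phi> z - \<phi> c) / (\<rho> * cmod D)"
    using \<rho> by (simp add: f_def w norm_divide norm_mult)
  ultimately show ?thesis using \<rho> D by (simp add: D_def[symmetric] field_simps)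
qed

section \<open>Inverse branches over discs without critical values\<close>

lemma finite_fibre:
  fixes f :: "complex \<Rightarrow> complex"
  assumes loc: "\<And>z. z \<in> S \<Longrightarrow> \<exists>r>0. inj_on f (ball z r)" and comp: "compact {z\<in>S. f z = b}"
  shows "finite {z\<in>S. f z = b}"
proof -
  define Z where "Z = {z\<in>S. f z = b}"
  have "\<forall>z\<in>Z. \<exists>r>0. inj_on f (ball z r)" using loc by (simp add: Z_def)
  then obtain r where r: "\<And>z. z \<in> Z \<Longrightarrow> r z > 0 \<and> inj_on f (ball z (r z))" by metis
  have single: "w = z" if "z \<in> Z" "w \<in> Z" "w \<in> ball z (r z)" for z w
    using inj_onD[of f "ball z (r z)" w z] r[OF that(1)] that by (simp add: Z_def)
  obtain C where C: "C \<subseteq> Z" "finite C" "Z \<subseteq> (\<Union>z\<in>C. ball z (r z))"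
    by (rule compactE_image[OF comp[folded Z_def], of Z "\<lambda>z. ball z (r z)"]) (use r in auto)
  have "Z \<subseteq> C"
  proof
    fix w assume w: "w \<in> Z"
    then obtain z where "z \<in> C" "w \<in> ball z (r z)" using C(3) by auto
    then show "w \<in> C" using single[of z w] w C(1) by auto
  qed
  then show ?thesis using C(2) finite_subset unfolding Z_def by auto
qed

text \<open>Around each of the finitely many preimages of \<open>b\<close> take a small disc of injectivity.  By properness the part
of the preimage of a neighbourhood of \<open>b\<close> outside these discs is compact, so its image misses a smaller
neighbourhood, which is evenly covered.  In particular the image is open and closed in \<open>D\<close>.\<close>

lemma proper_holomorphic_covering:
  fixes f :: "complex \<Rightarrow> complex"
  assumes S: "open S" and D: "open D" "connected D" and hol: "f holomorphic_on S"
    and im: "\<And>z. z \<in> S \<Longrightarrow> f z \<in> D" and reg: "\<And>z. z \<in> S \<Longrightarrow> deriv f z \<noteq> 0"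
    and proper: "\<And>K. compact K \<Longrightarrow> K \<subseteq> D \<Longrightarrow> compact {z\<in>S. f z \<in> K}" and ne: "S \<noteq> {}"
  shows "covering_space S f D"
proof -
  have loc: "\<exists>r>0. ball z r \<subseteq> S \<and> open (f ` ball z r) \<and> inj_on f (ball z r)" if "z \<in> S" for z
    using has_complex_derivative_locally_invertible[OF hol that S reg[OF that]] by metis
  have cont: "continuous_on S f" by (rule holomorphic_on_imp_continuous_on[OF hol])
  have even: "\<exists>T V. open T \<and> b \<in> T \<and> T \<subseteq> D \<and> S \<inter> f -` T = \<Union>V \<and> pairwise disjnt V \<and>
      (\<forall>u\<in>V. open u \<and> u \<subseteq> S \<and> inj_on f u \<and> f ` u = T) \<and> (V \<noteq> {} \<longrightarrow> b \<in> f ` S)" if b: "b \<in> D" for b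
  proof -
    define Z where "Z = {z\<in>S. f z = b}"
    have "compact {z\<in>S. f z \<in> {b}}" by (rule proper) (use b in auto)
    then have compZ: "compact {z\<in>S. f z = b}" by simp
    have "\<exists>r>0. inj_on f (ball z r)" if "z \<in> S" for z using loc[OF that] by metis
    then have fin: "finite Z" unfolding Z_def using compZ by (rule finite_fibre)
    have "\<forall>z\<in>Z. \<exists>r>0. ball z r \<subseteq> S \<and> inj_on f (ball z r)" using loc by (auto simp: Z_def)
    then obtain r where r: "\<And>z. z \<in> Z \<Longrightarrow> r z > 0 \<and> ball z (r z) \<subseteq> S \<and> inj_on f (ball z (r z))" by metis
    define \<rho> where "\<rho> = Min (insert 1 (r ` Z \<union> (\<lambda>(z, w). dist z w / 2) ` {(z, w). z \<in> Z \<and> w \<in> Z \<and> z \<noteq> w}))"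
    have finP: "finite {(z, w). z \<in> Z \<and> w \<in> Z \<and> z \<noteq> w}"
      by (rule finite_subset[of _ "Z \<times> Z"]) (use fin in auto)
    have fin2: "finite (insert 1 (r ` Z \<union> (\<lambda>(z, w). dist z w / 2) ` {(z, w). z \<in> Z \<and> w \<in> Z \<and> z \<noteq> w}))"
      using fin finP by simp
    have \<rho>: "\<rho> > 0" unfolding \<rho>_def
      by (subst Min_gr_iff[OF fin2]) (use r in auto)
    have \<rho>r: "\<rho> \<le> r z" if "z \<in> Z" for z
      unfolding \<rho>_def by (rule Min_le[OF fin2]) (use that in auto)
    have \<rho>d: "\<rho> \<le> dist z w / 2" if "z \<in> Z" "w \<in> Z" "z \<noteq> w" for z w
      unfolding \<rho>_def by (rule Min_le[OF fin2]) (use that in \<open>auto intro!: image_eqI[of _ _ "(z, w)"]\<close>)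
    have B: "ball z \<rho> \<subseteq> S" "inj_on f (ball z \<rho>)" if "z \<in> Z" for z
    proof -
      have "ball z \<rho> \<subseteq> ball z (r z)" using \<rho>r[OF that] by (rule subset_ball)
      then show "ball z \<rho> \<subseteq> S" "inj_on f (ball z \<rho>)" using r[OF that] by (auto intro: inj_on_subset)
    qed
    have Bo: "open (f ` ball z \<rho>)" if "z \<in> Z" for z
      by (rule open_mapping_thm3) (use B[OF that] holomorphic_on_subset[OF hol] in auto)
    have disj: "ball z \<rho> \<inter> ball w \<rho> = {}" if "z \<in> Z" "w \<in> Z" "z \<noteq> w" for z w
      using \<rho>d[OF that] by (intro disjoint_ballI) auto
    obtain \<delta> where \<delta>: "\<delta> > 0" "cball b \<delta> \<subseteq> D" using D(1) b open_contains_cball by metis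
    define X where "X = {z\<in>S. f z \<in> cball b \<delta>} - (\<Union>z\<in>Z. ball z \<rho>)"
    have "compact {z\<in>S. f z \<in> cball b \<delta>}" using \<delta> by (intro proper) auto
    then have "compact X" unfolding X_def by (rule compact_diff) (intro open_UN ballI open_ball)
    then have fX: "compact (f ` X)"
      by (rule compact_continuous_image[rotated]) (rule continuous_on_subset[OF cont], auto simp: X_def)
    have "b \<notin> f ` X"
    proof
      assume "b \<in> f ` X"
      then obtain z where z: "z \<in> X" "b = f z" by (elim imageE)
      then have "z \<in> Z" by (auto simp: X_def Z_def)
      then show False using z(1) \<rho> by (auto simp: X_def)
    qed
    define T where "T = ball b \<delta> \<inter> (\<Inter>z\<in>Z. f ` ball z \<rho>) - f ` X"
    have T: "open T" unfolding T_def
      using fX Bo fin by (intro open_Diff open_Int open_INT compact_imp_closed) auto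
    have bT: "b \<in> T" unfolding T_def
      using \<delta>(1) \<open>b \<notin> f ` X\<close> \<rho> by (auto simp: Z_def intro!: image_eqI)
    have TD: "T \<subseteq> D" using \<delta>(2) by (auto simp: T_def)
    define V where "V = (\<lambda>z. ball z \<rho> \<inter> f -` T) ` Z"
    have "S \<inter> f -` T = \<Union>V"
    proof (intro subset_antisym subsetI)
      fix z assume z: "z \<in> S \<inter> f -` T"
      then have "z \<notin> X" "f z \<in> ball b \<delta>" by (auto simp: T_def)
      then obtain y where "y \<in> Z" "z \<in> ball y \<rho>" using z by (auto simp: X_def)
      then show "z \<in> \<Union>V" using z by (auto simp: V_def)
    next
      fix z assume "z \<in> \<Union>V"
      then obtain y where "y \<in> Z" "z \<in> ball y \<rho> \<inter> f -` T" by (auto simp: V_def)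
      then show "z \<in> S \<inter> f -` T" using subsetD[OF B(1)] by auto
    qed
    moreover have "pairwise disjnt V"
    proof (rule pairwiseI)
      fix u v assume "u \<in> V" "v \<in> V" "u \<noteq> v"
      then obtain y z where "y \<in> Z" "z \<in> Z" "y \<noteq> z" "u = ball y \<rho> \<inter> f -` T" "v = ball z \<rho> \<inter> f -` T"
        by (auto simp: V_def)
      then show "disjnt u v" using disj[of y z] by (auto simp: disjnt_def)
    qed
    moreover have "open u \<and> u \<subseteq> S \<and> inj_on f u \<and> f ` u = T" if uV: "u \<in> V" for u
    proof -
      obtain z where z: "z \<in> Z" and u: "u = ball z \<rho> \<inter> f -` T"
        using uV unfolding V_def by auto
      have "open u" unfolding u
        by (rule continuous_open_preimage[OF continuous_on_subset[OF cont B(1)[OF z]] open_ball T])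
      moreover have "T \<subseteq> f ` ball z \<rho>" using z by (auto simp: T_def)
      then have "f ` u = T" unfolding u by auto
      moreover have "inj_on f u" using B(2)[OF z] by (rule inj_on_subset) (auto simp: u)
      ultimately show ?thesis using B(1)[OF z] by (auto simp: u)
    qed
    moreover have "V \<noteq> {} \<longrightarrow> b \<in> f ` S" by (auto simp: V_def Z_def)
    ultimately show ?thesis using T bT TD by blast
  qed
  have "open (f ` S)"
    unfolding open_subopen[of "f ` S"]
  proof
    fix y assume "y \<in> f ` S"
    then obtain z where z: "z \<in> S" "y = f z" by (elim imageE)
    obtain r where "r > 0" "ball z r \<subseteq> S" "open (f ` ball z r)" using loc[OF z(1)] by auto
    then show "\<exists>T. open T \<and> y \<in> T \<and> T \<subseteq> f ` S" using z(2)
      by (intro exI[of _ "f ` ball z r"]) (auto intro: image_mono)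
  qed
  moreover have "open (D - f ` S)"
    unfolding open_subopen[of "D - f ` S"]
  proof
    fix b assume b: "b \<in> D - f ` S"
    then obtain T V where "open T" "b \<in> T" "T \<subseteq> D" "S \<inter> f -` T = \<Union>V" "V \<noteq> {} \<longrightarrow> b \<in> f ` S"
      using even[of b] by auto
    then show "\<exists>T. open T \<and> b \<in> T \<and> T \<subseteq> D - f ` S"
      using b by (intro exI[of _ T]) auto
  qed
  moreover have "f ` S \<noteq> {}" using ne by simp
  moreover have fSD: "f ` S \<subseteq> D" using im by auto
  ultimately have "f ` S = D"
    using connectedD[OF D(2), of "f ` S" "D - f ` S"] by blast
  show ?thesis
  proof (rule covering_spaceI[OF cont \<open>f ` S = D\<close>])
    fix b assume b: "b \<in> D"
    obtain T V where TV: "open T" "b \<in> T" "T \<subseteq> D" "S \<inter> f -` T = \<Union>V" "pairwise disjnt V"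
      "\<forall>u\<in>V. open u \<and> u \<subseteq> S \<and> inj_on f u \<and> f ` u = T"
      using even[OF b] by auto
    have "\<exists>q. homeomorphism u T f q" if "u \<in> V" for u
    proof -
      have u: "open u" "u \<subseteq> S" "inj_on f u" "f ` u = T" using TV(6) that by auto
      obtain q where "homeomorphism u (f ` u) f q"
        by (rule invariance_of_domain_homeomorphism[OF u(1) continuous_on_subset[OF cont u(2)] _ u(3)]) auto
      then show ?thesis using u(4) by auto
    qed
    moreover have "openin (top_of_set D) T" using TV(1,3) by (simp add: open_subset)
    moreover have "openin (top_of_set S) u" if "u \<in> V" for u
      using TV(6) that by (auto simp: open_subset)
    ultimately show "\<exists>T. b \<in> T \<and> openin (top_of_set D) T \<and>
        (\<exists>v. \<Union>v = S \<inter> f -` T \<and> (\<forall>u\<in>v. openin (top_of_set S) u) \<and> pairwise disjnt v \<and>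
          (\<forall>u\<in>v. \<exists>q. homeomorphism u T f q))"
      using TV(2,4,5) by (intro exI[of _ T] conjI exI[of _ V]) auto
  qed
qed

text \<open>The identity of the disc lifts through the covering because discs are simply connected.\<close>

lemma proper_holomorphic_inverse_branch:
  fixes f :: "complex \<Rightarrow> complex"
  assumes S: "open S" and \<rho>: "\<rho> > 0" and hol: "f holomorphic_on S"
    and im: "\<And>z. z \<in> S \<Longrightarrow> f z \<in> ball c \<rho>" and reg: "\<And>z. z \<in> S \<Longrightarrow> deriv f z \<noteq> 0"
    and proper: "\<And>K. compact K \<Longrightarrow> K \<subseteq> ball c \<rho> \<Longrightarrow> compact {z\<in>S. f z \<in> K}"
    and z0: "z0 \<in> S" "f z0 = c"
  obtains \<phi> where "\<phi> holomorphic_on ball c \<rho>" "\<phi> c = z0"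
    "\<And>w. w \<in> ball c \<rho> \<Longrightarrow> \<phi> w \<in> S \<and> f (\<phi> w) = w"
    "\<And>w. w \<in> ball c \<rho> \<Longrightarrow> deriv f (\<phi> w) * deriv \<phi> w = 1"
proof -
  have cov: "covering_space S f (ball c \<rho>)"
    by (rule proper_holomorphic_covering[OF S open_ball _ hol im reg proper]) (use z0 in auto)
  have sc: "simply_connected (ball c \<rho>)" by (rule convex_imp_simply_connected) simp
  have lp: "locally path_connected (ball c \<rho>)" by (rule convex_imp_locally_path_connected) simp
  obtain \<phi> where \<phi>: "continuous_on (ball c \<rho>) \<phi>" "\<phi> \<in> ball c \<rho> \<rightarrow> S" "\<phi> c = z0"
    "\<And>w. w \<in> ball c \<rho> \<Longrightarrow> f (\<phi> w) = w"
    by (rule covering_space_lift_strong[OF cov z0(1) _ sc lp, of c "\<lambda>w. w"]) (use \<rho> z0 in auto)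
  have der: "(\<phi> has_field_derivative inverse (deriv f (\<phi> w))) (at w)" if w: "w \<in> ball c \<rho>" for w
  proof (rule has_field_derivative_inverse_basic[OF _ _ _ open_ball w])
    have "\<phi> w \<in> S" using \<phi>(2) w by auto
    then show "(f has_field_derivative deriv f (\<phi> w)) (at (\<phi> w))" "deriv f (\<phi> w) \<noteq> 0"
      using hol S reg by (auto intro: holomorphic_derivI)
    show "isCont \<phi> w" using \<phi>(1) w by (simp add: continuous_on_eq_continuous_at)
  qed (use \<phi>(4) in auto)
  show thesis
  proof (rule that[of \<phi>])
    show "\<phi> holomorphic_on ball c \<rho>"
      using der by (meson holomorphic_onI has_field_derivative_at_within field_differentiable_def)
    fix w assume w: "w \<in> ball c \<rho>"
    show "\<phi> w \<in> S \<and> f (\<phi> w) = w" using \<phi>(2,4) w by auto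
    then show "deriv f (\<phi> w) * deriv \<phi> w = 1"
      using DERIV_imp_deriv[OF der[OF w]] reg by simp
  qed (rule \<phi>(3))
qed

subsection \<open>A coordinate that sends a given finite point to infinity\<close>

text \<open>The point \<open>q + 1 / w\<close> in homogeneous coordinates, with inverse \<open>coord q\<close>, which is \<open>x \<mapsto> 1 / (x - q)\<close>.  A map that
keeps away from \<open>Fin q\<close> becomes a bounded holomorphic function in this coordinate, so that function theory
in the plane applies to self-maps of the sphere.  The squared length of the homogeneous coordinates
is \<open>away_size\<close>.\<close>

definition away :: "complex \<Rightarrow> complex \<Rightarrow> riemann_sphere" where
  "away q w = of_ratio (1 + q * w) w"

definition coord :: "complex \<Rightarrow> riemann_sphere \<Rightarrow> complex" where
  "coord q x = chart (Fin 0) (mob 0 1 1 (-q) x)"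

definition away_size :: "complex \<Rightarrow> complex \<Rightarrow> real" where
  "away_size q w = (cmod (1 + q * w))\<^sup>2 + (cmod w)\<^sup>2"

lemma away_nz: "1 + q * w \<noteq> 0 \<or> (w :: complex) \<noteq> 0"
  by (cases "w = 0") simp_all

lemma away_size_pos: "away_size q w > 0"
  unfolding away_size_def by (rule hom_norm_pos) (rule away_nz)

lemma Fin_eq_of_ratio: "Fin q = of_ratio q 1"
  by (simp add: of_ratio_def)

lemma away_ne: "away q w \<noteq> Fin q"
  unfolding away_def Fin_eq_of_ratio using of_ratio_eq_iff[OF away_nz, of q 1 q w] by (simp add: mult.commute)

lemma mob_away: "mob 0 1 1 (-q) (away q w) = Fin w"
  unfolding away_def mob_of_ratio[OF away_nz] by (simp add: of_ratio_def)

lemma coord_away [simp]: "coord q (away q w) = w"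
  by (simp add: coord_def mob_away)

lemma mob_coord: "x \<noteq> Fin q \<Longrightarrow> mob 0 1 1 (-q) x = Fin (coord q x)"
proof -
  assume "x \<noteq> Fin q"
  then have "mob 0 1 1 (-q) x \<noteq> Infty" by (cases x) (auto simp: mob_def)
  then show ?thesis unfolding coord_def by (cases "mob 0 1 1 (-q) x") auto
qed

lemma away_coord [simp]:
  assumes "x \<noteq> Fin q"
  shows "away q (coord q x) = x"
proof -
  have "mob (-q) (-1) (-1) 0 (Fin (coord q x)) = x"
    using mob_inverse[of 0 "-q" 1 1 x] mob_coord[OF assms] by simp
  moreover have "mob (-q) (-1) (-1) 0 (Fin w) = away q w" for w
  proof -
    have *: "- q * w + (-1) * 1 = - (1 + q * w)" "(-1) * w + 0 * 1 = - w" by simp_all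
    have w1: "w \<noteq> 0 \<or> (1::complex) \<noteq> 0" by simp
    show ?thesis unfolding Fin_eq_of_ratio away_def mob_of_ratio[OF w1] *
      by (simp only: of_ratio_def neg_equal_0_iff_equal minus_divide_divide)
  qed
  ultimately show ?thesis by simp
qed

lemma hom_rep_away: "\<phi> holomorphic_on S \<Longrightarrow> hom_rep (\<lambda>w. 1 + q * \<phi> w) \<phi> (\<lambda>w. away q (\<phi> w)) S"
  unfolding hom_rep_def by (auto intro!: holomorphic_intros simp: away_def)

lemma mero_at_away_comp:
  assumes "\<phi> holomorphic_on S" "open S" "w \<in> S"
  shows "mero_at (\<lambda>w. away q (\<phi> w)) w"
proof -
  obtain r where "r > 0" "ball w r \<subseteq> S" using assms(2,3) openE by blast
  then show ?thesis using hom_rep_away[OF holomorphic_on_subset[OF assms(1)], of "ball w r" q]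
    unfolding mero_at_def by blast
qed

lemma mero_at_away: "mero_at (away q) w"
  using mero_at_away_comp[of "\<lambda>w. w" UNIV w q] by simp

lemma continuous_on_away: "continuous_on S (away q)"
  by (simp add: continuous_at_imp_continuous_on mero_at_away mero_at_isCont)

lemma continuous_on_coord:
  assumes "Fin q \<notin> S"
  shows "continuous_on S (coord q)"
proof -
  have "isCont (coord q) x" if "x \<in> S" for x
  proof -
    have "x \<noteq> Fin q" using that assms by auto
    have "isCont (mob 0 1 1 (-q)) x"
      using mob_imp_continuous[of 0 "-q" 1 1 UNIV] by (simp add: continuous_on_eq_continuous_at)
    moreover have "isCont (chart (Fin 0)) (mob 0 1 1 (-q) x)"
      unfolding mob_coord[OF \<open>x \<noteq> Fin q\<close>] by (rule isCont_chart_Fin)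
    ultimately show ?thesis unfolding coord_def[abs_def] by (rule isCont_o2)
  qed
  then show ?thesis by (simp add: continuous_at_imp_continuous_on)
qed

lemma chord_away: "chord (away q w) (away q z) = 2 * cmod (w - z) / (sqrt (away_size q w) * sqrt (away_size q z))"
proof -
  have "(1 + q * w) * z - w * (1 + q * z) = z - w" by (simp add: algebra_simps)
  then show ?thesis
    unfolding away_def away_size_def chord_of_ratio[OF away_nz away_nz] by (simp add: norm_minus_commute)
qed

lemma chord_away_center: "chord (away q w) (Fin q) = 2 / (sqrt (away_size q w) * sqrt ((cmod q)\<^sup>2 + 1))"
proof -
  have "(1 + q * w) * 1 - w * q = 1" by (simp add: algebra_simps)
  then show ?thesis
    unfolding away_def away_size_def Fin_eq_of_ratio by (subst chord_of_ratio[OF away_nz]) auto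
qed

lemma chord_le_2: "chord x y \<le> 2"
  unfolding chord_def using norm_triangle_ineq4[of "stereo x" "stereo y"] by simp

lemma sqrt_away_size_ge: "1 / sqrt ((cmod q)\<^sup>2 + 1) \<le> sqrt (away_size q w)"
proof -
  have p: "sqrt ((cmod q)\<^sup>2 + 1) > 0" by (simp add: add_nonneg_pos)
  have "2 / (sqrt (away_size q w) * sqrt ((cmod q)\<^sup>2 + 1)) \<le> 2"
    using chord_le_2[of "away q w" "Fin q"] unfolding chord_away_center .
  then have "1 \<le> sqrt (away_size q w) * sqrt ((cmod q)\<^sup>2 + 1)"
    using p away_size_pos[of q w] by (simp add: divide_le_eq)
  then show ?thesis using p by (simp add: divide_le_eq)
qed

lemma away_size_ge: "1 / ((cmod q)\<^sup>2 + 1) \<le> away_size q w"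
proof -
  have "(1 / sqrt ((cmod q)\<^sup>2 + 1))\<^sup>2 \<le> (sqrt (away_size q w))\<^sup>2"
    by (intro power_mono sqrt_away_size_ge) auto
  moreover have "(sqrt (away_size q w))\<^sup>2 = away_size q w"
    by (intro real_sqrt_pow2 less_imp_le away_size_pos)
  moreover have "(1 / sqrt ((cmod q)\<^sup>2 + 1))\<^sup>2 = 1 / ((cmod q)\<^sup>2 + 1)"
    by (simp add: power_divide add_nonneg_nonneg)
  ultimately show ?thesis by simp
qed

lemma dist_away_le: "dist (away q w) (away q z) \<le> 4 * ((cmod q)\<^sup>2 + 1) * cmod (w - z)"
proof -
  have p: "sqrt ((cmod q)\<^sup>2 + 1) > 0" by (simp add: add_nonneg_pos)
  have ge: "1 \<le> sqrt (away_size q u) * sqrt ((cmod q)\<^sup>2 + 1)" for u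
    using sqrt_away_size_ge[of q u] p by (simp add: divide_le_eq)
  have s: "sqrt (away_size q u) > 0" for u using away_size_pos by simp
  have "1 * 1 \<le> (sqrt (away_size q w) * sqrt ((cmod q)\<^sup>2 + 1)) * (sqrt (away_size q z) * sqrt ((cmod q)\<^sup>2 + 1))"
    using s p ge[of w] ge[of z] by (intro mult_mono) linarith+
  also have "\<dots> = (sqrt (away_size q w) * sqrt (away_size q z)) * (sqrt ((cmod q)\<^sup>2 + 1) * sqrt ((cmod q)\<^sup>2 + 1))"
    by (simp only: mult_ac)
  also have "sqrt ((cmod q)\<^sup>2 + 1) * sqrt ((cmod q)\<^sup>2 + 1) = (cmod q)\<^sup>2 + 1"
    by (simp add: add_nonneg_nonneg)
  finally have "1 / (sqrt (away_size q w) * sqrt (away_size q z)) \<le> (cmod q)\<^sup>2 + 1"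
    using s[of w] s[of z] by (simp add: divide_le_eq mult.commute)
  then have "2 * cmod (w - z) * (1 / (sqrt (away_size q w) * sqrt (away_size q z))) \<le> 2 * cmod (w - z) * ((cmod q)\<^sup>2 + 1)"
    by (intro mult_left_mono) auto
  then have "chord (away q w) (away q z) \<le> 2 * cmod (w - z) * ((cmod q)\<^sup>2 + 1)"
    unfolding chord_away by simp
  then show ?thesis using dist_le_chord[of "away q w" "away q z"] by (simp add: algebra_simps)
qed

lemma norm_coord_le:
  assumes "\<delta> > 0" "dist (away q w) (Fin q) \<ge> \<delta>"
  shows "cmod w \<le> 4 / \<delta>"
proof (cases "w = 0")
  case False
  have a: "cmod w \<le> sqrt (away_size q w)" unfolding away_size_def by (rule real_le_rsqrt) simp
  have b: "1 \<le> sqrt ((cmod q)\<^sup>2 + 1)" by simp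
  have "cmod w * 1 \<le> sqrt (away_size q w) * sqrt ((cmod q)\<^sup>2 + 1)"
    by (rule mult_mono[OF a b]) (auto intro: less_imp_le[OF away_size_pos])
  then have "2 / (sqrt (away_size q w) * sqrt ((cmod q)\<^sup>2 + 1)) \<le> 2 / cmod w"
    using False by (intro divide_left_mono) (auto intro!: mult_pos_pos simp: away_size_pos add_nonneg_pos less_imp_le[OF away_size_pos])
  then have "\<delta> \<le> 4 / cmod w"
    using assms(2) dist_le_chord[of "away q w" "Fin q"] unfolding chord_away_center by simp
  then show ?thesis using False assms(1) by (simp add: field_simps)
qed (use assms in simp)

lemma sph_speed_away_comp:
  assumes "\<phi> holomorphic_on ball w r" "r > 0" "\<And>z. z \<in> ball w r \<Longrightarrow> F z = away q (\<phi> z)"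
  shows "sph_speed F w = cmod (deriv \<phi> w) / away_size q (\<phi> w)"
proof -
  have rep: "hom_rep (\<lambda>w. 1 + q * \<phi> w) \<phi> F (ball w r)"
    using hom_rep_away[OF assms(1), of q] assms(3) unfolding hom_rep_def by auto
  have d: "(\<phi> has_field_derivative deriv \<phi> w) (at w)"
    using assms(1,2) by (auto intro!: holomorphic_derivI[of _ "ball w r"])
  have "((\<lambda>w. 1 + q * \<phi> w) has_field_derivative q * deriv \<phi> w) (at w)"
    using d by (auto intro!: derivative_eq_intros)
  then have "deriv (\<lambda>w. 1 + q * \<phi> w) w = q * deriv \<phi> w" by (rule DERIV_imp_deriv)
  then have "deriv (\<lambda>w. 1 + q * \<phi> w) w * \<phi> w - (1 + q * \<phi> w) * deriv \<phi> w = - deriv \<phi> w"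
    by (simp add: algebra_simps)
  then show ?thesis
    unfolding sph_speed_hom_rep(1)[OF rep assms(2)] away_size_def by simp
qed

text \<open>If \<open>g\<close> keeps a fixed neighbourhood of \<open>Fin q\<close> away from a disc without critical values, an inverse branch of \<open>g\<close>
over the disc is a bounded univalent function in the coordinate \<^const>\<open>coord\<close>.  Its size is then controlled
by its derivative at the centre, that is, by the reciprocal of the derivative of \<open>g\<close>.\<close>

lemma inverse_branch_estimate:
  assumes \<delta>: "\<delta> > 0" and \<rho>: "\<rho> > 0"
  obtains C where "C > 0" "\<And>g x0 c. hmap g \<Longrightarrow>
    (\<And>x. local_deriv g x = 0 \<Longrightarrow> g x \<notin> away q ` ball c \<rho>) \<Longrightarrow>
    (\<And>x. x \<in> ball (Fin q) \<delta> \<Longrightarrow> g x \<notin> away q ` ball c \<rho>) \<Longrightarrow> g x0 = away q c \<Longrightarrow>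
    \<exists>\<Psi>. continuous_on (ball c \<rho>) \<Psi> \<and> \<Psi> c = x0 \<and> (\<forall>w\<in>ball c \<rho>. g (\<Psi> w) = away q w) \<and>
      (\<forall>w\<in>cball c (2 / 3 * \<rho>). dist (\<Psi> w) x0 * sph_deriv_norm g x0 \<le> C)"
proof -
  define Q where "Q = (cmod q)\<^sup>2 + 1"
  define N where "N = (1 + cmod q * (4 / \<delta>))\<^sup>2 + (4 / \<delta>)\<^sup>2"
  define K where "K = (2 * schottky_const\<^sup>2 + 2) * \<rho>"
  define C where "C = 4 * Q * K * (N * Q)"
  have Q: "Q > 0" by (simp add: Q_def add_nonneg_pos)
  have N: "N > 0" using \<delta> by (simp add: N_def add_nonneg_pos)
  have K: "K > 0" using \<rho> by (simp add: K_def add_nonneg_pos)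
  have "C > 0" using Q N K by (simp add: C_def)
  moreover have "\<exists>\<Psi>. continuous_on (ball c \<rho>) \<Psi> \<and> \<Psi> c = x0 \<and> (\<forall>w\<in>ball c \<rho>. g (\<Psi> w) = away q w) \<and>
      (\<forall>w\<in>cball c (2 / 3 * \<rho>). dist (\<Psi> w) x0 * sph_deriv_norm g x0 \<le> C)"
    if g: "hmap g" and crit: "\<And>x. local_deriv g x = 0 \<Longrightarrow> g x \<notin> away q ` ball c \<rho>"
      and far: "\<And>x. x \<in> ball (Fin q) \<delta> \<Longrightarrow> g x \<notin> away q ` ball c \<rho>" and x0: "g x0 = away q c" for g x0 c
  proof -
    define D where "D = ball c \<rho>"
    define F where "F = g \<circ> away q"
    define f where "f w = chart (Fin 0) ((mob 0 1 1 (-q) \<circ> F) w)" for w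
    have f_coord: "f w = coord q (F w)" for w by (simp add: f_def coord_def)
    have mF: "mero_at F w" for w using g mero_at_away unfolding hmap_def F_def by blast
    have contF: "continuous_on A F" for A by (simp add: continuous_at_imp_continuous_on mF mero_at_isCont)
    \<comment> \<open>\<open>S\<close> is the preimage of the disc in the coordinate, on which \<open>f\<close> is the map \<open>g\<close> in that coordinate\<close>
    define S' where "S' = {w. F w \<noteq> Fin q}"
    define S where "S = {w\<in>S'. f w \<in> D}"
    have "S' = F -` (- {Fin q})" by (auto simp: S'_def)
    then have S'o: "open S'" using open_vimage[OF _ contF[of UNIV], of "- {Fin q}"] by (simp add: open_Compl)
    have hol': "f holomorphic_on S'"
      unfolding f_def
    proof (rule mero_at_finite_holomorphic(1)[where F = "mob 0 1 1 (-q) \<circ> F", OF S'o])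
      show "mero_at (mob 0 1 1 (-q) \<circ> F) w" for w
        using hmap_mob[of 0 "-q" 1 1] mF unfolding hmap_def by simp
      show "(mob 0 1 1 (-q) \<circ> F) w \<noteq> Infty" if "w \<in> S'" for w
        using mob_coord[of "F w" q] that by (simp add: S'_def)
    qed
    have So: "open S"
    proof -
      have "S = S' \<inter> f -` D" by (auto simp: S_def)
      then show ?thesis
        using continuous_open_preimage[OF holomorphic_on_imp_continuous_on[OF hol'] S'o, of D] by (simp add: D_def)
    qed
    have hol: "f holomorphic_on S" using hol' by (rule holomorphic_on_subset) (auto simp: S_def)
    have Ff: "F w = away q (f w)" if "w \<in> S'" for w using that by (simp add: S'_def f_coord)
    have S_iff: "w \<in> S \<longleftrightarrow> F w \<in> away q ` D" for w
    proof
      assume "w \<in> S" then show "F w \<in> away q ` D" using Ff by (auto simp: S_def)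
    next
      assume "F w \<in> away q ` D"
      then obtain d where d: "d \<in> D" "F w = away q d" by (elim imageE)
      then have "w \<in> S'" using away_ne by (simp add: S'_def)
      moreover have "f w = d" using d by (simp add: f_coord)
      ultimately show "w \<in> S" using d by (simp add: S_def)
    qed
    have far': "dist (away q w) (Fin q) \<ge> \<delta>" if "w \<in> S" for w
      using far[of "away q w"] that S_iff[of w] by (auto simp: F_def D_def dist_commute not_less[symmetric])
    have bd: "cmod w \<le> 4 / \<delta>" if "w \<in> S" for w by (rule norm_coord_le[OF \<delta> far'[OF that]])
    have proper: "compact {w\<in>S. f w \<in> X}" if X: "compact X" "X \<subseteq> D" for X
    proof -
      have "compact (away q ` X)" using continuous_on_away X(1) by (rule compact_continuous_image)
      then have "closed (F -` (away q ` X))"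
        by (intro closed_vimage contF compact_imp_closed)
      moreover have "{w\<in>S. f w \<in> X} = F -` (away q ` X)"
      proof (intro set_eqI iffI)
        fix w assume "w \<in> {w\<in>S. f w \<in> X}"
        then show "w \<in> F -` (away q ` X)" using Ff[of w] by (auto simp: S_def)
      next
        fix w assume "w \<in> F -` (away q ` X)"
        then obtain d where d: "d \<in> X" "F w = away q d" by auto
        then have "w \<in> S" using X(2) S_iff[of w] by auto
        moreover have "f w = d" using d by (simp add: f_coord)
        ultimately show "w \<in> {w\<in>S. f w \<in> X}" using d by simp
      qed
      moreover have "bounded {w\<in>S. f w \<in> X}" using bd by (intro boundedI[of _ "4 / \<delta>"]) auto
      ultimately show ?thesis by (simp add: compact_eq_bounded_closed)
    qed
    have speed: "cmod (deriv f w) / away_size q (f w) = sph_deriv_norm g (away q w) / away_size q w"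
      if "w \<in> S" for w
    proof -
      obtain r where r: "r > 0" "ball w r \<subseteq> S" using So \<open>w \<in> S\<close> openE by blast
      have "sph_speed F w = cmod (deriv f w) / away_size q (f w)"
        by (rule sph_speed_away_comp[OF holomorphic_on_subset[OF hol r(2)] r(1)])
          (use r(2) Ff in \<open>auto simp: S_def\<close>)
      moreover have "sph_speed (away q) w = 1 / away_size q w"
        using sph_speed_away_comp[of "\<lambda>w. w" w 1 "away q" q] by (simp add: holomorphic_on_ident)
      moreover have "sph_speed F w = sph_deriv_norm g (away q w) * sph_speed (away q) w"
        unfolding F_def by (rule sph_speed_chain[OF g mero_at_away])
      ultimately show ?thesis by simp
    qed
    have reg: "deriv f w \<noteq> 0" if "w \<in> S" for w
    proof
      assume "deriv f w = 0"
      then have "sph_deriv_norm g (away q w) = 0" using speed[OF that] away_size_pos[of q w] by simp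
      then have "g (away q w) \<notin> away q ` ball c \<rho>" using crit by (simp add: sph_deriv_norm_zero_iff)
      then show False using that S_iff[of w] by (simp add: F_def D_def)
    qed
    have x0q: "x0 \<noteq> Fin q"
    proof
      assume "x0 = Fin q"
      then have "g x0 \<notin> away q ` ball c \<rho>" using far \<delta> by simp
      then show False using x0 \<rho> by simp
    qed
    define w0 where "w0 = coord q x0"
    have w0: "away q w0 = x0" using x0q by (simp add: w0_def)
    have w0S: "w0 \<in> S" "f w0 = c" using S_iff[of w0] x0 \<rho> by (simp_all add: F_def w0 D_def f_coord)
    have im: "f w \<in> ball c \<rho>" if "w \<in> S" for w using that by (simp add: S_def D_def)
    obtain \<phi> where \<phi>: "\<phi> holomorphic_on ball c \<rho>" "\<phi> c = w0"
      "\<And>w. w \<in> ball c \<rho> \<Longrightarrow> \<phi> w \<in> S \<and> f (\<phi> w) = w"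
      "\<And>w. w \<in> ball c \<rho> \<Longrightarrow> deriv f (\<phi> w) * deriv \<phi> w = 1"
      by (rule proper_holomorphic_inverse_branch[OF So \<rho> hol im reg proper[unfolded D_def] w0S]) auto
    define \<Psi> where "\<Psi> w = away q (\<phi> w)" for w
    have "continuous_on (ball c \<rho>) \<Psi>"
      unfolding \<Psi>_def using continuous_on_compose2[OF continuous_on_away holomorphic_on_imp_continuous_on[OF \<phi>(1)]]
      by auto
    moreover have "\<Psi> c = x0" by (simp add: \<Psi>_def \<phi>(2) w0)
    moreover have "g (\<Psi> w) = away q w" if "w \<in> ball c \<rho>" for w
    proof -
      have "\<phi> w \<in> S'" using \<phi>(3)[OF that] by (simp add: S_def)
      from Ff[OF this] show ?thesis using \<phi>(3)[OF that] by (simp add: F_def \<Psi>_def)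
    qed
    moreover have "dist (\<Psi> w) x0 * sph_deriv_norm g x0 \<le> C" if w: "w \<in> cball c (2 / 3 * \<rho>)" for w
    proof -
      have inj: "inj_on \<phi> (ball c \<rho>)" by (rule inj_on_inverseI[of _ f]) (use \<phi>(3) in auto)
      have cb: "c \<in> ball c \<rho>" using \<rho> by simp
      have "cmod (\<phi> w - \<phi> c) \<le> K * cmod (deriv \<phi> c)"
        unfolding K_def by (rule univalent_growth[OF \<phi>(1) inj \<rho>]) (use w in \<open>simp add: dist_norm norm_minus_commute\<close>)
      moreover have "dist (\<Psi> w) x0 \<le> 4 * Q * cmod (\<phi> w - \<phi> c)"
        unfolding \<Psi>_def Q_def w0[symmetric] \<phi>(2)[symmetric] by (rule dist_away_le)
      ultimately have 1: "dist (\<Psi> w) x0 \<le> 4 * Q * (K * cmod (deriv \<phi> c))"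
        using Q by (meson mult_left_mono order_trans less_imp_le mult_pos_pos zero_less_numeral)
      have "cmod (deriv f w0) * cmod (deriv \<phi> c) = 1"
        using \<phi>(4)[OF cb] by (simp add: \<phi>(2) norm_mult[symmetric])
      moreover have "sph_deriv_norm g x0 = cmod (deriv f w0) * away_size q w0 / away_size q c"
        using speed[OF w0S(1)] away_size_pos[of q w0] by (simp add: w0 w0S field_simps)
      ultimately have "cmod (deriv \<phi> c) * sph_deriv_norm g x0 = away_size q w0 / away_size q c"
        by (simp add: field_simps)
      also have "\<dots> \<le> N * Q"
      proof -
        have "cmod (1 + q * w0) \<le> 1 + cmod q * (4 / \<delta>)"
          using norm_triangle_ineq[of 1 "q * w0"] mult_left_mono[OF bd[OF w0S(1)], of "cmod q"] by (simp add: norm_mult)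
        then have "away_size q w0 \<le> N"
          unfolding away_size_def N_def using bd[OF w0S(1)] by (intro add_mono power_mono) auto
        moreover have "1 / away_size q c \<le> Q"
          using away_size_ge[of q c] away_size_pos[of q c] Q unfolding Q_def by (simp add: field_simps)
        ultimately have "away_size q w0 * (1 / away_size q c) \<le> N * Q"
          using N away_size_pos[of q c] by (intro mult_mono) auto
        then show ?thesis by simp
      qed
      finally have 2: "cmod (deriv \<phi> c) * sph_deriv_norm g x0 \<le> N * Q" .
      have nn: "sph_deriv_norm g x0 \<ge> 0" by (simp add: sph_deriv_norm_def)
      have "dist (\<Psi> w) x0 * sph_deriv_norm g x0 \<le> 4 * Q * (K * cmod (deriv \<phi> c)) * sph_deriv_norm g x0"
        using 1 nn by (rule mult_right_mono)
      also have "\<dots> = 4 * Q * K * (cmod (deriv \<phi> c) * sph_deriv_norm g x0)" by (simp only: mult_ac)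
      also have "\<dots> \<le> C" unfolding C_def using 2 Q K by (intro mult_left_mono) auto
      finally show ?thesis .
    qed
    ultimately show ?thesis by blast
  qed
  ultimately show thesis using that by metis
qed

section \<open>Uniform contraction near an attracting set\<close>

lemma iter_comp_add: "iter_comp \<gamma> (k + n) = iter_comp (\<lambda>i. \<gamma> (k + i)) n \<circ> iter_comp \<gamma> k"
  by (induction n) (simp_all add: fun_eq_iff)

text \<open>The idea of Earle and Hamilton: maps with values well inside a bounded open set \<open>S\<close> may be
  dilated about the current orbit point by a fixed factor \<open>1 + \<epsilon>\<close> and still map \<open>S\<close> into itself.
  Cauchy's estimate for the composition of the dilated maps gives exponential decay of the derivative
  of the original composition.\<close>

lemma dilated_composition_derivative:
  fixes f :: "nat \<Rightarrow> complex \<Rightarrow> complex"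
  assumes S: "open S" and B: "\<And>z. z \<in> S \<Longrightarrow> cmod z \<le> B" and d: "d > 0" and \<epsilon>: "\<epsilon> \<ge> 0" "\<epsilon> * (2 * B) < d"
    and hol: "\<And>i. f i holomorphic_on S"
    and inside: "\<And>i z. z \<in> S \<Longrightarrow> ball (f i z) d \<subseteq> S"
    and x: "r > 0" "cball x r \<subseteq> S"
  shows "cmod (deriv (iter_comp f k) x) \<le> B / r / (1 + \<epsilon>) ^ k"
    and "iter_comp f k holomorphic_on S" and "z \<in> S \<Longrightarrow> iter_comp f k z \<in> S"
proof -
  have fS: "f i z \<in> S" if "z \<in> S" for i z using inside[OF that] d by (meson centre_in_ball subsetD)
  have itS: "iter_comp f k z \<in> S" if "z \<in> S" for k z
    using that by (induction k) (auto intro: fS)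
  have ithol: "iter_comp f k holomorphic_on S" for k
  proof (induction k)
    case 0 then show ?case by (simp add: id_def)
  next
    case (Suc k)
    have "(f k \<circ> iter_comp f k) holomorphic_on S"
      by (rule holomorphic_on_compose_gen[OF Suc hol]) (use itS in auto)
    then show ?case by (simp only: iter_comp.simps)
  qed
  show "iter_comp f k holomorphic_on S" and "z \<in> S \<Longrightarrow> iter_comp f k z \<in> S"
    using ithol itS by auto
  have xS: "x \<in> S" using x by auto
  \<comment> \<open>the dilation fixes the orbit of \<open>x\<close> and multiplies each derivative along it by \<open>1 + \<epsilon>\<close>\<close>
  define g where "g i z = f i z + \<epsilon> * (f i z - f i (iter_comp f i x))" for i z
  have gS: "g i z \<in> S" if "z \<in> S" for i z
  proof -
    have "cmod (f i z - f i (iter_comp f i x)) \<le> B + B"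
      using B[OF fS[OF that]] B[OF fS[OF itS[OF xS]]] norm_triangle_ineq4 add_mono order_trans by metis
    then have "\<epsilon> * cmod (f i z - f i (iter_comp f i x)) \<le> \<epsilon> * (2 * B)"
      using \<epsilon>(1) by (intro mult_left_mono) auto
    then have "dist (f i z) (g i z) < d"
      using \<epsilon> by (simp add: g_def dist_norm norm_mult)
    then have "g i z \<in> ball (f i z) d" by simp
    then show ?thesis by (rule subsetD[OF inside[OF that]])
  qed
  have itg: "iter_comp g k z \<in> S" if "z \<in> S" for k z
    using that by (induction k) (auto intro: gS)
  have ghol: "g i holomorphic_on S" for i
    unfolding g_def by (intro holomorphic_intros hol)
  have itghol: "iter_comp g k holomorphic_on S" for k
  proof (induction k)
    case 0 then show ?case by (simp add: id_def)
  next
    case (Suc k)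
    have "(g k \<circ> iter_comp g k) holomorphic_on S"
      by (rule holomorphic_on_compose_gen[OF Suc ghol]) (use itg in auto)
    then show ?case by (simp only: iter_comp.simps)
  qed
  have same: "iter_comp g k x = iter_comp f k x" for k
    by (induction k) (auto simp: g_def)
  have dit: "(iter_comp f k has_field_derivative deriv (iter_comp f k) x) (at x)" for k
    using ithol S xS by (rule holomorphic_derivI)
  have der: "(iter_comp g k has_field_derivative (1 + of_real \<epsilon>) ^ k * deriv (iter_comp f k) x) (at x)" for k
  proof (induction k)
    case 0
    then show ?case by (simp add: id_def)
  next
    case (Suc k)
    define y where "y = iter_comp f k x"
    have yS: "y \<in> S" using itS xS by (simp add: y_def)
    have df: "(f k has_field_derivative deriv (f k) y) (at y)"
      using hol S yS by (rule holomorphic_derivI)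
    have "(iter_comp f (Suc k) has_field_derivative deriv (f k) y * deriv (iter_comp f k) x) (at x)"
      using DERIV_chain2[OF df[unfolded y_def] dit] by (simp add: o_def y_def)
    then have 1: "deriv (iter_comp f (Suc k)) x = deriv (f k) y * deriv (iter_comp f k) x"
      by (rule DERIV_imp_deriv)
    have dg: "(g k has_field_derivative (1 + of_real \<epsilon>) * deriv (f k) y) (at y)"
      unfolding g_def by (rule derivative_eq_intros df refl | simp add: algebra_simps)+
    have "((\<lambda>z. g k (iter_comp g k z)) has_field_derivative
        ((1 + of_real \<epsilon>) * deriv (f k) y) * ((1 + of_real \<epsilon>) ^ k * deriv (iter_comp f k) x)) (at x)"
      by (rule DERIV_chain2[OF _ Suc]) (use dg same in \<open>simp add: y_def\<close>)
    then show ?case unfolding 1 by (simp add: o_def mult_ac)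
  qed
  have "cmod ((deriv ^^ 1) (iter_comp g k) x) \<le> fact 1 * B / r ^ 1"
  proof (rule Cauchy_inequality)
    show "iter_comp g k holomorphic_on ball x r"
      using itghol by (rule holomorphic_on_subset) (use x in auto)
    show "continuous_on (cball x r) (iter_comp g k)"
      using holomorphic_on_imp_continuous_on[OF itghol] by (rule continuous_on_subset) (use x in auto)
    fix z assume "cmod (x - z) = r"
    then have "z \<in> S" using x by (auto simp: dist_norm)
    then show "cmod (iter_comp g k z) \<le> B" using B itg by blast
  qed (rule x)
  moreover have "deriv (iter_comp g k) x = (1 + of_real \<epsilon>) ^ k * deriv (iter_comp f k) x"
    by (rule DERIV_imp_deriv[OF der])
  moreover have "cmod ((1 + of_real \<epsilon>) ^ k) = (1 + \<epsilon>) ^ k"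
  proof -
    have "(1 + of_real \<epsilon> :: complex) = of_real (1 + \<epsilon>)" by simp
    then have "cmod (1 + of_real \<epsilon>) = 1 + \<epsilon>" using \<epsilon>(1) by (simp only: norm_of_real)
    then show ?thesis by (simp add: norm_power)
  qed
  ultimately have "(1 + \<epsilon>) ^ k * cmod (deriv (iter_comp f k) x) \<le> B / r" by (simp add: norm_mult)
  then show "cmod (deriv (iter_comp f k) x) \<le> B / r / (1 + \<epsilon>) ^ k"
    using \<epsilon>(1) by (subst pos_le_divide_eq) (simp_all add: mult.commute)
qed

text \<open>For \<open>y\<close> within \<open>r / 2\<close> of \<open>x\<close> the closed disc of radius \<open>r / 3\<close> about \<open>y\<close> lies in \<open>S\<close>, so the derivative estimate
holds on a convex set that contains \<open>x\<close> and \<open>z\<close>.\<close>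

lemma uniform_contraction:
  fixes S K :: "complex set"
  assumes S: "open S" "bounded S" and K: "compact K" "K \<subseteq> S" and r: "r > 0"
  obtains C \<theta> where "C \<ge> 0" "\<theta> > 1" "\<And>f x z k. (\<And>i. f i holomorphic_on S) \<Longrightarrow>
    (\<And>i y. y \<in> S \<Longrightarrow> f i y \<in> K) \<Longrightarrow> ball x r \<subseteq> S \<Longrightarrow> dist x z < r / 2 \<Longrightarrow>
    dist (iter_comp f k x) (iter_comp f k z) \<le> C / \<theta> ^ k"
proof -
  obtain B0 where B0: "\<And>z. z \<in> S \<Longrightarrow> cmod z \<le> B0" using S(2) unfolding bounded_iff by blast
  define B where "B = max B0 1"
  have B: "cmod z \<le> B" if "z \<in> S" for z using B0[OF that] by (simp add: B_def)
  have B1: "B > 0" by (simp add: B_def)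
  obtain d where d: "d > 0" "(\<Union>x\<in>K. ball x d) \<subseteq> S"
    using compact_subset_open_imp_ball_epsilon_subset[OF K(1) S(1) K(2)] by metis
  define \<epsilon> where "\<epsilon> = d / (4 * B)"
  have \<epsilon>: "\<epsilon> > 0" "\<epsilon> * (2 * B) < d" using d B1 by (simp_all add: \<epsilon>_def)
  define C where "C = B / (r / 3) * (r / 2)"
  show thesis
  proof (rule that[of C "1 + \<epsilon>"])
    show "C \<ge> 0" "1 + \<epsilon> > 1" using B1 r \<epsilon> by (simp_all add: C_def)
    fix f :: "nat \<Rightarrow> complex \<Rightarrow> complex" and x z :: complex and k :: nat
    assume hol: "\<And>i. f i holomorphic_on S" and fK: "\<And>i y. y \<in> S \<Longrightarrow> f i y \<in> K"
      and x: "ball x r \<subseteq> S" and z: "dist x z < r / 2"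
    have inside: "ball (f i y) d \<subseteq> S" if "y \<in> S" for i y using fK[OF that, of i] d(2) by auto
    have cb: "cball y (r / 3) \<subseteq> S" if "y \<in> ball x (r / 2)" for y
    proof -
      have "cball y (r / 3) \<subseteq> ball x r"
      proof
        fix u assume "u \<in> cball y (r / 3)"
        then show "u \<in> ball x r" using that r dist_triangle[of x u y] by simp
      qed
      then show ?thesis using x by auto
    qed
    have "cmod (iter_comp f k x - iter_comp f k z) \<le> (B / (r / 3) / (1 + \<epsilon>) ^ k) * cmod (x - z)"
    proof (rule field_differentiable_bound[OF convex_ball, of x "r / 2" _ "deriv (iter_comp f k)"])
      fix y assume y: "y \<in> ball x (r / 2)"
      have r3: "r / 3 > 0" using r by simp
      have "y \<in> cball y (r / 3)" using r by simp
      then have yS: "y \<in> S" by (rule subsetD[OF cb[OF y]])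
      have "iter_comp f k holomorphic_on S"
        by (rule dilated_composition_derivative(2)[where B = B and d = d and \<epsilon> = \<epsilon> and x = y and r = "r / 3"])
          (assumption | rule S(1) B d(1) less_imp_le[OF \<epsilon>(1)] \<epsilon>(2) hol inside r3 cb[OF y])+
      then have "(iter_comp f k has_field_derivative deriv (iter_comp f k) y) (at y)"
        using S(1) yS by (rule holomorphic_derivI)
      then show "(iter_comp f k has_field_derivative deriv (iter_comp f k) y) (at y within ball x (r / 2))"
        by (rule has_field_derivative_at_within)
      show "cmod (deriv (iter_comp f k) y) \<le> B / (r / 3) / (1 + \<epsilon>) ^ k"
        by (rule dilated_composition_derivative(1)[where S = S and d = d])
          (assumption | rule S(1) B d(1) less_imp_le[OF \<epsilon>(1)] \<epsilon>(2) hol inside r3 cb[OF y])+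
    qed (use r z in auto)
    also have "\<dots> \<le> (B / (r / 3) / (1 + \<epsilon>) ^ k) * (r / 2)"
      using z B1 r \<epsilon> by (intro mult_left_mono) (auto simp: dist_norm intro!: divide_nonneg_nonneg)
    finally show "dist (iter_comp f k x) (iter_comp f k z) \<le> C / (1 + \<epsilon>) ^ k"
      by (simp only: C_def dist_norm times_divide_eq_left)
  qed
qed

lemma infdist_lessE:
  assumes "infdist x A < \<delta>" "A \<noteq> {}"
  obtains a where "a \<in> A" "dist x a < \<delta>"
proof -
  have "(INF a\<in>A. dist x a) < \<delta>" using assms by (simp add: infdist_notempty)
  then have "\<exists>y\<in>dist x ` A. y < \<delta>" using assms(2) by (intro cInf_lessD) auto
  then show thesis using that by auto
qed

lemma compact_infdist_nbhd:
  assumes "compact A" "A \<noteq> {}" "open B" "A \<subseteq> B"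
  obtains \<delta> where "\<delta> > 0" "\<And>x. infdist x A < \<delta> \<Longrightarrow> x \<in> B"
proof -
  obtain \<epsilon> where \<epsilon>: "\<epsilon> > 0" "(\<Union>x\<in>A. ball x \<epsilon>) \<subseteq> B"
    using compact_subset_open_imp_ball_epsilon_subset[OF assms(1,3,4)] by metis
  have "x \<in> B" if x: "infdist x A < \<epsilon>" for x
  proof -
    obtain a where "a \<in> A" "dist x a < \<epsilon>" by (rule infdist_lessE[OF x assms(2)])
    then have "x \<in> (\<Union>x\<in>A. ball x \<epsilon>)" by (auto simp: dist_commute)
    then show ?thesis using \<epsilon>(2) by (rule subsetD[rotated])
  qed
  then show thesis using \<epsilon>(1) by (rule that[rotated])
qed

lemma open_contains_Fin:
  assumes "open S" "S \<noteq> {}"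
  obtains q where "Fin q \<in> S"
proof -
  obtain x where x: "x \<in> S" using assms(2) by auto
  show thesis
  proof (cases x)
    case (Fin q) then show thesis using that x by auto
  next
    case Infty
    have "open (chart_inv Infty -` S)" using assms(1) by (rule open_vimage) (rule continuous_on_chart_inv)
    moreover have "0 \<in> chart_inv Infty -` S" using x Infty by simp
    ultimately obtain e where e: "e > 0" "ball 0 e \<subseteq> chart_inv Infty -` S" by (rule openE)
    have "complex_of_real (e / 2) \<in> ball 0 e" using e(1) by simp
    then have "chart_inv Infty (complex_of_real (e / 2)) \<in> S" using e(2) by blast
    then show thesis using that e(1) by auto
  qed
qed

section \<open>Semigroup dynamics\<close>

locale rational_system =
  fixes m :: nat and h :: "nat \<Rightarrow> riemann_sphere \<Rightarrow> riemann_sphere"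
  assumes m: "m \<ge> 2" and h_Rat: "\<And>j. j \<in> {1..m} \<Longrightarrow> h j \<in> Rat"
begin

abbreviation "GG \<equiv> gen_semigroup (h ` {1..m})"

abbreviation orb :: "(nat \<Rightarrow> nat) \<Rightarrow> nat \<Rightarrow> riemann_sphere \<Rightarrow> riemann_sphere" where
  "orb w \<equiv> iter_comp (\<lambda>i. h (w i))"

lemma hmap_h: "j \<in> {1..m} \<Longrightarrow> hmap (h j)"
  by (rule Rat_imp_hmap[OF h_Rat])

lemma hmap_GG: "g \<in> GG \<Longrightarrow> hmap g"
proof (induction rule: gen_semigroup.induct)
  case (generator f)
  then show ?case using hmap_h by auto
qed (rule hmap_comp)

lemma h_GG: "j \<in> {1..m} \<Longrightarrow> h j \<in> GG"
  by (intro gen_semigroup.generator imageI)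

lemma words_shift: "w \<in> words m \<Longrightarrow> (\<lambda>i. w (k + i)) \<in> words m"
  by (auto simp: words_def)

lemma words_letter: "w \<in> words m \<Longrightarrow> w i \<in> {1..m}"
  by (simp add: words_def)

lemma orb_Suc_GG: "w \<in> words m \<Longrightarrow> orb w (Suc n) \<in> GG"
proof (induction n)
  case 0
  then show ?case using h_GG words_letter by simp
next
  case (Suc n)
  have "h (w (Suc n)) \<circ> orb w (Suc n) \<in> GG"
    by (rule gen_semigroup.compose[OF h_GG[OF words_letter[OF Suc.prems]] Suc.IH[OF Suc.prems]])
  then show ?case by (simp only: iter_comp.simps)
qed

lemma orb_GG: "w \<in> words m \<Longrightarrow> n \<ge> 1 \<Longrightarrow> orb w n \<in> GG"
  using orb_Suc_GG[of w "n - 1"] by simp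

lemma hmap_orb: "w \<in> words m \<Longrightarrow> hmap (orb w n)"
  by (cases n) (auto intro: hmap_id hmap_GG orb_Suc_GG simp del: iter_comp.simps(2))

lemma orb_foldr: "orb w n = foldr (\<circ>) (map h (map w (rev [0..<n]))) id"
  by (induction n) auto

lemma open_Fatou: "open (Fatou G)"
  unfolding Fatou_def by auto

lemma Fatou_equicontinuous: "x \<in> Fatou G \<Longrightarrow> equicontinuous_at G x"
  unfolding Fatou_def by auto

lemma closed_Julia: "closed (Julia G)"
  unfolding Julia_def using open_Fatou by (simp add: closed_Compl)

end

locale attracting_system = rational_system +
  fixes L :: "riemann_sphere set"
  assumes att: "attracting_minimal_set m h L" and Julia_ne: "Julia GG \<noteq> {}"
begin

lemma L_ne: "L \<noteq> {}" and compact_L: "compact L" and g_L: "g \<in> GG \<Longrightarrow> x \<in> L \<Longrightarrow> g x \<in> L"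
  using att unfolding attracting_minimal_set_def Let_def minimal_set_def invariant_compact_def by auto

lemma L_Fatou: "L \<subseteq> Fatou GG"
proof -
  obtain U' V' where "L \<subseteq> V'" "closure V' \<subseteq> U'" "closure U' \<subseteq> Fatou GG"
    using att unfolding attracting_minimal_set_def Let_def by (elim conjE exE) (rule that)
  then show ?thesis using closure_subset by blast
qed

lemma orb_L: "w \<in> words m \<Longrightarrow> x \<in> L \<Longrightarrow> orb w n x \<in> L"
  by (cases n) (auto intro: g_L orb_Suc_GG simp del: iter_comp.simps(2))

text \<open>Equicontinuity holds at each point of the compact set \<open>L\<close>, which the semigroup maps into itself.\<close>

lemma equicontinuous_near_L:
  assumes \<epsilon>: "\<epsilon> > 0"
  obtains \<delta> where "\<delta> > 0" "\<And>x g. infdist x L < \<delta> \<Longrightarrow> g \<in> GG \<Longrightarrow> infdist (g x) L < \<epsilon>"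
proof -
  have "\<exists>d>0. \<forall>g\<in>GG. \<forall>y. dist y a < d \<longrightarrow> dist (g y) (g a) < \<epsilon>" if "a \<in> L" for a
    using Fatou_equicontinuous[of a GG] L_Fatou that \<epsilon> unfolding equicontinuous_at_def by blast
  then obtain d where d: "\<And>a. a \<in> L \<Longrightarrow> d a > 0 \<and> (\<forall>g\<in>GG. \<forall>y. dist y a < d a \<longrightarrow> dist (g y) (g a) < \<epsilon>)"
    by metis
  obtain \<delta> where \<delta>: "\<delta> > 0" "\<And>x. infdist x L < \<delta> \<Longrightarrow> x \<in> (\<Union>a\<in>L. ball a (d a))"
    by (rule compact_infdist_nbhd[OF compact_L L_ne, of "\<Union>a\<in>L. ball a (d a)"]) (use d in auto)
  show thesis
  proof (rule that[OF \<delta>(1)])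
    fix x g assume x: "infdist x L < \<delta>" and g: "g \<in> GG"
    obtain a where a: "a \<in> L" "dist x a < d a" using \<delta>(2)[OF x] by (auto simp: dist_commute)
    then have "dist (g x) (g a) < \<epsilon>" using d[OF a(1)] g by blast
    then show "infdist (g x) L < \<epsilon>" using infdist_le[OF g_L[OF g a(1)]] by (rule order.strict_trans1[rotated])
  qed
qed

definition conv :: "(nat \<Rightarrow> nat) \<Rightarrow> riemann_sphere \<Rightarrow> bool" where
  "conv w x \<longleftrightarrow> (\<lambda>n. infdist (orb w n x) L) \<longlonglongrightarrow> 0"

text \<open>The Julia set is nonempty, so there is a finite point \<open>q\<close> outside \<open>closure U'\<close>.  In the coordinate \<open>coord q\<close>,
blocks of \<open>n\<close> letters map the bounded set given by \<open>U'\<close> into the compact subset given by \<open>closure V'\<close>,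
whatever the letters are; this is the situation of the uniform contraction.\<close>

lemma contraction_to_L:
  obtains n \<delta> C \<theta> where "n \<ge> 1" "\<delta> > 0" "C \<ge> 0" "\<theta> > 1"
    "\<And>x w k. infdist x L < \<delta> \<Longrightarrow> w \<in> words m \<Longrightarrow> infdist (orb w (k * n) x) L \<le> C / \<theta> ^ k"
proof -
  obtain U' V' n where UV: "open U'" "open V'" "n \<ge> 1" "L \<subseteq> V'" "closure V' \<subseteq> U'" "closure U' \<subseteq> Fatou GG"
    and into: "\<forall>ws. length ws = n \<and> set ws \<subseteq> {1..m} \<longrightarrow> foldr (\<circ>) (map h ws) id ` closure U' \<subseteq> V'"
    using att unfolding attracting_minimal_set_def Let_def by (elim conjE exE) (rule that)
  have into': "orb w n x \<in> V'" if "w \<in> words m" "x \<in> U'" for w x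
  proof -
    have "orb w n ` closure U' \<subseteq> V'"
      unfolding orb_foldr by (rule into[rule_format]) (use that(1) in \<open>auto simp: words_def\<close>)
    then show ?thesis using that(2) closure_subset[of U'] by blast
  qed
  have "- closure U' \<noteq> {}" using Julia_ne UV(6) unfolding Julia_def by auto
  then obtain q where q: "Fin q \<in> - closure U'" by (rule open_contains_Fin[rotated]) auto
  obtain \<delta>0 where \<delta>0: "\<delta>0 > 0" "ball (Fin q) \<delta>0 \<subseteq> - closure U'"
    by (rule openE[OF _ q]) auto
  have qU: "Fin q \<notin> U'" and qV: "Fin q \<notin> closure V'" "Fin q \<notin> V'"
    using q UV(5) closure_subset[of U'] closure_subset[of V'] by auto
  define S where "S = away q -` U'"
  define K where "K = coord q ` closure V'"
  have So: "open S" unfolding S_def using UV(1) by (rule open_vimage) (rule continuous_on_away)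
  have Sb: "bounded S"
  proof (rule boundedI)
    fix w assume "w \<in> S"
    then have "away q w \<in> closure U'" using closure_subset[of U'] by (auto simp: S_def)
    then have "away q w \<notin> ball (Fin q) \<delta>0" using \<delta>0(2) by auto
    then show "cmod w \<le> 4 / \<delta>0" by (intro norm_coord_le[OF \<delta>0(1), of q]) (auto simp: dist_commute)
  qed
  have Kc: "compact K" unfolding K_def
    by (intro compact_continuous_image continuous_on_coord closed_imp_compact_sphere qV) auto
  have KS: "K \<subseteq> S"
  proof
    fix w assume "w \<in> K"
    then obtain v where v: "v \<in> closure V'" "w = coord q v" by (auto simp: K_def)
    then have "away q w = v" using qV by (metis away_coord)
    then show "w \<in> S" using v UV(5) by (auto simp: S_def)
  qed
  have LV: "coord q ` L \<subseteq> K" using UV(4) closure_subset[of V'] by (auto simp: K_def)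
  have qL: "Fin q \<notin> L" using UV(4) qV by auto
  have Lc: "compact (coord q ` L)"
    by (intro compact_continuous_image continuous_on_coord compact_L qL)
  obtain r where r: "r > 0" "(\<Union>x\<in>coord q ` L. ball x r) \<subseteq> S"
    using compact_subset_open_imp_ball_epsilon_subset[OF Lc So] LV KS by blast
  obtain C \<theta> where C: "C \<ge> 0" "\<theta> > 1" "\<And>f x z k. (\<And>i. f i holomorphic_on S) \<Longrightarrow>
      (\<And>i y. y \<in> S \<Longrightarrow> f i y \<in> K) \<Longrightarrow> ball x r \<subseteq> S \<Longrightarrow> dist x z < r / 2 \<Longrightarrow>
      dist (iter_comp f k x) (iter_comp f k z) \<le> C / \<theta> ^ k"
    by (rule uniform_contraction[OF So Sb Kc KS r(1)]) blast
  define W where "W = {x. x \<noteq> Fin q \<and> coord q x \<in> (\<Union>a\<in>coord q ` L. ball a (r / 2))}"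
  have "W = (- {Fin q}) \<inter> coord q -` (\<Union>a\<in>coord q ` L. ball a (r / 2))" by (auto simp: W_def)
  moreover have "open ((- {Fin q}) \<inter> coord q -` (\<Union>a\<in>coord q ` L. ball a (r / 2)))"
    by (intro continuous_open_preimage continuous_on_coord) auto
  ultimately have Wo: "open W" by simp
  have LW: "L \<subseteq> W"
  proof
    fix a assume a: "a \<in> L"
    then have "coord q a \<in> ball (coord q a) (r / 2)" using r(1) by simp
    then show "a \<in> W" using a qL unfolding W_def by blast
  qed
  obtain \<delta> where \<delta>: "\<delta> > 0" "\<And>x. infdist x L < \<delta> \<Longrightarrow> x \<in> W"
    by (rule compact_infdist_nbhd[OF compact_L L_ne Wo LW]) blast
  define A where "A = 4 * ((cmod q)\<^sup>2 + 1)"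
  have A: "A > 0" by (simp add: A_def add_nonneg_pos)
  show thesis
  proof (rule that[OF UV(3) \<delta>(1), of "A * C" \<theta>])
    show "A * C \<ge> 0" "\<theta> > 1" using A C by auto
    fix x w k assume x: "infdist x L < \<delta>" and w: "w \<in> words m"
    obtain a where a: "a \<in> L" "dist (coord q a) (coord q x) < r / 2" and xq: "x \<noteq> Fin q"
      using \<delta>(2)[OF x] by (auto simp: W_def)
    have aq: "a \<noteq> Fin q" using a qL by auto
    define f where "f i z = coord q (orb (\<lambda>j. w (i * n + j)) n (away q z))" for i z
    have ws: "(\<lambda>j. w (i * n + j)) \<in> words m" for i using w by (rule words_shift)
    have inV: "orb (\<lambda>j. w (i * n + j)) n (away q z) \<in> V'" if "z \<in> S" for i z
      using into'[OF ws] that by (simp add: S_def)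
    have fK: "f i y \<in> K" if "y \<in> S" for i y
      using inV[OF that, of i] closure_subset[of V'] by (auto simp: f_def K_def)
    have fhol: "f i holomorphic_on S" for i
    proof -
      define F where "F = mob 0 1 1 (-q) \<circ> (orb (\<lambda>j. w (i * n + j)) n \<circ> away q)"
      have "(\<lambda>z. chart (Fin 0) (F z)) holomorphic_on S"
      proof (rule mero_at_finite_holomorphic(1)[OF So])
        fix z assume z: "z \<in> S"
        show "mero_at F z" unfolding F_def
          using hmap_mob[of 0 "-q" 1 1] hmap_orb[OF ws] mero_at_away unfolding hmap_def by simp
        have "orb (\<lambda>j. w (i * n + j)) n (away q z) \<noteq> Fin q" using inV[OF z, of i] qV by auto
        then show "F z \<noteq> Infty" unfolding F_def by (simp add: mob_coord)
      qed
      then show ?thesis by (simp add: f_def[abs_def] F_def coord_def[abs_def])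
    qed
    have orbit: "orb w (k * n) y = away q (iter_comp f k (coord q y)) \<and> iter_comp f k (coord q y) \<in> S"
      if y: "coord q y \<in> S" "y \<noteq> Fin q" for y
    proof (induction k)
      case 0 then show ?case using y by simp
    next
      case (Suc k)
      have "orb w (Suc k * n) y = orb (\<lambda>j. w (k * n + j)) n (orb w (k * n) y)"
        using iter_comp_add[of "\<lambda>i. h (w i)" "k * n" n] by (simp add: add.commute)
      also have "\<dots> = orb (\<lambda>j. w (k * n + j)) n (away q (iter_comp f k (coord q y)))"
        using Suc by simp
      also have "\<dots> = away q (f k (iter_comp f k (coord q y)))"
      proof -
        have "orb (\<lambda>j. w (k * n + j)) n (away q (iter_comp f k (coord q y))) \<noteq> Fin q"
          using inV[of "iter_comp f k (coord q y)" k] Suc qV by auto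
        then show ?thesis unfolding f_def by simp
      qed
      finally show ?case using fK[of "iter_comp f k (coord q y)" k] KS Suc by auto
    qed
    have xS': "coord q x \<in> (\<Union>x\<in>coord q ` L. ball x r)" "coord q a \<in> (\<Union>x\<in>coord q ` L. ball x r)"
      using a r(1) by (auto intro!: bexI[of _ a])
    have xS: "coord q x \<in> S" "coord q a \<in> S" using subsetD[OF r(2) xS'(1)] subsetD[OF r(2) xS'(2)] by simp_all
    have "dist (iter_comp f k (coord q a)) (iter_comp f k (coord q x)) \<le> C / \<theta> ^ k"
      by (rule C(3)[OF fhol fK _ a(2)]) (use a(1) r(2) in auto)
    then have "A * cmod (iter_comp f k (coord q x) - iter_comp f k (coord q a)) \<le> A * (C / \<theta> ^ k)"
      using A by (intro mult_left_mono) (auto simp: dist_norm norm_minus_commute)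
    then have "dist (orb w (k * n) x) (orb w (k * n) a) \<le> A * C / \<theta> ^ k"
      using orbit[OF xS(1) xq] orbit[OF xS(2) aq]
        dist_away_le[of q "iter_comp f k (coord q x)" "iter_comp f k (coord q a)"] by (simp add: A_def)
    then show "infdist (orb w (k * n) x) L \<le> A * C / \<theta> ^ k"
      using infdist_le[OF orb_L[OF w a(1)]] order_trans by blast
  qed
qed

text \<open>The contraction controls the times that are multiples of \<open>n\<close>.  By equicontinuity the first \<open>n\<close> points of the
orbit stay in the contracted neighbourhood, and restarting from them covers the other times.\<close>

lemma orbits_near_L_converge:
  obtains \<delta> where "\<delta> > 0" "\<And>x w. infdist x L < \<delta> \<Longrightarrow> w \<in> words m \<Longrightarrow> conv w x"
proof -
  obtain n \<delta> C \<theta> where n: "n \<ge> 1" "\<delta> > 0" "C \<ge> 0" "\<theta> > 1"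
    and contr: "\<And>x w k. infdist x L < \<delta> \<Longrightarrow> w \<in> words m \<Longrightarrow> infdist (orb w (k * n) x) L \<le> C / \<theta> ^ k"
    by (rule contraction_to_L) blast
  obtain \<delta>' where \<delta>': "\<delta>' > 0" "\<And>x g. infdist x L < \<delta>' \<Longrightarrow> g \<in> GG \<Longrightarrow> infdist (g x) L < \<delta>"
    by (rule equicontinuous_near_L[OF n(2)]) blast
  show thesis
  proof (rule that[of "min \<delta> \<delta>'"])
    show "min \<delta> \<delta>' > 0" using n \<delta>' by simp
    fix x w assume x: "infdist x L < min \<delta> \<delta>'" and w: "w \<in> words m"
    have near: "infdist (orb w i x) L < \<delta>" for i
      using x \<delta>'(2)[OF _ orb_GG[OF w]] by (cases "i = 0") auto
    have bound: "infdist (orb w j x) L \<le> C / \<theta> ^ (j div n)" for j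
    proof -
      have "orb w j x = orb (\<lambda>i. w (j mod n + i)) (j div n * n) (orb w (j mod n) x)"
        using iter_comp_add[of "\<lambda>i. h (w i)" "j mod n" "j div n * n"] by simp
      then show ?thesis using contr[OF near words_shift[OF w]] by simp
    qed
    have "filterlim (\<lambda>j. j div n) at_top sequentially"
      using n(1) by (intro filterlim_at_top_div_const_nat) auto
    then have "(\<lambda>j. (1 / \<theta>) ^ (j div n)) \<longlonglongrightarrow> 0"
      using n(4) by (intro filterlim_compose[OF LIMSEQ_power_zero]) auto
    then have "(\<lambda>j. C * (1 / \<theta>) ^ (j div n)) \<longlonglongrightarrow> 0" by (rule tendsto_mult_right_zero)
    then show "conv w x" unfolding conv_def
      by (rule tendsto_sandwich[OF _ _ tendsto_const, rotated 2])
        (use bound infdist_nonneg in \<open>auto simp: power_one_over divide_inverse power_inverse intro!: always_eventually\<close>)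
  qed
qed

lemma conv_shift: "conv w x \<longleftrightarrow> conv (\<lambda>i. w (k + i)) (orb w k x)"
proof -
  have "(\<lambda>n. infdist (orb (\<lambda>i. w (k + i)) n (orb w k x)) L) = (\<lambda>n. infdist (orb w (n + k) x) L)"
    using iter_comp_add[of "\<lambda>i. h (w i)" k] by (simp add: add.commute fun_eq_iff)
  then show ?thesis unfolding conv_def
    using LIMSEQ_offset[of "\<lambda>n. infdist (orb w n x) L" k 0]
      LIMSEQ_ignore_initial_segment[of "\<lambda>n. infdist (orb w n x) L" 0 k] by auto
qed

text \<open>If a word drives one point to \<open>L\<close>, an orbit that stays close enough to the first eventually enters the
neighbourhood of \<open>L\<close> from which every orbit converges.  Equicontinuity keeps the orbits close uniformly in
the word.\<close>

lemma conv_locally_constant: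
  assumes eq: "equicontinuous_at ((\<lambda>g. g \<circ> f) ` GG) x"
  shows "\<exists>\<eta>>0. \<forall>y. dist y x < \<eta> \<longrightarrow> (\<forall>w\<in>words m. conv w (f y) \<longleftrightarrow> conv w (f x))"
proof -
  obtain \<delta> where \<delta>: "\<delta> > 0" "\<And>x w. infdist x L < \<delta> \<Longrightarrow> w \<in> words m \<Longrightarrow> conv w x"
    by (rule orbits_near_L_converge) blast
  obtain \<eta> where \<eta>: "\<eta> > 0" "\<And>g y. g \<in> GG \<Longrightarrow> dist y x < \<eta> \<Longrightarrow> dist (g (f y)) (g (f x)) < \<delta> / 2"
  proof -
    have "\<delta> / 2 > 0" using \<delta>(1) by simp
    then obtain \<eta> where "\<eta> > 0" "\<forall>f'\<in>(\<lambda>g. g \<circ> f) ` GG. \<forall>y. dist y x < \<eta> \<longrightarrow> dist (f' y) (f' x) < \<delta> / 2"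
      using eq unfolding equicontinuous_at_def by (elim allE impE exE conjE)
    then show thesis by (intro that[of \<eta>]) auto
  qed
  have one: "conv w b" if "conv w a" "w \<in> words m" and close: "\<And>g. g \<in> GG \<Longrightarrow> dist (g a) (g b) < \<delta> / 2" for a b w
  proof -
    have "eventually (\<lambda>n. infdist (orb w n a) L < \<delta> / 2) sequentially"
      using that(1) \<delta>(1) unfolding conv_def by (intro order_tendstoD) auto
    then obtain N where N: "\<And>n. n \<ge> N \<Longrightarrow> infdist (orb w n a) L < \<delta> / 2"
      unfolding eventually_sequentially by blast
    define k where "k = max N 1"
    have "infdist (orb w k b) L \<le> infdist (orb w k a) L + dist (orb w k b) (orb w k a)"
      by (rule infdist_triangle)
    also have "\<dots> < \<delta> / 2 + \<delta> / 2"
      using N[of k] close[OF orb_GG[OF that(2), of k]] by (intro add_strict_mono) (auto simp: k_def dist_commute)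
    finally have "infdist (orb w k b) L < \<delta>" by simp
    then have "conv (\<lambda>i. w (k + i)) (orb w k b)" using \<delta>(2) words_shift[OF that(2)] by blast
    then show ?thesis using conv_shift by blast
  qed
  have "conv w (f y) \<longleftrightarrow> conv w (f x)" if y: "dist y x < \<eta>" and w: "w \<in> words m" for y w
  proof -
    have c: "dist (g (f y)) (g (f x)) < \<delta> / 2" "dist (g (f x)) (g (f y)) < \<delta> / 2" if "g \<in> GG" for g
      using \<eta>(2)[OF that y] by (simp_all add: dist_commute)
    show ?thesis
    proof
      assume "conv w (f y)"
      from this w c(1) show "conv w (f x)" by (rule one)
    next
      assume "conv w (f x)"
      from this w c(2) show "conv w (f y)" by (rule one)
    qed
  qed
  then have "\<forall>y. dist y x < \<eta> \<longrightarrow> (\<forall>w\<in>words m. conv w (f y) \<longleftrightarrow> conv w (f x))"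
    by (intro allI impI ballI)
  with \<eta>(1) show ?thesis by (intro exI conjI)
qed

end

section \<open>The probability of tending to the attracting set\<close>

instance riemann_sphere :: second_countable_topology
proof
  obtain D :: "complex set" where D: "countable D" "\<And>X. open X \<Longrightarrow> X \<noteq> {} \<Longrightarrow> \<exists>d\<in>D. d \<in> X"
    using countable_dense_exists by blast
  define B where "B = (\<lambda>(d, n). ball (Fin d) (1 / Suc n)) ` (D \<times> (UNIV :: nat set))"
  have "countable B" unfolding B_def using D(1) by (intro countable_image countable_SIGMA) auto
  moreover have "topological_basis B"
  proof (rule topological_basisI)
    show "open B'" if "B' \<in> B" for B' using that by (auto simp: B_def)
    fix S :: "riemann_sphere set" and x assume S: "open S" "x \<in> S"
    obtain e where e: "e > 0" "ball x e \<subseteq> S" using S by (rule openE)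
    obtain n where n: "1 / Suc n < e / 2"
      using e(1) by (metis half_gt_zero inverse_eq_divide reals_Archimedean)
    obtain q where q: "Fin q \<in> ball x (1 / Suc n)"
      by (rule open_contains_Fin[of "ball x (1 / Suc n)"]) auto
    have "open (Fin -` ball x (1 / Suc n))"
      by (rule open_vimage) (auto intro!: continuous_on_Fin continuous_on_id)
    moreover have "Fin -` ball x (1 / Suc n) \<noteq> {}" using q by auto
    ultimately obtain d where d: "d \<in> D" "Fin d \<in> ball x (1 / Suc n)" using D(2) by (metis vimageD)
    have "ball (Fin d) (1 / Suc n) \<subseteq> ball x e"
    proof
      fix y assume "y \<in> ball (Fin d) (1 / Suc n)"
      then show "y \<in> ball x e" using d(2) n dist_triangle[of x y "Fin d"] by simp
    qed
    moreover have "ball (Fin d) (1 / Suc n) \<in> B" using d(1) by (force simp: B_def)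
    moreover have "x \<in> ball (Fin d) (1 / Suc n)" using d(2) by (simp add: dist_commute)
    ultimately show "\<exists>B'\<in>B. x \<in> B' \<and> B' \<subseteq> S" using e(2) by blast
  qed
  ultimately show "\<exists>B :: riemann_sphere set set. countable B \<and> open = generate_topology B"
    using topological_basis_imp_subbasis by blast
qed

lemma dist_sphere_le_pi: "dist (x :: riemann_sphere) y \<le> pi"
  using Cauchy_Schwarz_ineq2[of "stereo x" "stereo y"]
  unfolding dist_riemann_sphere_def by (intro arccos_ubound) (simp_all add: abs_le_iff)

lemma dist_le_kappa: "dist (f z) (g z) \<le> kappa f g"
  unfolding kappa_def by (rule cSUP_upper) (auto intro!: bdd_aboveI[of _ pi] dist_sphere_le_pi)

lemma Metric_space_Rat: "Metric_space Rat kappa"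
proof
  fix f g k :: "riemann_sphere \<Rightarrow> riemann_sphere"
  show "0 \<le> kappa f g" using dist_le_kappa[of f undefined g] zero_le_dist order_trans by blast
  show "kappa f g = kappa g f" unfolding kappa_def by (simp add: dist_commute)
  show "kappa f g = 0 \<longleftrightarrow> f = g"
  proof
    assume "kappa f g = 0"
    then have "dist (f z) (g z) \<le> 0" for z using dist_le_kappa[of f z g] by simp
    then show "f = g" by (auto simp: fun_eq_iff)
  qed (simp add: kappa_def)
  show "kappa f k \<le> kappa f g + kappa g k"
    unfolding kappa_def[of f k]
  proof (rule cSUP_least)
    fix z show "dist (f z) (k z) \<le> kappa f g + kappa g k"
      using dist_triangle[of "f z" "k z" "g z"] dist_le_kappa[of f z g] dist_le_kappa[of g z k] by linarith
  qed simp
qed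

lemma space_borel_Rat [simp]: "space borel_Rat = Rat"
  and openin_sets_borel_Rat: "openin (Metric_space.mtopology Rat kappa) A \<Longrightarrow> A \<in> sets borel_Rat"
proof -
  have "{A. openin (Metric_space.mtopology Rat kappa) A} \<subseteq> Pow Rat"
    using openin_subset Metric_space.topspace_mtopology[OF Metric_space_Rat] by blast
  then show "space borel_Rat = Rat"
    and "openin (Metric_space.mtopology Rat kappa) A \<Longrightarrow> A \<in> sets borel_Rat"
    unfolding borel_Rat_def by (auto simp: sets_measure_of)
qed

lemma measurable_eval_Rat: "(\<lambda>f. f z) \<in> borel_measurable borel_Rat"
proof (rule borel_measurableI)
  fix S :: "riemann_sphere set" assume S: "open S"
  have "\<exists>r>0. Metric_space.mball Rat kappa f r \<subseteq> (\<lambda>f. f z) -` S \<inter> Rat" if f: "f \<in> (\<lambda>f. f z) -` S \<inter> Rat" for f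
  proof -
    obtain e where e: "e > 0" "ball (f z) e \<subseteq> S" using S f openE by auto
    have "Metric_space.mball Rat kappa f e \<subseteq> (\<lambda>f. f z) -` S \<inter> Rat"
    proof
      fix g assume "g \<in> Metric_space.mball Rat kappa f e"
      then have g: "g \<in> Rat" "kappa f g < e" by (simp_all add: Metric_space.in_mball[OF Metric_space_Rat])
      then have "g z \<in> ball (f z) e" using dist_le_kappa[of f z g] by simp
      then show "g \<in> (\<lambda>f. f z) -` S \<inter> Rat" using e(2) g by auto
    qed
    then show ?thesis using e(1) by blast
  qed
  then show "(\<lambda>f. f z) -` S \<inter> space borel_Rat \<in> sets borel_Rat"
    by (intro openin_sets_borel_Rat) (auto simp: Metric_space.openin_mtopology[OF Metric_space_Rat])
qed

text \<open>Evaluation is measurable in the map and continuous in the point; approximating the point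
  by a countable dense set shows that it is jointly measurable.\<close>

lemma measurable_eval_Rat2:
  assumes F: "F \<in> N \<rightarrow>\<^sub>M borel_Rat" and X: "X \<in> borel_measurable N"
  shows "(\<lambda>x. F x (X x)) \<in> borel_measurable N"
proof -
  obtain D :: "riemann_sphere set" where D: "countable D" "\<And>X. open X \<Longrightarrow> X \<noteq> {} \<Longrightarrow> \<exists>d\<in>D. d \<in> X"
    using countable_dense_exists by blast
  have "D \<noteq> {}" using D(2)[of UNIV] by auto
  define d where "d = from_nat_into D"
  have d: "\<exists>i. dist y (d i) < 1 / Suc k" for y k
  proof -
    obtain a where "a \<in> D" "a \<in> ball y (1 / Suc k)" using D(2)[of "ball y (1 / Suc k)"] by auto
    then show ?thesis unfolding d_def using from_nat_into_surj[OF D(1)] by fastforce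
  qed
  define idx where "idx k y = (LEAST i. dist y (d i) < 1 / Suc k)" for k y
  have near: "dist y (d (idx k y)) < 1 / Suc k" for k y
    unfolding idx_def using d[of y k] by (rule LeastI_ex)
  have [measurable]: "(\<lambda>x. dist (X x) (d i)) \<in> borel_measurable N" for i
    using X by (rule borel_measurable_continuous_on[rotated]) (intro continuous_intros)
  have idx: "(\<lambda>x. idx k (X x)) \<in> N \<rightarrow>\<^sub>M count_space UNIV" for k
    unfolding idx_def by measurable
  have Fd: "(\<lambda>x. F x (d i)) \<in> borel_measurable N" for i
    using measurable_compose[OF F measurable_eval_Rat] .
  have approx: "(\<lambda>x. F x (d (idx k (X x)))) \<in> borel_measurable N" for k
    by (rule measurable_compose_countable'[OF Fd idx]) auto
  show ?thesis
  proof (rule borel_measurable_LIMSEQ_metric[OF approx])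
    fix x assume x: "x \<in> space N"
    have "(\<lambda>k. d (idx k (X x))) \<longlonglongrightarrow> X x"
    proof (rule tendsto_dist_iff[THEN iffD2], rule tendsto_sandwich[OF _ _ tendsto_const])
      show "(\<lambda>k. 1 / real (Suc k)) \<longlonglongrightarrow> 0" using LIMSEQ_inverse_real_of_nat by (simp add: inverse_eq_divide)
      show "\<forall>\<^sub>F k in sequentially. dist (d (idx k (X x))) (X x) \<le> 1 / real (Suc k)"
        using near[of "X x"] by (intro always_eventually allI) (simp add: dist_commute less_imp_le)
    qed simp
    moreover have "F x \<in> Rat" using measurable_space[OF F x] by simp
    then have "isCont (F x) (X x)" by (intro hmap_isCont Rat_imp_hmap)
    ultimately show "(\<lambda>k. F x (d (idx k (X x)))) \<longlonglongrightarrow> F x (X x)"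
      by (rule isCont_tendsto_compose[rotated])
  qed
qed

text \<open>Convergence expressed by countably many conditions, for measurability.\<close>

lemma infdist_conv_iff:
  "(\<lambda>n. infdist (X n) A) \<longlonglongrightarrow> 0 \<longleftrightarrow> (\<forall>k. \<exists>N. \<forall>n\<ge>N. infdist (X n) A < 1 / Suc k)"
proof
  assume lim: "(\<lambda>n. infdist (X n) A) \<longlonglongrightarrow> 0"
  show "\<forall>k. \<exists>N. \<forall>n\<ge>N. infdist (X n) A < 1 / Suc k"
  proof
    fix k
    have "eventually (\<lambda>n. infdist (X n) A < 1 / Suc k) sequentially"
      using lim by (rule order_tendstoD) simp
    then show "\<exists>N. \<forall>n\<ge>N. infdist (X n) A < 1 / Suc k" by (simp add: eventually_sequentially)
  qed
next
  assume *: "\<forall>k. \<exists>N. \<forall>n\<ge>N. infdist (X n) A < 1 / Suc k"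
  show "(\<lambda>n. infdist (X n) A) \<longlonglongrightarrow> 0"
  proof (rule LIMSEQ_I)
    fix e :: real assume "e > 0"
    then obtain k where k: "1 / Suc k < e" using reals_Archimedean by (metis inverse_eq_divide)
    obtain N where "\<forall>n\<ge>N. infdist (X n) A < 1 / Suc k" using * by blast
    then have "\<forall>n\<ge>N. infdist (X n) A < e" using k by (metis less_trans)
    then show "\<exists>N. \<forall>n\<ge>N. norm (infdist (X n) A - 0) < e"
      by (intro exI[of _ N]) (simp add: infdist_nonneg)
  qed
qed

lemma iter_comp_case_nat: "iter_comp (case_nat f \<gamma>) (Suc n) z = iter_comp \<gamma> n (f z)"
  using iter_comp_add[of "case_nat f \<gamma>" 1 n] by simp

locale random_system = attracting_system +
  fixes p :: "nat \<Rightarrow> real"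
  assumes p_bounds: "\<And>j. j \<in> {1..m} \<Longrightarrow> 0 < p j \<and> p j < 1" and p_sum: "(\<Sum>j\<in>{1..m}. p j) = 1"
begin

definition letters :: "nat pmf" where
  "letters = embed_pmf (\<lambda>j. if j \<in> {1..m} then p j else 0)"

lemma pmf_letters: "pmf letters j = (if j \<in> {1..m} then p j else 0)"
  unfolding letters_def
proof (rule pmf_embed_pmf)
  show "0 \<le> (if x \<in> {1..m} then p x else 0)" for x using p_bounds[of x] by auto
  have "(\<integral>\<^sup>+ x. ennreal (if x \<in> {1..m} then p x else 0) \<partial>count_space UNIV)
      = (\<Sum>x\<in>{1..m}. ennreal (if x \<in> {1..m} then p x else 0))"
    by (rule nn_integral_count_space') auto
  also have "\<dots> = ennreal (\<Sum>x\<in>{1..m}. if x \<in> {1..m} then p x else 0)"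
    by (rule sum_ennreal) (use p_bounds in \<open>auto intro: less_imp_le\<close>)
  also have "(\<Sum>x\<in>{1..m}. if x \<in> {1..m} then p x else 0) = (\<Sum>x\<in>{1..m}. p x)"
    by (rule sum.cong) auto
  finally show "(\<integral>\<^sup>+ x. ennreal (if x \<in> {1..m} then p x else 0) \<partial>count_space UNIV) = 1"
    using p_sum by simp
qed

lemma set_letters: "set_pmf letters = {1..m}"
proof (rule set_eqI)
  show "j \<in> set_pmf letters \<longleftrightarrow> j \<in> {1..m}" for j
    using p_bounds[of j] by (auto simp: set_pmf_iff pmf_letters)
qed

text \<open>The value \<open>h 1\<close> outside \<open>{1..m}\<close>, a set of probability \<open>0\<close>, makes the map take values in \<^const>\<open>Rat\<close> everywhere.\<close>

definition map_of_letter :: "nat \<Rightarrow> riemann_sphere \<Rightarrow> riemann_sphere" where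
  "map_of_letter j = (if j \<in> {1..m} then h j else h 1)"

lemma map_of_letter_Rat: "map_of_letter j \<in> Rat"
  using h_Rat[of j] h_Rat[of 1] m by (simp add: map_of_letter_def)

lemma map_of_letter_measurable [measurable]: "map_of_letter \<in> measure_pmf letters \<rightarrow>\<^sub>M borel_Rat"
  using map_of_letter_Rat by simp

definition step :: "(riemann_sphere \<Rightarrow> riemann_sphere) measure" where
  "step = tau_measure m h p"

text \<open>The law of a single step is the image of a law on letters; this reduces integrals over maps to finite sums.\<close>

lemma step_eq: "step = distr (measure_pmf letters) borel_Rat map_of_letter"
proof -
  define N where "N = distr (measure_pmf letters) borel_Rat map_of_letter"
  have em: "emeasure N A = (\<Sum>j\<in>{1..m}. ennreal (p j) * emeasure (return borel_Rat (h j)) A)"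
    if A: "A \<in> sets borel_Rat" for A
  proof -
    have "emeasure N A = emeasure (measure_pmf letters) (map_of_letter -` A)"
      unfolding N_def by (subst emeasure_distr[OF map_of_letter_measurable A]) simp
    also have "\<dots> = (\<integral>\<^sup>+j. indicator (map_of_letter -` A) j \<partial>measure_pmf letters)" by simp
    also have "\<dots> = (\<Sum>j\<in>{1..m}. indicator (map_of_letter -` A) j * ennreal (pmf letters j))"
      by (subst nn_integral_measure_pmf_finite) (auto simp: set_letters)
    also have "\<dots> = (\<Sum>j\<in>{1..m}. ennreal (p j) * emeasure (return borel_Rat (h j)) A)"
      using A by (intro sum.cong) (auto simp: pmf_letters map_of_letter_def indicator_def emeasure_return)
    finally show ?thesis .
  qed
  have "step = measure_of (space N) (sets N) (emeasure N)"
    unfolding step_def tau_measure_def N_def[symmetric]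
  proof -
    have 1: "space N = space borel_Rat" "sets N = sets borel_Rat" by (simp_all add: N_def)
    show "measure_of (space borel_Rat) (sets borel_Rat)
        (\<lambda>A. \<Sum>j\<in>{1..m}. ennreal (p j) * emeasure (return borel_Rat (h j)) A) = measure_of (space N) (sets N) (emeasure N)"
      unfolding 1
      by (rule measure_of_eq) (use em sets.space_closed[of borel_Rat] sets.sigma_sets_eq[of borel_Rat] in auto)
  qed
  also have "\<dots> = N" by (rule measure_of_of_measure)
  finally show ?thesis by (simp add: N_def)
qed

lemma sets_step [measurable_cong, simp]: "sets step = sets borel_Rat" by (simp add: step_eq)
lemma space_step [simp]: "space step = Rat" by (simp add: step_eq)

lemma prob_step: "prob_space step"
  unfolding step_eq
  by (rule prob_space.prob_space_distr[OF measure_pmf.prob_space_axioms map_of_letter_measurable])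

lemma AE_step: "AE f in step. f \<in> h ` {1..m}"
proof -
  have ae: "AE j in measure_pmf letters. map_of_letter j \<in> h ` {1..m}"
    by (rule AE_pmfI) (auto simp: map_of_letter_def set_letters)
  have "finite (h ` {1..m})" by simp
  moreover have "h ` {1..m} \<subseteq> Rat" using h_Rat by auto
  ultimately have "h ` {1..m} \<in> sets borel_Rat"
  proof -
    have "closedin (Metric_space.mtopology Rat kappa) (h ` {1..m})"
      using Hausdorff_imp_t1_space[OF Metric_space.Hausdorff_space_mtopology[OF Metric_space_Rat]]
        \<open>finite (h ` {1..m})\<close> \<open>h ` {1..m} \<subseteq> Rat\<close>
      by (simp add: t1_space_closedin_finite Metric_space.topspace_mtopology[OF Metric_space_Rat])
    then have "Rat - (Rat - h ` {1..m}) \<in> sets borel_Rat"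
      using sets.compl_sets[of "Rat - h ` {1..m}" borel_Rat]
        openin_sets_borel_Rat[of "Rat - h ` {1..m}"] Metric_space.topspace_mtopology[OF Metric_space_Rat]
      by (auto simp: closedin_def)
    moreover have "Rat - (Rat - h ` {1..m}) = h ` {1..m}" using \<open>h ` {1..m} \<subseteq> Rat\<close> by auto
    ultimately show ?thesis by simp
  qed
  then show ?thesis unfolding step_eq
    using ae
  proof (subst AE_distr_iff[OF map_of_letter_measurable])
    have "{f \<in> space borel_Rat. f \<in> h ` {1..m}} = h ` {1..m}" using h_Rat by auto
    then show "{f \<in> space borel_Rat. f \<in> h ` {1..m}} \<in> sets borel_Rat"
      using \<open>h ` {1..m} \<in> sets borel_Rat\<close> by simp
  qed
qed

lemma nn_integral_step:
  assumes "u \<in> borel_measurable borel_Rat"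
  shows "(\<integral>\<^sup>+f. u f \<partial>step) = (\<Sum>j\<in>{1..m}. u (h j) * ennreal (p j))"
proof -
  have "(\<integral>\<^sup>+f. u f \<partial>step) = (\<integral>\<^sup>+j. u (map_of_letter j) \<partial>measure_pmf letters)"
    unfolding step_eq by (rule nn_integral_distr[OF map_of_letter_measurable]) (use assms in simp)
  also have "\<dots> = (\<Sum>j\<in>{1..m}. u (map_of_letter j) * ennreal (pmf letters j))"
    by (subst nn_integral_measure_pmf_finite) (simp_all only: set_letters finite_atLeastAtMost zero_le)
  also have "\<dots> = (\<Sum>j\<in>{1..m}. u (h j) * ennreal (p j))"
    by (rule sum.cong) (simp_all add: map_of_letter_def pmf_letters)
  finally show ?thesis .
qed

lemma integral_step:
  fixes u :: "(riemann_sphere \<Rightarrow> riemann_sphere) \<Rightarrow> real"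
  assumes "u \<in> borel_measurable borel_Rat"
  shows "(\<integral>f. u f \<partial>step) = (\<Sum>j\<in>{1..m}. p j * u (h j))"
proof -
  have "(\<integral>f. u f \<partial>step) = (\<integral>j. u (map_of_letter j) \<partial>measure_pmf letters)"
    unfolding step_eq by (rule integral_distr[OF map_of_letter_measurable]) (use assms in simp)
  also have "\<dots> = (\<Sum>j\<in>{1..m}. pmf letters j *\<^sub>R u (map_of_letter j))"
    by (rule integral_measure_pmf) (simp_all add: set_letters)
  also have "\<dots> = (\<Sum>j\<in>{1..m}. p j * u (h j))"
    by (rule sum.cong) (simp_all add: map_of_letter_def pmf_letters)
  finally show ?thesis .
qed

definition paths :: "(nat \<Rightarrow> riemann_sphere \<Rightarrow> riemann_sphere) measure" where
  "paths = PiM (UNIV :: nat set) (\<lambda>_. step)"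

lemma space_paths: "\<gamma> \<in> space paths \<longleftrightarrow> (\<forall>n. \<gamma> n \<in> Rat)"
  by (simp add: paths_def space_PiM PiE_iff)

lemma prob_paths: "prob_space paths"
  unfolding paths_def by (intro prob_space_PiM prob_step)

lemma measurable_path_component: "(\<lambda>\<gamma>. \<gamma> n) \<in> paths \<rightarrow>\<^sub>M borel_Rat"
proof -
  have "(\<lambda>\<gamma>. \<gamma> n) \<in> paths \<rightarrow>\<^sub>M step"
    unfolding paths_def by (rule measurable_component_singleton) simp
  then show ?thesis by (simp only: measurable_cong_sets[OF refl sets_step, of paths])
qed

lemma measurable_iter: "(\<lambda>\<gamma>. iter_comp \<gamma> n z) \<in> borel_measurable paths"
proof (induction n)
  case (Suc n)
  from measurable_eval_Rat2[OF measurable_path_component this] show ?case by simp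
qed simp

definition tends :: "riemann_sphere \<Rightarrow> (nat \<Rightarrow> riemann_sphere \<Rightarrow> riemann_sphere) set" where
  "tends z = {\<gamma> \<in> space paths. (\<lambda>n. infdist (iter_comp \<gamma> n z) L) \<longlonglongrightarrow> 0}"

lemma sets_tends: "tends z \<in> sets paths"
proof -
  have [measurable]: "(\<lambda>\<gamma>. infdist (iter_comp \<gamma> n z) L) \<in> borel_measurable paths" for n
    using measurable_iter by (rule borel_measurable_continuous_on[rotated]) (intro continuous_intros)
  have "{\<gamma> \<in> space paths. infdist (iter_comp \<gamma> n z) L < c} \<in> sets paths" for n c
    by measurable
  then show ?thesis unfolding tends_def infdist_conv_iff
    by (intro sets.sets_Collect_countable_All sets.sets_Collect_countable_Ex sets.sets_Collect_imp
        sets.sets_Collect_const)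
qed

abbreviation "T \<equiv> T_prob L step"

lemma T_eq: "T z = measure paths (tends z)"
  by (simp add: T_prob_def Let_def tends_def paths_def)

lemma T_bounds: "0 \<le> T z" "T z \<le> 1"
  unfolding T_eq using prob_space.prob_le_1[OF prob_paths] by auto

lemma AE_paths: "AE \<gamma> in paths. \<exists>w\<in>words m. \<gamma> = (\<lambda>i. h (w i))"
proof -
  have "AE \<gamma> in paths. \<gamma> n \<in> h ` {1..m}" for n
    unfolding paths_def
  proof (rule AE_PiM_component[where M = "\<lambda>_. step" and i = n and I = UNIV and P = "\<lambda>f. f \<in> h ` {1..m}"])
    show "prob_space step" by (rule prob_step)
    show "AE f in step. f \<in> h ` {1..m}" by (rule AE_step)
  qed simp
  then have "AE \<gamma> in paths. \<forall>n. \<gamma> n \<in> h ` {1..m}" by (simp add: AE_all_countable)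
  then show ?thesis
  proof eventually_elim
    case (elim \<gamma>)
    then have "\<forall>n. \<exists>j. j \<in> {1..m} \<and> \<gamma> n = h j" by blast
    then obtain w where "\<forall>n. w n \<in> {1..m} \<and> \<gamma> n = h (w n)" by metis
    then show ?case by (intro bexI[of _ w]) (auto simp: words_def)
  qed
qed

lemma T_cong:
  assumes "\<And>w. w \<in> words m \<Longrightarrow> conv w x \<longleftrightarrow> conv w y"
  shows "T x = T y"
  unfolding T_eq
proof (rule measure_eq_AE)
  show "AE \<gamma> in paths. \<gamma> \<in> tends x \<longleftrightarrow> \<gamma> \<in> tends y"
    using AE_paths
  proof eventually_elim
    case (elim \<gamma>)
    then obtain w where w: "w \<in> words m" "\<gamma> = (\<lambda>i. h (w i))" by (elim bexE)
    from assms[OF w(1)] show ?case unfolding tends_def conv_def w(2) by simp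
  qed
qed (rule sets_tends)+

lemma T_locally_constant:
  assumes "equicontinuous_at ((\<lambda>g. g \<circ> f) ` GG) x"
  shows "\<exists>\<eta>>0. \<forall>y. dist y x < \<eta> \<longrightarrow> T (f y) = T (f x)"
proof -
  obtain \<eta> where "\<eta> > 0" and \<eta>: "\<forall>y. dist y x < \<eta> \<longrightarrow> (\<forall>w\<in>words m. conv w (f y) \<longleftrightarrow> conv w (f x))"
    using conv_locally_constant[OF assms] by (elim exE conjE)
  have "T (f y) = T (f x)" if "dist y x < \<eta>" for y
    by (rule T_cong) (use \<eta> that in simp)
  then have "\<forall>y. dist y x < \<eta> \<longrightarrow> T (f y) = T (f x)" by (intro allI impI)
  with \<open>\<eta> > 0\<close> show ?thesis by (intro exI conjI)
qed

text \<open>The first map of a path is independent of the remaining ones, which again have the law of a path.\<close>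

lemma T_functional_equation: "T z = (\<Sum>j\<in>{1..m}. p j * T (h j z))"
proof -
  have nn: "0 \<le> p j * T (h j z)" if "j \<in> {1..m}" for j
    using p_bounds[OF that] T_bounds(1) by (intro mult_nonneg_nonneg) auto
  interpret step: prob_space step by (rule prob_step)
  interpret P: prob_space paths by (rule prob_paths)
  interpret S: sequence_space step by unfold_locales
  have iter: "distr (step \<Otimes>\<^sub>M paths) paths (\<lambda>(f, \<gamma>). case_nat f \<gamma>) = paths"
    using S.PiM_iter unfolding paths_def .
  have meas: "(\<lambda>(f, \<gamma>). case_nat f \<gamma>) \<in> step \<Otimes>\<^sub>M paths \<rightarrow>\<^sub>M paths"
    unfolding paths_def by measurable
  define A where "A = (\<lambda>(f, \<gamma>). case_nat f \<gamma>) -` tends z \<inter> space (step \<Otimes>\<^sub>M paths)"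
  have A: "A \<in> sets (step \<Otimes>\<^sub>M paths)" unfolding A_def using meas sets_tends by (rule measurable_sets)
  have slice: "Pair f -` A = tends (f z)" if f: "f \<in> Rat" for f
  proof -
    have iff: "case_nat f \<gamma> \<in> tends z \<and> \<gamma> \<in> space paths \<longleftrightarrow> \<gamma> \<in> tends (f z)" for \<gamma>
    proof -
      have lim: "(\<lambda>n. infdist (iter_comp (case_nat f \<gamma>) n z) L) \<longlonglongrightarrow> 0 \<longleftrightarrow>
          (\<lambda>n. infdist (iter_comp \<gamma> n (f z)) L) \<longlonglongrightarrow> 0"
        using filterlim_sequentially_Suc[of "\<lambda>n. infdist (iter_comp (case_nat f \<gamma>) n z) L" "nhds 0"]
        by (simp only: iter_comp_case_nat)
      have "case_nat f \<gamma> \<in> space paths" if "\<gamma> \<in> space paths"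
        using that f by (simp add: space_paths split: nat.split)
      then show ?thesis unfolding tends_def mem_Collect_eq lim by - (rule iffI, simp_all)
    qed
    show ?thesis
    proof (rule set_eqI)
      show "\<gamma> \<in> Pair f -` A \<longleftrightarrow> \<gamma> \<in> tends (f z)" for \<gamma>
      proof -
        have "\<gamma> \<in> Pair f -` A \<longleftrightarrow> (f, \<gamma>) \<in> A" by (rule vimage_eq)
        also have "\<dots> \<longleftrightarrow> case_nat f \<gamma> \<in> tends z \<and> \<gamma> \<in> space paths"
          unfolding A_def Int_iff vimage_eq prod.case space_pair_measure mem_Times_iff using f by simp
        finally show ?thesis using iff[of \<gamma>] by simp
      qed
    qed
  qed
  have "ennreal (T z) = emeasure paths (tends z)" by (simp add: T_eq P.emeasure_eq_measure)
  also have "\<dots> = emeasure (distr (step \<Otimes>\<^sub>M paths) paths (\<lambda>(f, \<gamma>). case_nat f \<gamma>)) (tends z)"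
    by (simp only: iter)
  also have "\<dots> = emeasure (step \<Otimes>\<^sub>M paths) A"
    unfolding A_def by (rule emeasure_distr[OF meas sets_tends])
  also have "\<dots> = (\<integral>\<^sup>+f. emeasure paths (Pair f -` A) \<partial>step)"
    using A by (rule P.emeasure_pair_measure_alt)
  also have "\<dots> = (\<Sum>j\<in>{1..m}. emeasure paths (Pair (h j) -` A) * ennreal (p j))"
  proof (rule nn_integral_step)
    have "(\<lambda>f. emeasure paths (Pair f -` A)) \<in> borel_measurable step" using A by (rule P.measurable_emeasure_Pair)
    then show "(\<lambda>f. emeasure paths (Pair f -` A)) \<in> borel_measurable borel_Rat"
      by (simp only: measurable_cong_sets[OF sets_step refl, of borel])
  qed
  also have "\<dots> = (\<Sum>j\<in>{1..m}. ennreal (p j * T (h j z)))"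
  proof (rule sum.cong[OF refl])
    fix j assume j: "j \<in> {1..m}"
    have "emeasure paths (Pair (h j) -` A) = ennreal (T (h j z))"
      using slice[OF h_Rat[OF j]] by (simp add: T_eq P.emeasure_eq_measure)
    then show "emeasure paths (Pair (h j) -` A) * ennreal (p j) = ennreal (p j * T (h j z))"
      using p_bounds[OF j] T_bounds by (simp add: ennreal_mult' mult.commute)
  qed
  also have "\<dots> = ennreal (\<Sum>j\<in>{1..m}. p j * T (h j z))"
    by (rule sum_ennreal[OF nn])
  finally show ?thesis by (simp only: ennreal_inj[OF T_bounds(1) sum_nonneg[OF nn]])
qed

end

section \<open>Rational maps are open with finite fibres\<close>

lemma Rat_finite_fibre:
  assumes "f \<in> Rat"
  shows "finite {z. f (Fin z) = y}"
proof -
  obtain P Q where f: "f = rat_map P Q" and PQ: "coprime P Q" "max (degree P) (degree Q) \<ge> 1"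
    using assms unfolding Rat_def by blast
  obtain u v where uv: "u \<noteq> 0 \<or> v \<noteq> 0" "y = of_ratio u v" by (rule of_ratio_cases)
  define R where "R = smult v P - smult u Q"
  have "R \<noteq> 0"
  proof
    assume "R = 0"
    then have eq: "smult v P = smult u Q" by (simp add: R_def)
    have unit: "degree A = 0" if "A dvd P" "A dvd Q" for A
    proof -
      have "is_unit A" using PQ(1) that coprime_common_divisor by blast
      then show ?thesis by (rule is_unit_polyE) simp
    qed
    show False
    proof (cases "v = 0")
      case True
      then have "Q = 0" using eq uv(1) by simp
      then show False using unit[of P] PQ(2) by simp
    next
      case False
      then have "smult (1 / v) (smult v P) = P" by simp
      then have P: "P = smult (u / v) Q" by (simp add: eq)
      then have "Q dvd P" by (metis dvd_refl dvd_smult)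
      then have "degree Q = 0" using unit[of Q] by simp
      moreover have "degree P \<le> degree Q" using P degree_smult_le by metis
      ultimately show False using PQ(2) by simp
    qed
  qed
  moreover have "{z. f (Fin z) = y} \<subseteq> {z. poly R z = 0}"
  proof
    fix z assume "z \<in> {z. f (Fin z) = y}"
    then have "of_ratio (poly P z) (poly Q z) = of_ratio u v" by (simp add: f uv(2))
    moreover have "poly P z \<noteq> 0 \<or> poly Q z \<noteq> 0" using coprime_no_common_root[OF PQ(1)] by blast
    ultimately have "poly P z * v = poly Q z * u" using of_ratio_eq_iff uv(1) by simp
    then show "z \<in> {z. poly R z = 0}" by (simp add: R_def mult.commute)
  qed
  ultimately show ?thesis using poly_roots_finite finite_subset by blast
qed

lemma infinite_open_sphere:
  assumes "open (S :: riemann_sphere set)" "S \<noteq> {}"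
  shows "infinite {z. Fin z \<in> S}"
proof -
  have "open (Fin -` S)"
    using assms(1) by (rule open_vimage) (intro continuous_on_Fin continuous_on_id)
  moreover obtain q where "Fin q \<in> S" by (rule open_contains_Fin[OF assms])
  then have "Fin -` S \<noteq> {}" by auto
  ultimately have "infinite (Fin -` S)" using finite_imp_not_open by blast
  then show ?thesis by (simp add: vimage_def)
qed

lemma three_points:
  assumes "infinite E"
  obtains e1 e2 e3 where "e1 \<in> E" "e2 \<in> E" "e3 \<in> E" "e1 \<noteq> e2" "e1 \<noteq> e3" "e2 \<noteq> e3"
proof -
  obtain B where "finite B" "card B = 3" "B \<subseteq> E" using infinite_arbitrarily_large[OF assms] by blast
  then obtain x y z where "B = {x, y, z}" "x \<noteq> y" "y \<noteq> z" "x \<noteq> z" using card_3_iff by metis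
  then show thesis using \<open>B \<subseteq> E\<close> by (intro that[of x y z]) auto
qed

text \<open>The open mapping theorem in charts; the map is not locally constant because its fibres are finite.\<close>

lemma Rat_open_map:
  assumes f: "f \<in> Rat" and S: "open S" "x \<in> S"
  shows "eventually (\<lambda>y. y \<in> f ` S) (nhds (f x))"
proof -
  define \<zeta> where "\<zeta> = chart x x"
  define F where "F = f \<circ> chart_inv x"
  define \<phi> where "\<phi> w = chart (F \<zeta>) (F w)" for w
  have F\<zeta>: "F \<zeta> = f x" by (simp add: F_def \<zeta>_def)
  have m: "mero_at F \<zeta>" using Rat_imp_hmap[OF f] mero_at_chart_inv unfolding hmap_def F_def by blast
  have "\<phi> analytic_on {\<zeta>}" unfolding \<phi>_def by (rule mero_at_chart_analytic[OF m])
  then obtain r0 where r0: "r0 > 0" "\<phi> holomorphic_on ball \<zeta> r0" unfolding analytic_on_def by auto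
  have "eventually (\<lambda>w. chart_inv x w \<in> S) (nhds \<zeta>)"
    by (rule isCont_eventually_in[OF mero_at_isCont[OF mero_at_chart_inv] S(1)]) (simp add: \<zeta>_def S)
  moreover have "eventually (\<lambda>w. F w = chart_inv (F \<zeta>) (\<phi> w)) (nhds \<zeta>)"
    unfolding \<phi>_def by (rule eventually_chart_inv_chart[OF m])
  moreover have "eventually (\<lambda>w. w \<in> ball \<zeta> r0) (nhds \<zeta>)"
    using r0 by (intro eventually_nhds_in_open) auto
  ultimately have "eventually (\<lambda>w. chart_inv x w \<in> S \<and> F w = chart_inv (F \<zeta>) (\<phi> w) \<and> w \<in> ball \<zeta> r0) (nhds \<zeta>)"
    by eventually_elim auto
  then obtain r where r: "r > 0" and
    near: "\<And>w. w \<in> ball \<zeta> r \<Longrightarrow> chart_inv x w \<in> S \<and> F w = chart_inv (F \<zeta>) (\<phi> w) \<and> w \<in> ball \<zeta> r0"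
    unfolding eventually_nhds_metric by (auto simp: dist_commute)
  have "\<not> \<phi> constant_on ball \<zeta> r"
  proof
    assume "\<phi> constant_on ball \<zeta> r"
    then obtain c where c: "\<And>w. w \<in> ball \<zeta> r \<Longrightarrow> \<phi> w = c" unfolding constant_on_def by blast
    have const: "F w = chart_inv (F \<zeta>) c" if "w \<in> ball \<zeta> r" for w using near[OF that] c[OF that] by simp
    define O' where "O' = {y. chart x y \<in> ball \<zeta> r \<and> chart_inv x (chart x y) = y}"
    have "eventually (\<lambda>y. y \<in> O') (nhds x)"
      unfolding O'_def mem_Collect_eq
      using isCont_eventually_in[OF isCont_chart[of x], of "ball \<zeta> r"] eventually_chart_inv_chart_self[of x] r
      by (intro eventually_conj) (auto simp: \<zeta>_def)
    then obtain V where V: "open V" "x \<in> V" "V \<subseteq> O'" unfolding eventually_nhds by auto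
    then have "infinite {z. Fin z \<in> V}" by (intro infinite_open_sphere) auto
    moreover have "{z. Fin z \<in> V} \<subseteq> {z. f (Fin z) = chart_inv (F \<zeta>) c}"
    proof
      fix z assume "z \<in> {z. Fin z \<in> V}"
      then have "Fin z \<in> O'" using V(3) by auto
      then show "z \<in> {z. f (Fin z) = chart_inv (F \<zeta>) c}"
        using const[of "chart x (Fin z)"] by (simp add: O'_def F_def)
    qed
    ultimately show False using Rat_finite_fibre[OF f] finite_subset by blast
  qed
  moreover have "\<phi> holomorphic_on ball \<zeta> r"
    using r0(2) by (rule holomorphic_on_subset) (use near in auto)
  ultimately have "open (\<phi> ` ball \<zeta> r)"
    by (intro open_mapping_thm[of \<phi> "ball \<zeta> r"]) auto
  moreover have "\<phi> \<zeta> = chart (f x) (f x)" by (simp add: \<phi>_def F\<zeta>)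
  then have "chart (f x) (f x) \<in> \<phi> ` ball \<zeta> r" using r by (metis centre_in_ball imageI)
  ultimately have "eventually (\<lambda>y. chart (f x) y \<in> \<phi> ` ball \<zeta> r) (nhds (f x))"
    by (rule isCont_eventually_in[OF isCont_chart])
  with eventually_chart_inv_chart_self[of "f x"] show ?thesis
  proof eventually_elim
    case (elim y)
    then obtain w where w: "w \<in> ball \<zeta> r" "chart (f x) y = \<phi> w" by (elim imageE)
    then have "y = f (chart_inv x w)" using elim(1) near[OF w(1)] F\<zeta> by (simp add: F_def)
    then show ?case using near[OF w(1)] by simp
  qed
qed

section \<open>Consequences of the open set condition\<close>

lemma equicontinuous_at_subset: "equicontinuous_at \<F> x \<Longrightarrow> \<G> \<subseteq> \<F> \<Longrightarrow> equicontinuous_at \<G> x"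
  unfolding equicontinuous_at_def
proof (intro allI impI)
  fix e :: real
  assume "\<forall>e>0. \<exists>d>0. \<forall>f\<in>\<F>. \<forall>y. dist y x < d \<longrightarrow> dist (f y) (f x) < e" "\<G> \<subseteq> \<F>" "e > 0"
  then obtain d where "d > 0" and d: "\<forall>f\<in>\<F>. \<forall>y. dist y x < d \<longrightarrow> dist (f y) (f x) < e" by auto
  have "\<forall>f\<in>\<G>. \<forall>y. dist y x < d \<longrightarrow> dist (f y) (f x) < e"
    using d subsetD[OF \<open>\<G> \<subseteq> \<F>\<close>] by simp
  with \<open>d > 0\<close> show "\<exists>d>0. \<forall>f\<in>\<G>. \<forall>y. dist y x < d \<longrightarrow> dist (f y) (f x) < e"
    by (intro exI conjI)
qed

lemma isCont_eventually_nhds: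
  fixes f :: "'a::t2_space \<Rightarrow> 'b::topological_space"
  assumes "isCont f x" "eventually P (nhds (f x))"
  shows "eventually (\<lambda>y. P (f y)) (nhds x)"
proof -
  obtain S where S: "open S" "f x \<in> S" "\<forall>y\<in>S. P y" using assms(2) unfolding eventually_nhds by auto
  from isCont_eventually_in[OF assms(1) S(1,2)] show ?thesis by eventually_elim (use S in auto)
qed

locale osc_system = random_system +
  fixes U :: "riemann_sphere set"
  assumes osc: "open_set_condition m h U"
begin

lemma U_open: "open U"
  using osc unfolding open_set_condition_def by (rule conjunct1)

lemma U_ne: "U \<noteq> {}"
  using osc unfolding open_set_condition_def by (elim conjE)

lemma U_pre:
  assumes "j \<in> {1..m}" "h j x \<in> U"
  shows "x \<in> U"
proof -
  have "(\<Union>j\<in>{1..m}. h j -` U) \<subseteq> U" using osc unfolding open_set_condition_def by (elim conjE)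
  then show ?thesis by (rule subsetD) (use assms in \<open>intro UN_I, simp_all\<close>)
qed

lemma U_disj:
  assumes "i \<in> {1..m}" "j \<in> {1..m}" "h i x \<in> U" "h j x \<in> U"
  shows "i = j"
proof (rule ccontr)
  assume "i \<noteq> j"
  then have "h i -` U \<inter> h j -` U = {}"
    using osc assms(1,2) unfolding open_set_condition_def by metis
  then show False using assms(3,4) by auto
qed

lemma U_pre_GG: "g \<in> GG \<Longrightarrow> g x \<in> U \<Longrightarrow> x \<in> U"
proof (induction arbitrary: x rule: gen_semigroup.induct)
  case (generator f)
  then show ?case using U_pre by auto
next
  case (compose f g)
  have "f (g x) \<in> U" using compose.prems by (simp only: comp_apply)
  then have "g x \<in> U" by (rule compose.IH(1))
  then show ?case by (rule compose.IH(2))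
qed

lemma U_orb_le:
  assumes w: "w \<in> words m" and "orb w n x \<in> U" "k \<le> n"
  shows "orb w k x \<in> U"
proof (cases "k = n")
  case False
  have "orb w n x = orb (\<lambda>i. w (k + i)) (n - k) (orb w k x)"
    using iter_comp_add[of "\<lambda>i. h (w i)" k "n - k"] assms(3) by simp
  then show ?thesis
    using U_pre_GG[OF orb_GG[OF words_shift[OF w]], of "n - k" k "orb w k x"] assms False by simp
qed (use assms in simp)

text \<open>A map that misses \<open>U\<close> near a point continues to do so under composition with \<open>G\<close>, because
  \<open>g -` U \<subseteq> U\<close>; Montel's theorem applies.\<close>

lemma equicontinuous_if_misses_U:
  assumes f: "hmap f" and \<Omega>: "open \<Omega>" "x \<in> \<Omega>" and miss: "\<And>y. y \<in> \<Omega> \<Longrightarrow> f y \<notin> U"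
  shows "equicontinuous_at (insert f ((\<lambda>g. g \<circ> f) ` GG)) x"
proof -
  have "infinite U"
  proof
    assume "finite U"
    then have "finite (Fin -` U)" by (rule finite_vimageI) (simp add: inj_on_def)
    then show False using infinite_open_sphere[OF U_open U_ne] by (simp add: vimage_def)
  qed
  then obtain e1 e2 e3 where e: "e1 \<in> U" "e2 \<in> U" "e3 \<in> U" "e1 \<noteq> e2" "e1 \<noteq> e3" "e2 \<noteq> e3"
    by (rule three_points)
  show ?thesis
  proof (rule Montel_three_points[OF _ \<Omega> e(4-6)])
    show "hmap k" if "k \<in> insert f ((\<lambda>g. g \<circ> f) ` GG)" for k
      using that f hmap_GG hmap_comp by auto
    have "k y \<notin> U" if k: "k \<in> insert f ((\<lambda>g. g \<circ> f) ` GG)" and y: "y \<in> \<Omega>" for k y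
      using k
    proof
      assume "k \<in> (\<lambda>g. g \<circ> f) ` GG"
      then obtain g where "g \<in> GG" "k = g \<circ> f" by blast
      then show ?thesis using U_pre_GG[of g "f y"] miss[OF y] by auto
    qed (use miss[OF y] in simp)
    then show "k y \<noteq> e1 \<and> k y \<noteq> e2 \<and> k y \<noteq> e3"
      if "k \<in> insert f ((\<lambda>g. g \<circ> f) ` GG)" "y \<in> \<Omega>" for k y
      using that e(1-3) by metis
  qed
qed

text \<open>Near \<open>x\<close> the letter \<open>w k\<close> leads into \<open>U\<close>; by disjointness of the preimages the letter \<open>j\<close> then leads outside.\<close>

lemma equicontinuous_off_branch:
  assumes w: "w \<in> words m" and x: "orb w (Suc k) x \<in> U" and j: "j \<in> {1..m}" "j \<noteq> w k"
  shows "equicontinuous_at (insert (h j \<circ> orb w k) ((\<lambda>g. g \<circ> (h j \<circ> orb w k)) ` GG)) x"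
proof (rule equicontinuous_if_misses_U)
  show "hmap (h j \<circ> orb w k)" using hmap_comp[OF hmap_h[OF j(1)] hmap_orb[OF w]] .
  show "open (orb w (Suc k) -` U)"
    by (rule open_vimage[OF U_open]) (intro hmap_continuous_on hmap_orb w)
  show "x \<in> orb w (Suc k) -` U" using x by simp
  fix y assume "y \<in> orb w (Suc k) -` U"
  then have "h (w k) (orb w k y) \<in> U" by simp
  then show "(h j \<circ> orb w k) y \<notin> U"
    using U_disj[OF j(1) words_letter[OF w, of k]] j(2) by auto
qed

text \<open>In the functional equation at \<open>orb w k y\<close> the terms of the letters other than \<open>w k\<close> do not depend on \<open>y\<close> near \<open>x\<close>.\<close>

lemma T_local_step:
  assumes w: "w \<in> words m" and x: "orb w (Suc k) x \<in> U"
  shows "eventually (\<lambda>y. T (orb w k y) - T (orb w k x)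
      = p (w k) * (T (orb w (Suc k) y) - T (orb w (Suc k) x))) (nhds x)"
proof -
  have "eventually (\<lambda>y. \<forall>j\<in>{1..m} - {w k}. T (h j (orb w k y)) = T (h j (orb w k x))) (nhds x)"
  proof (rule eventually_ball_finite)
    show "\<forall>j\<in>{1..m} - {w k}. eventually (\<lambda>y. T (h j (orb w k y)) = T (h j (orb w k x))) (nhds x)"
    proof
      fix j assume j: "j \<in> {1..m} - {w k}"
      have "equicontinuous_at ((\<lambda>g. g \<circ> (h j \<circ> orb w k)) ` GG) x"
        by (rule equicontinuous_at_subset[OF equicontinuous_off_branch[OF w x]]) (use j in auto)
      from T_locally_constant[OF this]
      show "eventually (\<lambda>y. T (h j (orb w k y)) = T (h j (orb w k x))) (nhds x)"
        unfolding eventually_nhds_metric by simp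
    qed
  qed simp
  then show ?thesis
  proof eventually_elim
    case (elim y)
    have split: "T z = p (w k) * T (h (w k) z) + (\<Sum>j\<in>{1..m} - {w k}. p j * T (h j z))" for z
      by (subst T_functional_equation, rule sum.remove) (use words_letter[OF w, of k] in auto)
    have "(\<Sum>j\<in>{1..m} - {w k}. p j * T (h j (orb w k y))) = (\<Sum>j\<in>{1..m} - {w k}. p j * T (h j (orb w k x)))"
      by (rule sum.cong) (use elim in auto)
    then show ?case using split[of "orb w k y"] split[of "orb w k x"] by (simp add: right_diff_distrib)
  qed
qed

definition weight :: "(nat \<Rightarrow> nat) \<Rightarrow> nat \<Rightarrow> real" where
  "weight w n = (\<Prod>i<n. p (w i))"

lemma weight_pos:
  assumes "w \<in> words m"
  shows "weight w n > 0"
  unfolding weight_def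
proof (rule prod_pos)
  show "0 < p (w i)" for i using p_bounds[OF words_letter[OF assms, of i]] by simp
qed

lemma weight_tendsto_0:
  assumes w: "w \<in> words m"
  shows "weight w \<longlonglongrightarrow> 0"
proof -
  define q where "q = Max (p ` {1..m})"
  have le: "p j \<le> q" if "j \<in> {1..m}" for j unfolding q_def using that by simp
  have "q \<in> p ` {1..m}" unfolding q_def using m by (intro Max_in) auto
  then have q: "0 < q" "q < 1" using p_bounds by auto
  have "weight w n \<le> q ^ n" for n
  proof -
    have "weight w n \<le> (\<Prod>i<n. q)" unfolding weight_def
      using p_bounds words_letter[OF w] le by (intro prod_mono) (auto intro: less_imp_le)
    then show ?thesis by simp
  qed
  moreover have "(\<lambda>n. q ^ n) \<longlonglongrightarrow> 0" using q by (intro LIMSEQ_power_zero) auto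
  ultimately show ?thesis
    using weight_pos[OF w]
    by (intro tendsto_sandwich[of "\<lambda>_. 0" "weight w" sequentially "\<lambda>n. q ^ n"])
      (auto intro!: always_eventually less_imp_le)
qed

lemma T_local_product:
  assumes w: "w \<in> words m" and x: "orb w n x \<in> U"
  shows "eventually (\<lambda>y. T y - T x = weight w n * (T (orb w n y) - T (orb w n x))) (nhds x)"
  using x
proof (induction n)
  case 0
  then show ?case by (simp add: weight_def)
next
  case (Suc n)
  have "orb w n x \<in> U" by (rule U_orb_le[OF w Suc.prems]) simp
  from Suc.IH[OF this] T_local_step[OF w Suc.prems] show ?case
    by eventually_elim (simp add: weight_def)
qed

text \<open>By the local formula, \<open>T - weight w n * (T \<circ> orb w n)\<close> is locally constant along \<open>\<Psi>\<close>.\<close>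

lemma T_connected_product:
  fixes \<Psi> :: "complex \<Rightarrow> riemann_sphere"
  assumes w: "w \<in> words m" and \<Psi>: "continuous_on (ball c \<rho>) \<Psi>"
    and U: "\<And>u. u \<in> ball c \<rho> \<Longrightarrow> orb w n (\<Psi> u) \<in> U" and uv: "u \<in> ball c \<rho>" "v \<in> ball c \<rho>"
  shows "T (\<Psi> u) - T (\<Psi> v) = weight w n * (T (orb w n (\<Psi> u)) - T (orb w n (\<Psi> v)))"
proof -
  define E where "E z = T z - weight w n * T (orb w n z)" for z
  have "E (\<Psi> u) = E (\<Psi> v)"
  proof (rule connected_local_const[OF connected_ball uv, of "\<lambda>u. E (\<Psi> u)"], intro ballI)
    fix a assume a: "a \<in> ball c \<rho>"
    have "isCont \<Psi> a" using \<Psi> a by (simp add: continuous_on_eq_continuous_at)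
    moreover have "eventually (\<lambda>y. E (\<Psi> a) = E y) (nhds (\<Psi> a))"
      using T_local_product[OF w U[OF a]] by eventually_elim (simp add: E_def right_diff_distrib)
    ultimately have "eventually (\<lambda>b. E (\<Psi> a) = E (\<Psi> b)) (nhds a)" by (rule isCont_eventually_nhds)
    then show "eventually (\<lambda>b. E (\<Psi> a) = E (\<Psi> b)) (at a within ball c \<rho>)"
      using filter_leD[OF at_within_le_nhds] by blast
  qed
  then show ?thesis by (simp add: E_def right_diff_distrib)
qed

lemma T_continuous:
  assumes w: "w \<in> words m" and x: "\<And>n. orb w n x \<in> U"
  shows "isCont T x"
  unfolding isCont_def
proof (rule tendstoI)
  fix e :: real assume "e > 0"
  then have "eventually (\<lambda>n. weight w n < e) sequentially"
    using order_tendstoD(2)[OF weight_tendsto_0[OF w]] by simp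
  then obtain n where n: "weight w n < e" by (metis eventually_sequentially order_refl)
  have "eventually (\<lambda>y. dist (T y) (T x) < e) (nhds x)"
    using T_local_product[OF w x[of n]]
  proof eventually_elim
    case (elim y)
    have "\<bar>T (orb w n y) - T (orb w n x)\<bar> \<le> 1"
      using T_bounds[of "orb w n y"] T_bounds[of "orb w n x"] by linarith
    then have "\<bar>T y - T x\<bar> \<le> weight w n * 1"
      unfolding elim abs_mult using weight_pos[OF w, of n] by (intro mult_mono) auto
    then show ?case using n by (simp add: dist_real_def)
  qed
  then show "eventually (\<lambda>y. dist (T y) (T x) < e) (at x)"
    using filter_leD[OF at_within_le_nhds] by blast
qed

definition nonconst :: "riemann_sphere set" where
  "nonconst = {x. \<not> eventually (\<lambda>y. T y = T x) (nhds x)}"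

text \<open>If \<open>T\<close> is constant near \<open>x\<close>, the local formula makes \<open>T\<close> constant on the image of a neighbourhood of \<open>x\<close>
under \<open>h j\<close>, which is a neighbourhood of \<open>h j x\<close>.\<close>

lemma nonconst_backward:
  assumes j: "j \<in> {1..m}" and x: "h j x \<in> nonconst" "h j x \<in> U"
  shows "x \<in> nonconst"
proof (rule ccontr)
  assume "x \<notin> nonconst"
  then have c: "eventually (\<lambda>y. T y = T x) (nhds x)" by (simp add: nonconst_def)
  have w: "(\<lambda>_. j) \<in> words m" using j by (simp add: words_def)
  have "eventually (\<lambda>y. T y - T x = p j * (T (h j y) - T (h j x))) (nhds x)"
    using T_local_step[OF w, of 0 x] x by simp
  with c have "eventually (\<lambda>y. T (h j y) = T (h j x)) (nhds x)"
    by eventually_elim (use p_bounds[OF j] in simp)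
  then obtain S where S: "open S" "x \<in> S" "\<And>y. y \<in> S \<Longrightarrow> T (h j y) = T (h j x)"
    unfolding eventually_nhds by blast
  from Rat_open_map[OF h_Rat[OF j] S(1,2)]
  have "eventually (\<lambda>y. T y = T (h j x)) (nhds (h j x))"
    by eventually_elim (use S(3) in auto)
  then show False using x(1) by (simp add: nonconst_def)
qed

lemma nonconst_backward_GG:
  "g \<in> GG \<Longrightarrow> g x \<in> nonconst \<inter> U \<Longrightarrow> x \<in> nonconst \<inter> U"
proof (induction arbitrary: x rule: gen_semigroup.induct)
  case (generator f)
  then obtain j where j: "j \<in> {1..m}" "f = h j" by (elim imageE)
  have "h j x \<in> nonconst" "h j x \<in> U" using generator.prems j(2) by auto
  then show ?case using nonconst_backward[OF j(1)] U_pre[OF j(1)] by (intro IntI)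
next
  case (compose f g)
  have "f (g x) \<in> nonconst \<inter> U" using compose.prems by (simp only: comp_apply)
  then have "g x \<in> nonconst \<inter> U" by (rule compose.IH(1))
  then show ?case by (rule compose.IH(2))
qed

text \<open>The preimages of a finite set \<open>nonconst \<inter> U\<close> under two different generators would be disjoint
  subsets of it, each at least as large.\<close>

lemma infinite_nonconst:
  assumes "nonconst \<inter> U \<noteq> {}"
  shows "infinite (nonconst \<inter> U)"
proof
  define E where "E = nonconst \<inter> U"
  assume "finite (nonconst \<inter> U)"
  then have fin: "finite E" by (simp add: E_def)
  have sub: "h j -` E \<subseteq> E" if "j \<in> {1..m}" for j
    using nonconst_backward_GG[OF h_GG[OF that]] by (auto simp: E_def)
  have card: "card E \<le> card (h j -` E)" if j: "j \<in> {1..m}" for j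
  proof -
    have "h j ` (h j -` E) = E" using Rat_surj[OF h_Rat[OF j]] by (rule surj_image_vimage_eq)
    then show ?thesis using card_image_le[OF finite_subset[OF sub[OF j] fin], of "h j"] by simp
  qed
  have 12: "1 \<in> {1..m}" "2 \<in> {1..m}" using m by auto
  have "h 1 -` E \<inter> h 2 -` E = {}"
    using U_disj[OF 12] by (auto simp: E_def)
  then have "card (h 1 -` E) + card (h 2 -` E) = card (h 1 -` E \<union> h 2 -` E)"
    by (intro card_Un_disjoint[symmetric] finite_subset[OF sub fin] 12)
  also have "\<dots> \<le> card E" using sub[OF 12(1)] sub[OF 12(2)] by (intro card_mono fin) auto
  finally have "card E = 0" using card[OF 12(1)] card[OF 12(2)] by linarith
  then show False using fin assms by (simp add: E_def)
qed

text \<open>The semigroup is not equicontinuous on \<open>N\<close>, so by Montel's theorem some element maps a point of \<open>N\<close> into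
the infinite set \<open>nonconst \<inter> U\<close>, which is invariant under preimages.\<close>

lemma T_nonconstant_near_Julia:
  assumes ne: "nonconst \<inter> U \<noteq> {}" and y: "y \<in> Julia GG" and N: "open N" "y \<in> N"
  shows "\<exists>a\<in>N. \<exists>b\<in>N. T a \<noteq> T b"
proof -
  obtain e1 e2 e3 where e: "e1 \<in> nonconst \<inter> U" "e2 \<in> nonconst \<inter> U" "e3 \<in> nonconst \<inter> U"
    "e1 \<noteq> e2" "e1 \<noteq> e3" "e2 \<noteq> e3"
    by (rule three_points[OF infinite_nonconst[OF ne]])
  have "\<exists>g\<in>GG. \<exists>x\<in>N. g x \<in> nonconst \<inter> U"
  proof (rule ccontr)
    assume neg: "\<not> ?thesis"
    have "equicontinuous_at GG x" if "x \<in> N" for x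
    proof (rule Montel_three_points[OF hmap_GG N(1) that e(4-6)])
      fix g z assume "g \<in> GG" "z \<in> N"
      then have "g z \<notin> nonconst \<inter> U" using neg by (metis (no_types))
      then show "g z \<noteq> e1 \<and> g z \<noteq> e2 \<and> g z \<noteq> e3" using e(1-3) by (metis (no_types))
    qed
    then have "N \<subseteq> Fatou GG" unfolding Fatou_def using N(1) by blast
    then show False using y N(2) by (auto simp: Julia_def)
  qed
  then obtain g x where gx: "g \<in> GG" "x \<in> N" "g x \<in> nonconst \<inter> U" by blast
  then have "x \<in> nonconst" using nonconst_backward_GG by blast
  then have "\<not> (\<forall>y\<in>N. T y = T x)" using N(1) gx(2) unfolding nonconst_def eventually_nhds by blast
  then show ?thesis using gx(2) by metis
qed

text \<open>Equicontinuity at \<open>a\<close> of the maps \<open>f \<circ> h j\<close> is equicontinuity at \<open>h j a\<close> of the maps \<open>f\<close>, since \<open>h j\<close> is open.\<close>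

lemma Fatou_forward:
  assumes j: "j \<in> {1..m}" and x: "x \<in> Fatou GG"
  shows "h j x \<in> Fatou GG"
proof -
  have eq: "equicontinuous_at GG (h j a)" if a: "a \<in> Fatou GG" for a
    unfolding equicontinuous_at_def
  proof (intro allI impI)
    fix e :: real assume "e > 0"
    then obtain d where d: "d > 0" "\<forall>f\<in>GG. \<forall>y. dist y a < d \<longrightarrow> dist (f y) (f a) < e"
      using Fatou_equicontinuous[OF a] unfolding equicontinuous_at_def by (elim allE impE exE conjE)
    have "eventually (\<lambda>v. v \<in> h j ` ball a d) (nhds (h j a))"
      by (rule Rat_open_map[OF h_Rat[OF j]]) (use d in auto)
    then obtain d' where d': "d' > 0" "\<And>v. dist v (h j a) < d' \<Longrightarrow> v \<in> h j ` ball a d"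
      unfolding eventually_nhds_metric by blast
    have "dist (f v) (f (h j a)) < e" if f: "f \<in> GG" and v: "dist v (h j a) < d'" for f v
    proof -
      obtain y where y: "y \<in> ball a d" "v = h j y" using d'(2)[OF v] by (elim imageE)
      have "f \<circ> h j \<in> GG" using f h_GG[OF j] by (rule gen_semigroup.compose)
      moreover have "dist y a < d" using y(1) by (simp add: dist_commute)
      ultimately have "dist ((f \<circ> h j) y) ((f \<circ> h j) a) < e" using d(2) by blast
      then show ?thesis by (simp add: y(2))
    qed
    then show "\<exists>d>0. \<forall>f\<in>GG. \<forall>y. dist y (h j a) < d \<longrightarrow> dist (f y) (f (h j a)) < e"
      using d'(1) by blast
  qed
  have "open (h j ` Fatou GG)"
    unfolding open_subopen[of "h j ` Fatou GG"]
  proof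
    fix v assume "v \<in> h j ` Fatou GG"
    then obtain a where "a \<in> Fatou GG" "v = h j a" by blast
    then show "\<exists>T. open T \<and> v \<in> T \<and> T \<subseteq> h j ` Fatou GG"
      using Rat_open_map[OF h_Rat[OF j] open_Fatou[of GG], of a] unfolding eventually_nhds by blast
  qed
  moreover have "\<forall>v\<in>h j ` Fatou GG. equicontinuous_at GG v" using eq by blast
  ultimately have "h j ` Fatou GG \<in> {U. open U \<and> (\<forall>x\<in>U. equicontinuous_at GG x)}" by simp
  then have "h j ` Fatou GG \<subseteq> Fatou GG"
    by (subst (2) Fatou_def) (rule Union_upper)
  then show ?thesis using imageI[OF x] by (rule subsetD)
qed

end

section \<open>A metric for weak convergence on the sphere\<close>

definition BL :: "(riemann_sphere \<Rightarrow> real) set" where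
  "BL = {\<phi>. (\<forall>x. \<bar>\<phi> x\<bar> \<le> 1) \<and> (\<forall>x y. \<bar>\<phi> x - \<phi> y\<bar> \<le> dist x y)}"

text \<open>The bounded Lipschitz metric, extended by \<open>0\<close> to arbitrary measures.\<close>

definition BL_dist :: "riemann_sphere measure \<Rightarrow> riemann_sphere measure \<Rightarrow> real" where
  "BL_dist \<mu> \<nu> = (if \<mu> \<in> M1 \<and> \<nu> \<in> M1
     then SUP \<phi>\<in>BL. \<bar>(\<integral>x. \<phi> x \<partial>\<mu>) - (\<integral>x. \<phi> x \<partial>\<nu>)\<bar> else 0)"

lemma BL_abs_le: "\<phi> \<in> BL \<Longrightarrow> \<bar>\<phi> x\<bar> \<le> 1"
  and BL_Lipschitz: "\<phi> \<in> BL \<Longrightarrow> \<bar>\<phi> x - \<phi> y\<bar> \<le> dist x y"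
  by (simp_all add: BL_def)

lemma Lipschitz_imp_continuous:
  fixes \<phi> :: "'a::metric_space \<Rightarrow> real"
  assumes "C \<ge> 0" "\<And>x y. \<bar>\<phi> x - \<phi> y\<bar> \<le> C * dist x y"
  shows "continuous_on S \<phi>"
proof -
  have "C-lipschitz_on S \<phi>" using assms by (intro lipschitz_onI) (auto simp: dist_real_def)
  then show ?thesis by (rule lipschitz_on_continuous_on)
qed

lemma BL_continuous: "\<phi> \<in> BL \<Longrightarrow> continuous_on S \<phi>"
  using Lipschitz_imp_continuous[of 1 \<phi>] BL_Lipschitz by simp

lemma BL_zero: "(\<lambda>_. 0) \<in> BL"
  by (simp add: BL_def)

lemma M1_D:
  assumes "\<mu> \<in> M1"
  shows "prob_space \<mu>" "sets \<mu> = sets borel" "space \<mu> = UNIV"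
  using assms sets_eq_imp_space_eq[of \<mu> borel] by (auto simp: M1_def)

lemma sphere_continuous_bounded:
  fixes \<phi> :: "riemann_sphere \<Rightarrow> real"
  assumes "continuous_on UNIV \<phi>"
  obtains B where "\<And>x. \<bar>\<phi> x\<bar> \<le> B"
proof -
  have "compact (\<phi> ` UNIV)" using assms compact_UNIV_sphere by (rule compact_continuous_image)
  then obtain B where "\<forall>y\<in>range \<phi>. norm y \<le> B"
    using compact_imp_bounded[of "range \<phi>"] unfolding bounded_iff by auto
  then show thesis by (intro that[of B]) simp
qed

lemma M1_integrable:
  fixes \<phi> :: "riemann_sphere \<Rightarrow> real"
  assumes \<mu>: "\<mu> \<in> M1" and \<phi>: "continuous_on UNIV \<phi>"
  shows "integrable \<mu> \<phi>"
proof -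
  interpret prob_space \<mu> by (rule M1_D[OF \<mu>])
  obtain B where B: "\<And>x. \<bar>\<phi> x\<bar> \<le> B" by (rule sphere_continuous_bounded[OF \<phi>]) blast
  have "\<phi> \<in> borel_measurable \<mu>"
    using borel_measurable_continuous_onI[OF \<phi>] measurable_cong_sets[OF M1_D(2)[OF \<mu>] refl, of borel] by metis
  then show ?thesis by (rule integrable_const_bound[where B = B, rotated]) (use B in simp)
qed

lemma M1_integral_diff_le:
  fixes \<phi> \<psi> :: "riemann_sphere \<Rightarrow> real"
  assumes \<mu>: "\<mu> \<in> M1" and c: "continuous_on UNIV \<phi>" "continuous_on UNIV \<psi>" and e: "\<And>x. \<bar>\<phi> x - \<psi> x\<bar> \<le> e"
  shows "\<bar>(\<integral>x. \<phi> x \<partial>\<mu>) - (\<integral>x. \<psi> x \<partial>\<mu>)\<bar> \<le> e"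
proof -
  interpret prob_space \<mu> by (rule M1_D[OF \<mu>])
  have i: "integrable \<mu> \<phi>" "integrable \<mu> \<psi>" using M1_integrable[OF \<mu>] c by auto
  have "\<bar>(\<integral>x. \<phi> x \<partial>\<mu>) - (\<integral>x. \<psi> x \<partial>\<mu>)\<bar> = \<bar>\<integral>x. \<phi> x - \<psi> x \<partial>\<mu>\<bar>" using i by simp
  also have "\<dots> \<le> (\<integral>x. \<bar>\<phi> x - \<psi> x\<bar> \<partial>\<mu>)" by (rule integral_abs_bound)
  also have "\<dots> \<le> (\<integral>x. e \<partial>\<mu>)" using i e by (intro integral_mono) auto
  also have "\<dots> = e" by (simp add: prob_space)
  finally show ?thesis .
qed

lemma M1_integral_BL_le:
  assumes "\<mu> \<in> M1" "\<phi> \<in> BL"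
  shows "\<bar>\<integral>x. \<phi> x \<partial>\<mu>\<bar> \<le> 1"
  using M1_integral_diff_le[OF assms(1) BL_continuous[OF assms(2)] BL_continuous[OF BL_zero], of 1]
    BL_abs_le[OF assms(2)] by simp

lemma BL_dist_bdd:
  assumes "\<mu> \<in> M1" "\<nu> \<in> M1"
  shows "bdd_above ((\<lambda>\<phi>. \<bar>(\<integral>x. \<phi> x \<partial>\<mu>) - (\<integral>x. \<phi> x \<partial>\<nu>)\<bar>) ` BL)"
proof (rule bdd_aboveI2)
  fix \<phi> assume "\<phi> \<in> BL"
  then show "\<bar>(\<integral>x. \<phi> x \<partial>\<mu>) - (\<integral>x. \<phi> x \<partial>\<nu>)\<bar> \<le> 2"
    using M1_integral_BL_le[OF assms(1), of \<phi>] M1_integral_BL_le[OF assms(2), of \<phi>] by linarith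
qed

lemma BL_dist_ge:
  assumes "\<mu> \<in> M1" "\<nu> \<in> M1" "\<phi> \<in> BL"
  shows "\<bar>(\<integral>x. \<phi> x \<partial>\<mu>) - (\<integral>x. \<phi> x \<partial>\<nu>)\<bar> \<le> BL_dist \<mu> \<nu>"
  using cSUP_upper[OF assms(3) BL_dist_bdd[OF assms(1,2)]] assms(1,2) by (simp add: BL_dist_def)

lemma BL_dist_le:
  assumes "\<And>\<phi>. \<phi> \<in> BL \<Longrightarrow> \<bar>(\<integral>x. \<phi> x \<partial>\<mu>) - (\<integral>x. \<phi> x \<partial>\<nu>)\<bar> \<le> c"
  shows "BL_dist \<mu> \<nu> \<le> c"
proof (cases "\<mu> \<in> M1 \<and> \<nu> \<in> M1")
  case True
  have "(SUP \<phi>\<in>BL. \<bar>(\<integral>x. \<phi> x \<partial>\<mu>) - (\<integral>x. \<phi> x \<partial>\<nu>)\<bar>) \<le> c"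
    using BL_zero assms by (intro cSUP_least) auto
  then show ?thesis using True by (simp add: BL_dist_def)
next
  case False
  then show ?thesis using assms[OF BL_zero] by (auto simp: BL_dist_def)
qed

lemma scaled_Lipschitz_in_BL:
  assumes K: "K > 0" and "\<And>x. \<bar>\<psi> x\<bar> \<le> K" "\<And>x y. \<bar>\<psi> x - \<psi> y\<bar> \<le> K * dist x y"
  shows "(\<lambda>x. \<psi> x / K) \<in> BL"
  unfolding BL_def mem_Collect_eq
proof (intro conjI allI)
  show "\<bar>\<psi> x / K\<bar> \<le> 1" for x using assms by (simp add: abs_divide)
  show "\<bar>\<psi> x / K - \<psi> y / K\<bar> \<le> dist x y" for x y
    using assms(3)[of x y] K by (simp add: diff_divide_distrib[symmetric] abs_divide divide_le_eq mult.commute)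
qed

lemma Lipschitz_integral_diff_le:
  assumes "\<mu> \<in> M1" "\<nu> \<in> M1" and K: "K > 0" and "\<And>x. \<bar>\<psi> x\<bar> \<le> K" "\<And>x y. \<bar>\<psi> x - \<psi> y\<bar> \<le> K * dist x y"
  shows "\<bar>(\<integral>x. \<psi> x \<partial>\<mu>) - (\<integral>x. \<psi> x \<partial>\<nu>)\<bar> \<le> K * BL_dist \<mu> \<nu>"
proof -
  have "\<bar>(\<integral>x. \<psi> x / K \<partial>\<mu>) - (\<integral>x. \<psi> x / K \<partial>\<nu>)\<bar> \<le> BL_dist \<mu> \<nu>"
    by (rule BL_dist_ge[OF assms(1,2) scaled_Lipschitz_in_BL[OF assms(3-5)]])
  then show ?thesis using K
    by (simp add: diff_divide_distrib[symmetric] abs_divide divide_le_eq mult.commute)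
qed

text \<open>The indicator of a closed set is the limit of the Lipschitz functions \<open>max 0 (1 - Suc n * infdist x C)\<close>.\<close>

lemma M1_eqI:
  assumes \<mu>: "\<mu> \<in> M1" and \<nu>: "\<nu> \<in> M1"
    and eq: "\<And>\<phi>. \<phi> \<in> BL \<Longrightarrow> (\<integral>x. \<phi> x \<partial>\<mu>) = (\<integral>x. \<phi> x \<partial>\<nu>)"
  shows "\<mu> = \<nu>"
proof -
  interpret \<mu>: prob_space \<mu> by (rule M1_D[OF \<mu>])
  interpret \<nu>: prob_space \<nu> by (rule M1_D[OF \<nu>])
  have "BL_dist \<mu> \<nu> \<le> 0" by (rule BL_dist_le) (simp add: eq)
  have closed_eq: "measure \<mu> C = measure \<nu> C" if C: "closed C" for C
  proof (cases "C = {}")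
    case False
    define \<psi> where "\<psi> n x = max 0 (1 - real (Suc n) * infdist x C)" for n x
    have bd: "\<bar>\<psi> n x\<bar> \<le> 1" for n x
      using infdist_nonneg[of x C] by (simp add: \<psi>_def)
    have Lip: "\<bar>\<psi> n x - \<psi> n y\<bar> \<le> real (Suc n) * dist x y" for n x y
    proof -
      have "\<bar>infdist x C - infdist y C\<bar> \<le> dist x y"
        using infdist_triangle[of x C y] infdist_triangle[of y C x] by (simp add: dist_commute abs_le_iff)
      then have "real (Suc n) * \<bar>infdist x C - infdist y C\<bar> \<le> real (Suc n) * dist x y"
        by (intro mult_left_mono) auto
      then have "\<bar>real (Suc n) * infdist x C - real (Suc n) * infdist y C\<bar> \<le> real (Suc n) * dist x y"
        by (simp only: right_diff_distrib[symmetric] abs_mult abs_of_nat)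
      then show ?thesis unfolding \<psi>_def by linarith
    qed
    have cont: "continuous_on UNIV (\<psi> n)" for n
      by (rule Lipschitz_imp_continuous[OF _ Lip]) simp
    have int_eq: "(\<integral>x. \<psi> n x \<partial>\<mu>) = (\<integral>x. \<psi> n x \<partial>\<nu>)" for n
    proof -
      have "\<bar>(\<integral>x. \<psi> n x \<partial>\<mu>) - (\<integral>x. \<psi> n x \<partial>\<nu>)\<bar> \<le> real (Suc n) * BL_dist \<mu> \<nu>"
      proof (rule Lipschitz_integral_diff_le[OF \<mu> \<nu> _ _ Lip])
        show "\<bar>\<psi> n x\<bar> \<le> real (Suc n)" for x using bd[of n x] by simp
      qed simp
      also have "\<dots> \<le> 0" using \<open>BL_dist \<mu> \<nu> \<le> 0\<close> by (simp add: mult_nonneg_nonpos)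
      finally show ?thesis by simp
    qed
    have lim: "(\<lambda>n. \<psi> n x) \<longlonglongrightarrow> indicator C x" for x
    proof (cases "x \<in> C")
      case True
      then show ?thesis by (simp add: \<psi>_def)
    next
      case False
      then have pos: "infdist x C > 0" using C \<open>C \<noteq> {}\<close> by (metis in_closed_iff_infdist_zero infdist_nonneg order_le_less)
      obtain N where N: "1 / infdist x C < real N" using reals_Archimedean2 by blast
      have "\<psi> n x = 0" if "n \<ge> N" for n
      proof -
        have "1 / infdist x C < real (Suc n)" using N that by linarith
        then have "1 < real (Suc n) * infdist x C" using pos by (simp add: divide_less_eq)
        then show ?thesis by (simp add: \<psi>_def)
      qed
      then have "eventually (\<lambda>n. \<psi> n x = 0) sequentially" unfolding eventually_sequentially by blast
      then show ?thesis using False by (simp add: tendsto_eventually)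
    qed
    have conv: "(\<lambda>n. \<integral>x. \<psi> n x \<partial>\<kappa>) \<longlonglongrightarrow> measure \<kappa> C" if \<kappa>: "\<kappa> \<in> M1" for \<kappa>
    proof -
      interpret \<kappa>: prob_space \<kappa> by (rule M1_D[OF \<kappa>])
      have Cs: "C \<in> sets \<kappa>" using C M1_D(2)[OF \<kappa>] by simp
      have "(\<lambda>n. \<integral>x. \<psi> n x \<partial>\<kappa>) \<longlonglongrightarrow> (\<integral>x. indicator C x \<partial>\<kappa>)"
      proof (rule integral_dominated_convergence[where w = "\<lambda>_. 1"])
        show "AE x in \<kappa>. (\<lambda>n. \<psi> n x) \<longlonglongrightarrow> indicator C x" using lim by simp
        show "AE x in \<kappa>. norm (\<psi> n x) \<le> 1" for n using bd by simp
        show "\<psi> n \<in> borel_measurable \<kappa>" for n using M1_integrable[OF \<kappa> cont] by simp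
        show "indicator C \<in> borel_measurable \<kappa>" using Cs by simp
      qed simp
      then show ?thesis using Cs by simp
    qed
    show ?thesis using LIMSEQ_unique[OF conv[OF \<mu>]] conv[OF \<nu>] int_eq by simp
  qed simp
  show ?thesis
  proof (rule measure_eqI_generator_eq[where \<Omega> = UNIV and E = "Collect closed" and A = "\<lambda>_. UNIV"])
    show "Int_stable (Collect closed :: riemann_sphere set set)" by (auto simp: Int_stable_def)
    show "sets \<mu> = sigma_sets UNIV (Collect closed)" "sets \<nu> = sigma_sets UNIV (Collect closed)"
      using M1_D(2)[OF \<mu>] M1_D(2)[OF \<nu>] by (simp_all add: borel_eq_closed)
    show "emeasure \<mu> X = emeasure \<nu> X" if "X \<in> Collect closed" for X
      using closed_eq that by (simp add: \<mu>.emeasure_eq_measure \<nu>.emeasure_eq_measure)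
  qed auto
qed

lemma Metric_space_M1: "Metric_space M1 BL_dist"
proof
  fix \<mu> \<nu> \<kappa> :: "riemann_sphere measure"
  show "0 \<le> BL_dist \<mu> \<nu>"
  proof (cases "\<mu> \<in> M1 \<and> \<nu> \<in> M1")
    case True
    then show ?thesis using BL_dist_ge[of \<mu> \<nu>, OF _ _ BL_zero] by simp
  next
    case False
    then show ?thesis by (auto simp: BL_dist_def)
  qed
  show "BL_dist \<mu> \<nu> = BL_dist \<nu> \<mu>" unfolding BL_dist_def by (simp only: abs_minus_commute conj_commute)
  assume \<mu>: "\<mu> \<in> M1" and \<nu>: "\<nu> \<in> M1"
  show "BL_dist \<mu> \<nu> = 0 \<longleftrightarrow> \<mu> = \<nu>"
  proof
    assume "BL_dist \<mu> \<nu> = 0"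
    then show "\<mu> = \<nu>" using BL_dist_ge[OF \<mu> \<nu>] by (intro M1_eqI[OF \<mu> \<nu>]) simp
  next
    assume "\<mu> = \<nu>"
    then have "BL_dist \<mu> \<nu> \<le> 0" by (intro BL_dist_le) simp
    moreover have "0 \<le> BL_dist \<mu> \<nu>" using BL_dist_ge[OF \<mu> \<nu> BL_zero] by simp
    ultimately show "BL_dist \<mu> \<nu> = 0" by simp
  qed
  assume \<kappa>: "\<kappa> \<in> M1"
  show "BL_dist \<mu> \<kappa> \<le> BL_dist \<mu> \<nu> + BL_dist \<nu> \<kappa>"
  proof (rule BL_dist_le)
    fix \<phi> assume "\<phi> \<in> BL"
    then show "\<bar>(\<integral>x. \<phi> x \<partial>\<mu>) - (\<integral>x. \<phi> x \<partial>\<kappa>)\<bar> \<le> BL_dist \<mu> \<nu> + BL_dist \<nu> \<kappa>"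
      using BL_dist_ge[OF \<mu> \<nu>, of \<phi>] BL_dist_ge[OF \<nu> \<kappa>, of \<phi>] by linarith
  qed
qed

text \<open>The approximation is the infimal convolution of \<open>\<phi>\<close> with \<open>K * dist\<close>, where \<open>K\<close> is so large that points
beyond the radius of uniform continuity cannot lower the infimum.\<close>

lemma Lipschitz_approximation:
  fixes \<phi> :: "riemann_sphere \<Rightarrow> real"
  assumes \<phi>: "continuous_on UNIV \<phi>" and e: "e > 0"
  obtains K \<psi> where "K > 0" "\<And>x. \<bar>\<psi> x\<bar> \<le> K" "\<And>x y. \<bar>\<psi> x - \<psi> y\<bar> \<le> K * dist x y" "\<And>x. \<bar>\<phi> x - \<psi> x\<bar> \<le> e"
proof -
  obtain B where B: "\<And>x. \<bar>\<phi> x\<bar> \<le> B" by (rule sphere_continuous_bounded[OF \<phi>]) blast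
  have B0: "B \<ge> 0" using B[of undefined] by linarith
  have "uniformly_continuous_on UNIV \<phi>" using \<phi> compact_UNIV_sphere by (rule compact_uniformly_continuous)
  then obtain \<delta> where \<delta>: "\<delta> > 0" "\<And>x y. dist x y < \<delta> \<Longrightarrow> \<bar>\<phi> x - \<phi> y\<bar> < e"
    using e unfolding uniformly_continuous_on_def dist_real_def by (metis UNIV_I)
  define K where "K = 2 * B / \<delta> + B + 1"
  have K: "K > 0" "K \<ge> B" "K * \<delta> \<ge> 2 * B"
  proof -
    show "K > 0" "K \<ge> B" using B0 \<delta>(1) by (simp_all add: K_def add_nonneg_pos)
    have "K * \<delta> = 2 * B + (B + 1) * \<delta>" using \<delta>(1) by (simp add: K_def algebra_simps)
    then show "K * \<delta> \<ge> 2 * B" using B0 \<delta>(1) by simp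
  qed
  define \<psi> where "\<psi> x = (INF y. \<phi> y + K * dist x y)" for x
  have bdd: "bdd_below (range (\<lambda>y. \<phi> y + K * dist x y))" for x
  proof (rule bdd_belowI2)
    show "- B \<le> \<phi> y + K * dist x y" for y using B[of y] K(1) zero_le_dist[of x y] by (smt (verit) mult_nonneg_nonneg)
  qed
  have le: "\<psi> x \<le> \<phi> y + K * dist x y" for x y unfolding \<psi>_def by (rule cINF_lower[OF bdd]) simp
  have ge: "c \<le> \<psi> x" if "\<And>y. c \<le> \<phi> y + K * dist x y" for c x unfolding \<psi>_def by (rule cINF_greatest) (use that in auto)
  show thesis
  proof (rule that[OF K(1)])
    fix x y
    have "- B \<le> \<psi> x"
      by (rule ge) (use B K(1) zero_le_dist[of x] in \<open>smt (verit) mult_nonneg_nonneg\<close>)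
    then show "\<bar>\<psi> x\<bar> \<le> K" using le[of x x] B[of x] K(2) by simp
    have one: "\<psi> a \<le> \<psi> b + K * dist a b" for a b
    proof -
      have "\<psi> a - K * dist a b \<le> \<psi> b"
      proof (rule ge)
        fix y
        have "K * dist a y \<le> K * (dist a b + dist b y)" using K(1) by (intro mult_left_mono dist_triangle) auto
        then show "\<psi> a - K * dist a b \<le> \<phi> y + K * dist b y" using le[of a y] by (simp add: distrib_left)
      qed
      then show ?thesis by simp
    qed
    show "\<bar>\<psi> x - \<psi> y\<bar> \<le> K * dist x y" using one[of x y] one[of y x] by (simp add: dist_commute abs_le_iff)
    have "\<phi> x - e \<le> \<psi> x"
    proof (rule ge)
      fix y
      show "\<phi> x - e \<le> \<phi> y + K * dist x y"
      proof (cases "dist x y < \<delta>")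
        case True
        then show ?thesis using \<delta>(2)[OF True] K(1) zero_le_dist[of x y] by (smt (verit) mult_nonneg_nonneg)
      next
        case False
        then have "K * \<delta> \<le> K * dist x y" using K(1) by (intro mult_left_mono) auto
        then show ?thesis using K(3) B[of x] B[of y] e by linarith
      qed
    qed
    then show "\<bar>\<phi> x - \<psi> x\<bar> \<le> e" using le[of x x] e by simp
  qed
qed

text \<open>A function of \<open>BL\<close> is determined up to \<open>3 * e\<close> by its values at the points of a finite \<open>e\<close>-net, rounded to
multiples of \<open>e\<close>.\<close>

lemma BL_totally_bounded:
  assumes e: "e > 0"
  obtains R where "finite R" "R \<subseteq> BL" "R \<noteq> {}" "\<And>\<phi>. \<phi> \<in> BL \<Longrightarrow> \<exists>\<psi>\<in>R. \<forall>x. \<bar>\<phi> x - \<psi> x\<bar> \<le> 3 * e"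
proof -
  obtain F where F: "finite F" "(UNIV :: riemann_sphere set) \<subseteq> (\<Union>x\<in>F. ball x e)"
    using compactE_image[OF compact_UNIV_sphere, of UNIV "\<lambda>x. ball x e"] e by (metis UNIV_I UN_I centre_in_ball open_ball subsetI)
  define pat where "pat \<phi> = restrict (\<lambda>x. \<lfloor>\<phi> x / e\<rfloor>) F" for \<phi> :: "riemann_sphere \<Rightarrow> real"
  define k where "k = \<lceil>1 / e\<rceil> + 1"
  have "pat ` BL \<subseteq> F \<rightarrow>\<^sub>E {-k..k}"
  proof (rule image_subsetI)
    fix \<phi> assume \<phi>: "\<phi> \<in> BL"
    have "\<lfloor>\<phi> x / e\<rfloor> \<in> {-k..k}" for x
    proof -
      have "\<phi> x / e \<le> 1 / e" "- (1 / e) \<le> \<phi> x / e"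
        using BL_abs_le[OF \<phi>, of x] e by (simp_all add: field_simps abs_le_iff)
      then show ?thesis unfolding k_def by (simp add: floor_le_iff le_floor_iff) linarith
    qed
    then show "pat \<phi> \<in> F \<rightarrow>\<^sub>E {-k..k}" unfolding pat_def by (intro restrict_PiE_iff[THEN iffD2] ballI)
  qed
  then have fin: "finite (pat ` BL)" by (rule finite_subset) (intro finite_PiE F finite_atLeastAtMost_int)
  define rep where "rep q = (SOME \<psi>. \<psi> \<in> BL \<and> pat \<psi> = q)" for q
  have rep: "rep (pat \<phi>) \<in> BL \<and> pat (rep (pat \<phi>)) = pat \<phi>" if "\<phi> \<in> BL" for \<phi>
    unfolding rep_def by (rule someI[of _ \<phi>]) (use that in simp)
  show thesis
  proof (rule that[of "rep ` pat ` BL"])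
    show "finite (rep ` pat ` BL)" using fin by simp
    show "rep ` pat ` BL \<subseteq> BL" using rep by auto
    show "rep ` pat ` BL \<noteq> {}" using BL_zero by auto
    fix \<phi> assume \<phi>: "\<phi> \<in> BL"
    define \<psi> where "\<psi> = rep (pat \<phi>)"
    have \<psi>: "\<psi> \<in> BL" "pat \<psi> = pat \<phi>" using rep[OF \<phi>] by (simp_all add: \<psi>_def)
    have "\<bar>\<phi> y - \<psi> y\<bar> \<le> 3 * e" for y
    proof -
      have "y \<in> (\<Union>x\<in>F. ball x e)" using F(2) by (rule subsetD) simp
      then obtain x where x: "x \<in> F" "dist x y < e" by auto
      have "\<lfloor>\<phi> x / e\<rfloor> = \<lfloor>\<psi> x / e\<rfloor>" using fun_cong[OF \<psi>(2), of x] x(1) by (simp add: pat_def)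
      then have "\<bar>\<phi> x / e - \<psi> x / e\<bar> \<le> 1" by linarith
      then have "\<bar>\<phi> x - \<psi> x\<bar> \<le> e" using e by (simp add: diff_divide_distrib[symmetric] abs_divide divide_le_eq)
      then show ?thesis
        using BL_Lipschitz[OF \<phi>, of x y] BL_Lipschitz[OF \<psi>(1), of x y] x(2) by linarith
    qed
    moreover have "\<psi> \<in> rep ` pat ` BL" unfolding \<psi>_def using \<phi> by (intro imageI)
    ultimately show "\<exists>\<psi>\<in>rep ` pat ` BL. \<forall>x. \<bar>\<phi> x - \<psi> x\<bar> \<le> 3 * e" by (intro bexI[of _ \<psi>] allI)
  qed
qed

text \<open>Lipschitz approximation of test functions makes weakly open sets metrically open.  Conversely, by total
boundedness finitely many test functions control the supremum in \<^const>\<open>BL_dist\<close>.\<close>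

lemma mtopology_BL_dist: "Metric_space.mtopology M1 BL_dist = weak_topology"
proof -
  interpret M: Metric_space M1 BL_dist by (rule Metric_space_M1)
  let ?S = "{{\<mu> \<in> M1. (\<integral>x. \<phi> x \<partial>\<mu>) \<in> V} | (\<phi> :: riemann_sphere \<Rightarrow> real) V. continuous_on UNIV \<phi> \<and> open V}"
  have sub: "openin M.mtopology S" if S: "S \<in> ?S" for S
  proof -
    obtain \<phi> V where \<phi>: "continuous_on UNIV (\<phi> :: riemann_sphere \<Rightarrow> real)" "open V"
      and S: "S = {\<mu> \<in> M1. (\<integral>x. \<phi> x \<partial>\<mu>) \<in> V}" using S by auto
    have "\<exists>r>0. M.mball \<mu> r \<subseteq> S" if \<mu>: "\<mu> \<in> S" for \<mu>
    proof -
      have \<mu>M: "\<mu> \<in> M1" and "(\<integral>x. \<phi> x \<partial>\<mu>) \<in> V" using \<mu> S by auto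
      then obtain e where e: "e > 0" "ball (\<integral>x. \<phi> x \<partial>\<mu>) e \<subseteq> V" using \<phi>(2) openE by blast
      obtain K \<psi> where K: "K > 0" "\<And>x. \<bar>\<psi> x\<bar> \<le> K" "\<And>x y. \<bar>\<psi> x - \<psi> y\<bar> \<le> K * dist x y" "\<And>x. \<bar>\<phi> x - \<psi> x\<bar> \<le> e / 4"
        using Lipschitz_approximation[OF \<phi>(1), of "e / 4"] e(1) by (metis zero_less_divide_iff zero_less_numeral)
      have c\<psi>: "continuous_on UNIV \<psi>" by (rule Lipschitz_imp_continuous[OF less_imp_le[OF K(1)] K(3)])
      have "M.mball \<mu> (e / (4 * K)) \<subseteq> S"
      proof
        fix \<nu> assume "\<nu> \<in> M.mball \<mu> (e / (4 * K))"
        then have \<nu>: "\<nu> \<in> M1" "BL_dist \<mu> \<nu> < e / (4 * K)" by simp_all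
        have "\<bar>(\<integral>x. \<psi> x \<partial>\<mu>) - (\<integral>x. \<psi> x \<partial>\<nu>)\<bar> \<le> K * BL_dist \<mu> \<nu>"
          by (rule Lipschitz_integral_diff_le[OF \<mu>M \<nu>(1) K(1-3)])
        also have "\<dots> < e / 4" using \<nu>(2) K(1) by (simp add: field_simps)
        finally have "\<bar>(\<integral>x. \<phi> x \<partial>\<mu>) - (\<integral>x. \<phi> x \<partial>\<nu>)\<bar> < e"
          using M1_integral_diff_le[OF \<mu>M \<phi>(1) c\<psi> K(4)] M1_integral_diff_le[OF \<nu>(1) \<phi>(1) c\<psi> K(4)] e(1) by linarith
        then have "(\<integral>x. \<phi> x \<partial>\<nu>) \<in> ball (\<integral>x. \<phi> x \<partial>\<mu>) e" by (simp add: dist_real_def)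
        then show "\<nu> \<in> S" using e(2) \<nu>(1) S by auto
      qed
      moreover have "e / (4 * K) > 0" using e(1) K(1) by simp
      ultimately show ?thesis by blast
    qed
    moreover have "S \<subseteq> M1" using S by auto
    ultimately show ?thesis unfolding M.openin_mtopology by blast
  qed
  have 1: "openin M.mtopology S" if "openin weak_topology S" for S
  proof -
    have "generate_topology_on ?S S"
      using that unfolding weak_topology_def by (simp only: openin_topology_generated_by_iff)
    then show ?thesis by (rule generate_topology_on_coarsest[OF istopology_openin sub, rotated]) auto
  qed
  have basic: "openin weak_topology {\<mu> \<in> M1. (\<integral>x. \<phi> x \<partial>\<mu>) \<in> V}" if "\<phi> \<in> BL" "open V" for \<phi> V
    unfolding weak_topology_def
    by (rule topology_generated_by_Basis) (use BL_continuous[OF that(1)] that(2) in blast)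
  have 2: "openin weak_topology S" if S: "openin M.mtopology S" for S
  proof (subst openin_subopen, rule ballI)
    fix \<mu> assume \<mu>: "\<mu> \<in> S"
    have SM: "S \<subseteq> M1" using S unfolding M.openin_mtopology by simp
    then have \<mu>M: "\<mu> \<in> M1" using \<mu> by blast
    obtain r where r: "r > 0" "M.mball \<mu> r \<subseteq> S" using S \<mu> unfolding M.openin_mtopology by blast
    obtain R where R: "finite R" "R \<subseteq> BL" "R \<noteq> {}" "\<And>\<phi>. \<phi> \<in> BL \<Longrightarrow> \<exists>\<psi>\<in>R. \<forall>x. \<bar>\<phi> x - \<psi> x\<bar> \<le> 3 * (r / 16)"
      by (rule BL_totally_bounded[of "r / 16"]) (use r in auto)
    define N where "N = (\<Inter>\<psi>\<in>R. {\<nu> \<in> M1. (\<integral>x. \<psi> x \<partial>\<nu>) \<in> ball (\<integral>x. \<psi> x \<partial>\<mu>) (r / 4)})"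
    have "openin weak_topology N" unfolding N_def
    proof (rule openin_INT2[OF R(1) R(3)])
      show "openin weak_topology {\<nu> \<in> M1. (\<integral>x. \<psi> x \<partial>\<nu>) \<in> ball (\<integral>x. \<psi> x \<partial>\<mu>) (r / 4)}" if "\<psi> \<in> R" for \<psi>
        using R(2) that by (intro basic) auto
    qed
    moreover have "\<mu> \<in> N" using \<mu>M r(1) by (simp add: N_def)
    moreover have "N \<subseteq> M.mball \<mu> r"
    proof
      fix \<nu> assume \<nu>: "\<nu> \<in> N"
      then have \<nu>M: "\<nu> \<in> M1" using R(3) by (auto simp: N_def)
      have "BL_dist \<mu> \<nu> \<le> 3 * r / 4"
      proof (rule BL_dist_le)
        fix \<phi> assume \<phi>: "\<phi> \<in> BL"
        obtain \<psi> where \<psi>: "\<psi> \<in> R" "\<forall>x. \<bar>\<phi> x - \<psi> x\<bar> \<le> 3 * (r / 16)" using R(4)[OF \<phi>] by (elim bexE)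
        have \<psi>BL: "\<psi> \<in> BL" using R(2) \<psi>(1) by (rule subsetD)
        have "\<bar>(\<integral>x. \<psi> x \<partial>\<mu>) - (\<integral>x. \<psi> x \<partial>\<nu>)\<bar> < r / 4"
          using \<nu> \<psi>(1) by (simp add: N_def dist_real_def)
        then show "\<bar>(\<integral>x. \<phi> x \<partial>\<mu>) - (\<integral>x. \<phi> x \<partial>\<nu>)\<bar> \<le> 3 * r / 4"
          using M1_integral_diff_le[OF \<mu>M BL_continuous[OF \<phi>] BL_continuous[OF \<psi>BL] \<psi>(2)[rule_format]]
            M1_integral_diff_le[OF \<nu>M BL_continuous[OF \<phi>] BL_continuous[OF \<psi>BL] \<psi>(2)[rule_format]] r(1)
          by linarith
      qed
      then show "\<nu> \<in> M.mball \<mu> r" using \<mu>M \<nu>M r(1) by simp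
    qed
    ultimately show "\<exists>T. openin weak_topology T \<and> \<mu> \<in> T \<and> T \<subseteq> S" using r(2) by blast
  qed
  show ?thesis unfolding topology_eq using 1 2 by blast
qed

section \<open>Equicontinuity of the dual transition operators\<close>

context osc_system
begin

definition Avg :: "(riemann_sphere \<Rightarrow> real) \<Rightarrow> riemann_sphere \<Rightarrow> real" where
  "Avg \<phi> z = (\<Sum>j\<in>{1..m}. p j * \<phi> (h j z))"

lemma M_op_eq:
  assumes "continuous_on UNIV \<phi>"
  shows "M_op step \<phi> z = Avg \<phi> z"
  unfolding M_op_def Avg_def
  by (rule integral_step[of "\<lambda>g. \<phi> (g z)"])
    (rule measurable_compose[OF measurable_eval_Rat borel_measurable_continuous_onI[OF assms]])

lemma Avg_continuous:
  assumes \<phi>: "continuous_on UNIV \<phi>"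
  shows "continuous_on UNIV (Avg \<phi>)"
  unfolding Avg_def[abs_def]
proof (rule continuous_on_sum)
  fix j assume j: "j \<in> {1..m}"
  have "continuous_on UNIV (\<lambda>z. \<phi> (h j z))"
    by (rule continuous_on_compose2[OF \<phi> hmap_continuous_on[OF hmap_h[OF j]]]) simp
  then show "continuous_on UNIV (\<lambda>z. p j * \<phi> (h j z))" by (intro continuous_intros)
qed

text \<open>The measure is the law of the image of a random point under an independent random letter.\<close>

lemma M_dual_exists:
  assumes \<mu>: "\<mu> \<in> M1"
  shows "\<exists>\<nu>. \<nu> \<in> M1 \<and> (\<forall>\<phi>. continuous_on UNIV \<phi> \<longrightarrow> (\<integral>x. \<phi> x \<partial>\<nu>) = (\<integral>x. M_op step \<phi> x \<partial>\<mu>))"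
proof -
  interpret \<mu>: prob_space \<mu> by (rule M1_D[OF \<mu>])
  interpret pair_prob_space "measure_pmf letters" \<mu> by unfold_locales
  define E where "E z = map_of_letter (fst z) (snd z)" for z
  have "E \<in> borel_measurable (measure_pmf letters \<Otimes>\<^sub>M \<mu>)"
    unfolding E_def
  proof (rule measurable_compose_countable'[where I = UNIV and f = "\<lambda>j z. map_of_letter j (snd z)" and g = fst])
    fix j
    have "map_of_letter j \<in> borel_measurable borel"
      by (rule borel_measurable_continuous_onI) (intro hmap_continuous_on Rat_imp_hmap map_of_letter_Rat)
    then have "map_of_letter j \<in> borel_measurable \<mu>"
      using measurable_cong_sets[OF M1_D(2)[OF \<mu>] refl, of borel] by metis
    then show "(\<lambda>z. map_of_letter j (snd z)) \<in> borel_measurable (measure_pmf letters \<Otimes>\<^sub>M \<mu>)"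
      by (rule measurable_compose[OF measurable_snd])
    have "fst \<in> measure_pmf letters \<Otimes>\<^sub>M \<mu> \<rightarrow>\<^sub>M measure_pmf letters" by (rule measurable_fst)
    then show "fst \<in> measure_pmf letters \<Otimes>\<^sub>M \<mu> \<rightarrow>\<^sub>M count_space UNIV"
      by (simp only: measurable_cong_sets[OF refl sets_measure_pmf_count_space])
  qed simp
  note E = this
  define \<nu> where "\<nu> = distr (measure_pmf letters \<Otimes>\<^sub>M \<mu>) borel E"
  have "\<nu> \<in> M1" unfolding M1_def \<nu>_def
    using prob_space_distr[OF E] by simp
  moreover have "(\<integral>x. \<phi> x \<partial>\<nu>) = (\<integral>x. M_op step \<phi> x \<partial>\<mu>)" if \<phi>: "continuous_on UNIV \<phi>" for \<phi>
  proof -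
    have m\<phi>: "\<phi> \<in> borel_measurable borel" by (rule borel_measurable_continuous_onI[OF \<phi>])
    have int: "integrable (measure_pmf letters \<Otimes>\<^sub>M \<mu>) (\<lambda>z. \<phi> (E z))"
      using M1_integrable[OF \<open>\<nu> \<in> M1\<close> \<phi>] unfolding \<nu>_def by (rule integrable_distr[OF E])
    have "(\<integral>x. \<phi> x \<partial>\<nu>) = (\<integral>z. \<phi> (E z) \<partial>(measure_pmf letters \<Otimes>\<^sub>M \<mu>))"
      unfolding \<nu>_def by (rule integral_distr[OF E m\<phi>])
    also have "\<dots> = (\<integral>x. (\<integral>j. \<phi> (map_of_letter j x) \<partial>measure_pmf letters) \<partial>\<mu>)"
      using integral_snd[of "\<lambda>j x. \<phi> (map_of_letter j x)"] int by (simp add: E_def case_prod_unfold)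
    also have "\<dots> = (\<integral>x. M_op step \<phi> x \<partial>\<mu>)"
    proof (rule Bochner_Integration.integral_cong[OF refl])
      fix x
      have "(\<integral>j. \<phi> (map_of_letter j x) \<partial>measure_pmf letters) = (\<Sum>j\<in>{1..m}. pmf letters j *\<^sub>R \<phi> (map_of_letter j x))"
        by (rule integral_measure_pmf) (simp_all add: set_letters)
      also have "\<dots> = Avg \<phi> x" unfolding Avg_def
        by (rule sum.cong) (simp_all add: map_of_letter_def pmf_letters)
      finally show "(\<integral>j. \<phi> (map_of_letter j x) \<partial>measure_pmf letters) = M_op step \<phi> x"
        by (simp add: M_op_eq[OF \<phi>])
    qed
    finally show ?thesis .
  qed
  ultimately show ?thesis by blast
qed

lemma M_dual_spec:
  assumes \<mu>: "\<mu> \<in> M1"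
  shows "M_dual step \<mu> \<in> M1"
    and "continuous_on UNIV \<phi> \<Longrightarrow> (\<integral>x. \<phi> x \<partial>(M_dual step \<mu>)) = (\<integral>x. Avg \<phi> x \<partial>\<mu>)"
proof -
  define P where "P \<nu> \<longleftrightarrow> \<nu> \<in> M1 \<and> (\<forall>\<phi>. continuous_on UNIV \<phi> \<longrightarrow> (\<integral>x. \<phi> x \<partial>\<nu>) = (\<integral>x. M_op step \<phi> x \<partial>\<mu>))" for \<nu>
  obtain \<nu> where \<nu>: "P \<nu>" using M_dual_exists[OF \<mu>] unfolding P_def by (elim exE)
  have "\<kappa> = \<nu>" if \<kappa>: "P \<kappa>" for \<kappa>
  proof (rule M1_eqI)
    fix \<phi> assume "\<phi> \<in> BL"
    then show "(\<integral>x. \<phi> x \<partial>\<kappa>) = (\<integral>x. \<phi> x \<partial>\<nu>)" using \<nu> \<kappa> BL_continuous unfolding P_def by simp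
  qed (use \<nu> \<kappa> in \<open>simp_all add: P_def\<close>)
  then have "P (M_dual step \<mu>)"
    unfolding M_dual_def P_def[symmetric] using \<nu> by (rule theI[rotated])
  then show "M_dual step \<mu> \<in> M1"
    and "continuous_on UNIV \<phi> \<Longrightarrow> (\<integral>x. \<phi> x \<partial>(M_dual step \<mu>)) = (\<integral>x. Avg \<phi> x \<partial>\<mu>)"
    unfolding P_def by (simp_all add: M_op_eq cong: Bochner_Integration.integral_cong)
qed

lemma M_dual_iterate:
  "(M_dual step ^^ n) (return borel z) \<in> M1"
  "continuous_on UNIV \<phi> \<Longrightarrow> (\<integral>x. \<phi> x \<partial>((M_dual step ^^ n) (return borel z))) = (Avg ^^ n) \<phi> z"
proof -
  show M: "(M_dual step ^^ n) (return borel z) \<in> M1" for n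
  proof (induction n)
    case 0
    then show ?case by (simp add: M1_def prob_space_return)
  next
    case (Suc n)
    then show ?case using M_dual_spec(1) by simp
  qed
  show "(\<integral>x. \<phi> x \<partial>((M_dual step ^^ n) (return borel z))) = (Avg ^^ n) \<phi> z" if "continuous_on UNIV \<phi>"
    using that
  proof (induction n arbitrary: \<phi>)
    case 0
    then show ?case by (simp add: integral_return borel_measurable_continuous_onI)
  next
    case (Suc n)
    have "(\<integral>x. \<phi> x \<partial>((M_dual step ^^ Suc n) (return borel z))) = (\<integral>x. Avg \<phi> x \<partial>((M_dual step ^^ n) (return borel z)))"
      using M_dual_spec(2)[OF M Suc.prems] by simp
    also have "\<dots> = (Avg ^^ n) (Avg \<phi>) z" by (rule Suc.IH[OF Avg_continuous[OF Suc.prems]])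
    also have "\<dots> = (Avg ^^ Suc n) \<phi> z" by (simp only: funpow_Suc_right o_apply)
    finally show ?case .
  qed
qed

lemma Avg_diff_le:
  assumes "\<And>j. j \<in> {1..m} \<Longrightarrow> \<bar>\<phi> (h j a) - \<phi> (h j b)\<bar> \<le> c j"
  shows "\<bar>Avg \<phi> a - Avg \<phi> b\<bar> \<le> (\<Sum>j\<in>{1..m}. p j * c j)"
proof -
  have "Avg \<phi> a - Avg \<phi> b = (\<Sum>j\<in>{1..m}. p j * (\<phi> (h j a) - \<phi> (h j b)))"
    unfolding Avg_def by (simp add: sum_subtractf right_diff_distrib)
  also have "\<bar>\<dots>\<bar> \<le> (\<Sum>j\<in>{1..m}. \<bar>p j * (\<phi> (h j a) - \<phi> (h j b))\<bar>)" by (rule sum_abs)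
  also have "\<dots> \<le> (\<Sum>j\<in>{1..m}. p j * c j)"
  proof (rule sum_mono)
    fix j assume j: "j \<in> {1..m}"
    show "\<bar>p j * (\<phi> (h j a) - \<phi> (h j b))\<bar> \<le> p j * c j"
      using assms[OF j] p_bounds[OF j] by (simp add: abs_mult)
  qed
  finally show ?thesis .
qed

lemma p_sum_const: "(\<Sum>j\<in>{1..m}. p j * c) = c"
  using p_sum by (simp add: sum_distrib_right[symmetric])

lemma Avg_iterate_abs_le:
  assumes "\<phi> \<in> BL"
  shows "\<bar>(Avg ^^ N) \<phi> z\<bar> \<le> 1"
proof (induction N arbitrary: z)
  case 0
  then show ?case using BL_abs_le[OF assms] by simp
next
  case (Suc N)
  have "\<bar>(Avg ^^ Suc N) \<phi> z\<bar> \<le> (\<Sum>j\<in>{1..m}. \<bar>p j * (Avg ^^ N) \<phi> (h j z)\<bar>)"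
    by (simp add: Avg_def sum_abs)
  also have "\<dots> \<le> (\<Sum>j\<in>{1..m}. p j * 1)"
  proof (rule sum_mono)
    fix j assume j: "j \<in> {1..m}"
    show "\<bar>p j * (Avg ^^ N) \<phi> (h j z)\<bar> \<le> p j * 1" using Suc[of "h j z"] p_bounds[OF j] by (simp add: abs_mult)
  qed
  also have "\<dots> = 1" by (rule p_sum_const)
  finally show ?case .
qed

lemma Avg_iterate_diff_le:
  assumes "\<phi> \<in> BL" and "\<And>g. g \<in> insert id GG \<Longrightarrow> dist (g a) (g b) \<le> e"
  shows "\<bar>(Avg ^^ N) \<phi> a - (Avg ^^ N) \<phi> b\<bar> \<le> e"
  using assms(2)
proof (induction N arbitrary: a b)
  case 0
  then show ?case using BL_Lipschitz[OF assms(1), of a b] 0[of id] by simp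
next
  case (Suc N)
  have "\<bar>(Avg ^^ N) \<phi> (h j a) - (Avg ^^ N) \<phi> (h j b)\<bar> \<le> e" if j: "j \<in> {1..m}" for j
  proof (rule Suc.IH)
    fix g assume "g \<in> insert id GG"
    then have "g \<circ> h j \<in> GG" using h_GG[OF j] gen_semigroup.compose by auto
    then have "dist ((g \<circ> h j) a) ((g \<circ> h j) b) \<le> e" by (intro Suc.prems insertI2)
    then show "dist (g (h j a)) (g (h j b)) \<le> e" by (simp only: o_apply)
  qed
  then have "\<bar>Avg ((Avg ^^ N) \<phi>) a - Avg ((Avg ^^ N) \<phi>) b\<bar> \<le> (\<Sum>j\<in>{1..m}. p j * e)"
    by (rule Avg_diff_le)
  then show ?case unfolding p_sum_const by simp
qed

text \<open>The oscillation at \<open>x\<close> of all iterated averages of functions in \<open>BL\<close>, composed with \<open>f\<close>, is at most \<open>c\<close>.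
The averages represent the dual iterates, and the uniformity in \<open>N\<close> and \<open>\<phi>\<close> corresponds to equicontinuity
in \<^const>\<open>BL_dist\<close>.\<close>

definition small_osc :: "riemann_sphere \<Rightarrow> (riemann_sphere \<Rightarrow> riemann_sphere) \<Rightarrow> real \<Rightarrow> bool" where
  "small_osc x f c \<longleftrightarrow> (\<forall>e>0. eventually (\<lambda>y. \<forall>N. \<forall>\<phi>\<in>BL. \<bar>(Avg ^^ N) \<phi> (f y) - (Avg ^^ N) \<phi> (f x)\<bar> \<le> c + e) (nhds x))"

lemma small_osc_2: "small_osc x f 2"
  unfolding small_osc_def
proof (intro allI impI always_eventually ballI)
  fix e :: real and y N \<phi> assume "e > 0" "\<phi> \<in> BL"
  then show "\<bar>(Avg ^^ N) \<phi> (f y) - (Avg ^^ N) \<phi> (f x)\<bar> \<le> 2 + e"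
    using Avg_iterate_abs_le[of \<phi> N "f y"] Avg_iterate_abs_le[of \<phi> N "f x"] by linarith
qed

text \<open>An iterated average of \<open>\<phi>\<close> is a convex combination of functions \<open>\<phi> \<circ> g\<close>, where \<open>g\<close> is the identity or lies in the
semigroup.\<close>

lemma small_osc_equicontinuous:
  assumes eq: "equicontinuous_at (insert f ((\<lambda>g. g \<circ> f) ` GG)) x"
  shows "small_osc x f 0"
  unfolding small_osc_def
proof (intro allI impI)
  fix e :: real assume "e > 0"
  then obtain d where d: "d > 0" "\<forall>k\<in>insert f ((\<lambda>g. g \<circ> f) ` GG). \<forall>y. dist y x < d \<longrightarrow> dist (k y) (k x) < e"
    using eq unfolding equicontinuous_at_def by (elim allE impE exE conjE)
  have "\<bar>(Avg ^^ N) \<phi> (f y) - (Avg ^^ N) \<phi> (f x)\<bar> \<le> 0 + e" if y: "dist y x < d" and \<phi>: "\<phi> \<in> BL" for y N \<phi>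
    unfolding add_0
  proof (rule Avg_iterate_diff_le[OF \<phi>])
    fix g assume g: "g \<in> insert id GG"
    have "g \<circ> f \<in> insert f ((\<lambda>g. g \<circ> f) ` GG)"
      using g
    proof
      assume "g \<in> GG"
      then show ?thesis by (intro insertI2 image_eqI[of _ _ g] refl)
    qed (simp only: id_comp insertI1)
    then have "dist ((g \<circ> f) y) ((g \<circ> f) x) < e" using d(2)[THEN bspec, THEN spec, THEN mp] y by (simp only:)
    then show "dist (g (f y)) (g (f x)) \<le> e" by (simp only: o_apply less_imp_le)
  qed
  then show "eventually (\<lambda>y. \<forall>N. \<forall>\<phi>\<in>BL. \<bar>(Avg ^^ N) \<phi> (f y) - (Avg ^^ N) \<phi> (f x)\<bar> \<le> 0 + e) (nhds x)"
    unfolding eventually_nhds_metric using d(1) by (intro exI[of _ d]) simp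
qed

text \<open>One average is a convex combination over the letters, of which only \<open>j0\<close> has oscillation; at \<open>N = 0\<close> there is
no average, and continuity of \<open>f\<close> is used instead.\<close>

lemma small_osc_step:
  assumes f: "isCont f x" and j0: "j0 \<in> {1..m}" and c0: "small_osc x (h j0 \<circ> f) c"
    and rest: "\<And>j. j \<in> {1..m} \<Longrightarrow> j \<noteq> j0 \<Longrightarrow> small_osc x (h j \<circ> f) 0" and c: "c \<ge> 0"
  shows "small_osc x f (p j0 * c)"
  unfolding small_osc_def
proof (intro allI impI)
  fix e :: real assume e: "e > 0"
  define cc where "cc j = (if j = j0 then c else 0)" for j
  have all: "small_osc x (h j \<circ> f) (cc j)" if "j \<in> {1..m}" for j
    using c0 rest[OF that] by (simp add: cc_def)
  have ev: "eventually (\<lambda>y. \<forall>j\<in>{1..m}. \<forall>N. \<forall>\<phi>\<in>BL. \<bar>(Avg ^^ N) \<phi> ((h j \<circ> f) y) - (Avg ^^ N) \<phi> ((h j \<circ> f) x)\<bar> \<le> cc j + e) (nhds x)"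
    by (rule eventually_ball_finite) (use all e in \<open>auto simp: small_osc_def\<close>)
  have evf: "eventually (\<lambda>y. f y \<in> ball (f x) e) (nhds x)"
    by (rule isCont_eventually_in[OF f]) (use e in auto)
  have sum: "(\<Sum>j\<in>{1..m}. p j * (cc j + e)) = p j0 * c + e"
  proof -
    have "(\<Sum>j\<in>{1..m}. p j * (cc j + e)) = (\<Sum>j\<in>{1..m}. p j * cc j) + (\<Sum>j\<in>{1..m}. p j * e)"
      by (simp add: distrib_left sum.distrib)
    also have "(\<Sum>j\<in>{1..m}. p j * cc j) = (\<Sum>j\<in>{1..m}. if j = j0 then p j * c else 0)"
      by (rule sum.cong) (auto simp: cc_def)
    also have "\<dots> = p j0 * c" using j0 by (simp add: sum.delta)
    finally show ?thesis by (simp only: p_sum_const)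
  qed
  show "eventually (\<lambda>y. \<forall>N. \<forall>\<phi>\<in>BL. \<bar>(Avg ^^ N) \<phi> (f y) - (Avg ^^ N) \<phi> (f x)\<bar> \<le> p j0 * c + e) (nhds x)"
    using ev evf
  proof eventually_elim
    case (elim y)
    show ?case
    proof (intro allI ballI)
      fix N \<phi> assume \<phi>: "\<phi> \<in> BL"
      show "\<bar>(Avg ^^ N) \<phi> (f y) - (Avg ^^ N) \<phi> (f x)\<bar> \<le> p j0 * c + e"
      proof (cases N)
        case 0
        have "p j0 * c \<ge> 0" using p_bounds[OF j0] c by simp
        moreover have "dist (f y) (f x) < e" using elim(2) by (simp add: dist_commute)
        ultimately show ?thesis using BL_Lipschitz[OF \<phi>, of "f y" "f x"] 0 by simp
      next
        case (Suc N')
        have "\<bar>Avg ((Avg ^^ N') \<phi>) (f y) - Avg ((Avg ^^ N') \<phi>) (f x)\<bar> \<le> (\<Sum>j\<in>{1..m}. p j * (cc j + e))"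
          by (rule Avg_diff_le) (use elim(1) \<phi> in simp)
        then show ?thesis using Suc sum by simp
      qed
    qed
  qed
qed

text \<open>The orbit stays in \<open>U\<close>, so at each time the side branches are equicontinuous; starting from the trivial
bound \<open>2\<close> at time \<open>k + n\<close>, each step back gains the probability of a letter.\<close>

lemma small_osc_orbit:
  assumes w: "w \<in> words m" and x: "\<And>n. orb w n x \<in> U"
  shows "small_osc x (orb w k) (2 * (\<Prod>i<n. p (w (k + i))))"
proof (induction n arbitrary: k)
  case 0
  then show ?case using small_osc_2 by simp
next
  case (Suc n)
  have "small_osc x (orb w k) (p (w k) * (2 * (\<Prod>i<n. p (w (Suc k + i)))))"
  proof (rule small_osc_step)
    show "isCont (orb w k) x" by (rule hmap_isCont[OF hmap_orb[OF w]])
    show "w k \<in> {1..m}" by (rule words_letter[OF w])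
    show "small_osc x (h (w k) \<circ> orb w k) (2 * (\<Prod>i<n. p (w (Suc k + i))))" using Suc[of "Suc k"] by (simp only: iter_comp.simps)
    show "small_osc x (h j \<circ> orb w k) 0" if "j \<in> {1..m}" "j \<noteq> w k" for j
      by (rule small_osc_equicontinuous[OF equicontinuous_off_branch[OF w x that]])
    show "2 * (\<Prod>i<n. p (w (Suc k + i))) \<ge> 0"
    proof -
      have "0 \<le> p (w i)" for i using p_bounds[OF words_letter[OF w, of i]] by simp
      then show ?thesis by (simp add: prod_nonneg)
    qed
  qed
  moreover have "p (w k) * (2 * (\<Prod>i<n. p (w (Suc k + i)))) = 2 * (\<Prod>i<Suc n. p (w (k + i)))"
    unfolding prod.lessThan_Suc_shift by simp
  ultimately show ?case by (simp only:)
qed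

lemma F_pt0_orbit:
  assumes w: "w \<in> words m" and x: "\<And>n. orb w n x \<in> U"
  shows "x \<in> F_pt0 step"
proof -
  have "\<exists>d>0. \<forall>n\<ge>1. \<forall>z. dist z x < d \<longrightarrow>
      BL_dist ((M_dual step ^^ n) (return borel z)) ((M_dual step ^^ n) (return borel x)) < e" if e: "e > 0" for e
  proof -
    have "eventually (\<lambda>n. weight w n < e / 8) sequentially"
      by (rule order_tendstoD(2)[OF weight_tendsto_0[OF w]]) (use e in simp)
    then obtain k where k: "weight w k < e / 8" unfolding eventually_sequentially by (metis order_refl)
    have "small_osc x (orb w 0) (2 * weight w k)"
      using small_osc_orbit[OF w x, where k = 0 and n = k] by (simp add: weight_def)
    moreover have "e / 4 > 0" using e by simp
    ultimately have "eventually (\<lambda>y. \<forall>N. \<forall>\<phi>\<in>BL. \<bar>(Avg ^^ N) \<phi> (orb w 0 y) - (Avg ^^ N) \<phi> (orb w 0 x)\<bar>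
        \<le> 2 * weight w k + e / 4) (nhds x)" unfolding small_osc_def by (elim allE impE)
    then obtain d where d: "d > 0" "\<And>y N \<phi>. dist y x < d \<Longrightarrow> \<phi> \<in> BL \<Longrightarrow>
        \<bar>(Avg ^^ N) \<phi> y - (Avg ^^ N) \<phi> x\<bar> \<le> 2 * weight w k + e / 4"
      unfolding eventually_nhds_metric by auto
    have "BL_dist ((M_dual step ^^ n) (return borel z)) ((M_dual step ^^ n) (return borel x)) < e"
      if z: "dist z x < d" for n z
    proof -
      have "BL_dist ((M_dual step ^^ n) (return borel z)) ((M_dual step ^^ n) (return borel x)) \<le> 2 * weight w k + e / 4"
        by (rule BL_dist_le) (use d(2)[OF z] in \<open>simp add: M_dual_iterate(2)[OF BL_continuous]\<close>)
      then show ?thesis using k e by linarith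
    qed
    then show ?thesis using d(1) by blast
  qed
  then show ?thesis unfolding F_pt0_def mem_Collect_eq
    by (intro exI[of _ BL_dist] conjI Metric_space_M1 mtopology_BL_dist allI impI)
qed

end

section \<open>Ergodic sums\<close>

locale ergodic_system = prob_space M for M :: "'a measure" +
  fixes \<Theta> :: "'a \<Rightarrow> 'a"
  assumes inv: "invariant_measure M \<Theta>" and erg: "ergodic_measure M \<Theta>"
begin

lemma \<Theta>_measurable [measurable]: "\<Theta> \<in> M \<rightarrow>\<^sub>M M" and distr_\<Theta>: "distr M M \<Theta> = M"
  using inv by (simp_all add: invariant_measure_def)

lemma \<Theta>_space: "x \<in> space M \<Longrightarrow> \<Theta> x \<in> space M"
  using measurable_space[OF \<Theta>_measurable] .

lemma iterate_measurable: "(\<Theta> ^^ n) \<in> M \<rightarrow>\<^sub>M M"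
proof (induction n)
  case (Suc n)
  from measurable_comp[OF this \<Theta>_measurable] show ?case by simp
qed (simp add: id_def)

lemma integrable_\<Theta>:
  fixes g :: "'a \<Rightarrow> real"
  assumes "integrable M g"
  shows "integrable M (\<lambda>x. g (\<Theta> x))" "(\<integral>x. g (\<Theta> x) \<partial>M) = (\<integral>x. g x \<partial>M)"
proof -
  have g: "g \<in> borel_measurable M" using assms by simp
  show "integrable M (\<lambda>x. g (\<Theta> x))"
    using integrable_distr_eq[OF \<Theta>_measurable g] assms by (simp add: distr_\<Theta>)
  show "(\<integral>x. g (\<Theta> x) \<partial>M) = (\<integral>x. g x \<partial>M)"
    using integral_distr[OF \<Theta>_measurable g] by (simp add: distr_\<Theta>)
qed

definition bsum :: "('a \<Rightarrow> real) \<Rightarrow> nat \<Rightarrow> 'a \<Rightarrow> real" where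
  "bsum g n x = (\<Sum>i<n. g ((\<Theta> ^^ i) x))"

lemma bsum_0 [simp]: "bsum g 0 x = 0"
  by (simp add: bsum_def)

lemma bsum_Suc: "bsum g (Suc n) x = g x + bsum g n (\<Theta> x)"
  unfolding bsum_def by (subst sum.lessThan_Suc_shift) (simp add: funpow_swap1)

lemma bsum_measurable:
  assumes "g \<in> borel_measurable M"
  shows "bsum g n \<in> borel_measurable M"
  unfolding bsum_def[abs_def]
  by (intro borel_measurable_sum measurable_compose[OF iterate_measurable assms])

text \<open>The maximum of \<open>0\<close> and the first \<open>n\<close> ergodic sums, in the recursive form that Garsia's argument uses.\<close>

primrec max_bsum :: "('a \<Rightarrow> real) \<Rightarrow> nat \<Rightarrow> 'a \<Rightarrow> real" where
  "max_bsum g 0 x = 0"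
| "max_bsum g (Suc n) x = max 0 (g x + max_bsum g n (\<Theta> x))"

lemma max_bsum_nonneg: "max_bsum g n x \<ge> 0"
  by (cases n) simp_all

lemma max_bsum_mono: "max_bsum g n x \<le> max_bsum g (Suc n) x"
proof (induction n arbitrary: x)
  case (Suc n)
  have "g x + max_bsum g n (\<Theta> x) \<le> g x + max_bsum g (Suc n) (\<Theta> x)" using Suc[of "\<Theta> x"] by simp
  then show ?case unfolding max_bsum.simps(2)[of g "Suc n"] max_bsum.simps(2)[of g n x] by (rule max.mono[OF order_refl])
qed simp

lemma bsum_le_max_bsum: "bsum g n x \<le> max_bsum g n x"
proof (induction n arbitrary: x)
  case (Suc n)
  have "bsum g (Suc n) x \<le> g x + max_bsum g n (\<Theta> x)" using Suc[of "\<Theta> x"] by (simp add: bsum_Suc)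
  then show ?case by simp
qed simp

lemma max_bsum_integrable:
  assumes "integrable M g"
  shows "integrable M (max_bsum g n)"
proof (induction n)
  case 0
  then show ?case by simp
next
  case (Suc n)
  have "integrable M (\<lambda>x. max 0 (g x + max_bsum g n (\<Theta> x)))"
    by (rule integrable_max[OF integrable_zero
          Bochner_Integration.integrable_add[OF assms integrable_\<Theta>(1)[OF Suc]]])
  then show ?case by simp
qed

text \<open>Garsia's argument: where the maximum \<open>max_bsum g n\<close> is positive, \<open>max_bsum g n x \<le> g x + max_bsum g n (\<Theta> x)\<close>, and the
integrals of \<open>max_bsum g n\<close> and \<open>max_bsum g n \<circ> \<Theta>\<close> agree.\<close>

lemma maximal_ergodic:
  assumes g: "integrable M g"
  shows "0 \<le> (\<integral>x. indicator {x. \<exists>n. max_bsum g n x > 0} x * g x \<partial>M)"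
proof -
  define I where "I n x = indicator {x. max_bsum g n x > 0} x * g x" for n x
  have meas [measurable]: "max_bsum g n \<in> borel_measurable M" "g \<in> borel_measurable M" for n
    using max_bsum_integrable[OF g] g by simp_all
  have ge: "max_bsum g n x - max_bsum g n (\<Theta> x) \<le> I n x" for n x
  proof (cases "max_bsum g n x > 0")
    case True
    then obtain k where n: "n = Suc k" by (cases n) auto
    have "max_bsum g n x = g x + max_bsum g k (\<Theta> x)" using True n by (simp add: max_def split: if_splits)
    also have "\<dots> \<le> g x + max_bsum g n (\<Theta> x)" using max_bsum_mono[of g k "\<Theta> x"] n by simp
    finally show ?thesis using True by (simp add: I_def)
  next
    case False
    then show ?thesis using max_bsum_nonneg[of g n "\<Theta> x"] by (simp add: I_def)
  qed
  have Im: "I n \<in> borel_measurable M" for n unfolding I_def by measurable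
  have Iint: "integrable M (I n)" for n
    by (rule Bochner_Integration.integrable_bound[OF g Im]) (simp add: I_def indicator_def)
  have I0: "0 \<le> (\<integral>x. I n x \<partial>M)" for n
  proof -
    have "0 = (\<integral>x. max_bsum g n x - max_bsum g n (\<Theta> x) \<partial>M)"
      using max_bsum_integrable[OF g, of n] integrable_\<Theta>[OF max_bsum_integrable[OF g, of n]] by simp
    also have "\<dots> \<le> (\<integral>x. I n x \<partial>M)"
      using max_bsum_integrable[OF g, of n] integrable_\<Theta>[OF max_bsum_integrable[OF g, of n]] Iint ge
      by (intro integral_mono) auto
    finally show ?thesis .
  qed
  have "(\<lambda>n. \<integral>x. I n x \<partial>M) \<longlonglongrightarrow> (\<integral>x. indicator {x. \<exists>n. max_bsum g n x > 0} x * g x \<partial>M)"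
  proof (rule integral_dominated_convergence[where w = "\<lambda>x. \<bar>g x\<bar>"])
    show "(\<lambda>x. indicator {x. \<exists>n. max_bsum g n x > 0} x * g x) \<in> borel_measurable M" by measurable
    show "integrable M (\<lambda>x. \<bar>g x\<bar>)" using g by simp
    show "AE x in M. norm (I n x) \<le> \<bar>g x\<bar>" for n by (simp add: I_def indicator_def)
    show "AE x in M. (\<lambda>n. I n x) \<longlonglongrightarrow> indicator {x. \<exists>n. max_bsum g n x > 0} x * g x"
    proof (intro always_eventually allI)
      fix x
      show "(\<lambda>n. I n x) \<longlonglongrightarrow> indicator {x. \<exists>n. max_bsum g n x > 0} x * g x"
      proof (cases "\<exists>n. max_bsum g n x > 0")
        case True
        then obtain N where N: "max_bsum g N x > 0" by (elim exE)
        have "max_bsum g n x > 0" if "n \<ge> N" for n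
          using lift_Suc_mono_le[of "\<lambda>n. max_bsum g n x", OF max_bsum_mono that] N by simp
        then have "eventually (\<lambda>n. I n x = g x) sequentially"
          unfolding eventually_sequentially by (intro exI[of _ N]) (simp add: I_def)
        then show ?thesis using True by (simp add: tendsto_eventually)
      next
        case False
        then show ?thesis by (simp add: I_def)
      qed
    qed
  qed (rule Im)
  then show ?thesis by (rule LIMSEQ_le_const) (use I0 in blast)
qed

text \<open>Let \<open>\<epsilon>\<close> be half the mean of \<open>f\<close> and \<open>g x = \<epsilon> - f x\<close>.  By ergodicity the ergodic sums of \<open>g\<close> are unbounded above almost
everywhere or bounded above almost everywhere.  The former is impossible by the maximal ergodic theorem,
because \<open>g\<close> has negative mean.  In the latter case the sums of \<open>f\<close> grow at least like \<open>n * \<epsilon>\<close>.\<close>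

theorem bsum_tendsto_infinity:
  assumes f: "integrable M f" and pos: "(\<integral>x. f x \<partial>M) > 0"
  shows "AE x in M. filterlim (\<lambda>n. bsum f n x) at_top sequentially"
proof -
  define \<epsilon> where "\<epsilon> = (\<integral>x. f x \<partial>M) / 2"
  define g where "g x = \<epsilon> - f x" for x
  have g: "integrable M g" unfolding g_def using f by simp
  have gm: "g \<in> borel_measurable M" using g by simp
  have gint: "(\<integral>x. g x \<partial>M) < 0" unfolding g_def using f pos by (simp add: prob_space \<epsilon>_def)
  have bs: "bsum g n x = real n * \<epsilon> - bsum f n x" for n x
    by (simp add: bsum_def g_def sum_subtractf)
  define B where "B = {x \<in> space M. \<forall>k::nat. \<exists>n. bsum g n x > real k}"
  have B: "B \<in> sets M"
  proof -
    have "{x \<in> space M. bsum g n x > real k} \<in> sets M" for n k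
      using bsum_measurable[OF gm, of n] by measurable
    then show ?thesis unfolding B_def
      by (intro sets.sets_Collect_countable_All sets.sets_Collect_countable_Ex)
  qed
  have unb: "(\<forall>k::nat. \<exists>n. bsum g n x > real k) \<longleftrightarrow> (\<forall>k::nat. \<exists>n. bsum g n (\<Theta> x) > real k)" for x
  proof
    assume *: "\<forall>k::nat. \<exists>n. bsum g n x > real k"
    show "\<forall>k::nat. \<exists>n. bsum g n (\<Theta> x) > real k"
    proof
      fix k :: nat
      obtain l :: nat where l: "real k + \<bar>g x\<bar> \<le> real l" using real_arch_simple by blast
      obtain n where n: "bsum g n x > real l" using * by blast
      then obtain n' where "n = Suc n'" by (cases n) auto
      then have "bsum g n' (\<Theta> x) > real k" using n l by (simp add: bsum_Suc)
      then show "\<exists>n. bsum g n (\<Theta> x) > real k" by blast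
    qed
  next
    assume *: "\<forall>k::nat. \<exists>n. bsum g n (\<Theta> x) > real k"
    show "\<forall>k::nat. \<exists>n. bsum g n x > real k"
    proof
      fix k :: nat
      obtain l :: nat where l: "real k + \<bar>g x\<bar> \<le> real l" using real_arch_simple by blast
      obtain n where n: "bsum g n (\<Theta> x) > real l" using * by blast
      then have "bsum g (Suc n) x > real k" using l by (simp add: bsum_Suc)
      then show "\<exists>n. bsum g n x > real k" by blast
    qed
  qed
  have "\<Theta> -` B \<inter> space M = B"
  proof (rule set_eqI)
    fix x
    show "x \<in> \<Theta> -` B \<inter> space M \<longleftrightarrow> x \<in> B"
      unfolding B_def using unb[of x] \<Theta>_space[of x] by auto
  qed
  then have "emeasure M B = 0 \<or> emeasure M (space M - B) = 0"
    using erg B unfolding ergodic_measure_def by blast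
  then show ?thesis
  proof
    assume "emeasure M B = 0"
    then have "AE x in M. x \<notin> B" using B by (intro AE_not_in null_setsI)
    then show ?thesis
    proof (rule AE_mp, intro AE_I2 impI)
      fix x assume "x \<in> space M" "x \<notin> B"
      then have "\<not> (\<forall>k::nat. \<exists>n. bsum g n x > real k)" by (simp add: B_def)
      then obtain k :: nat where k: "\<And>n. bsum g n x \<le> real k" by (meson not_le)
      have le: "real n * \<epsilon> - real k \<le> bsum f n x" for n using bs[of n x] k[of n] by linarith
      have "\<epsilon> > 0" using pos by (simp add: \<epsilon>_def)
      then have "filterlim (\<lambda>n. real n * \<epsilon> - real k) at_top sequentially" by real_asymp
      then show "filterlim (\<lambda>n. bsum f n x) at_top sequentially"
        by (rule filterlim_at_top_mono) (intro always_eventually allI le)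
    qed
  next
    assume "emeasure M (space M - B) = 0"
    then have "AE x in M. x \<in> B" using B by (intro AE_I[of _ _ "space M - B"]) auto
    then have "AE x in M. indicator {x. \<exists>n. max_bsum g n x > 0} x * g x = g x"
    proof (rule AE_mp, intro AE_I2 impI)
      fix x assume "x \<in> B"
      then obtain n where "bsum g n x > real 0" unfolding B_def by blast
      then have "max_bsum g n x > 0" using bsum_le_max_bsum[of g n x] by simp
      then have "\<exists>n. max_bsum g n x > 0" by (rule exI)
      then show "indicator {x. \<exists>n. max_bsum g n x > 0} x * g x = g x" by simp
    qed
    then have "(\<integral>x. indicator {x. \<exists>n. max_bsum g n x > 0} x * g x \<partial>M) = (\<integral>x. g x \<partial>M)"
      by (rule integral_cong_AE[rotated 2]) (use gm max_bsum_integrable[OF g] in measurable)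
    then show ?thesis using maximal_ergodic[OF g] gint by simp
  qed
qed

lemma ergodic_recurrence:
  assumes A: "A \<in> sets M" and pos: "emeasure M A > 0"
  shows "AE x in M. \<exists>\<^sub>\<infinity>n. (\<Theta> ^^ n) x \<in> A"
proof -
  have int: "integrable M (indicator A :: 'a \<Rightarrow> real)"
    using A by (simp add: integrable_indicator_iff emeasure_eq_measure)
  have "(\<integral>x. indicator A x \<partial>M) = measure M A" using A by simp
  then have "(\<integral>x. (indicator A x :: real) \<partial>M) > 0" using pos by (simp add: emeasure_eq_measure)
  from bsum_tendsto_infinity[OF int this] show ?thesis
  proof eventually_elim
    case (elim x)
    show ?case
    proof (rule ccontr)
      assume "\<not> (\<exists>\<^sub>\<infinity>n. (\<Theta> ^^ n) x \<in> A)"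
      then have fin: "finite {n. (\<Theta> ^^ n) x \<in> A}" by (simp add: INFM_iff_infinite)
      have bd: "bsum (indicator A) n x \<le> real (card {n. (\<Theta> ^^ n) x \<in> A})" for n
      proof -
        have "bsum (indicator A) n x = real (card ({..<n} \<inter> {n. (\<Theta> ^^ n) x \<in> A}))"
          unfolding bsum_def by (simp add: indicator_def sum.If_cases)
        also have "\<dots> \<le> real (card {n. (\<Theta> ^^ n) x \<in> A})" using card_mono[OF fin] by simp
        finally show ?thesis .
      qed
      have "eventually (\<lambda>n. bsum (indicator A) n x \<ge> real (card {n. (\<Theta> ^^ n) x \<in> A}) + 1) sequentially"
        using elim unfolding filterlim_at_top by blast
      then obtain n where "bsum (indicator A) n x \<ge> real (card {n. (\<Theta> ^^ n) x \<in> A}) + 1"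
        unfolding eventually_sequentially by blast
      then show False using bd[of n] by simp
    qed
  qed
qed

text \<open>The union of the preimages of \<open>A\<close> under the iterates is invariant, and it has the measure of \<open>A\<close> because the
preimages increase.\<close>

lemma ergodic_forward_invariant:
  assumes A: "A \<in> sets M" and fwd: "\<And>x. x \<in> A \<Longrightarrow> \<Theta> x \<in> A" and pos: "emeasure M A > 0"
  shows "AE x in M. x \<in> A"
proof -
  define B where "B n = (\<Theta> ^^ n) -` A \<inter> space M" for n
  have Bs: "B n \<in> sets M" for n unfolding B_def using iterate_measurable A by (rule measurable_sets)
  have inc: "incseq B"
    by (rule incseq_SucI) (auto simp: B_def fwd)
  have shift: "emeasure M (B n) = emeasure M A" for n
  proof (induction n)
    case 0
    have "B 0 = A" using sets.sets_into_space[OF A] by (auto simp: B_def)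
    then show ?case by simp
  next
    case (Suc n)
    have "emeasure M (B n) = emeasure (distr M M \<Theta>) (B n)" by (simp only: distr_\<Theta>)
    also have "\<dots> = emeasure M (\<Theta> -` B n \<inter> space M)" by (rule emeasure_distr[OF \<Theta>_measurable Bs])
    also have "\<Theta> -` B n \<inter> space M = B (Suc n)"
      unfolding B_def using \<Theta>_space by (auto simp: funpow_swap1)
    finally show ?case using Suc by simp
  qed
  have "range B \<subseteq> sets M" using Bs by blast
  from SUP_emeasure_incseq[OF this inc] have eq: "emeasure M (\<Union>n. B n) = emeasure M A"
    by (simp add: shift)
  have Us: "(\<Union>n. B n) \<in> sets M" using Bs by (intro sets.countable_UN) blast
  have sub: "A \<subseteq> (\<Union>n. B n)" using sets.sets_into_space[OF A] by (auto simp: B_def intro!: exI[of _ 0])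
  have "\<Theta> -` (\<Union>n. B n) \<inter> space M = (\<Union>n. B n)"
  proof (rule set_eqI, rule iffI)
    fix x assume "x \<in> \<Theta> -` (\<Union>n. B n) \<inter> space M"
    then obtain n where "(\<Theta> ^^ n) (\<Theta> x) \<in> A" "x \<in> space M" by (auto simp: B_def)
    then have "x \<in> B (Suc n)" by (simp add: B_def funpow_swap1)
    then show "x \<in> (\<Union>n. B n)" by blast
  next
    fix x assume "x \<in> (\<Union>n. B n)"
    then obtain n where n: "(\<Theta> ^^ n) x \<in> A" "x \<in> space M" by (auto simp: B_def)
    then have "(\<Theta> ^^ n) (\<Theta> x) \<in> A" using fwd by (simp add: funpow_swap1[symmetric])
    then have "\<Theta> x \<in> B n" using \<Theta>_space n(2) by (simp add: B_def)
    then show "x \<in> \<Theta> -` (\<Union>n. B n) \<inter> space M" using n(2) by blast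
  qed
  then have "emeasure M (\<Union>n. B n) = 0 \<or> emeasure M (space M - (\<Union>n. B n)) = 0"
    using erg Us unfolding ergodic_measure_def by blast
  then have "emeasure M (space M - (\<Union>n. B n)) = 0" using eq pos by auto
  then have "prob (\<Union>n. B n) = 1"
    using prob_compl[OF Us] by (simp add: emeasure_eq_measure)
  then have "prob A = 1" using eq by (simp add: emeasure_eq_measure)
  then show ?thesis using A by (simp add: prob_eq_1)
qed

end

section \<open>Difference quotients along returns\<close>

lemma sph_deriv_norm_nonneg: "sph_deriv_norm f x \<ge> 0"
  by (simp add: sph_deriv_norm_def)

text \<open>A single pair of homogeneous coordinates represents the map near \<open>x\<close>, and the Wronskian formula expresses the
derivative norm at all nearby points through this pair.\<close>

lemma sph_deriv_norm_isCont:
  assumes g: "hmap g"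
  shows "isCont (sph_deriv_norm g) x"
proof -
  define \<zeta> where "\<zeta> = chart x x"
  have "mero_at (g \<circ> chart_inv x) \<zeta>" using g mero_at_chart_inv unfolding hmap_def by blast
  then obtain A B r where r: "r > 0" and rep: "hom_rep A B (g \<circ> chart_inv x) (ball \<zeta> r)"
    unfolding mero_at_def by blast
  have hol: "A holomorphic_on ball \<zeta> r" "B holomorphic_on ball \<zeta> r" using rep unfolding hom_rep_def by auto
  define k where "k w = cmod (deriv A w * B w - A w * deriv B w) / ((cmod (A w))\<^sup>2 + (cmod (B w))\<^sup>2) * (1 + (cmod w)\<^sup>2)" for w
  have eq: "sph_deriv_norm g (chart_inv x w) = k w" if w: "w \<in> ball \<zeta> r" for w
  proof -
    obtain s where s: "s > 0" "ball w s \<subseteq> ball \<zeta> r" by (rule openE[OF open_ball w])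
    have "sph_speed (g \<circ> chart_inv x) w = sph_deriv_norm g (chart_inv x w) * (1 / (1 + (cmod w)\<^sup>2))"
      using sph_speed_chain[OF g mero_at_chart_inv, of x w] by (simp only: sph_speed_chart_inv)
    moreover have "1 + (cmod w)\<^sup>2 \<noteq> 0" by (metis add_pos_nonneg less_irrefl zero_le_power2 zero_less_one)
    ultimately show ?thesis
      using sph_speed_hom_rep(1)[OF hom_rep_subset[OF rep s(2)] s(1)] by (simp add: k_def field_simps)
  qed
  have \<zeta>b: "\<zeta> \<in> ball \<zeta> r" using r by simp
  have nz: "A \<zeta> \<noteq> 0 \<or> B \<zeta> \<noteq> 0" using rep \<zeta>b unfolding hom_rep_def by auto
  have cont: "isCont u \<zeta>" if "u holomorphic_on ball \<zeta> r" for u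
    using holomorphic_on_imp_continuous_on[OF that] \<zeta>b by (simp add: continuous_on_eq_continuous_at)
  have "isCont k \<zeta>" unfolding k_def
    using cont[OF hol(1)] cont[OF hol(2)] cont[OF holomorphic_deriv[OF hol(1) open_ball]]
      cont[OF holomorphic_deriv[OF hol(2) open_ball]] hom_norm_pos[OF nz]
    by (intro continuous_intros) auto
  then have "isCont (\<lambda>y. k (chart x y)) x"
    unfolding \<zeta>_def by (rule isCont_o2[OF isCont_chart])
  moreover have "eventually (\<lambda>y. chart x y \<in> ball \<zeta> r) (nhds x)"
    by (rule isCont_eventually_in[OF isCont_chart]) (use r in \<open>auto simp: \<zeta>_def\<close>)
  with eventually_chart_inv_chart_self[of x]
  have "eventually (\<lambda>y. k (chart x y) = sph_deriv_norm g y) (nhds x)"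
    by eventually_elim (use eq in metis)
  ultimately show ?thesis using isCont_cong by fastforce
qed

lemma sph_deriv_norm_continuous: "hmap g \<Longrightarrow> continuous_on UNIV (sph_deriv_norm g)"
  by (simp add: continuous_at_imp_continuous_on sph_deriv_norm_isCont)

context osc_system
begin

lemma sph_deriv_norm_orb:
  assumes "w \<in> words m"
  shows "sph_deriv_norm (orb w n) x = (\<Prod>i<n. sph_deriv_norm (h (w i)) (orb w i x))"
proof (induction n)
  case 0
  have "sph_speed (id \<circ> chart_inv x) (chart x x) * (1 + (cmod (chart x x))\<^sup>2) = 1"
    using sph_speed_chart_inv[of x "chart x x"] by (simp add: add_nonneg_eq_0_iff)
  then show ?case by (simp only: iter_comp.simps sph_deriv_norm_eq_speed lessThan_0 prod.empty)
next
  case (Suc n)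
  have "sph_deriv_norm (h (w n) \<circ> orb w n) x = sph_deriv_norm (h (w n)) (orb w n x) * sph_deriv_norm (orb w n) x"
    by (rule sph_deriv_norm_comp[OF hmap_h[OF words_letter[OF assms]] hmap_orb[OF assms]])
  then show ?case unfolding iter_comp.simps prod.lessThan_Suc Suc by (simp only: mult.commute)
qed

lemma critical_value_postcritical:
  assumes "g \<in> GG" "local_deriv g x = 0"
  shows "g x \<in> postcritical GG"
proof -
  have "g x \<in> CV g" unfolding CV_def using assms(2) by (intro imageI) simp
  then have "g x \<in> (\<Union>g\<in>GG. CV g)" using assms(1) by (rule UN_I[rotated])
  then show ?thesis unfolding postcritical_def using closure_subset by (rule subsetD[rotated])
qed

text \<open>Around a Julia point of \<open>U - P(G)\<close> there is a disc with inverse branches for every return, and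
  on it \<open>T\<close> takes two different values.  At a return, one of these two values differs from the value
  at the orbit point; pulling it back scales the difference by the weight of the word.\<close>

lemma return_estimate:
  assumes ne: "nonconst \<inter> U \<noteq> {}" and y0: "y0 \<in> Julia GG" "y0 \<in> U" "y0 \<notin> postcritical GG"
  obtains N C \<eta> where "open N" "y0 \<in> N" "N \<subseteq> U" "C > 0" "\<eta> > 0"
    "\<And>w n x. w \<in> words m \<Longrightarrow> n \<ge> 1 \<Longrightarrow> orb w n x \<in> N \<Longrightarrow>
      \<exists>z. z \<noteq> x \<and> dist z x * sph_deriv_norm (orb w n) x \<le> C \<and> \<bar>T z - T x\<bar> \<ge> \<eta> * weight w n"
proof -
  have y0L: "y0 \<notin> L" using L_Fatou y0(1) by (auto simp: Julia_def)
  define \<epsilon> where "\<epsilon> = infdist y0 L / 2"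
  have "infdist y0 L > 0"
    using y0L L_ne compact_imp_closed[OF compact_L] infdist_nonneg[of y0 L]
    by (metis in_closed_iff_infdist_zero order_le_less)
  then have \<epsilon>: "\<epsilon> > 0" "\<epsilon> < infdist y0 L" by (simp_all add: \<epsilon>_def)
  obtain \<delta>' where \<delta>': "\<delta>' > 0" "\<And>x g. infdist x L < \<delta>' \<Longrightarrow> g \<in> GG \<Longrightarrow> infdist (g x) L < \<epsilon>"
    by (rule equicontinuous_near_L[OF \<epsilon>(1)]) blast
  \<comment> \<open>the disc of radius \<open>\<delta>\<close> about a finite point \<open>q\<close> near \<open>L\<close> is mapped by the semigroup into the \<open>\<epsilon>\<close>-neighbourhood of \<open>L\<close>, hence away from \<open>y0\<close>\<close>
  define \<delta> where "\<delta> = min \<delta>' \<epsilon> / 2"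
  have \<delta>: "\<delta> > 0" using \<delta>'(1) \<epsilon>(1) by (simp add: \<delta>_def)
  obtain a where a: "a \<in> L" using L_ne by auto
  obtain q where q: "Fin q \<in> ball a \<delta>" by (rule open_contains_Fin[of "ball a \<delta>"]) (use \<delta> in auto)
  have near_q: "infdist z L < min \<delta>' \<epsilon>" if "z \<in> ball (Fin q) \<delta>" for z
  proof -
    have "dist z a \<le> dist z (Fin q) + dist (Fin q) a" by (rule dist_triangle)
    also have "\<dots> < \<delta> + \<delta>" using that q by (intro add_strict_mono) (auto simp: dist_commute)
    finally show ?thesis using infdist_le[OF a, of z] by (simp add: \<delta>_def)
  qed
  have y0q: "y0 \<noteq> Fin q" using near_q[of "Fin q"] \<delta> \<epsilon>(2) by auto
  define V where "V = (U - postcritical GG) \<inter> {y. \<epsilon> < infdist y L}"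
  have "open {y. \<epsilon> < infdist y L}" by (intro open_Collect_less continuous_intros)
  then have Vo: "open V" unfolding V_def postcritical_def
    by (intro open_Int open_Diff U_open closed_closure)
  define c where "c = coord q y0"
  have "open (away q -` V)" using Vo by (rule open_vimage) (rule continuous_on_away)
  moreover have "c \<in> away q -` V" using y0 y0q \<epsilon>(2) by (simp add: c_def V_def)
  ultimately obtain R where R: "R > 0" "ball c R \<subseteq> away q -` V" by (rule openE)
  define \<rho> where "\<rho> = R / 4"
  have \<rho>: "\<rho> > 0" using R by (simp add: \<rho>_def)
  have inV: "away q u \<in> V" if "u \<in> ball c (4 * \<rho>)" for u using R(2) that by (auto simp: \<rho>_def)
  define N where "N = (- {Fin q}) \<inter> coord q -` ball c \<rho>"
  have No: "open N" unfolding N_def by (intro continuous_open_preimage continuous_on_coord) auto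
  have y0N: "y0 \<in> N" using y0q \<rho> by (simp add: N_def c_def)
  have NU: "N \<subseteq> U"
  proof
    fix y assume "y \<in> N"
    then have "y \<noteq> Fin q" "coord q y \<in> ball c (4 * \<rho>)" using \<rho> by (auto simp: N_def)
    then show "y \<in> U" using inV[of "coord q y"] by (simp add: V_def)
  qed
  obtain b1 b2 where b: "b1 \<in> N" "b2 \<in> N" "T b1 \<noteq> T b2"
    using T_nonconstant_near_Julia[OF ne y0(1) No y0N] by (elim bexE)
  define \<eta> where "\<eta> = \<bar>T b1 - T b2\<bar> / 2"
  have \<eta>: "\<eta> > 0" using b(3) by (simp add: \<eta>_def)
  have "3 * \<rho> > 0" using \<rho> by simp
  then obtain C where C: "C > 0" and branch: "\<And>g x0 c. hmap g \<Longrightarrow>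
    (\<And>x. local_deriv g x = 0 \<Longrightarrow> g x \<notin> away q ` ball c (3 * \<rho>)) \<Longrightarrow>
    (\<And>x. x \<in> ball (Fin q) \<delta> \<Longrightarrow> g x \<notin> away q ` ball c (3 * \<rho>)) \<Longrightarrow> g x0 = away q c \<Longrightarrow>
    \<exists>\<Psi>. continuous_on (ball c (3 * \<rho>)) \<Psi> \<and> \<Psi> c = x0 \<and> (\<forall>w\<in>ball c (3 * \<rho>). g (\<Psi> w) = away q w) \<and>
      (\<forall>w\<in>cball c (2 / 3 * (3 * \<rho>)). dist (\<Psi> w) x0 * sph_deriv_norm g x0 \<le> C)"
    by (rule inverse_branch_estimate[OF \<delta>, of "3 * \<rho>" q]) blast
  show thesis
  proof (rule that[OF No y0N NU C \<eta>])
    fix w n x assume w: "w \<in> words m" and n: "n \<ge> 1" and xN: "orb w n x \<in> N"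
    define g where "g = orb w n"
    have gG: "g \<in> GG" unfolding g_def by (rule orb_GG[OF w n])
    define c' where "c' = coord q (g x)"
    have gxq: "g x \<noteq> Fin q" and c': "dist c c' < \<rho>" using xN by (auto simp: N_def g_def c'_def)
    have gx: "g x = away q c'" using gxq by (simp add: c'_def)
    have sub: "ball c' (3 * \<rho>) \<subseteq> ball c (4 * \<rho>)"
    proof
      fix u assume "u \<in> ball c' (3 * \<rho>)"
      then show "u \<in> ball c (4 * \<rho>)" using c' dist_triangle[of c u c'] by simp
    qed
    have imV: "y \<in> V" if "y \<in> away q ` ball c' (3 * \<rho>)" for y
      using that inV sub by auto
    obtain \<Psi> where \<Psi>: "continuous_on (ball c' (3 * \<rho>)) \<Psi>" "\<Psi> c' = x"
      "\<forall>u\<in>ball c' (3 * \<rho>). g (\<Psi> u) = away q u"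
      "\<forall>u\<in>cball c' (2 / 3 * (3 * \<rho>)). dist (\<Psi> u) x * sph_deriv_norm g x \<le> C"
    proof -
      have "\<exists>\<Psi>. continuous_on (ball c' (3 * \<rho>)) \<Psi> \<and> \<Psi> c' = x \<and> (\<forall>w\<in>ball c' (3 * \<rho>). g (\<Psi> w) = away q w) \<and>
        (\<forall>w\<in>cball c' (2 / 3 * (3 * \<rho>)). dist (\<Psi> w) x * sph_deriv_norm g x \<le> C)"
      proof (rule branch[OF hmap_GG[OF gG] _ _ gx])
        fix z assume "local_deriv g z = 0"
        then have "g z \<in> postcritical GG" by (rule critical_value_postcritical[OF gG])
        then show "g z \<notin> away q ` ball c' (3 * \<rho>)" using imV[of "g z"] by (auto simp: V_def)
      next
        fix z assume "z \<in> ball (Fin q) \<delta>"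
        then have "infdist (g z) L < \<epsilon>" using \<delta>'(2)[OF _ gG] near_q by simp
        then show "g z \<notin> away q ` ball c' (3 * \<rho>)" using imV[of "g z"] by (auto simp: V_def)
      qed
      then show thesis by (elim exE conjE) (rule that)
    qed
    have "\<exists>b\<in>N. \<bar>T b - T (g x)\<bar> \<ge> \<eta>"
    proof (cases "\<bar>T b1 - T (g x)\<bar> \<ge> \<eta>")
      case False
      moreover have "\<bar>T b1 - T b2\<bar> \<le> \<bar>T b1 - T (g x)\<bar> + \<bar>T b2 - T (g x)\<bar>" by linarith
      ultimately have "\<bar>T b2 - T (g x)\<bar> \<ge> \<eta>" unfolding \<eta>_def by simp
      then show ?thesis using b(2) by (intro bexI[of _ b2])
    qed (use b(1) in \<open>intro bexI[of _ b1]\<close>)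
    then obtain b where b: "b \<in> N" "\<bar>T b - T (g x)\<bar> \<ge> \<eta>" by (elim bexE)
    define u where "u = coord q b"
    have bq: "away q u = b" and uc: "dist c u < \<rho>" using b(1) by (auto simp: N_def u_def)
    have "dist c' u < 2 * \<rho>" using dist_triangle[of c' u c] uc c' by (simp add: dist_commute)
    then have u: "u \<in> ball c' (3 * \<rho>)" "u \<in> cball c' (2 / 3 * (3 * \<rho>))" using \<rho> by auto
    have c'b: "c' \<in> ball c' (3 * \<rho>)" using \<rho> by simp
    have gU: "orb w n (\<Psi> v) \<in> U" if "v \<in> ball c' (3 * \<rho>)" for v
    proof -
      have "g (\<Psi> v) = away q v" using \<Psi>(3) that by (rule bspec)
      then have "g (\<Psi> v) \<in> V" using inV sub that by auto
      then show ?thesis by (simp add: g_def V_def)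
    qed
    have "T (\<Psi> u) - T (\<Psi> c') = weight w n * (T (orb w n (\<Psi> u)) - T (orb w n (\<Psi> c')))"
      by (rule T_connected_product[OF w \<Psi>(1) gU u(1) c'b])
    moreover have "orb w n (\<Psi> u) = b" using \<Psi>(3)[THEN bspec, OF u(1)] bq by (simp add: g_def)
    ultimately have "T (\<Psi> u) - T x = weight w n * (T b - T (g x))" using \<Psi>(2) by (simp add: g_def)
    then have "\<bar>T (\<Psi> u) - T x\<bar> = weight w n * \<bar>T b - T (g x)\<bar>"
      using weight_pos[OF w, of n] by (simp add: abs_mult)
    also have "\<dots> \<ge> weight w n * \<eta>" using b(2) weight_pos[OF w, of n] by (intro mult_left_mono) auto
    finally have big: "\<eta> * weight w n \<le> \<bar>T (\<Psi> u) - T x\<bar>" by (simp only: mult.commute)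
    have "0 < \<eta> * weight w n" using \<eta> weight_pos[OF w] by simp
    then have "\<Psi> u \<noteq> x" using big by auto
    moreover have "dist (\<Psi> u) x * sph_deriv_norm (orb w n) x \<le> C"
      using \<Psi>(4)[THEN bspec, OF u(2)] by (simp add: g_def)
    ultimately show "\<exists>z. z \<noteq> x \<and> dist z x * sph_deriv_norm (orb w n) x \<le> C \<and> \<bar>T z - T x\<bar> \<ge> \<eta> * weight w n"
      using big by (intro exI[of _ "\<Psi> u"] conjI)
  qed
qed

lemma weight_le_1:
  assumes w: "w \<in> words m"
  shows "weight w n \<le> 1"
  unfolding weight_def
  by (rule prod_le_1) (use p_bounds[OF words_letter[OF w]] in \<open>auto intro: less_imp_le\<close>)

text \<open>At a return the pulled back point has distance at most \<open>C / D\<close> from \<open>x\<close>, where \<open>D\<close> is the derivative of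
\<open>orb w n\<close> at \<open>x\<close>, and \<open>T\<close> differs there by at least \<open>\<eta> * weight w n\<close>.  So the difference quotient is at least a constant
times \<open>weight w n * D powr \<beta>\<close>, and \<open>lim\<close> is the divergence of the logarithm of this product for the
smaller exponent \<open>\<beta>'\<close>.\<close>

lemma Hoelder_quotient_unbounded:
  assumes w: "w \<in> words m" and ret: "\<exists>\<^sub>\<infinity>n. orb w n x \<in> N" and C: "C > 0" and \<eta>: "\<eta> > 0"
    and est: "\<And>n. n \<ge> 1 \<Longrightarrow> orb w n x \<in> N \<Longrightarrow>
      \<exists>z. z \<noteq> x \<and> dist z x * sph_deriv_norm (orb w n) x \<le> C \<and> \<bar>T z - T x\<bar> \<ge> \<eta> * weight w n"
    and \<beta>': "\<beta>' > 0" and \<beta>: "\<beta>' \<le> \<beta>"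
    and pos: "\<And>n. sph_deriv_norm (orb w n) x > 0"
    and lim: "filterlim (\<lambda>n. \<beta>' * ln (sph_deriv_norm (orb w n) x) + ln (weight w n)) at_top sequentially"
    and bd: "Limsup (at x) (\<lambda>z. ereal (\<bar>T z - T x\<bar> / dist z x powr \<beta>)) < \<infinity>"
  shows False
proof -
  define D where "D n = sph_deriv_norm (orb w n) x" for n
  have D: "D n > 0" for n using pos by (simp add: D_def)
  have wp: "weight w n > 0" "weight w n \<le> 1" for n using weight_pos[OF w] weight_le_1[OF w] by auto
  obtain B :: nat where "Limsup (at x) (\<lambda>z. ereal (\<bar>T z - T x\<bar> / dist z x powr \<beta>)) < ereal (real B)"
    using bd less_PInf_Ex_of_nat[of "Limsup (at x) (\<lambda>z. ereal (\<bar>T z - T x\<bar> / dist z x powr \<beta>))"] by auto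
  then have "eventually (\<lambda>z. ereal (\<bar>T z - T x\<bar> / dist z x powr \<beta>) < ereal (real B)) (at x)"
    by (rule Limsup_lessD)
  then obtain d where d: "d > 0" "\<And>z. z \<noteq> x \<Longrightarrow> dist z x < d \<Longrightarrow> \<bar>T z - T x\<bar> / dist z x powr \<beta> < real B"
    unfolding eventually_at by auto
  \<comment> \<open>once \<open>weight w n * D n powr \<beta>\<close> exceeds \<open>Q\<close>, the difference quotient exceeds its supposed bound \<open>B\<close>\<close>
  define Q where "Q = max (real B * C powr \<beta> / \<eta>) 1"
  have Q: "Q \<ge> 1" "real B * C powr \<beta> \<le> Q * \<eta>"
  proof -
    show "Q \<ge> 1" by (simp add: Q_def)
    have "real B * C powr \<beta> / \<eta> \<le> Q" by (simp add: Q_def)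
    then show "real B * C powr \<beta> \<le> Q * \<eta>" using \<eta> by (simp add: divide_le_eq)
  qed
  \<comment> \<open>the first bound makes the quotient exceed \<open>B\<close>, the other two make the pulled back point close to \<open>x\<close>\<close>
  define M0 where "M0 = max (ln Q + 1) (max 0 (\<beta>' * ln (C / d) + 1))"
  have "eventually (\<lambda>n. \<beta>' * ln (D n) + ln (weight w n) \<ge> M0) sequentially"
    using lim unfolding filterlim_at_top D_def by (rule spec)
  then obtain n0 where n0: "\<And>n. n \<ge> n0 \<Longrightarrow> \<beta>' * ln (D n) + ln (weight w n) \<ge> M0"
    unfolding eventually_sequentially by blast
  obtain n where n: "n > max n0 1" "orb w n x \<in> N"
    using ret unfolding INFM_nat by blast
  have big: "\<beta>' * ln (D n) + ln (weight w n) \<ge> M0" using n0[of n] n by simp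
  have lnw: "ln (weight w n) \<le> 0" using wp[of n] by simp
  have "\<beta>' * ln (D n) \<ge> 0" using big lnw by (simp add: M0_def)
  then have lnD: "ln (D n) \<ge> 0" using \<beta>' by (simp add: zero_le_mult_iff)
  have "\<beta>' * ln (D n) > \<beta>' * ln (C / d)" using big lnw by (simp add: M0_def)
  then have "ln (C / d) < ln (D n)" using \<beta>' by simp
  then have "C / d < D n" using C d D by simp
  then have Cd: "C / D n < d" using d D[of n] by (simp add: field_simps)
  obtain z where z: "z \<noteq> x" "dist z x * D n \<le> C" "\<bar>T z - T x\<bar> \<ge> \<eta> * weight w n"
    using est[of n] n unfolding D_def by auto
  have dz: "dist z x > 0" using z(1) by simp
  have dle: "dist z x \<le> C / D n" using z(2) D[of n] by (simp add: le_divide_eq)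
  then have "\<bar>T z - T x\<bar> / dist z x powr \<beta> < real B" using d(2)[OF z(1)] Cd by simp
  then have "\<bar>T z - T x\<bar> < real B * dist z x powr \<beta>" using dz by (simp add: divide_less_eq)
  also have "\<dots> \<le> real B * (C / D n) powr \<beta>"
    using dle dz \<beta> \<beta>' by (intro mult_left_mono powr_mono2) auto
  also have "\<dots> = real B * C powr \<beta> / D n powr \<beta>" using C D[of n] by (simp add: powr_divide)
  finally have "\<eta> * weight w n * D n powr \<beta> < real B * C powr \<beta>"
    using z(3) D[of n] by (simp add: less_divide_eq) (meson mult_right_mono order_le_less_trans powr_ge_zero)
  also have "\<dots> \<le> Q * \<eta>" by (rule Q(2))
  finally have lt: "weight w n * D n powr \<beta> < Q" using \<eta> by (simp add: mult_ac)
  have "ln (weight w n * D n powr \<beta>) = \<beta> * ln (D n) + ln (weight w n)"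
    using wp[of n] D[of n] by (simp add: ln_mult ln_powr)
  moreover have "\<beta>' * ln (D n) \<le> \<beta> * ln (D n)" using \<beta> lnD by (rule mult_right_mono)
  ultimately have "ln (weight w n * D n powr \<beta>) \<ge> ln Q + 1" using big by (simp add: M0_def)
  moreover have "ln (weight w n * D n powr \<beta>) < ln Q"
    using lt Q wp[of n] D[of n] by simp
  ultimately show False by simp
qed

end

section \<open>The invariant measure of the skew product\<close>

lemma closed_words: "closed (words m)"
proof -
  have "words m = (\<Inter>n. (\<lambda>w. w n) -` {1..m})" by (auto simp: words_def)
  moreover have "closed ((\<lambda>w :: nat \<Rightarrow> nat. w n) -` {1..m})" for n
  proof (rule closed_vimage)
    show "closed {1..m}" by (intro finite_imp_closed) simp
    show "continuous_on UNIV (\<lambda>w :: nat \<Rightarrow> nat. w n)" by (rule continuous_on_product_coordinates)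
  qed
  ultimately show ?thesis by (simp add: closed_INT)
qed

lemma skew_Julia_words: "z \<in> skew_Julia m h \<Longrightarrow> fst z \<in> words m"
proof -
  assume z: "z \<in> skew_Julia m h"
  have "skew_Julia m h \<subseteq> words m \<times> UNIV"
    unfolding skew_Julia_def by (rule closure_minimal) (auto intro!: closed_Times closed_words)
  then show ?thesis using z by auto
qed

text \<open>Otherwise open null sets cover \<open>Q\<close>, and countably many of them suffice.\<close>

lemma support_point:
  fixes Q :: "riemann_sphere set"
  assumes sets: "sets \<mu> = sets borel" and Q: "Q \<in> sets borel" "emeasure \<mu> Q > 0"
  shows "\<exists>y\<in>Q. \<forall>N. open N \<longrightarrow> y \<in> N \<longrightarrow> emeasure \<mu> N > 0"
proof (rule ccontr)
  assume neg: "\<not> ?thesis"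
  define \<F> where "\<F> = {N. open N \<and> emeasure \<mu> N = 0}"
  have cov: "Q \<subseteq> \<Union>\<F>"
  proof
    fix y assume "y \<in> Q"
    then obtain N where "open N" "y \<in> N" "\<not> emeasure \<mu> N > 0" using neg by metis
    then show "y \<in> \<Union>\<F>" unfolding \<F>_def by (intro UnionI[of N]) (simp_all add: zero_less_iff_neq_zero)
  qed
  obtain \<F>' where F: "\<F>' \<subseteq> \<F>" "countable \<F>'" "\<Union>\<F>' = \<Union>\<F>"
    by (rule Lindelof[of \<F>]) (auto simp: \<F>_def)
  have "(\<Union>N\<in>\<F>'. N) \<in> null_sets \<mu>"
    by (rule null_sets_UN'[OF F(2)]) (use F(1) sets in \<open>auto simp: \<F>_def null_sets_def\<close>)
  then have "\<Union>\<F>' \<in> null_sets \<mu>" by simp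
  moreover have "Q \<subseteq> \<Union>\<F>'" using cov F(3) by simp
  ultimately have "Q \<in> null_sets \<mu>" using null_sets_subset[of _ \<mu> Q] Q(1) sets by simp
  then show False using Q(2) by (simp add: null_sets_def)
qed

locale skew_system = osc_system +
  fixes M :: "((nat \<Rightarrow> nat) \<times> riemann_sphere) measure"
  assumes sets_M: "sets M = sets (restrict_space borel (skew_Julia m h))"
    and prob_M: "prob_space M" and inv_M: "invariant_measure M (skew h)" and erg_M: "ergodic_measure M (skew h)"
    and lyap: "lyapunov h M > 0"

sublocale skew_system \<subseteq> E: ergodic_system M "skew h"
  using prob_M inv_M erg_M by (intro ergodic_system.intro ergodic_system_axioms.intro)

context skew_system
begin

lemma space_M: "space M = skew_Julia m h"
  using sets_eq_imp_space_eq[OF sets_M] by (simp add: space_restrict_space)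

lemma words_M: "z \<in> space M \<Longrightarrow> fst z \<in> words m"
  using skew_Julia_words by (simp add: space_M)

lemma measurable_M:
  assumes "f \<in> borel \<rightarrow>\<^sub>M K"
  shows "f \<in> M \<rightarrow>\<^sub>M K"
proof -
  have "f \<in> restrict_space borel (skew_Julia m h) \<rightarrow>\<^sub>M K" using assms by (rule measurable_restrict_space1)
  then show ?thesis by (simp only: measurable_cong_sets[OF sets_M refl])
qed

lemma measurable_point: "snd \<in> borel_measurable M"
  by (intro measurable_M borel_measurable_continuous_onI continuous_intros)

lemma measurable_letter: "(\<lambda>z. fst z 0) \<in> M \<rightarrow>\<^sub>M count_space UNIV"
proof (rule measurable_M)
  have c: "continuous_on UNIV (\<lambda>z :: (nat \<Rightarrow> nat) \<times> riemann_sphere. fst z 0)"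
    by (rule continuous_on_compose2[OF continuous_on_product_coordinates[of 0] continuous_on_fst[OF continuous_on_id]]) simp
  have "(\<lambda>z :: (nat \<Rightarrow> nat) \<times> riemann_sphere. fst z 0) \<in> borel \<rightarrow>\<^sub>M borel"
    by (rule borel_measurable_continuous_onI[OF c])
  then show "(\<lambda>z :: (nat \<Rightarrow> nat) \<times> riemann_sphere. fst z 0) \<in> borel \<rightarrow>\<^sub>M count_space UNIV"
    by (simp only: measurable_cong_sets[OF refl sets_borel_eq_count_space])
qed

lemma measurable_letter_point:
  assumes "\<And>j. j \<in> {1..m} \<Longrightarrow> F j \<in> borel \<rightarrow>\<^sub>M K"
  shows "(\<lambda>z. F (fst z 0) (snd z)) \<in> M \<rightarrow>\<^sub>M K"
proof (rule measurable_compose_countable'[where I = "{1..m}"])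
  show "(\<lambda>z. F j (snd z)) \<in> M \<rightarrow>\<^sub>M K" if "j \<in> {1..m}" for j
    by (rule measurable_compose[OF measurable_point assms[OF that]])
  show "(\<lambda>z. fst z 0) \<in> M \<rightarrow>\<^sub>M count_space {1..m}"
    using measurable_letter words_letter[OF words_M]
    by (auto simp: measurable_def)
qed simp

lemma skew_iterate: "(skew h ^^ n) (w, x) = (\<lambda>i. w (n + i), orb w n x)"
  by (induction n) (simp_all add: skew_def)

definition speed :: "nat \<Rightarrow> riemann_sphere \<Rightarrow> real" where
  "speed j x = sph_deriv_norm (h j) x"

lemma speed_measurable: "j \<in> {1..m} \<Longrightarrow> speed j \<in> borel_measurable borel"
  unfolding speed_def[abs_def]
  by (intro borel_measurable_continuous_onI sph_deriv_norm_continuous hmap_h)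

lemma speed_nonneg: "speed j x \<ge> 0"
  by (simp add: speed_def sph_deriv_norm_nonneg)

lemma speed_bounded: "\<exists>B\<ge>1. \<forall>j\<in>{1..m}. \<forall>x. speed j x \<le> B"
proof -
  have "\<exists>B. \<forall>x. speed j x \<le> B" if j: "j \<in> {1..m}" for j
  proof -
    obtain B where "\<And>x. \<bar>sph_deriv_norm (h j) x\<bar> \<le> B"
      by (rule sphere_continuous_bounded[OF sph_deriv_norm_continuous[OF hmap_h[OF j]]]) blast
    then have "\<forall>x. speed j x \<le> B" unfolding speed_def by (metis abs_ge_self order_trans)
    then show ?thesis by (rule exI)
  qed
  then obtain B where B: "\<And>j x. j \<in> {1..m} \<Longrightarrow> speed j x \<le> B j" by metis
  define BB where "BB = max 1 (Max (B ` {1..m}))"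
  have "speed j x \<le> BB" if "j \<in> {1..m}" for j x
  proof -
    have "B j \<le> Max (B ` {1..m})" using that by (intro Max_ge) auto
    then show ?thesis using B[OF that, of x] by (simp add: BB_def)
  qed
  then show ?thesis by (intro exI[of _ BB]) (simp add: BB_def)
qed

definition lspeed :: "(nat \<Rightarrow> nat) \<times> riemann_sphere \<Rightarrow> real" where
  "lspeed z = ln (speed (fst z 0) (snd z))"

lemma lspeed_measurable: "lspeed \<in> borel_measurable M"
  unfolding lspeed_def[abs_def]
  by (rule measurable_letter_point[of "\<lambda>j x. ln (speed j x)"]) (intro borel_measurable_ln speed_measurable)

text \<open>Since the Lyapunov exponent is positive, the negative part of the logarithm is integrable, so
  the exponent is an ordinary integral and the derivative vanishes almost nowhere.\<close>

lemma lyapunov_facts: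
  shows "integrable M lspeed" and "AE z in M. speed (fst z 0) (snd z) > 0"
    and "lyapunov h M = ereal (\<integral>z. lspeed z \<partial>M)"
proof -
  define f where "f z = ext_ln (speed (fst z 0) (snd z))" for z :: "(nat \<Rightarrow> nat) \<times> riemann_sphere"
  define Pp Np where "Pp = (\<integral>\<^sup>+z. e2ennreal (f z) \<partial>M)" and "Np = (\<integral>\<^sup>+z. e2ennreal (- f z) \<partial>M)"
  have ly: "lyapunov h M = enn2ereal Pp - enn2ereal Np"
    unfolding lyapunov_def ext_integral_def Pp_def Np_def f_def speed_def by (simp add: case_prod_unfold)
  obtain B where B: "B \<ge> 1" "\<And>j x. j \<in> {1..m} \<Longrightarrow> speed j x \<le> B" using speed_bounded by metis
  have letter: "fst z 0 \<in> {1..m}" if "z \<in> space M" for z by (rule words_letter[OF words_M[OF that]])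
  have fB: "e2ennreal (f z) \<le> ennreal (ln B)" if "z \<in> space M" for z
  proof -
    have "f z \<le> ereal (ln B)"
      using B(2)[OF letter[OF that], of "snd z"] speed_nonneg[of "fst z 0" "snd z"] by (auto simp: f_def ext_ln_def)
    then have "e2ennreal (f z) \<le> e2ennreal (ereal (ln B))" by (rule e2ennreal_mono)
    then show ?thesis by (simp add: ennreal.abs_eq[symmetric] e2ennreal_ereal)
  qed
  have "Pp \<le> (\<integral>\<^sup>+z. ennreal (ln B) \<partial>M)" unfolding Pp_def by (rule nn_integral_mono) (rule fB)
  also have "\<dots> = ennreal (ln B)" by (simp add: E.emeasure_space_1)
  finally have P: "Pp \<noteq> \<infinity>" by (auto simp: top_unique)
  have N: "Np \<noteq> \<infinity>"
  proof
    assume "Np = \<infinity>"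
    moreover obtain r where "enn2ereal Pp = ereal r" using P by (cases Pp) auto
    ultimately show False using lyap ly by simp
  qed
  have fm: "f \<in> borel_measurable M"
    unfolding f_def[abs_def]
  proof (rule measurable_letter_point[of "\<lambda>j x. ext_ln (speed j x)"])
    fix j assume "j \<in> {1..m}"
    note speed_measurable[OF this, measurable]
    show "(\<lambda>x. ext_ln (speed j x)) \<in> borel_measurable borel" unfolding ext_ln_def by measurable
  qed
  have "AE z in M. e2ennreal (- f z) \<noteq> \<infinity>"
    by (rule nn_integral_PInf_AE) (use fm N in \<open>auto simp: Np_def\<close>)
  then have ae: "AE z in M. speed (fst z 0) (snd z) > 0"
  proof eventually_elim
    case (elim z)
    then have "speed (fst z 0) (snd z) \<noteq> 0" by (auto simp: f_def ext_ln_def)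
    then show ?case using speed_nonneg[of "fst z 0" "snd z"] by simp
  qed
  then show "AE z in M. speed (fst z 0) (snd z) > 0" .
  have P_eq: "Pp = (\<integral>\<^sup>+z. ennreal (lspeed z) \<partial>M)"
    unfolding Pp_def using ae by (intro nn_integral_cong_AE, eventually_elim) (simp add: f_def ext_ln_def lspeed_def e2ennreal_ereal)
  have N_eq: "Np = (\<integral>\<^sup>+z. ennreal (- lspeed z) \<partial>M)"
    unfolding Np_def using ae by (intro nn_integral_cong_AE, eventually_elim) (simp add: f_def ext_ln_def lspeed_def e2ennreal_ereal)
  show int: "integrable M lspeed"
    unfolding real_integrable_def using lspeed_measurable P N P_eq N_eq by simp
  have "(\<integral>z. lspeed z \<partial>M) = enn2real Pp - enn2real Np"
    unfolding P_eq N_eq by (rule real_lebesgue_integral_def[OF int])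
  moreover have fin: "enn2ereal q = ereal (enn2real q)" if "q \<noteq> \<infinity>" for q
    using that by (cases q rule: ennreal_cases) (simp_all add: enn2ereal_ennreal)
  then have "enn2ereal Pp = ereal (enn2real Pp)" "enn2ereal Np = ereal (enn2real Np)"
    using fin P N by simp_all
  ultimately show "lyapunov h M = ereal (\<integral>z. lspeed z \<partial>M)" unfolding ly by simp
qed

end

section \<open>Itineraries\<close>

context osc_system
begin

text \<open>While an orbit stays in \<open>U\<close>, the open set condition makes its letters a function of the
  point alone; the default value \<open>m\<close> keeps the function total.  The conclusion of the
  theorem can thus be derived from a Borel property of the point, which is what passes from the
  skew product to the projected measure.\<close>

definition letter :: "riemann_sphere \<Rightarrow> nat" where
  "letter x = (LEAST j. m \<le> j \<or> 1 \<le> j \<and> j < m \<and> h j x \<in> U)"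

definition expand :: "riemann_sphere \<Rightarrow> riemann_sphere" where
  "expand x = h (letter x) x"

lemma letter_range: "letter x \<in> {1..m}"
proof -
  let ?P = "\<lambda>j. m \<le> j \<or> 1 \<le> j \<and> j < m \<and> h j x \<in> U"
  have "?P (letter x)" unfolding letter_def by (rule LeastI[of ?P m]) simp
  moreover have "letter x \<le> m" unfolding letter_def by (rule Least_le) simp
  ultimately show ?thesis using m by auto
qed

lemma letter_eq:
  assumes j: "j \<in> {1..m}" "h j x \<in> U"
  shows "letter x = j"
  unfolding letter_def
proof (rule Least_equality)
  show "m \<le> j \<or> 1 \<le> j \<and> j < m \<and> h j x \<in> U" using j by auto
  show "j \<le> i" if "m \<le> i \<or> 1 \<le> i \<and> i < m \<and> h i x \<in> U" for i
    using that U_disj[of i j x] j by auto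
qed

lemma letter_measurable: "letter \<in> borel \<rightarrow>\<^sub>M count_space UNIV"
proof -
  have "(\<lambda>x. m \<le> j \<or> 1 \<le> j \<and> j < m \<and> h j x \<in> U) \<in> borel \<rightarrow>\<^sub>M count_space UNIV" for j
  proof (cases "j \<in> {1..m}")
    case True
    have hm [measurable]: "h j \<in> borel_measurable borel"
      by (intro borel_measurable_continuous_onI hmap_continuous_on hmap_h True)
    have [measurable]: "U \<in> sets borel" using U_open by simp
    show ?thesis by measurable
  next
    case False
    then have "(\<lambda>x. m \<le> j \<or> 1 \<le> j \<and> j < m \<and> h j x \<in> U) = (\<lambda>_. m \<le> j)" by auto
    then show ?thesis by simp
  qed
  then show ?thesis unfolding letter_def[abs_def] by (rule measurable_Least)
qed

lemma letter_compose_measurable: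
  assumes "\<And>j. j \<in> {1..m} \<Longrightarrow> F j \<in> borel \<rightarrow>\<^sub>M K"
  shows "(\<lambda>x. F (letter x) x) \<in> borel \<rightarrow>\<^sub>M K"
proof (rule measurable_compose_countable'[where I = "{1..m}"])
  show "letter \<in> borel \<rightarrow>\<^sub>M count_space {1..m}"
    using letter_measurable letter_range by (auto simp: measurable_def)
qed (use assms in auto)

lemma expand_iterate_measurable: "(expand ^^ n) \<in> borel_measurable borel"
proof (induction n)
  case (Suc n)
  have "expand \<in> borel_measurable borel" unfolding expand_def[abs_def]
    by (rule letter_compose_measurable) (intro borel_measurable_continuous_onI hmap_continuous_on hmap_h)
  from measurable_comp[OF Suc this] show ?case by (simp add: o_def)
qed (simp add: id_def)

lemma itinerary:
  assumes w: "w \<in> words m" and x: "\<And>n. orb w n x \<in> U"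
  shows "(expand ^^ n) x = orb w n x" and "letter ((expand ^^ n) x) = w n"
proof -
  have l: "letter (orb w n x) = w n" for n
    using letter_eq[OF words_letter[OF w], of n "orb w n x"] x[of "Suc n"] by simp
  show 1: "(expand ^^ n) x = orb w n x"
    by (induction n) (simp_all add: expand_def l)
  then show "letter ((expand ^^ n) x) = w n" using l by simp
qed

lemma itinerary_word: "(\<lambda>n. letter ((expand ^^ n) x)) \<in> words m"
  using letter_range by (simp add: words_def)

lemma itinerary_orb: "orb (\<lambda>n. letter ((expand ^^ n) x)) n x = (expand ^^ n) x"
  by (induction n) (simp_all add: expand_def)

end

section \<open>Typical points\<close>

context skew_system
begin

definition lweight :: "(nat \<Rightarrow> nat) \<times> riemann_sphere \<Rightarrow> real" where
  "lweight z = ln (p (fst z 0))"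

lemma lweight_integrable: "integrable M lweight"
proof (rule E.integrable_const_bound)
  show "AE z in M. norm (lweight z) \<le> Max ((\<lambda>j. \<bar>ln (p j)\<bar>) ` {1..m})"
    using words_letter[OF words_M] by (intro AE_I2) (auto simp: lweight_def intro!: Max_ge)
  show "lweight \<in> borel_measurable M"
    unfolding lweight_def[abs_def] by (rule measurable_letter_point[of "\<lambda>j x. ln (p j)"]) simp
qed

definition v :: real where
  "v = - (\<integral>z. lweight z \<partial>M) / (\<integral>z. lspeed z \<partial>M)"

lemma lspeed_pos: "(\<integral>z. lspeed z \<partial>M) > 0"
  using lyap unfolding lyapunov_facts(3) by simp

lemma v_eq: "v_exponent h p M = ereal v"
proof -
  have "(\<integral>(w, x). ln (p (w 0)) \<partial>M) = (\<integral>z. lweight z \<partial>M)"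
    by (simp add: lweight_def case_prod_unfold)
  then show ?thesis using lspeed_pos unfolding v_exponent_def lyapunov_facts(3) v_def by simp
qed

lemma v_nonneg: "v \<ge> 0"
proof -
  have "0 \<le> (\<integral>z. - lweight z \<partial>M)"
  proof (rule Bochner_Integration.integral_nonneg)
    fix z assume "z \<in> space M"
    then have "0 < p (fst z 0)" "p (fst z 0) < 1" using p_bounds[OF words_letter[OF words_M]] by auto
    then show "0 \<le> - lweight z" by (simp add: lweight_def)
  qed
  then show ?thesis unfolding v_def by (intro divide_nonneg_pos lspeed_pos) simp
qed

lemma AE_iterate:
  assumes "AE z in M. P z"
  shows "AE z in M. P ((skew h ^^ n) z)"
proof (induction n)
  case (Suc n)
  then have "AE z in distr M M (skew h). P ((skew h ^^ n) z)" by (simp only: E.distr_\<Theta>)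
  then have "AE z in M. P ((skew h ^^ n) (skew h z))" by (rule AE_distrD[OF E.\<Theta>_measurable])
  then show ?case by (simp add: funpow_swap1)
qed (use assms in simp)

lemma AE_speed_pos: "AE z in M. \<forall>n. speed (fst z n) (orb (fst z) n (snd z)) > 0"
proof -
  have "AE z in M. speed (fst z n) (orb (fst z) n (snd z)) > 0" for n
    using AE_iterate[OF lyapunov_facts(2), of n]
  proof eventually_elim
    case (elim z)
    then show ?case by (cases z) (simp add: skew_iterate)
  qed
  then show ?thesis by (simp add: AE_all_countable)
qed

lemma AE_growth:
  assumes r: "r > v"
  shows "AE z in M. filterlim (\<lambda>n. \<Sum>i<n. r * ln (speed (fst z i) (orb (fst z) i (snd z))) + ln (p (fst z i)))
    at_top sequentially"
proof -
  define f where "f z = r * lspeed z + lweight z" for z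
  have f: "integrable M f" unfolding f_def[abs_def]
    by (intro Bochner_Integration.integrable_add integrable_mult_right lyapunov_facts(1) lweight_integrable)
  have "(\<integral>z. f z \<partial>M) = r * (\<integral>z. lspeed z \<partial>M) + (\<integral>z. lweight z \<partial>M)"
    unfolding f_def using lyapunov_facts(1) lweight_integrable by simp
  moreover have "- (\<integral>z. lweight z \<partial>M) < r * (\<integral>z. lspeed z \<partial>M)"
    using r unfolding v_def by (simp only: pos_divide_less_eq[OF lspeed_pos])
  ultimately have "(\<integral>z. f z \<partial>M) > 0" by simp
  from E.bsum_tendsto_infinity[OF f this] show ?thesis
  proof eventually_elim
    case (elim z)
    then show ?case
      unfolding E.bsum_def by (cases z) (simp add: skew_iterate f_def lspeed_def lweight_def)
  qed
qed

text \<open>The Fatou set is forward invariant, so by ergodicity it carries all of the mass or none.\<close>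

lemma AE_Fatou_or_Julia: "(AE z in M. snd z \<in> Fatou GG) \<or> (AE z in M. snd z \<in> Julia GG)"
proof -
  define A where "A = snd -` Fatou GG \<inter> space M"
  have A: "A \<in> sets M" unfolding A_def
    by (rule measurable_sets[OF measurable_point]) (simp add: open_Fatou)
  have fwd: "skew h z \<in> A" if "z \<in> A" for z
  proof -
    have "skew h z \<in> space M" using that by (intro E.\<Theta>_space) (simp add: A_def)
    moreover have "snd (skew h z) = h (fst z 0) (snd z)" by (simp add: skew_def case_prod_unfold)
    ultimately show ?thesis
      using Fatou_forward[OF words_letter[OF words_M]] that by (simp add: A_def)
  qed
  show ?thesis
  proof (cases "emeasure M A = 0")
    case True
    then have "AE z in M. z \<notin> A" using A by (intro AE_not_in) (simp add: null_sets_def)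
    then have "AE z in M. snd z \<in> Julia GG"
      using AE_space by eventually_elim (simp add: A_def Julia_def)
    then show ?thesis by (rule disjI2)
  next
    case False
    then have "AE z in M. z \<in> A"
      by (intro E.ergodic_forward_invariant[OF A fwd]) (simp_all add: zero_less_iff_neq_zero)
    then have "AE z in M. snd z \<in> Fatou GG" by eventually_elim (simp add: A_def)
    then show ?thesis by (rule disjI1)
  qed
qed

lemma AE_recurrence:
  assumes N: "open N" and pos: "emeasure (distr M borel snd) N > 0"
  shows "AE z in M. \<exists>\<^sub>\<infinity>n. orb (fst z) n (snd z) \<in> N"
proof -
  define A where "A = snd -` N \<inter> space M"
  have A: "A \<in> sets M" unfolding A_def
    by (rule measurable_sets[OF measurable_point]) (simp add: N)
  have "emeasure M A > 0" using pos N by (simp add: emeasure_distr[OF measurable_point] A_def)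
  from E.ergodic_recurrence[OF A this] show ?thesis
  proof eventually_elim
    case (elim z)
    then show ?case
    proof (rule INFM_mono)
      fix n assume "(skew h ^^ n) z \<in> A"
      then show "orb (fst z) n (snd z) \<in> N" by (cases z) (simp add: A_def skew_iterate)
    qed
  qed
qed

text \<open>Phrased with the itinerary instead of a word, these properties of an orbit are Borel in the point.\<close>

definition typical :: "riemann_sphere set \<Rightarrow> real \<Rightarrow> riemann_sphere \<Rightarrow> bool" where
  "typical N r x \<longleftrightarrow> (\<exists>\<^sub>\<infinity>n. (expand ^^ n) x \<in> N) \<and>
    (\<forall>n. speed (letter ((expand ^^ n) x)) ((expand ^^ n) x) > 0) \<and>
    filterlim (\<lambda>n. \<Sum>i<n. r * ln (speed (letter ((expand ^^ i) x)) ((expand ^^ i) x)) + ln (p (letter ((expand ^^ i) x))))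
      at_top sequentially"

lemma typical_measurable:
  assumes N: "open N"
  shows "{x \<in> space borel. typical N r x} \<in> sets borel"
proof -
  have [measurable]: "N \<in> sets borel" using N by simp
  note expand_iterate_measurable[measurable]
  define S where "S x = speed (letter x) x" for x
  define P where "P x = ln (p (letter x))" for x
  have [measurable]: "S \<in> borel_measurable borel" unfolding S_def[abs_def]
    by (rule letter_compose_measurable[OF speed_measurable])
  have [measurable]: "P \<in> borel_measurable borel" unfolding P_def[abs_def]
    by (rule letter_compose_measurable[of "\<lambda>j x. ln (p j)"]) simp
  have top: "filterlim f at_top sequentially \<longleftrightarrow> (\<forall>k. \<exists>n0. \<forall>n\<ge>n0. real k \<le> f n)" for f :: "nat \<Rightarrow> real"
  proof
    assume "filterlim f at_top sequentially"
    then show "\<forall>k. \<exists>n0. \<forall>n\<ge>n0. real k \<le> f n"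
      unfolding filterlim_at_top eventually_sequentially by (intro allI) (rule spec)
  next
    assume f: "\<forall>k. \<exists>n0. \<forall>n\<ge>n0. real k \<le> f n"
    show "filterlim f at_top sequentially"
      unfolding filterlim_at_top eventually_sequentially
    proof
      fix Z :: real
      obtain k where k: "Z \<le> real k" using real_arch_simple[of Z] by (elim exE)
      obtain n0 where "\<forall>n\<ge>n0. real k \<le> f n" using f[THEN spec, of k] by (elim exE)
      then show "\<exists>n0. \<forall>n\<ge>n0. Z \<le> f n" using k order_trans by (intro exI[of _ n0]) blast
    qed
  qed
  have "typical N r x \<longleftrightarrow> (\<forall>k. \<exists>n>k. (expand ^^ n) x \<in> N) \<and> (\<forall>n. S ((expand ^^ n) x) > 0) \<and>
      (\<forall>k. \<exists>n0. \<forall>n\<ge>n0. real k \<le> (\<Sum>i<n. r * ln (S ((expand ^^ i) x)) + P ((expand ^^ i) x)))" for x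
    unfolding typical_def top INFM_nat S_def P_def ..
  moreover have "{x \<in> space borel. (\<forall>k. \<exists>n>k. (expand ^^ n) x \<in> N) \<and> (\<forall>n. S ((expand ^^ n) x) > 0) \<and>
      (\<forall>k. \<exists>n0. \<forall>n\<ge>n0. real k \<le> (\<Sum>i<n. r * ln (S ((expand ^^ i) x)) + P ((expand ^^ i) x)))} \<in> sets borel"
    by measurable
  ultimately show ?thesis by simp
qed

text \<open>The properties hold for almost every pair of a word and a point.  Recurrence to \<open>N \<subseteq> U\<close> keeps the whole
orbit in \<open>U\<close>, so the word of the pair is the itinerary of the point.\<close>

lemma AE_typical:
  assumes N: "open N" "N \<subseteq> U" and pos: "emeasure (distr M borel snd) N > 0" and r: "r > v"
  shows "AE x in distr M borel snd. typical N r x"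
  unfolding AE_distr_iff[OF measurable_point typical_measurable[OF N(1)]]
  using AE_recurrence[OF N(1) pos] AE_speed_pos AE_growth[OF r] AE_space
proof eventually_elim
  case (elim z)
  define w x where "w = fst z" and "x = snd z"
  have w: "w \<in> words m" unfolding w_def by (rule words_M[OF elim(4)])
  have U: "orb w n x \<in> U" for n
  proof -
    obtain k where "k > n" "orb w k x \<in> N" using elim(1) unfolding INFM_nat w_def x_def by (elim allE exE conjE)
    then show ?thesis using U_orb_le[OF w, of k x n] N(2) by auto
  qed
  have l: "letter (orb w n x) = w n" for n
    using itinerary(2)[OF w U, of n] unfolding itinerary(1)[OF w U] .
  have "typical N r x"
    using elim(1-3) unfolding typical_def itinerary(1)[OF w U] l w_def[symmetric] x_def[symmetric]
    by (intro conjI)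
  then show ?case by (simp add: x_def)
qed

text \<open>An exponent \<open>\<beta> > v\<close> for which the difference quotients are bounded is excluded by the growth for a rational
number between \<open>v\<close> and \<open>\<beta>\<close>; restricting to these leaves countably many null sets.\<close>

lemma typical_conclusion:
  assumes N: "N \<subseteq> U" and C: "C > 0" and \<eta>: "\<eta> > 0"
    and est: "\<And>w n x. w \<in> words m \<Longrightarrow> n \<ge> 1 \<Longrightarrow> orb w n x \<in> N \<Longrightarrow>
      \<exists>z. z \<noteq> x \<and> dist z x * sph_deriv_norm (orb w n) x \<le> C \<and> \<bar>T z - T x\<bar> \<ge> \<eta> * weight w n"
    and tq: "\<And>q :: rat. real_of_rat q > v \<Longrightarrow> typical N (real_of_rat q) x"
  shows "x \<in> F_pt0 step \<and> isCont T x \<and> Hoelder_exponent T x \<le> ereal v"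
proof -
  define w where "w n = letter ((expand ^^ n) x)" for n
  have w: "w \<in> words m" unfolding w_def[abs_def] by (rule itinerary_word)
  have ob: "(expand ^^ n) x = orb w n x" for n unfolding w_def[abs_def] by (rule itinerary_orb[symmetric])
  have l: "letter (orb w n x) = w n" for n using w_def[of n, unfolded ob] by (rule sym)
  have typ': "\<exists>\<^sub>\<infinity>n. orb w n x \<in> N" "speed (w n) (orb w n x) > 0"
    "filterlim (\<lambda>n. \<Sum>i<n. real_of_rat q * ln (speed (w i) (orb w i x)) + ln (p (w i))) at_top sequentially"
    if "real_of_rat q > v" for q n
    using tq[OF that] unfolding typical_def ob l by auto
  obtain q0 where "real_of_rat q0 > v" using of_rat_dense[of v "v + 1"] by auto
  note q0 = typ'(1,2)[OF this]
  have U: "orb w n x \<in> U" for n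
  proof -
    obtain k where "k > n" "orb w k x \<in> N" using q0(1) unfolding INFM_nat by (elim allE exE conjE)
    then show ?thesis using U_orb_le[OF w, of k x n] N by auto
  qed
  have D: "sph_deriv_norm (orb w n) x = (\<Prod>i<n. speed (w i) (orb w i x))" for n
    unfolding speed_def by (rule sph_deriv_norm_orb[OF w])
  have Dpos: "sph_deriv_norm (orb w n) x > 0" for n unfolding D by (intro prod_pos q0(2))
  have "Hoelder_exponent T x \<le> ereal v"
    unfolding Hoelder_exponent_def
  proof (rule SUP_least)
    fix \<beta> :: real assume "\<beta> \<in> {\<beta>. \<beta> \<ge> 0 \<and> Limsup (at x) (\<lambda>z. ereal (\<bar>T z - T x\<bar> / dist z x powr \<beta>)) < \<infinity>}"
    then have bd: "Limsup (at x) (\<lambda>z. ereal (\<bar>T z - T x\<bar> / dist z x powr \<beta>)) < \<infinity>" by simp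
    show "ereal \<beta> \<le> ereal v"
    proof (rule ccontr)
      assume "\<not> ereal \<beta> \<le> ereal v"
      then obtain q where q: "v < real_of_rat q" "real_of_rat q < \<beta>" using of_rat_dense[of v \<beta>] by auto
      have "(\<Sum>i<n. real_of_rat q * ln (speed (w i) (orb w i x)) + ln (p (w i)))
          = real_of_rat q * ln (sph_deriv_norm (orb w n) x) + ln (weight w n)" for n
      proof -
        have "ln (sph_deriv_norm (orb w n) x) = (\<Sum>i<n. ln (speed (w i) (orb w i x)))"
          unfolding D using q0(2) by (intro ln_prod) (auto simp: less_imp_neq[THEN not_sym])
        moreover have "ln (weight w n) = (\<Sum>i<n. ln (p (w i)))"
          unfolding weight_def
        proof (rule ln_prod)
          show "p (w i) \<noteq> 0" for i using p_bounds[OF words_letter[OF w, of i]] by simp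
        qed simp
        ultimately show ?thesis by (simp only: sum.distrib sum_distrib_left)
      qed
      then have lim: "filterlim (\<lambda>n. real_of_rat q * ln (sph_deriv_norm (orb w n) x) + ln (weight w n)) at_top sequentially"
        using typ'(3)[OF q(1)] by (simp only:)
      have "real_of_rat q > 0" using v_nonneg q(1) by (rule order_le_less_trans)
      then show False
        by (rule Hoelder_quotient_unbounded[OF w q0(1) C \<eta> _ _ less_imp_le[OF q(2)] Dpos lim bd, rotated]) (rule est[OF w])
    qed
  qed
  then show ?thesis using F_pt0_orbit[OF w U] T_continuous[OF w U] by (intro conjI)
qed

text \<open>The neighbourhood \<open>N\<close> and its constants are chosen at a point of the support in \<open>U - P(G)\<close> that lies in the Julia
set; they are the same for almost all points.\<close>

theorem AE_Hoelder:
  assumes pos: "emeasure (distr M borel snd) (U - postcritical GG) > 0"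
    and ne: "nonconst \<inter> U \<noteq> {}"
  shows "AE x in distr M borel snd. x \<in> Julia GG \<longrightarrow>
    x \<in> F_pt0 step \<and> isCont T x \<and> Hoelder_exponent T x \<le> ereal v"
proof -
  define \<mu> where "\<mu> = distr M borel snd"
  have sets_\<mu>: "sets \<mu> = sets borel" by (simp add: \<mu>_def)
  have Jm: "{x \<in> space borel. x \<in> Julia GG} \<in> sets borel" "{x \<in> space borel. x \<in> Fatou GG} \<in> sets borel"
    using closed_Julia open_Fatou by simp_all
  have Um: "U - postcritical GG \<in> sets borel" "(U - postcritical GG) \<inter> Julia GG \<in> sets borel"
    using U_open closed_Julia by (auto simp: postcritical_def)
  consider "AE z in M. snd z \<in> Fatou GG" | "AE z in M. snd z \<in> Julia GG"
    using AE_Fatou_or_Julia by blast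
  then show ?thesis
  proof cases
    case 1
    then have "AE x in \<mu>. x \<in> Fatou GG" unfolding \<mu>_def AE_distr_iff[OF measurable_point Jm(2)] .
    then have "AE x in \<mu>. x \<notin> Julia GG" by eventually_elim (simp add: Julia_def)
    then show ?thesis unfolding \<mu>_def[symmetric] by eventually_elim (rule impI, erule notE)
  next
    case 2
    then have "AE x in \<mu>. x \<in> Julia GG" unfolding \<mu>_def AE_distr_iff[OF measurable_point Jm(1)] .
    then have "AE x in \<mu>. x \<in> U - postcritical GG \<longleftrightarrow> x \<in> (U - postcritical GG) \<inter> Julia GG"
      by eventually_elim simp
    then have "emeasure \<mu> (U - postcritical GG) = emeasure \<mu> ((U - postcritical GG) \<inter> Julia GG)"
      by (rule emeasure_eq_AE) (use Um sets_\<mu> in simp_all)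
    then have "emeasure \<mu> ((U - postcritical GG) \<inter> Julia GG) > 0" using pos by (simp add: \<mu>_def)
    from support_point[OF sets_\<mu> Um(2) this]
    obtain y0 where y0: "y0 \<in> (U - postcritical GG) \<inter> Julia GG"
      and supp: "\<forall>N. open N \<longrightarrow> y0 \<in> N \<longrightarrow> emeasure \<mu> N > 0" by (elim bexE)
    have y: "y0 \<in> Julia GG" "y0 \<in> U" "y0 \<notin> postcritical GG" using y0 by auto
    obtain N C \<eta> where N: "open N" "y0 \<in> N" "N \<subseteq> U" and C: "C > 0" and \<eta>: "\<eta> > 0"
      and est: "\<And>w n x. w \<in> words m \<Longrightarrow> n \<ge> 1 \<Longrightarrow> orb w n x \<in> N \<Longrightarrow>
        \<exists>z. z \<noteq> x \<and> dist z x * sph_deriv_norm (orb w n) x \<le> C \<and> \<bar>T z - T x\<bar> \<ge> \<eta> * weight w n"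
      by (rule return_estimate[OF ne y]) (rule that)
    have posN: "emeasure (distr M borel snd) N > 0" using supp N(1,2) unfolding \<mu>_def by simp
    have "AE x in distr M borel snd. \<forall>q :: rat. real_of_rat q > v \<longrightarrow> typical N (real_of_rat q) x"
      unfolding AE_all_countable
    proof
      show "AE x in distr M borel snd. v < real_of_rat q \<longrightarrow> typical N (real_of_rat q) x" for q
        using AE_typical[OF N(1,3) posN] by (cases "v < real_of_rat q") simp_all
    qed
    then show ?thesis
    proof eventually_elim
      case (elim x)
      have "x \<in> F_pt0 step \<and> isCont T x \<and> Hoelder_exponent T x \<le> ereal v"
        by (rule typical_conclusion[OF N(3) C \<eta> est]) (use elim in simp_all)
      then show ?case by (rule impI)
    qed
  qed
qed

end

theorem theorem2p52:
  fixes m :: nat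
    and h :: "nat \<Rightarrow> riemann_sphere \<Rightarrow> riemann_sphere"
    and p :: "nat \<Rightarrow> real"
    and U L :: "riemann_sphere set"
    and M :: "((nat \<Rightarrow> nat) \<times> riemann_sphere) measure"
    and G :: "(riemann_sphere \<Rightarrow> riemann_sphere) set"
    and \<tau> :: "(riemann_sphere \<Rightarrow> riemann_sphere) measure"
    and \<mu> :: "riemann_sphere measure"
    and \<xi> :: riemann_sphere
  assumes "m \<ge> 2"
    and "\<And>j. j \<in> {1..m} \<Longrightarrow> h j \<in> Rat"
    and G_def: "G = gen_semigroup (h ` {1..m})"
    and "at_least_three (Julia G)"
    and "\<And>j. j \<in> {1..m} \<Longrightarrow> 0 < p j \<and> p j < 1"
    and "(\<Sum>j\<in>{1..m}. p j) = 1"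
    and tau_def: "\<tau> = tau_measure m h p"
    and "open_set_condition m h U"
    and "sets M = sets (restrict_space borel (skew_Julia m h))"
    and "prob_space M"
    and "invariant_measure M (skew h)"
    and "ergodic_measure M (skew h)"
    and "lyapunov h M > 0"
    and mu_def: "\<mu> = distr M borel snd"
    and "emeasure \<mu> (U - postcritical G) > 0"
    and "attracting_minimal_set m h L"
    and "\<xi> \<in> U"
    and "\<And>N. open N \<Longrightarrow> \<xi> \<in> N \<Longrightarrow> \<not> T_prob L \<tau> constant_on N"
  shows "AE z0 in \<mu>. z0 \<in> Julia G \<longrightarrow>
           z0 \<in> F_pt0 \<tau> \<and> isCont (T_prob L \<tau>) z0 \<and>
           Hoelder_exponent (T_prob L \<tau>) z0 \<le> v_exponent h p M"
proof -
  obtain B where "B \<subseteq> Julia G" "card B = 3" using assms(4) unfolding at_least_three_def by (elim exE conjE)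
  then have "Julia G \<noteq> {}" by auto
  then interpret skew_system m h L p U M
    by (intro skew_system.intro osc_system.intro random_system.intro attracting_system.intro rational_system.intro
        skew_system_axioms.intro osc_system_axioms.intro random_system_axioms.intro attracting_system_axioms.intro)
      (use assms in simp_all)
  have \<tau>: "\<tau> = step" by (simp only: tau_def step_def)
  have "\<xi> \<in> nonconst"
  proof (rule ccontr)
    assume "\<xi> \<notin> nonconst"
    then have "eventually (\<lambda>y. T y = T \<xi>) (nhds \<xi>)" by (simp add: nonconst_def)
    then obtain N where "open N" "\<xi> \<in> N" "\<forall>y\<in>N. T y = T \<xi>" unfolding eventually_nhds by (elim exE conjE)
    then show False using assms(18)[of N] unfolding \<tau> constant_on_def by blast
  qed
  then have ne: "nonconst \<inter> U \<noteq> {}" using assms(17) by auto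
  show ?thesis
    unfolding \<tau> mu_def G_def v_eq
    by (rule AE_Hoelder[OF _ ne]) (use assms(15) in \<open>simp only: mu_def G_def\<close>)
qed

end
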